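(* As $\epsilon\to0$, the functionals $\mathcal H^{\tilde\mu}_{\epsilon,0}$ $\Gamma$-converge to $\mathcal H^{\mu}$ with respect to weak-$*$ convergence in $\mathcal M(\tilde\Omega;\mathbb R^d)$, i.e. $\Gamma\text{-}\lim_{\epsilon\to0}\mathcal H^{\tilde\mu}_{\epsilon,0}=\mathcal H^{\mu}$.
   Context: Setting: $d\in\mathbb N$; $\Omega\subset\mathbb R^d$ is compact and its interior $\Omega^\circ$ is a bounded Lipschitz domain; $\Omega$ is strictly star shaped with respect to $0$: $\lambda x\in\Omega^\circ$ for all $x\in\Omega$, $0\le\lambda<1$; $w:\Omega\to[0,\infty)$ is continuous; $1<\alpha<\frac{d}{d-1}$, $\alpha'=\frac{\alpha}{\alpha-1}$; $\mu^+,\mu^-$ are Borel probability measures on $\Omega$, $\mu:=\mu^+-\mu^-$. $|\cdot|$ is the Euclidean norm, $|q|$ the total variation measure of a vector measure $q$, $dx$ Lebesgue measure, $\mathcal M(K;\mathbb R^d)$ the $\mathbb R^d$-valued Radon measures on a compact set $K$ (weak-$*$ topology as dual of $C(K;\mathbb R^d)$). Spaces, for a compact set $K$ (here $K=\Omega$ or $K=\Omega_\tau$ below; Sobolev spaces on the interior): $W^{1,p}_\emptyset(K)=\{v\in W^{1,p}(K):\int_K v\,dx=0\}$; $W^{-1,p}_\perp(K)=\{v\in(W^{1,p'}(K))^*:\langle v,1\rangle=0\}$ with $p'$ conjugate to $p$; $\operatorname{div}:L^p(K;\mathbb R^d)\to W^{-1,p}_\perp(K)$, $\langle\operatorname{div}q,\phi\rangle=-\int_K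 q\cdot\nabla\phi\,dx$ for $\phi\in W^{1,p'}_\emptyset(K)$. Measures with total mass zero are regarded as elements of $W^{-1,\alpha}_\perp(K)$ (since $W^{1,\alpha'}(K)\hookrightarrow C(K)$). $C^1_\emptyset(K)=\{v\in C^1(K):\int_Kv\,dx=0\}$; for $q\in\mathcal M(K;\mathbb R^d)$ and $\nu\in\{v\in (C^1(K))^*:\langle v,1\rangle=0\}$, $\operatorname{div}_{\mathcal M}q=\nu$ means $-\int_K\nabla\phi\cdot dq=\langle\nu,\phi\rangle$ for all $\phi\in C^1_\emptyset(K)$. Assumption on $\Omega$: for every $\nu\in W^{-1,\alpha'}_\perp(\Omega)$ there is a unique $y\in W^{1,\alpha'}_\emptyset(\Omega)$ with $-\int_\Omega\nabla y\cdot\nabla\phi\,dx=\langle\nu,\phi\rangle$ for all $\phi\in W^{1,\alpha}_\emptyset(\Omega)$. Enlarged domains: fix a sequence of parameters $\tau>0$, $\tau\to0$, and nonnegative mollifiers $\phi_\tau\in C_c^\infty(\mathbb R^d)$ ($\int\phi_\tau=1$, supports shrinking to $\{0\}$). For each $\tau$ choose $s_\tau>0$, $s_\tau\to0$, such that $\Omega_\tau:=(1+s_\tau)\Omega\supset\Omega+\operatorname{supp}\phi_\tau$ and $\Omega_\tau\supset\Omega_\vartheta$ for $\tau>\vartheta$. Put $\tilde\Omega=\bigcup_\tau\Omega_\tau$. $\tilde f$ denotes extension of a function or measure $f$ by zero to $\tilde\Omega$; $\hat w$ is a continuous extension of $w$ to $\tilde\Omega$ with $\min_{\tilde\Omega}\hat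 w=\min_\Omega w$. The parameter $\epsilon$ runs through this sequence and $\Omega_\epsilon$ is the domain for $\tau=\epsilon$. Functionals: for $q\in\mathcal M(\Omega_\epsilon;\mathbb R^d)$, $$\mathcal H^{\tilde\mu}_{\epsilon,0}(q)=\int_{\Omega_\epsilon}\hat w\,d|q|+\frac\epsilon\alpha\Big\|\frac{dq}{dx}\Big\|^\alpha_{L^\alpha(\Omega_\epsilon)}$$ if $q\ll dx$, $\frac{dq}{dx}\in L^\alpha(\Omega_\epsilon;\mathbb R^d)$ and $\operatorname{div}\frac{dq}{dx}=\tilde\mu$ in $W^{-1,\alpha}_\perp(\Omega_\epsilon)$, and $+\infty$ otherwise. For $q\in\mathcal M(\Omega;\mathbb R^d)$, $\mathcal H^{\mu}(q)=\int_\Omega w\,d|q|$ if $\operatorname{div}_{\mathcal M}q=\mu$, and $+\infty$ otherwise. Both are regarded as functionals on $\mathcal M(\tilde\Omega;\mathbb R^d)$ by identifying measures on $\Omega_\epsilon$ (resp. $\Omega$) with their zero extensions, with value $+\infty$ on measures that are not such zero extensions. $\Gamma$-convergence $F=\Gamma\text{-}\lim F_n$: (i) $F(x)\le\liminf F_n(x_n)$ whenever $x_n\to x$; (ii) for every $x$ there is $x_n\to x$ with $F(x)\ge\limsup F_n(x_n)$; here convergence is weak-$*$ (sequential). *)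

theory Defs
  imports "HOL-Analysis.Analysis"
begin

section \<open>Lipschitz domains, smooth functions\<close>

text \<open>
  Near each boundary point the domain is the epigraph of a Lipschitz function over a hyperplane
  \<open>{y. y \<bullet> e = 0}\<close>, the unit vector \<open>e\<close> being the ``last axis'' of a rotated coordinate system.
  In dimension one the hyperplane is \<open>{0}\<close>.
\<close>

definition lipschitz_domain :: "'a::euclidean_space set \<Rightarrow> bool" where
  "lipschitz_domain U \<longleftrightarrow> open U \<and> connected U \<and> U \<noteq> {} \<and>
     (\<forall>p\<in>frontier U. \<exists>r>0. \<exists>e \<gamma> L. norm e = 1 \<and> L-lipschitz_on {y. y \<bullet> e = 0} \<gamma> \<and>
        U \<inter> ball p r = {x \<in> ball p r. x \<bullet> e > \<gamma> (x - (x \<bullet> e) *\<^sub>R e)})"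

definition gradient :: "('a::euclidean_space \<Rightarrow> real) \<Rightarrow> 'a \<Rightarrow> 'a" where
  "gradient f x = (THE D. GDERIV f x :> D)"

primrec Ck :: "nat \<Rightarrow> ('a::euclidean_space \<Rightarrow> real) \<Rightarrow> bool" where
  "Ck 0 f = continuous_on UNIV f"
| "Ck (Suc k) f = ((\<forall>x. f differentiable (at x)) \<and> (\<forall>b\<in>Basis. Ck k (\<lambda>x. gradient f x \<bullet> b)))"

definition supp :: "('a::topological_space \<Rightarrow> real) \<Rightarrow> 'a set" where
  "supp f = closure {x. f x \<noteq> 0}"

text \<open>Elements of $C_c^\infty(U)$ are represented by their zero extensions to the whole space.\<close>

definition test_functions :: "'a::euclidean_space set \<Rightarrow> ('a \<Rightarrow> real) set" where
  "test_functions U = {\<phi>. (\<forall>k. Ck k \<phi>) \<and> compact (supp \<phi>) \<and> supp \<phi> \<subseteq> U}"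


section \<open>Lebesgue and Sobolev spaces\<close>

text \<open>
  Elements of $L^p$ and $W^{1,p}$ are represented by functions on the whole space, whose values
  matter only almost everywhere on the given set.
\<close>

definition Lp :: "real \<Rightarrow> 'a::euclidean_space set \<Rightarrow> ('a \<Rightarrow> 'b::euclidean_space) set" where
  "Lp p S = {f. f \<in> borel_measurable (lebesgue_on S) \<and>
                integrable (lebesgue_on S) (\<lambda>x. norm (f x) powr p)}"

definition Lp_norm :: "real \<Rightarrow> 'a::euclidean_space set \<Rightarrow> ('a \<Rightarrow> 'b::euclidean_space) \<Rightarrow> real" where
  "Lp_norm p S f = (LINT x|lebesgue_on S. norm (f x) powr p) powr (1 / p)"

definition loc_integrable :: "'a::euclidean_space set \<Rightarrow> ('a \<Rightarrow> 'b::euclidean_space) \<Rightarrow> bool" where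
  "loc_integrable U f \<longleftrightarrow> (\<forall>C. compact C \<and> C \<subseteq> U \<longrightarrow> integrable (lebesgue_on C) f)"

definition is_weak_gradient ::
    "'a::euclidean_space set \<Rightarrow> ('a \<Rightarrow> real) \<Rightarrow> ('a \<Rightarrow> 'a) \<Rightarrow> bool" where
  "is_weak_gradient U f g \<longleftrightarrow> loc_integrable U f \<and> loc_integrable U g \<and>
     (\<forall>\<phi>\<in>test_functions U.
        (LINT x|lebesgue_on U. f x *\<^sub>R gradient \<phi> x) = - (LINT x|lebesgue_on U. \<phi> x *\<^sub>R g x))"

text \<open>The weak gradient is unique up to null sets, so the choice of a version is immaterial.\<close>

definition weak_gradient :: "'a::euclidean_space set \<Rightarrow> ('a \<Rightarrow> real) \<Rightarrow> 'a \<Rightarrow> 'a" where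
  "weak_gradient U f = (SOME g. is_weak_gradient U f g)"

text \<open>
  $W^{1,p}(K)$ is the Sobolev space on the interior of \<open>K\<close>. Integrals over \<open>K\<close> of Sobolev functions
  and of their weak gradients are therefore written as integrals over the interior; the boundaries
  of the sets of interest are null sets.
\<close>

definition W1 :: "real \<Rightarrow> 'a::euclidean_space set \<Rightarrow> ('a \<Rightarrow> real) set" where
  "W1 p K = {f \<in> Lp p (interior K). \<exists>g \<in> Lp p (interior K). is_weak_gradient (interior K) f g}"

definition W1_norm :: "real \<Rightarrow> 'a::euclidean_space set \<Rightarrow> ('a \<Rightarrow> real) \<Rightarrow> real" where
  "W1_norm p K f = (Lp_norm p (interior K) f powr p +
                    Lp_norm p (interior K) (weak_gradient (interior K) f) powr p) powr (1 / p)"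

definition W1_mean0 :: "real \<Rightarrow> 'a::euclidean_space set \<Rightarrow> ('a \<Rightarrow> real) set" where
  "W1_mean0 p K = {f \<in> W1 p K. (LINT x|lebesgue_on (interior K). f x) = 0}"

definition conj_exp :: "real \<Rightarrow> real" where
  "conj_exp p = p / (p - 1)"

text \<open>
  Elements of the dual of $W^{1,p}(K)$ are functionals on functions; boundedness makes them
  insensitive to changes on null sets, and their values off $W^{1,p}(K)$ are irrelevant.
\<close>

definition W1_dual :: "real \<Rightarrow> 'a::euclidean_space set \<Rightarrow> (('a \<Rightarrow> real) \<Rightarrow> real) set" where
  "W1_dual p K = {\<nu>.
     (\<forall>f\<in>W1 p K. \<forall>g\<in>W1 p K. \<nu> (\<lambda>x. f x + g x) = \<nu> f + \<nu> g) \<and>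
     (\<forall>c. \<forall>f\<in>W1 p K. \<nu> (\<lambda>x. c * f x) = c * \<nu> f) \<and>
     (\<exists>C. \<forall>f\<in>W1 p K. \<bar>\<nu> f\<bar> \<le> C * W1_norm p K f)}"

definition Wm1_perp :: "real \<Rightarrow> 'a::euclidean_space set \<Rightarrow> (('a \<Rightarrow> real) \<Rightarrow> real) set" where
  "Wm1_perp p K = {\<nu> \<in> W1_dual (conj_exp p) K. \<nu> (\<lambda>_. 1) = 0}"

definition div_Lp :: "'a::euclidean_space set \<Rightarrow> ('a \<Rightarrow> 'a) \<Rightarrow> ('a \<Rightarrow> real) \<Rightarrow> real" where
  "div_Lp K u \<phi> = - (LINT x|lebesgue_on (interior K). u x \<bullet> weak_gradient (interior K) \<phi> x)"

text \<open>Equality of two elements of $W^{-1,p}_\perp(K)$.\<close>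

definition eq_Wm1_perp ::
    "real \<Rightarrow> 'a::euclidean_space set \<Rightarrow> (('a \<Rightarrow> real) \<Rightarrow> real) \<Rightarrow> (('a \<Rightarrow> real) \<Rightarrow> real) \<Rightarrow> bool" where
  "eq_Wm1_perp p K \<nu> \<nu>' \<longleftrightarrow> (\<forall>\<phi>\<in>W1_mean0 (conj_exp p) K. \<nu> \<phi> = \<nu>' \<phi>)"

definition solves_neumann ::
    "real \<Rightarrow> 'a::euclidean_space set \<Rightarrow> (('a \<Rightarrow> real) \<Rightarrow> real) \<Rightarrow> ('a \<Rightarrow> real) \<Rightarrow> bool" where
  "solves_neumann p K \<nu> y \<longleftrightarrow> y \<in> W1_mean0 p K \<and>
     (\<forall>\<phi>\<in>W1_mean0 (conj_exp p) K.
        - (LINT x|lebesgue_on (interior K).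
             weak_gradient (interior K) y x \<bullet> weak_gradient (interior K) \<phi> x) = \<nu> \<phi>)"

text \<open>Uniqueness is uniqueness as an element of $W^{1,p}$, i.e. up to null sets.\<close>

definition neumann_uniquely_solvable :: "real \<Rightarrow> 'a::euclidean_space set \<Rightarrow> bool" where
  "neumann_uniquely_solvable p K \<longleftrightarrow> (\<forall>\<nu>\<in>Wm1_perp p K.
     (\<exists>y. solves_neumann p K \<nu> y) \<and>
     (\<forall>y y'. solves_neumann p K \<nu> y \<and> solves_neumann p K \<nu> y' \<longrightarrow>
        (AE x in lebesgue_on (interior K). y x = y' x)))"


section \<open>Signed and vector measures\<close>

text \<open>
  A finite Borel measure on a compact set \<open>K\<close> with values in a Euclidean space is a countably
  additive set function on the Borel sets of the whole space that is concentrated on \<open>K\<close>. So a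
  measure on \<open>K\<close> and its zero extension are the same object, and \<open>vmeasures K \<subseteq> vmeasures K'\<close> for
  \<open>K \<subseteq> K'\<close>. Off the Borel sets the value is fixed to be 0 (as for \<^const>\<open>measure\<close>). The case
  \<open>'b = real\<close> gives signed measures. Finite Borel measures on Euclidean space are Radon.
\<close>

definition vmeasures ::
    "'a::euclidean_space set \<Rightarrow> ('a set \<Rightarrow> 'b::euclidean_space) set" where
  "vmeasures K = {q.
     (\<forall>A. range A \<subseteq> sets borel \<and> disjoint_family A \<longrightarrow> (\<lambda>n::nat. q (A n)) sums q (\<Union>n. A n)) \<and>
     (\<forall>A\<in>sets borel. q A = q (A \<inter> K)) \<and>
     (\<forall>A. A \<notin> sets borel \<longrightarrow> q A = 0)}"

definition total_variation ::
    "('a::euclidean_space set \<Rightarrow> 'b::euclidean_space) \<Rightarrow> 'a measure" where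
  "total_variation q = measure_of UNIV (sets borel)
     (\<lambda>A. SUP P\<in>{P. finite P \<and> P \<subseteq> sets borel \<and> partition_on A P}. \<Sum>B\<in>P. ennreal (norm (q B)))"

text \<open>Positive part of the Jordan decomposition; \<open>ennreal\<close> maps negative numbers to 0.\<close>

definition jordan_pos :: "('a::euclidean_space set \<Rightarrow> real) \<Rightarrow> 'a measure" where
  "jordan_pos \<nu> = measure_of UNIV (sets borel) (\<lambda>A. SUP B\<in>{B\<in>sets borel. B \<subseteq> A}. ennreal (\<nu> B))"

definition jordan_neg :: "('a::euclidean_space set \<Rightarrow> real) \<Rightarrow> 'a measure" where
  "jordan_neg \<nu> = jordan_pos (\<lambda>A. - \<nu> A)"

text \<open>$\int_K F \cdot dq$, computed componentwise.\<close>

definition vint ::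
    "'a::euclidean_space set \<Rightarrow> ('a set \<Rightarrow> 'b::euclidean_space) \<Rightarrow> ('a \<Rightarrow> 'b) \<Rightarrow> real" where
  "vint K q F = (\<Sum>b\<in>Basis. (LINT x:K|jordan_pos (\<lambda>A. q A \<bullet> b). F x \<bullet> b)
                           - (LINT x:K|jordan_neg (\<lambda>A. q A \<bullet> b). F x \<bullet> b))"

definition weakstar_conv ::
    "'a::euclidean_space set \<Rightarrow> (nat \<Rightarrow> 'a set \<Rightarrow> 'b::euclidean_space) \<Rightarrow> ('a set \<Rightarrow> 'b) \<Rightarrow> bool" where
  "weakstar_conv K qs q \<longleftrightarrow> (\<forall>F. continuous_on K F \<longrightarrow> (\<lambda>n. vint K (qs n) F) \<longlonglongrightarrow> vint K q F)"

definition abs_cont_dx :: "('a::euclidean_space set \<Rightarrow> 'b::euclidean_space) \<Rightarrow> bool" where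
  "abs_cont_dx q \<longleftrightarrow> (\<forall>A\<in>sets borel. emeasure lborel A = 0 \<longrightarrow> q A = 0)"

text \<open>The Radon--Nikodym derivative $dq/dx$ (of an absolutely continuous \<open>q\<close>), unique up to null sets.\<close>

definition dq_dx :: "('a::euclidean_space set \<Rightarrow> 'b::euclidean_space) \<Rightarrow> 'a \<Rightarrow> 'b" where
  "dq_dx q = (SOME g. integrable lborel g \<and> (\<forall>A\<in>sets borel. q A = (LINT x:A|lborel. g x)))"

text \<open>
  A measure acts on a Sobolev function through the continuous representative of the latter on \<open>K\<close>,
  which for \<open>p > d\<close> is provided by the embedding of $W^{1,p}(K)$ into $C(K)$.
\<close>

definition cont_rep :: "'a::euclidean_space set \<Rightarrow> ('a \<Rightarrow> real) \<Rightarrow> 'a \<Rightarrow> real" where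
  "cont_rep K f = (SOME h. continuous_on K h \<and> (AE x in lebesgue_on (interior K). h x = f x))"

definition measure_as_Wm1 ::
    "'a::euclidean_space set \<Rightarrow> ('a set \<Rightarrow> real) \<Rightarrow> ('a \<Rightarrow> real) \<Rightarrow> real" where
  "measure_as_Wm1 K \<mu> \<phi> = vint K \<mu> (cont_rep K \<phi>)"

text \<open>
  $C^1(K)$: continuous on \<open>K\<close>, differentiable in the interior, with a gradient that extends
  continuously to \<open>K\<close>. If \<open>K\<close> is the closure of its interior, the extension is unique on \<open>K\<close>.
\<close>

definition is_C1_gradient :: "'a::euclidean_space set \<Rightarrow> ('a \<Rightarrow> real) \<Rightarrow> ('a \<Rightarrow> 'a) \<Rightarrow> bool" where
  "is_C1_gradient K f G \<longleftrightarrow> continuous_on K G \<and> (\<forall>x\<in>interior K. GDERIV f x :> G x)"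

definition C1 :: "'a::euclidean_space set \<Rightarrow> ('a \<Rightarrow> real) set" where
  "C1 K = {f. continuous_on K f \<and> (\<exists>G. is_C1_gradient K f G)}"

definition C1_gradient :: "'a::euclidean_space set \<Rightarrow> ('a \<Rightarrow> real) \<Rightarrow> 'a \<Rightarrow> 'a" where
  "C1_gradient K f = (SOME G. is_C1_gradient K f G)"

definition C1_mean0 :: "'a::euclidean_space set \<Rightarrow> ('a \<Rightarrow> real) set" where
  "C1_mean0 K = {f \<in> C1 K. (LINT x|lebesgue_on K. f x) = 0}"

definition div_M_eq ::
    "'a::euclidean_space set \<Rightarrow> ('a set \<Rightarrow> 'a) \<Rightarrow> (('a \<Rightarrow> real) \<Rightarrow> real) \<Rightarrow> bool" where
  "div_M_eq K q \<nu> \<longleftrightarrow> (\<forall>\<phi>\<in>C1_mean0 K. - vint K q (C1_gradient K \<phi>) = \<nu> \<phi>)"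


section \<open>The functionals and Gamma-convergence\<close>

text \<open>
  By the convention for \<^const>\<open>vmeasures\<close>, the same \<open>\<mu>\<close> also denotes its zero extension, and the
  functionals are defined on measures on any larger set, with value \<open>\<infinity>\<close> unless the argument is
  concentrated on \<open>K\<close>. In \<open>H_eps\<close> the set \<open>K\<close> is the enlarged domain belonging to \<open>\<epsilon>\<close>.
\<close>

definition H_eps ::
    "real \<Rightarrow> ('a::euclidean_space \<Rightarrow> real) \<Rightarrow> ('a set \<Rightarrow> real) \<Rightarrow> 'a set \<Rightarrow> real \<Rightarrow> ('a set \<Rightarrow> 'a) \<Rightarrow> ennreal"
  where
  "H_eps \<alpha> w \<mu> K \<epsilon> q =
     (if q \<in> vmeasures K \<and> abs_cont_dx q \<and> dq_dx q \<in> Lp \<alpha> K \<and>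
         eq_Wm1_perp \<alpha> K (div_Lp K (dq_dx q)) (measure_as_Wm1 K \<mu>)
      then (\<integral>\<^sup>+x\<in>K. ennreal (w x) \<partial>total_variation q)
             + ennreal (\<epsilon> / \<alpha> * Lp_norm \<alpha> K (dq_dx q) powr \<alpha>)
      else \<infinity>)"

definition H_lim ::
    "('a::euclidean_space \<Rightarrow> real) \<Rightarrow> ('a set \<Rightarrow> real) \<Rightarrow> 'a set \<Rightarrow> ('a set \<Rightarrow> 'a) \<Rightarrow> ennreal" where
  "H_lim w \<mu> K q =
     (if q \<in> vmeasures K \<and> div_M_eq K q (vint K \<mu>)
      then (\<integral>\<^sup>+x\<in>K. ennreal (w x) \<partial>total_variation q)
      else \<infinity>)"

definition gamma_limit ::
    "'x set \<Rightarrow> ((nat \<Rightarrow> 'x) \<Rightarrow> 'x \<Rightarrow> bool) \<Rightarrow> (nat \<Rightarrow> 'x \<Rightarrow> 'v::complete_linorder) \<Rightarrow> ('x \<Rightarrow> 'v) \<Rightarrow> bool" where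
  "gamma_limit X conv Fs F \<longleftrightarrow>
     (\<forall>x\<in>X. \<forall>xs. range xs \<subseteq> X \<and> conv xs x \<longrightarrow> F x \<le> liminf (\<lambda>n. Fs n (xs n))) \<and>
     (\<forall>x\<in>X. \<exists>xs. range xs \<subseteq> X \<and> conv xs x \<and> limsup (\<lambda>n. Fs n (xs n)) \<le> F x)"

definition borel_prob_on :: "'a::euclidean_space set \<Rightarrow> 'a measure \<Rightarrow> bool" where
  "borel_prob_on K M \<longleftrightarrow> sets M = sets borel \<and> emeasure M UNIV = 1 \<and> emeasure M K = 1"

end

theory Submission
  imports Defs
begin

text \<open>
  A local cone property of star shaped Lipschitz domains gives
  Morrey's estimate, hence continuous representatives for exponents \<open>p > d\<close>, and, by spreading the
  mass at each point along segments into a small ball and from there to a ball around the origin,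
  a field \<open>v \<in> L\<^sup>\<alpha>(\<Omega>)\<close> with divergence \<open>\<mu>\<close>.

  Lower bound: the densities of a sequence of bounded energy are tested with dilated \<open>C\<^sup>1\<close> functions,
  and the weighted variation is weak-* lower semicontinuous by the polar decomposition.

  Upper bound: for \<open>q\<close> of finite energy, \<open>q - v\<close> is divergence free. Let \<open>S\<^sub>k\<close> shrink towards the origin and
  then mollify, so that \<open>S\<^sub>k(q - v)\<close> is a smooth divergence free field supported in \<open>\<Omega>\<close>. The recovery
  sequence is \<open>v + S\<^sub>k(q - v)\<close> with \<open>k\<close> growing so slowly with \<open>\<epsilon> \<rightarrow> 0\<close> that the \<open>L\<^sup>\<alpha>\<close> term vanishes.
\<close>

text \<open>The bound on \<alpha> says that the conjugate exponent p exceeds the dimension d.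
  Carrying a point mass along segments into a ball gives a field of size |x - y|^(1-d) near the
  point, which then lies in L^\<alpha>; dually, Sobolev functions of exponent p are continuous and
  can be paired with \<mu>, which may have atoms. Smoothing q alone would smooth its divergence too,
  whereas \<open>H_eps\<close> prescribes \<mu> exactly; subtracting v first leaves a field without
  sources. S is the adjoint of the map from a gradient g to \<open>c *R moll c \<eta> g\<close>, the
  gradient of a dilated and mollified test function, so the fluxes of S q and S v cancel against
  every Sobolev test function. The energy is controlled with little convergence: v - S v tends to 0
  in L^1, |S q| is at most S|q|, and S|q| converges weakly against the continuous weight. In the
  lower bound the test functions live on \<Omega> but the fields on larger sets; dilation fits the
  domains, and the uniform bound on the variations that comes with weak convergence absorbs the
  error.\<close>

abbreviation borel_functions ("\<B>") where "\<B> \<equiv> borel_measurable borel"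

notation scaleR (infixr "*R" 75)

section \<open>Vector measures\<close>

definition borel_additive :: "('a::topological_space set => 'b::real_normed_vector) => bool" where
 "borel_additive q \<longleftrightarrow> (\<forall>A. range A \<subseteq> sets borel \<and> disjoint_family A \<longrightarrow>
   (\<lambda>n::nat. q (A n)) sums q (\<Union>n. A n))"

lemma borel_additiveD:
 "borel_additive q ==> range A \<subseteq> sets borel ==> disjoint_family A ==> (\<lambda>n::nat. q (A n)) sums q (\<Union>n. A n)"
 by (simp add: borel_additive_def)

lemma borel_additive_empty: assumes "borel_additive q" shows "q {} = 0"
proof -
 have "(\<lambda>n::nat. q {}) sums q (\<Union>n::nat. {})" by (rule borel_additiveD[OF assms]) (auto simp: disjoint_family_on_def)
 then have "(\<lambda>n::nat. q {}) \<longlonglongrightarrow> 0" by (simp add: sums_summable summable_LIMSEQ_zero)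
 then show ?thesis by (simp add: LIMSEQ_const_iff)
qed

lemma borel_additive_Un:
 assumes "borel_additive q" "A \<in> sets borel" "B \<in> sets borel" "A \<inter> B = {}"
 shows "q (A \<union> B) = q A + q B"
proof -
 have "(\<lambda>n. q (binaryset A B n)) sums q (\<Union>n. binaryset A B n)" using assms(2-4) by (intro borel_additiveD[OF assms(1)])
   (auto simp: range_binaryset_eq disjoint_family_on_def binaryset_def)
 moreover have "(\<lambda>n. q (binaryset A B n)) sums (\<Sum>n\<in>{0,1}. q (binaryset A B n))"
  by (rule sums_finite) (auto simp: binaryset_def borel_additive_empty[OF assms(1)])
 ultimately show ?thesis by (auto simp: UN_binaryset_eq binaryset_def dest: sums_unique2)
qed

lemma borel_additive_Diff:
 assumes "borel_additive q" "A \<in> sets borel" "B \<in> sets borel" "B \<subseteq> A"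
 shows "q (A - B) = q A - q B"
proof -
 have "q ((A - B) \<union> B) = q (A - B) + q B" using assms by (intro borel_additive_Un) auto
 moreover have "(A - B) \<union> B = A" using assms by auto
 ultimately show ?thesis by simp
qed

lemma borel_additive_minus: "borel_additive q ==> borel_additive (\<lambda>A. - q A)" by (auto simp: borel_additive_def intro: sums_minus)

lemma borel_additive_inner: "borel_additive q ==> borel_additive (\<lambda>A. q A \<bullet> b)"
 by (auto simp: borel_additive_def intro: bounded_linear.sums[OF bounded_linear_inner_left])

lemma vmeasures_borel_additive: "q \<in> vmeasures K ==> borel_additive q" by (auto simp: borel_additive_def vmeasures_def)

text \<open>Call a set bad if q is unbounded on its Borel subsets. If the whole space were bad,
  disjoint pieces with |q| > 1 could be peeled off one after the other while the remainder stays
  bad, and the series of their values could not converge.\<close>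

lemma borel_additive_bounded:
 fixes q :: "'a::topological_space set => real"
 assumes q: "borel_additive q"
 obtains C where "\<And>A. A \<in> sets borel ==> \<bar>q A\<bar> \<le> C"
proof (rule ccontr)
 assume no: "\<not> thesis"
 define bad where "bad E \<longleftrightarrow> E \<in> sets borel \<and> (\<forall>c. \<exists>B\<in>sets borel. B \<subseteq> E \<and> \<bar>q B\<bar> > c)" for E
 have step: "\<exists>E'. bad E' \<and> (E' \<subseteq> E \<and> \<bar>q (E - E')\<bar> > 1)" if E: "bad E" for E
 proof -
  \<comment> \<open>The margin 1 + |q E| makes both |q B| and |q (E - B)| exceed 1, so whichever
    half is bad can be kept and the other one removed.\<close>
  obtain B where B: "B \<in> sets borel" "B \<subseteq> E" "\<bar>q B\<bar> > 1 + \<bar>q E\<bar>" using E unfolding bad_def by blast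
  have EB: "E \<in> sets borel" "E - B \<in> sets borel" using E B by (auto simp: bad_def)
  have d: "q (E - B) = q E - q B" using EB B by (intro borel_additive_Diff[OF q]) auto
  have "bad B \<or> bad (E - B)"
  proof (rule ccontr)
   assume "\<not> ?thesis"
   then obtain c1 c2 where c: "\<And>D. D \<in> sets borel ==> D \<subseteq> B ==> \<bar>q D\<bar> \<le> c1"
     "\<And>D. D \<in> sets borel ==> D \<subseteq> E - B ==> \<bar>q D\<bar> \<le> c2" using B EB unfolding bad_def by (meson not_le)
   obtain D where D: "D \<in> sets borel" "D \<subseteq> E" "\<bar>q D\<bar> > c1 + c2" using E unfolding bad_def by blast
   have "q ((D \<inter> B) \<union> (D - B)) = q (D \<inter> B) + q (D - B)" using D B by (intro borel_additive_Un[OF q]) auto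
   moreover have "(D \<inter> B) \<union> (D - B) = D" by auto
   moreover have "\<bar>q (D \<inter> B)\<bar> \<le> c1" using D B by (intro c) auto
   moreover have "\<bar>q (D - B)\<bar> \<le> c2" using D B by (intro c) auto
   ultimately show False using D(3) by auto
  qed
  then show ?thesis
  proof
   assume "bad B" then show ?thesis using B d by (intro exI[of _ B]) auto
  next
   assume "bad (E - B)"
   moreover have "E - (E - B) = B" using B by auto
   ultimately show ?thesis using B by (intro exI[of _ "E - B"]) auto
  qed
 qed
 have "bad UNIV" unfolding bad_def using no that by (auto simp: not_le) (meson not_le)
 then have "\<exists>E. \<forall>n::nat. bad (E n) \<and> (E (Suc n) \<subseteq> E n \<and> \<bar>q (E n - E (Suc n))\<bar> > 1)"
  by (intro dependent_nat_choice step exI[of _ UNIV])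
 then obtain E where E: "\<And>n::nat. bad (E n)" "\<And>n. E (Suc n) \<subseteq> E n \<and> \<bar>q (E n - E (Suc n))\<bar> > 1" by auto
 define A where "A n = E n - E (Suc n)" for n
 have anti: "m \<le> n ==> E n \<subseteq> E m" for m n using E(2) by (simp add: lift_Suc_antimono_le)
 have "disjoint_family A" unfolding disjoint_family_on_def
 proof (intro ballI impI)
  fix m n :: nat assume "m \<noteq> n"
  then consider "Suc m \<le> n" | "Suc n \<le> m" by linarith
  then show "A m \<inter> A n = {}" using anti unfolding A_def by cases blast+
 qed
 moreover have "range A \<subseteq> sets borel" using E(1) by (auto simp: A_def bad_def)
 ultimately have "(\<lambda>n. q (A n)) sums q (\<Union>n. A n)" by (intro borel_additiveD[OF q])
 then have "(\<lambda>n. q (A n)) \<longlonglongrightarrow> 0" by (simp add: sums_summable summable_LIMSEQ_zero)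
 then have "\<forall>\<^sub>F n in sequentially. \<bar>q (A n)\<bar> < 1" using tendstoD[of _ 0 _ 1] by fastforce
 then show False using E(2) by (auto simp: A_def eventually_sequentially) (meson less_asym order_refl)
qed

lemma sets_measure_of_borel [simp]: "sets (measure_of UNIV (sets borel) \<mu>) = sets borel"
 by (metis sets.sigma_sets_eq sets_measure_of space_borel subset_UNIV Pow_UNIV)

text \<open>The empty set competes in the supremum, so the truncation of negative values by
  \<open>ennreal\<close> changes nothing. All computations are done with the real supremum S, which
  is finite by \<open>borel_additive_bounded\<close>; additivity holds because a subset of a
  disjoint union splits.\<close>

lemma jordan_pos_measure:
 fixes \<nu> :: "'a::euclidean_space set => real"
 assumes q: "borel_additive \<nu>"
 shows "sets (jordan_pos \<nu>) = sets borel" "finite_measure (jordan_pos \<nu>)"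
  and "A \<in> sets borel ==> measure (jordan_pos \<nu>) A = (SUP B\<in>{B\<in>sets borel. B \<subseteq> A}. \<nu> B)"
proof -
 obtain C where C: "\<And>A. A \<in> sets borel ==> \<bar>\<nu> A\<bar> \<le> C" using borel_additive_bounded[OF q] by blast
 define S where "S A = (SUP B\<in>{B\<in>sets borel. B \<subseteq> A}. \<nu> B)" for A
 have e: "\<nu> {} = 0" by (rule borel_additive_empty[OF q])
 have bdd: "bdd_above (\<nu> ` {B\<in>sets borel. B \<subseteq> A})" for A using C by (intro bdd_aboveI[of _ C]) (auto dest: abs_le_D1)
 have up: "\<nu> B \<le> S A" if "B \<in> sets borel" "B \<subseteq> A" for A B unfolding S_def using that by (intro cSUP_upper bdd) auto
 have least: "S A \<le> c" if "\<And>B. B \<in> sets borel ==> B \<subseteq> A ==> \<nu> B \<le> c" for A c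
  unfolding S_def using that by (intro cSUP_least) auto
 have pos: "0 \<le> S A" for A using up[of "{}" A] e by simp
 have S0: "S {} = 0" using pos[of "{}"] least[of "{}" 0] e by force
 have mono: "S A \<le> S B" if "A \<subseteq> B" for A B using that by (intro least up) auto
 have add: "S (A \<union> B) = S A + S B" if AB: "A \<in> sets borel" "B \<in> sets borel" "A \<inter> B = {}" for A B
 proof (rule antisym)
  show "S (A \<union> B) \<le> S A + S B"
  proof (rule least)
   fix D assume D: "D \<in> sets borel" "D \<subseteq> A \<union> B"
   have "D = (D \<inter> A) \<union> (D \<inter> B)" using D by auto
   then have "\<nu> D = \<nu> (D \<inter> A) + \<nu> (D \<inter> B)" using D AB borel_additive_Un[OF q, of "D \<inter> A" "D \<inter> B"] by auto
   moreover have "\<nu> (D \<inter> A) \<le> S A" "\<nu> (D \<inter> B) \<le> S B" using D AB by (auto intro!: up)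
   ultimately show "\<nu> D \<le> S A + S B" by simp
  qed
  have "S A \<le> S (A \<union> B) - \<nu> D" if D: "D \<in> sets borel" "D \<subseteq> B" for D
  proof (rule least)
   fix E assume E: "E \<in> sets borel" "E \<subseteq> A"
   have "\<nu> (E \<union> D) = \<nu> E + \<nu> D" using AB D E by (intro borel_additive_Un[OF q]) auto
   moreover have "\<nu> (E \<union> D) \<le> S (A \<union> B)" using D E by (intro up) auto
   ultimately show "\<nu> E \<le> S (A \<union> B) - \<nu> D" by simp
  qed
  then have "S B \<le> S (A \<union> B) - S A" by (intro least) (simp add: algebra_simps)
  then show "S A + S B \<le> S (A \<union> B)" by simp
 qed
 have sums: "(\<lambda>n::nat. S (A n)) sums S (\<Union>n. A n)" if A: "range A \<subseteq> sets borel" "disjoint_family A" for A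
 proof -
  have fin: "(\<Sum>i<n. S (A i)) = S (\<Union>i<n. A i)" for n
  proof (induction n)
   case (Suc n)
   have "S ((\<Union>i<n. A i) \<union> A n) = S (\<Union>i<n. A i) + S (A n)"
    using A by (intro add) (auto simp: disjoint_family_on_def, metis disjoint_iff nat_neq_iff)
   then show ?case using Suc by (simp add: lessThan_Suc Un_commute)
  qed (simp add: S0)
  have le: "(\<Sum>i<n. S (A i)) \<le> S (\<Union>n. A n)" for n unfolding fin by (intro mono) auto
  have sm: "summable (\<lambda>n. S (A n))" using le pos by (intro summableI_nonneg_bounded) auto
  have "suminf (\<lambda>n. S (A n)) \<le> S (\<Union>n. A n)" using le sm by (intro suminf_le_const) auto
  moreover have "S (\<Union>n. A n) \<le> suminf (\<lambda>n. S (A n))"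
  proof (rule least)
   fix B assume B: "B \<in> sets borel" "B \<subseteq> (\<Union>n. A n)"
   have "(\<lambda>n. \<nu> (B \<inter> A n)) sums \<nu> (\<Union>n. B \<inter> A n)" using A B by (intro borel_additiveD[OF q]) (auto simp: disjoint_family_on_def)
   moreover have "(\<Union>n. B \<inter> A n) = B" using B by auto
   ultimately have s: "(\<lambda>n. \<nu> (B \<inter> A n)) sums \<nu> B" by simp
   have "(\<Sum>n. \<nu> (B \<inter> A n)) \<le> (\<Sum>n. S (A n))" using A B s sm by (intro suminf_le up) (auto intro: sums_summable)
   then show "\<nu> B \<le> (\<Sum>n. S (A n))" using s sums_unique by force
  qed
  ultimately show ?thesis using sm by (simp add: sums_iff)
 qed
 have eq: "(SUP B\<in>{B\<in>sets borel. B \<subseteq> A}. ennreal (\<nu> B)) = ennreal (S A)" for A unfolding S_def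
 proof (rule antisym)
  show "(SUP B\<in>{B \<in> sets borel. B \<subseteq> A}. ennreal (\<nu> B)) \<le> ennreal (SUP B\<in>{B\<in>sets borel. B \<subseteq> A}. \<nu> B)"
   using up unfolding S_def by (intro SUP_least ennreal_leI) auto
  show "ennreal (SUP B\<in>{B\<in>sets borel. B \<subseteq> A}. \<nu> B) \<le> (SUP B\<in>{B \<in> sets borel. B \<subseteq> A}. ennreal (\<nu> B))"
  proof (rule ennreal_le_epsilon)
   fix e :: real assume "0 < e"
   then obtain B where B: "B \<in> sets borel" "B \<subseteq> A" "S A - e < \<nu> B" using less_cSUP_iff[OF _ bdd, of A "S A - e"] unfolding S_def by auto
   have "ennreal (S A) \<le> ennreal (\<nu> B + e)" using B by (intro ennreal_leI) simp
   also have "\<dots> \<le> ennreal (\<nu> B) + ennreal e"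
    by (cases "0 \<le> \<nu> B") (use \<open>0 < e\<close> in \<open>auto simp: ennreal_plus ennreal_neg intro: ennreal_leI\<close>)
   also have "\<dots> \<le> (SUP B\<in>{B \<in> sets borel. B \<subseteq> A}. ennreal (\<nu> B)) + ennreal e" using B by (intro add_right_mono SUP_upper) auto
   finally show "ennreal (SUP B\<in>{B\<in>sets borel. B \<subseteq> A}. \<nu> B) \<le> (SUP B\<in>{B \<in> sets borel. B \<subseteq> A}. ennreal (\<nu> B)) + ennreal e"
    unfolding S_def .
  qed
 qed
 show s: "sets (jordan_pos \<nu>) = sets borel" by (simp add: jordan_pos_def)
 have em: "emeasure (jordan_pos \<nu>) A = ennreal (S A)" if "A \<in> sets borel" for A
 proof -
  have "emeasure (jordan_pos \<nu>) A = (SUP B\<in>{B\<in>sets borel. B \<subseteq> A}. ennreal (\<nu> B))"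
  proof (rule emeasure_measure_of[of "jordan_pos \<nu>"], unfold s)
   show "positive (sets borel) (\<lambda>A. SUP B\<in>{B \<in> sets borel. B \<subseteq> A}. ennreal (\<nu> B))" by (simp add: positive_def eq S0)
   show "countably_additive (sets borel) (\<lambda>A. SUP B\<in>{B \<in> sets borel. B \<subseteq> A}. ennreal (\<nu> B))" unfolding countably_additive_def eq
   proof (intro allI impI)
    fix A :: "nat => 'a set" assume "range A \<subseteq> sets borel" "disjoint_family A"
    then show "(\<Sum>i. ennreal (S (A i))) = ennreal (S (\<Union>i. A i))" by (intro suminf_ennreal_eq sums pos)
   qed
  qed (use that in \<open>auto simp: jordan_pos_def\<close>)
  then show ?thesis by (simp add: eq)
 qed
 show "finite_measure (jordan_pos \<nu>)" by (rule finite_measureI) (metis em ennreal_neq_top infinity_ennreal_def s sets.top sets_eq_imp_space_eq space_borel)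
 show "A \<in> sets borel ==> measure (jordan_pos \<nu>) A = (SUP B\<in>{B\<in>sets borel. B \<subseteq> A}. \<nu> B)"
  using em pos by (simp add: measure_def S_def)
qed

text \<open>No Hahn set is needed: for B inside A, \<nu> B = \<nu> A - \<nu> (A - B) is at most
  \<nu> A plus the negative part of A. Taking the supremum over B gives one inequality, and the same
  for -\<nu> gives the other.\<close>

lemma jordan_decomposition:
 fixes \<nu> :: "'a::euclidean_space set => real"
 assumes q: "borel_additive \<nu>" and A: "A \<in> sets borel"
 shows "measure (jordan_pos \<nu>) A - measure (jordan_neg \<nu>) A = \<nu> A"
proof -
 have half: "measure (jordan_pos \<nu>) A \<le> \<nu> A + measure (jordan_pos (\<lambda>A. - \<nu> A)) A"
  if q: "borel_additive \<nu>" for \<nu> :: "'a set => real"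
 proof -
  note m = jordan_pos_measure(3)[OF q A] jordan_pos_measure(3)[OF borel_additive_minus[OF q] A]
  obtain C where C: "\<And>A. A \<in> sets borel ==> \<bar>\<nu> A\<bar> \<le> C" using borel_additive_bounded[OF q] by blast
  have bdd: "bdd_above ((\<lambda>A. - \<nu> A) ` {B\<in>sets borel. B \<subseteq> A})" by (rule bdd_aboveI[of _ C]) (use C in \<open>auto dest: abs_le_D2\<close>)
  show ?thesis unfolding m
  proof (rule cSUP_least)
   fix B assume B: "B \<in> {B \<in> sets borel. B \<subseteq> A}"
   then have "- \<nu> (A - B) \<le> (SUP B\<in>{B \<in> sets borel. B \<subseteq> A}. - \<nu> B)" using A by (intro cSUP_upper bdd) auto
   moreover have "\<nu> (A - B) = \<nu> A - \<nu> B" using A B by (intro borel_additive_Diff[OF q]) auto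
   ultimately show "\<nu> B \<le> \<nu> A + (SUP B\<in>{B \<in> sets borel. B \<subseteq> A}. - \<nu> B)" by simp
  qed auto
 qed
 show ?thesis using half[OF q] half[OF borel_additive_minus[OF q]] by (simp add: jordan_neg_def)
qed

text \<open>The differences are written crosswise as sums because extended nonnegative integrals
  cannot be subtracted; in this form the identity survives monotone limits.\<close>

lemma nn_integral_eq_of_measure_diff:
 assumes fin: "finite_measure P" "finite_measure N" "finite_measure P'" "finite_measure N'"
  and [measurable_cong]: "sets P = sets borel" "sets N = sets borel" "sets P' = sets borel" "sets N' = sets borel"
  and eq: "\<And>A. A \<in> sets borel ==> measure P A - measure N A = measure P' A - measure N' A"
  and u: "(u :: 'a::topological_space => ennreal) \<in> \<B>"
 shows "(\<integral>\<^sup>+x. u x \<partial>P) + (\<integral>\<^sup>+x. u x \<partial>N') = (\<integral>\<^sup>+x. u x \<partial>P') + (\<integral>\<^sup>+x. u x \<partial>N)"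
 using u
proof (induction rule: borel_measurable_induct)
 case (set A)
 have "ennreal (measure P A) + ennreal (measure N' A) = ennreal (measure P' A) + ennreal (measure N A)" using eq[OF set] by (simp flip: ennreal_plus)
 then show ?case using set fin by (simp add: finite_measure.emeasure_eq_measure)
next
 case (mult u c)
 then have "c * ((\<integral>\<^sup>+x. u x \<partial>P) + (\<integral>\<^sup>+x. u x \<partial>N')) = c * ((\<integral>\<^sup>+x. u x \<partial>P') + (\<integral>\<^sup>+x. u x \<partial>N))" by simp
 with mult(2) show ?case by (simp add: nn_integral_cmult distrib_left)
next
 case (add u v)
 then show ?case by (simp add: nn_integral_add) (metis (no_types, opaque_lifting) add.assoc add.left_commute)
next
 case (seq U)
 have [measurable]: "U i \<in> \<B>" for i using seq by auto
 have inc: "incseq (\<lambda>i. \<integral>\<^sup>+x. U i x \<partial>M)" for M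
  using \<open>incseq U\<close> by (auto simp: incseq_def le_fun_def intro!: nn_integral_mono)
 have s: "(\<integral>\<^sup>+x. (SUP i. U i x) \<partial>M) = (SUP i. \<integral>\<^sup>+x. U i x \<partial>M)" if "sets M = sets borel" for M
  using seq that by (intro nn_integral_monotone_convergence_SUP) (auto cong: measurable_cong_sets)
 have "(SUP i. \<integral>\<^sup>+x. U i x \<partial>P) + (SUP i. \<integral>\<^sup>+x. U i x \<partial>N') = (SUP i. (\<integral>\<^sup>+x. U i x \<partial>P) + (\<integral>\<^sup>+x. U i x \<partial>N'))"
  by (intro ennreal_SUP_add[symmetric] inc)
 also have "\<dots> = (SUP i. (\<integral>\<^sup>+x. U i x \<partial>P') + (\<integral>\<^sup>+x. U i x \<partial>N))" using seq by simp
 also have "\<dots> = (SUP i. \<integral>\<^sup>+x. U i x \<partial>P') + (SUP i. \<integral>\<^sup>+x. U i x \<partial>N)" by (intro ennreal_SUP_add inc)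
 finally show ?case by (simp add: s SUP_apply image_comp assms(5-8))
qed (auto cong: nn_integral_cong)

lemma integrable_bounded_borel:
 fixes g :: "'a::topological_space => 'b::{banach, second_countable_topology}"
 assumes "finite_measure M" "sets M = sets borel" "g \<in> \<B>" "\<And>x. norm (g x) \<le> C"
 shows "integrable M g" using assms by (intro finite_measure.integrable_const_bound[of M g C]) (auto cong: measurable_cong_sets)

text \<open>Makes integration against a signed measure independent of the pair of measures that
  represents it, so Jordan parts can be exchanged for more convenient ones. Adding C makes g
  nonnegative, and the extra total masses cancel by \<open>eq\<close> for the whole space.\<close>

lemma integral_eq_of_measure_diff:
 assumes fin: "finite_measure P" "finite_measure N" "finite_measure P'" "finite_measure N'"
  and s: "sets P = sets borel" "sets N = sets borel" "sets P' = sets borel" "sets N' = sets borel"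
  and eq: "\<And>A. A \<in> sets borel ==> measure P A - measure N A = measure P' A - measure N' A"
  and g: "(g :: 'a::topological_space => real) \<in> \<B>" "\<And>x. \<bar>g x\<bar> \<le> C"
 shows "(LINT x|P. g x) - (LINT x|N. g x) = (LINT x|P'. g x) - (LINT x|N'. g x)"
proof -
 have nn: "0 \<le> g x + C" for x using g(2)[of x] by linarith
 have i: "(\<integral>\<^sup>+x. ennreal (g x + C) \<partial>M) = ennreal ((LINT x|M. g x) + C * measure M UNIV)"
  "0 \<le> (LINT x|M. g x) + C * measure M UNIV"
  if M: "finite_measure M" "sets M = sets borel" for M
 proof -
  interpret finite_measure M by fact
  have sp: "space M = UNIV" using M(2) sets_eq_imp_space_eq by fastforce
  have ig: "integrable M g" using integrable_bounded_borel[OF M g(1), of C] g(2) by auto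
  have "(LINT x|M. g x + C) = (LINT x|M. g x) + C * measure M UNIV" using ig by (simp add: sp)
  moreover have "(\<integral>\<^sup>+x. ennreal (g x + C) \<partial>M) = ennreal (LINT x|M. g x + C)" using ig nn by (intro nn_integral_eq_integral) auto
  moreover have "0 \<le> (LINT x|M. g x + C)" using nn by (intro Bochner_Integration.integral_nonneg) auto
  ultimately show "(\<integral>\<^sup>+x. ennreal (g x + C) \<partial>M) = ennreal ((LINT x|M. g x) + C * measure M UNIV)"
   "0 \<le> (LINT x|M. g x) + C * measure M UNIV" by auto
 qed
 have "(\<integral>\<^sup>+x. ennreal (g x + C) \<partial>P) + (\<integral>\<^sup>+x. ennreal (g x + C) \<partial>N')
   = (\<integral>\<^sup>+x. ennreal (g x + C) \<partial>P') + (\<integral>\<^sup>+x. ennreal (g x + C) \<partial>N)"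
  using g(1) by (intro nn_integral_eq_of_measure_diff fin s eq) auto
 then have "(LINT x|P. g x) + C * measure P UNIV + ((LINT x|N'. g x) + C * measure N' UNIV)
   = (LINT x|P'. g x) + C * measure P' UNIV + ((LINT x|N. g x) + C * measure N UNIV)"
  using i(2)[OF fin(1) s(1)] i(2)[OF fin(2) s(2)] i(2)[OF fin(3) s(3)] i(2)[OF fin(4) s(4)]
  unfolding i(1)[OF fin(1) s(1)] i(1)[OF fin(2) s(2)] i(1)[OF fin(3) s(3)] i(1)[OF fin(4) s(4)] by (simp flip: ennreal_plus)
 moreover have "C * measure P UNIV - C * measure N UNIV = C * measure P' UNIV - C * measure N' UNIV" using eq[of UNIV] by (simp flip: right_diff_distrib)
 ultimately show ?thesis by linarith
qed

section \<open>Vector measures with densities and their total variation\<close>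

lemma vmeasures_zero_off:
 assumes "q \<in> vmeasures K" "A \<in> sets borel" "A \<inter> K = {}"
 shows "q A = 0"
proof -
 have "q A = q (A \<inter> K)" using assms(1,2) unfolding vmeasures_def by blast
 then show ?thesis using borel_additive_empty[OF vmeasures_borel_additive[OF assms(1)]] assms(3) by simp
qed

lemma density_set_function_vmeasures:
 fixes f :: "'a::euclidean_space => 'b::euclidean_space"
 assumes s: "sets L = sets borel" and f: "integrable L f" and K: "\<And>x. x \<notin> K ==> f x = 0" "K \<in> sets borel"
 shows "(\<lambda>A. if A \<in> sets borel then LINT x:A|L. f x else 0) \<in> vmeasures K" unfolding vmeasures_def
proof (intro CollectI conjI allI impI ballI)
 have si: "set_integrable L A f" if "A \<in> sets borel" for A using that f s unfolding set_integrable_def by (intro integrable_mult_indicator) auto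
 fix A :: "nat => 'a set" assume A: "range A \<subseteq> sets borel \<and> disjoint_family A"
 have disj: "A i \<inter> A j = {}" if "i \<noteq> j" for i j using A that by (auto simp: disjoint_family_on_def)
 have eq: "(LINT x:(\<Union>i. A i)|L. f x) = (\<Sum>i. (LINT x:(A i)|L. f x))" using A disj s by (intro lebesgue_integral_countable_add si) auto
 \<comment> \<open>\<open>eq\<close> only identifies the value of \<open>suminf\<close>;
   \<open>sums\<close> also asks for summability. It comes from the norms, whose partial sums are
   bounded by the integral of \<open>norm (f x)\<close>.\<close>
 have nn: "(\<lambda>i. LINT x:A i|L. norm (f x)) sums (LINT x:(\<Union>i. A i)|L. norm (f x))"
 proof -
  have "summable (\<lambda>i. LINT x:A i|L. norm (f x))"
  proof (rule summableI_nonneg_bounded[where x="LINT x|L. norm (f x)"])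
   fix n
   have "(\<Sum>i<n. LINT x:A i|L. norm (f x)) = (LINT x:(\<Union>i<n. A i)|L. norm (f x))"
   proof (rule set_integral_finite_Union[symmetric])
    show "disjoint_family_on A {..<n}" using A disj by (auto simp: disjoint_family_on_def)
   next
    fix i show "set_integrable L (A i) (\<lambda>x. norm (f x))" using si[of "A i"] A by (intro set_integrable_norm) auto
   qed (use A s in auto)
   also have "\<dots> \<le> (LINT x|L. norm (f x))" unfolding set_lebesgue_integral_def
   proof (rule integral_mono)
    have "set_integrable L (\<Union>i<n. A i) (\<lambda>x. norm (f x))" using si[of "\<Union>i<n. A i"] A by (intro set_integrable_norm) auto
    then show "integrable L (\<lambda>x. indicat_real (\<Union>i<n. A i) x *R norm (f x))" by (simp add: set_integrable_def)
   qed (use f in \<open>auto simp: indicator_def\<close>)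
   finally show "(\<Sum>i<n. LINT x:A i|L. norm (f x)) \<le> (LINT x|L. norm (f x))" .
  qed (auto simp: set_lebesgue_integral_def intro!: Bochner_Integration.integral_nonneg)
  moreover have "(LINT x:(\<Union>i. A i)|L. norm (f x)) = (\<Sum>i. (LINT x:(A i)|L. norm (f x)))"
   using A disj s si[of "\<Union>i. A i"] by (intro lebesgue_integral_countable_add set_integrable_norm) auto
  ultimately show ?thesis by (simp add: summable_sums)
 qed
 have "summable (\<lambda>i. LINT x:A i|L. f x)"
 proof (rule summable_comparison_test')
  show "summable (\<lambda>i. LINT x:A i|L. norm (f x))" using nn by (rule sums_summable)
  show "norm (LINT x:A i|L. f x) \<le> (LINT x:A i|L. norm (f x))" if "i \<ge> 0" for i using A by (intro set_integral_norm_bound si) auto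
 qed
 then have "(\<lambda>i. LINT x:A i|L. f x) sums (LINT x:(\<Union>i. A i)|L. f x)" unfolding eq by (rule summable_sums)
 then show "(\<lambda>n. if A n \<in> sets borel then LINT x:A n|L. f x else 0) sums
    (if (\<Union>n. A n) \<in> sets borel then LINT x:(\<Union>n. A n)|L. f x else 0)" using A by auto
next
 fix A :: "'a set" assume "A \<in> sets borel"
 moreover have "(LINT x:A|L. f x) = (LINT x:A \<inter> K|L. f x)" unfolding set_lebesgue_integral_def using K(1)
  by (intro Bochner_Integration.integral_cong) (auto simp: indicator_def)
 ultimately show "(if A \<in> sets borel then LINT x:A|L. f x else 0)
   = (if A \<inter> K \<in> sets borel then LINT x:A \<inter> K|L. f x else 0)" using K(2) by auto
qed auto

lemma finite_measure_density_real:
 assumes "integrable L f" "\<And>x. 0 \<le> f x"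
 shows "finite_measure (density L (\<lambda>x. ennreal (f x)))"
proof (rule finite_measureI)
 have "emeasure (density L (\<lambda>x. ennreal (f x))) (space L) = (\<integral>\<^sup>+x. ennreal (f x) \<partial>L)"
  using assms by (subst emeasure_density) (auto intro!: nn_integral_cong)
 also have "\<dots> = ennreal (LINT x|L. f x)" using assms by (intro nn_integral_eq_integral) auto
 finally show "emeasure (density L (\<lambda>x. ennreal (f x))) (space (density L (\<lambda>x. ennreal (f x)))) \<noteq> \<infinity>" by simp
qed

lemma measure_density_real:
 assumes "integrable L f" "\<And>x. 0 \<le> f x" "A \<in> sets L"
 shows "measure (density L (\<lambda>x. ennreal (f x))) A = (LINT x:A|L. f x)"
proof -
 have "A \<inter> space L = A" using assms(3) sets.sets_into_space by auto
 then have "measure (density L (\<lambda>x. ennreal (f x))) A = (LINT x|density L (\<lambda>x. ennreal (f x)). indicator A x)" by simp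
 also have "\<dots> = (LINT x|L. f x *R indicator A x)" using assms by (intro integral_density) auto
 finally show ?thesis by (simp add: set_lebesgue_integral_def mult.commute)
qed

text \<open>\<open>vint\<close> is defined by the Jordan parts of each component. The positive and
  negative parts of \<open>f x \<bullet> b\<close> are densities of another pair representing the
  same component, so \<open>integral_eq_of_measure_diff\<close> applies. The base L is kept general:
  it will be the total variation in the polar form and Lebesgue measure for fields.\<close>

lemma vint_density:
 fixes q :: "'a::euclidean_space set => 'b::euclidean_space"
 assumes q: "borel_additive q" and s: "sets L = sets borel" and f: "integrable L f"
  and qf: "\<And>A. A \<in> sets borel ==> q A = (LINT x:A|L. f x)"
  and F: "(\<lambda>x. indicator K x *R F x) \<in> \<B>" "\<And>x. x \<in> K ==> norm (F x) \<le> C"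
 shows "vint K q F = (LINT x:K|L. F x \<bullet> f x)"
proof -
 define G where "G x = indicator K x *R F x" for x
 have Gm: "G \<in> \<B>" using F(1) by (simp add: G_def[abs_def])
 have GC: "norm (G x) \<le> max C 0" for x using F(2)[of x] by (auto simp: G_def indicator_def)
 have fm: "f \<in> \<B>" using f s by (auto dest: borel_measurable_integrable cong: measurable_cong_sets)
 have int: "integrable L (\<lambda>x. (G x \<bullet> b) * (f x \<bullet> b))" if "b \<in> Basis" for b
 proof (rule Bochner_Integration.integrable_bound[of _ "\<lambda>x. max C 0 * norm (f x)"])
  show "AE x in L. norm ((G x \<bullet> b) * (f x \<bullet> b)) \<le> norm (max C 0 * norm (f x))"
  proof (rule AE_I2)
   fix x
   have "\<bar>G x \<bullet> b\<bar> \<le> max C 0" "\<bar>f x \<bullet> b\<bar> \<le> norm (f x)"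
    using order_trans[OF Basis_le_norm[OF that, of "G x"] GC[of x]] Basis_le_norm[OF that, of "f x"] by auto
   then show "norm ((G x \<bullet> b) * (f x \<bullet> b)) \<le> norm (max C 0 * norm (f x))" by (auto simp: abs_mult intro!: mult_mono)
  qed
  show "(\<lambda>x. (G x \<bullet> b) * (f x \<bullet> b)) \<in> borel_measurable L" using Gm fm s by (auto cong: measurable_cong_sets)
 qed (use f in auto)
 have "(LINT x:K|jordan_pos (\<lambda>A. q A \<bullet> b). F x \<bullet> b) - (LINT x:K|jordan_neg (\<lambda>A. q A \<bullet> b). F x \<bullet> b)
   = (LINT x|L. (G x \<bullet> b) * (f x \<bullet> b))" if b: "b \<in> Basis" for b
 proof -
  define fp fn where "fp x = max 0 (f x \<bullet> b)" and "fn x = max 0 (- (f x \<bullet> b))" for x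
  have ifp: "integrable L fp" "integrable L fn" unfolding fp_def[abs_def] fn_def[abs_def] using f by (auto intro!: integrable_max)
  have nn: "0 \<le> fp x" "0 \<le> fn x" for x by (auto simp: fp_def fn_def)
  let ?P = "density L (\<lambda>x. ennreal (fp x))" let ?N = "density L (\<lambda>x. ennreal (fn x))"
  have ba: "borel_additive (\<lambda>A. q A \<bullet> b)" using q by (rule borel_additive_inner)
  have gm: "(\<lambda>x. G x \<bullet> b) \<in> \<B>" using Gm by measurable
  have gm': "(\<lambda>x. G x \<bullet> b) \<in> borel_measurable L" using gm s by (auto cong: measurable_cong_sets)
  have gb: "\<bar>G x \<bullet> b\<bar> \<le> max C 0" for x using order_trans[OF Basis_le_norm[OF b, of "G x"] GC[of x]] .
  have "(LINT x|jordan_pos (\<lambda>A. q A \<bullet> b). G x \<bullet> b) - (LINT x|jordan_neg (\<lambda>A. q A \<bullet> b). G x \<bullet> b)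
    = (LINT x|?P. G x \<bullet> b) - (LINT x|?N. G x \<bullet> b)"
  proof (rule integral_eq_of_measure_diff)
   fix A :: "'a set" assume A: "A \<in> sets borel"
   have "measure ?P A - measure ?N A = (LINT x:A|L. fp x) - (LINT x:A|L. fn x)" using A s ifp nn by (simp add: measure_density_real)
   also have "\<dots> = (LINT x:A|L. fp x - fn x)"
   proof (rule set_integral_diff(2)[symmetric])
    show "set_integrable L A fp" "set_integrable L A fn" using A s ifp unfolding set_integrable_def by (intro integrable_mult_indicator; simp)+
   qed
   also have "(\<lambda>x. fp x - fn x) = (\<lambda>x. f x \<bullet> b)" by (auto simp: fp_def fn_def max_def)
   also have "(LINT x:A|L. f x \<bullet> b) = (LINT x|L. (indicator A x *R f x) \<bullet> b)" by (simp add: set_lebesgue_integral_def)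
   also have "\<dots> = (LINT x|L. indicator A x *R f x) \<bullet> b" using f A s by (intro integral_inner_left) (auto intro!: integrable_mult_indicator)
   finally show "measure (jordan_pos (\<lambda>A. q A \<bullet> b)) A - measure (jordan_neg (\<lambda>A. q A \<bullet> b)) A
     = measure ?P A - measure ?N A" using jordan_decomposition[OF ba A] qf[OF A] by (simp add: set_lebesgue_integral_def)
  qed (use ba s ifp nn gm gb in \<open>auto simp: jordan_neg_def intro!: jordan_pos_measure borel_additive_minus finite_measure_density_real\<close>)
  also have "\<dots> = (LINT x|L. fp x *R (G x \<bullet> b)) - (LINT x|L. fn x *R (G x \<bullet> b))" using ifp nn gm' by (simp add: integral_density)
  also have "\<dots> = (LINT x|L. fp x *R (G x \<bullet> b) - fn x *R (G x \<bullet> b))"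
  proof (rule Bochner_Integration.integral_diff[symmetric])
   have "integrable L (\<lambda>x. h x *R (G x \<bullet> b))" if "integrable L h" for h :: "'a => real"
   proof (rule Bochner_Integration.integrable_bound[of _ "\<lambda>x. max C 0 * h x"])
    show "AE x in L. norm (h x *R (G x \<bullet> b)) \<le> norm (max C 0 * h x)"
    proof (rule AE_I2)
     fix x
     have "\<bar>h x\<bar> * \<bar>G x \<bullet> b\<bar> \<le> \<bar>h x\<bar> * max C 0" using gb[of x] by (intro mult_left_mono) auto
     then show "norm (h x *R (G x \<bullet> b)) \<le> norm (max C 0 * h x)" by (simp add: abs_mult mult.commute)
    qed
   qed (use that gm' in auto)
   then show "integrable L (\<lambda>x. fp x *R (G x \<bullet> b))" "integrable L (\<lambda>x. fn x *R (G x \<bullet> b))" using ifp by auto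
  qed
  also have "\<dots> = (LINT x|L. (G x \<bullet> b) * (f x \<bullet> b))" by (rule Bochner_Integration.integral_cong) (auto simp: fp_def fn_def max_def)
  finally show ?thesis by (simp add: set_lebesgue_integral_def G_def)
 qed
 then have "vint K q F = (\<Sum>b\<in>Basis. \<integral>x. (G x \<bullet> b) * (f x \<bullet> b) \<partial>L)" by (simp add: vint_def)
 also have "\<dots> = (LINT x|L. (\<Sum>b\<in>Basis. (G x \<bullet> b) * (f x \<bullet> b)))" using int by (intro Bochner_Integration.integral_sum[symmetric]) auto
 also have "\<dots> = (LINT x|L. G x \<bullet> f x)" by (simp add: euclidean_inner[symmetric])
 finally show ?thesis by (simp add: G_def set_lebesgue_integral_def)
qed

lemma finite_sum_measure_ex:
 assumes I: "finite I" and s: "\<And>i. i \<in> I ==> sets (M i) = sets (borel :: 'a::topological_space measure)"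
 obtains L where "sets L = sets (borel :: 'a measure)" "\<And>A. A \<in> sets borel ==> emeasure L A = (\<Sum>i\<in>I. emeasure (M i) A)"
proof -
 define L where "L = measure_of UNIV (sets (borel :: 'a measure)) (\<lambda>A. \<Sum>i\<in>I. emeasure (M i) A)"
 have sL: "sets L = sets borel" by (simp add: L_def)
 have "emeasure L A = (\<Sum>i\<in>I. emeasure (M i) A)" if "A \<in> sets borel" for A
 proof (rule emeasure_measure_of[of L, OF L_def], unfold sL)
  show "positive (sets borel) (\<lambda>A. \<Sum>i\<in>I. emeasure (M i) A)" by (simp add: positive_def)
  show "countably_additive (sets borel) (\<lambda>A. \<Sum>i\<in>I. emeasure (M i) A)" unfolding countably_additive_def
  proof (intro allI impI)
   fix A :: "nat => 'a set" assume A: "range A \<subseteq> sets borel" "disjoint_family A"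
   have "(\<Sum>n. \<Sum>i\<in>I. emeasure (M i) (A n)) = (\<Sum>i\<in>I. \<Sum>n. emeasure (M i) (A n))" by (intro suminf_sum) auto
   also have "\<dots> = (\<Sum>i\<in>I. emeasure (M i) (\<Union>n. A n))" using A s by (intro sum.cong suminf_emeasure) auto
   finally show "(\<Sum>n. \<Sum>i\<in>I. emeasure (M i) (A n)) = (\<Sum>i\<in>I. emeasure (M i) (\<Union>n. A n))" .
  qed
 qed (use that in auto)
 then show ?thesis using sL that by blast
qed

text \<open>The sum L of the Jordan parts of all components dominates each of them, and
  Radon-Nikodym gives the components of f. L is an auxiliary base only: it allows
  \<open>total_variation\<close> to be computed before that is known to be a measure.\<close>

lemma vmeasure_density_ex:
 fixes q :: "'a::euclidean_space set => 'b::euclidean_space"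
 assumes q: "borel_additive q"
 obtains L f where "finite_measure L" "sets L = sets borel" "integrable L f"
  "\<And>A. A \<in> sets borel ==> q A = (LINT x:A|L. f x)"
proof -
 have ba: "borel_additive (\<lambda>A. q A \<bullet> b)" for b using q by (rule borel_additive_inner)
 define M where "M = (\<lambda>(b::'b, s). if s then jordan_pos (\<lambda>A. q A \<bullet> b) else jordan_neg (\<lambda>A. q A \<bullet> b))"
 have M: "finite_measure (M i)" "sets (M i) = sets borel" for i
  unfolding M_def using ba by (auto simp: jordan_neg_def split: prod.split intro!: jordan_pos_measure borel_additive_minus)
 obtain L where L: "sets L = sets borel"
  and eL: "\<And>A. A \<in> sets borel ==> emeasure L A = (\<Sum>i\<in>Basis \<times> UNIV. emeasure (M i) A)"
  using finite_sum_measure_ex[of "Basis \<times> (UNIV :: bool set)" M] M by auto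
 have spL: "space L = UNIV" using L sets_eq_imp_space_eq by fastforce
 have "emeasure (M i) UNIV \<noteq> \<infinity>" for i using finite_measure.emeasure_finite[OF M(1)[of i], of UNIV] by simp
 then have "(\<Sum>i\<in>Basis \<times> UNIV. emeasure (M i) UNIV) < top" by (subst ennreal_sum_less_top) (auto simp: less_top)
 then have "emeasure L (space L) \<noteq> \<infinity>" unfolding spL using eL[of UNIV] sets.top[of borel] by (metis infinity_ennreal_def less_irrefl space_borel)
 then interpret L: finite_measure L by (rule finite_measureI)
 have "\<exists>D. D \<in> borel_measurable L \<and> integrable L D \<and> (\<forall>x. 0 \<le> D x) \<and> (\<forall>A\<in>sets borel. measure (M i) A = (LINT x:A|L. D x))"
  if i: "i \<in> Basis \<times> UNIV" for i
 proof -
  have ac: "absolutely_continuous L (M i)" unfolding absolutely_continuous_def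
  proof
   fix A assume A: "A \<in> null_sets L"
   have "emeasure (M i) A \<le> (\<Sum>i\<in>Basis \<times> UNIV. emeasure (M i) A)" using i by (intro member_le_sum) auto
   also have "\<dots> = 0" using A eL[of A] L by (auto simp: null_sets_def)
   finally show "A \<in> null_sets (M i)" using A M L by (auto simp: null_sets_def)
  qed
  obtain D where D: "D \<in> borel_measurable L" "AE x in L. RN_deriv L (M i) x = ennreal (D x)" "\<And>x. 0 \<le> D x" using L.real_RN_deriv[OF M(1) ac] M L by metis
  have dm: "density L (\<lambda>x. ennreal (D x)) = M i"
  proof -
   have "density L (\<lambda>x. ennreal (D x)) = density L (RN_deriv L (M i))" using D by (intro density_cong) auto
   also have "\<dots> = M i" using ac M L by (intro L.density_RN_deriv) auto
   finally show ?thesis .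
  qed
  have "(\<integral>\<^sup>+x. ennreal (D x) \<partial>L) = emeasure (M i) (space L)"
   unfolding dm[symmetric] using D by (subst emeasure_density) (auto intro!: nn_integral_cong)
  also have "\<dots> < \<infinity>" using M(1)[of i] by (simp add: finite_measure.emeasure_eq_measure)
  finally have iD: "integrable L D" using D by (intro integrableI_nonneg) auto
  then show ?thesis using D dm measure_density_real[OF iD D(3)] L by metis
 qed
 then obtain D where D: "\<And>i. i \<in> Basis \<times> UNIV ==> integrable L (D i)"
   "\<And>i A. i \<in> Basis \<times> UNIV ==> A \<in> sets borel ==> measure (M i) A = (LINT x:A|L. D i x)" by metis
 define f where "f x = (\<Sum>b\<in>Basis. (D (b, True) x - D (b, False) x) *R b)" for x
 have fi: "integrable L f" unfolding f_def[abs_def] using D(1) by (intro Bochner_Integration.integrable_sum) auto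
 have fb: "f x \<bullet> b = D (b, True) x - D (b, False) x" if "b \<in> Basis" for x b unfolding f_def using that by simp
 have "q A = (LINT x:A|L. f x)" if A: "A \<in> sets borel" for A
 proof (rule euclidean_eqI)
  fix b :: 'b assume b: "b \<in> Basis"
  have si: "set_integrable L A (D (b, s))" for s using D(1)[of "(b, s)"] b A L unfolding set_integrable_def by (intro integrable_mult_indicator) auto
  have "q A \<bullet> b = measure (M (b, True)) A - measure (M (b, False)) A" using jordan_decomposition[OF ba[of b] A] by (simp add: M_def)
  also have "\<dots> = (LINT x:A|L. D (b, True) x) - (LINT x:A|L. D (b, False) x)" using b A by (simp add: D(2))
  also have "\<dots> = (LINT x:A|L. D (b, True) x - D (b, False) x)" using si by (intro set_integral_diff(2)[symmetric]) auto
  also have "\<dots> = (LINT x:A|L. f x \<bullet> b)" using fb b by simp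
  also have "\<dots> = (LINT x|L. (indicator A x *R f x) \<bullet> b)" by (simp add: set_lebesgue_integral_def)
  also have "\<dots> = (LINT x|L. indicator A x *R f x) \<bullet> b" using fi A L by (intro integral_inner_left) (auto intro!: integrable_mult_indicator)
  finally show "q A \<bullet> b = (LINT x:A|L. f x) \<bullet> b" by (simp add: set_lebesgue_integral_def)
 qed
 then show ?thesis using that[of L f] L.finite_measure_axioms L fi by blast
qed

text \<open>The estimate from above is the triangle inequality. For the estimate from below, a
  simple function u close to f in L^1 supplies the partition: on its level sets u is constant, so no
  cancellation occurs there. The second claim evaluates the defining supremum, which is available
  only once it is known to be countably additive.\<close>

lemma total_variation_density:
 fixes q :: "'a::euclidean_space set => 'b::euclidean_space"
 assumes s: "sets L = sets borel" and f: "integrable L f"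
  and qf: "\<And>A. A \<in> sets borel ==> q A = (LINT x:A|L. f x)"
 shows "total_variation q = density L (\<lambda>x. ennreal (norm (f x)))"
  and "A \<in> sets borel ==> (SUP P\<in>{P. finite P \<and> P \<subseteq> sets borel \<and> partition_on A P}. \<Sum>B\<in>P. ennreal (norm (q B)))
   = emeasure (total_variation q) A"
proof -
 let ?D = "density L (\<lambda>x. ennreal (norm (f x)))"
 let ?P = "\<lambda>A. {P. finite P \<and> P \<subseteq> sets borel \<and> partition_on A P}"
 have fm: "f \<in> borel_measurable L" using f by auto
 have sD: "sets ?D = sets borel" using s by simp
 have spL: "space L = UNIV" using s sets_eq_imp_space_eq by fastforce
 have si: "set_integrable L A f" if "A \<in> sets borel" for A using that f s unfolding set_integrable_def by (intro integrable_mult_indicator) auto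
 have sin: "set_integrable L A (\<lambda>x. norm (f x))" if "A \<in> sets borel" for A using si[OF that] by (rule set_integrable_norm)
 have eD: "emeasure ?D A = ennreal (LINT x:A|L. norm (f x))" if A: "A \<in> sets borel" for A
 proof -
  have "emeasure ?D A = (\<integral>\<^sup>+x. ennreal (indicator A x *R norm (f x)) \<partial>L)"
   using A s fm by (subst emeasure_density) (auto intro!: nn_integral_cong simp: indicator_def)
  also have "\<dots> = ennreal (LINT x:A|L. norm (f x))" using sin[OF A] unfolding set_lebesgue_integral_def set_integrable_def by (intro nn_integral_eq_integral) auto
  finally show ?thesis .
 qed
 have main: "(SUP P\<in>?P A. \<Sum>B\<in>P. ennreal (norm (q B))) = emeasure ?D A" if A: "A \<in> sets borel" for A
 proof (rule antisym)
  show "(SUP P\<in>?P A. \<Sum>B\<in>P. ennreal (norm (q B))) \<le> emeasure ?D A"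
  proof (rule SUP_least)
   fix P assume P: "P \<in> ?P A"
   have "(\<Sum>B\<in>P. ennreal (norm (q B))) \<le> (\<Sum>B\<in>P. emeasure ?D B)"
   proof (rule sum_mono)
    fix B assume "B \<in> P"
    then have B: "B \<in> sets borel" using P by auto
    have "norm (q B) \<le> (LINT x:B|L. norm (f x))" unfolding qf[OF B] using si[OF B] by (rule set_integral_norm_bound)
    then show "ennreal (norm (q B)) \<le> emeasure ?D B" unfolding eD[OF B] by (rule ennreal_leI)
   qed
   also have "\<dots> = emeasure ?D (\<Union>B\<in>P. B)" using P by (intro sum_emeasure)
     (auto simp: disjoint_family_on_def partition_on_def disjoint_def s)
   also have "(\<Union>B\<in>P. B) = A" using P by (auto simp: partition_on_def)
   finally show "(\<Sum>B\<in>P. ennreal (norm (q B))) \<le> emeasure ?D A" .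
  qed
  show "emeasure ?D A \<le> (SUP P\<in>?P A. \<Sum>B\<in>P. ennreal (norm (q B)))"
  proof (rule ennreal_le_epsilon)
   fix e :: real assume e: "0 < e"
   \<comment> \<open>Integrability is unfolded to its definition, a sequence of simple functions
     converging to f in L^1.\<close>
   obtain t where t: "\<And>i::nat. Bochner_Integration.simple_bochner_integrable L (t i)"
    and lim: "(\<lambda>i. \<integral>\<^sup>+x. norm (f x - t i x) \<partial>L) \<longlonglongrightarrow> 0"
    using f unfolding integrable.simps by (auto elim!: has_bochner_integral.cases)
   have "\<forall>\<^sub>F i in sequentially. (\<integral>\<^sup>+x. norm (f x - t i x) \<partial>L) < ennreal (e/2)" using lim e by (intro order_tendstoD) auto
   then obtain i where i: "(\<integral>\<^sup>+x. norm (f x - t i x) \<partial>L) < ennreal (e/2)" by (auto simp: eventually_sequentially)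
   define u where "u = t i"
   have usf: "simple_function L u" using t[of i] by (auto simp: u_def elim: Bochner_Integration.simple_bochner_integrable.cases)
   have ui: "integrable L u" using t[of i] unfolding u_def by (metis has_bochner_integral_simple_bochner_integrable integrable.intros)
   have fu: "integrable L (\<lambda>x. norm (f x - u x))" using f ui by auto
   have fue: "(LINT x|L. norm (f x - u x)) \<le> e/2" using i e fu by (simp add: u_def nn_integral_eq_integral ennreal_less_iff)
   have fin: "finite (u ` A)" using usf spL finite_subset[of "u ` A" "u ` UNIV"] by (auto simp: simple_function_def)
   define B where "B y = A \<inter> u -` {y}" for y
   have B: "B y \<in> sets borel" for y using simple_functionD(2)[OF usf, of "{y}"] A s spL by (auto simp: B_def)
   have inj: "inj_on B (u ` A)" by (auto simp: inj_on_def B_def)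
   have P: "B ` u ` A \<in> ?P A" using fin B by (auto simp: partition_on_def disjoint_def B_def)
   \<comment> \<open>On \<open>B y\<close> the function u equals y, so the norm of its integral is
     the integral of its norm. The distance of f and u is paid twice, once for the norms and once
     for the integrals; this is why u was chosen within e/2.\<close>
   have piece: "(LINT x:B y|L. norm (f x)) \<le> norm (q (B y)) + 2 * (LINT x:B y|L. norm (f x - u x))"
    (is "?l \<le> _") for y
   proof -
    have i1: "set_integrable L (B y) (\<lambda>x. norm (f x - u x))" "set_integrable L (B y) u"
     using B[of y] s fu ui unfolding set_integrable_def by (intro integrable_mult_indicator; simp)+
    have i2: "set_integrable L (B y) (\<lambda>x. norm (u x))" using i1(2) by (rule set_integrable_norm)
    have "?l \<le> (LINT x:B y|L. norm (f x - u x) + norm (u x))" using i1 i2 sin[OF B] norm_triangle_sub[of "f _" "u _"]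
     by (intro set_integral_mono) (auto simp: add.commute)
    also have "\<dots> = (LINT x:B y|L. norm (f x - u x)) + (LINT x:B y|L. norm (u x))" using i1 i2 by (intro set_integral_add)
    also have "(LINT x:B y|L. norm (u x)) = (LINT x:B y|L. norm y)" by (intro set_lebesgue_integral_cong) (use B s in \<open>auto simp: B_def\<close>)
    also have "\<dots> = norm (LINT x:B y|L. y)"
    proof -
     have "(LINT x:B y|L. y) = measure L (B y) *R y"
     \<comment> \<open>L may have infinite mass; that \<open>B y\<close> has finite mass follows
       from the integrability of u, which equals y there, provided y is not 0.\<close>
     proof (cases "y = 0 \<or> B y = {}")
      case False
      have "integrable L (\<lambda>x. indicator (B y) x *R norm y)" using i2 unfolding set_integrable_def
       by (rule Bochner_Integration.integrable_cong[THEN iffD1, rotated -1]) (auto simp: B_def indicator_def)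
      then have "integrable L (\<lambda>x. inverse (norm y) * (indicator (B y) x * norm y))" by simp
      also have "(\<lambda>x. inverse (norm y) * (indicator (B y) x * norm y)) = (\<lambda>x. indicat_real (B y) x)" using False by auto
      finally have "integrable L (indicat_real (B y))" .
      then show ?thesis using spL by (simp add: set_lebesgue_integral_def)
     qed (auto simp: set_lebesgue_integral_def)
     moreover have "(LINT x:B y|L. norm y) = measure L (B y) * norm y" using spL by (simp add: set_lebesgue_integral_def)
     ultimately show ?thesis by simp
    qed
    also have "(LINT x:B y|L. y) = (LINT x:B y|L. u x)" by (intro set_lebesgue_integral_cong) (use B s in \<open>auto simp: B_def\<close>)
    also have "(LINT x:B y|L. u x) = q (B y) - (LINT x:B y|L. f x - u x)" using si[OF B] i1(2) unfolding qf[OF B] by (subst set_integral_diff) auto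
    also have "norm \<dots> \<le> norm (q (B y)) + norm (LINT x:B y|L. f x - u x)" by (rule norm_triangle_ineq4)
    also have "norm (LINT x:B y|L. f x - u x) \<le> (LINT x:B y|L. norm (f x - u x))" using si[OF B] i1(2) by (intro set_integral_norm_bound set_integral_diff)
    finally show ?thesis by simp
   qed
   have un: "(\<Union>y\<in>u ` A. B y) = A" by (auto simp: B_def)
   have split: "(LINT x:A|L. g x) = (\<Sum>y\<in>u ` A. LINT x:B y|L. g x)" if "integrable L g" for g :: "'a => real"
   proof -
    have "(LINT x:(\<Union>y\<in>u ` A. B y)|L. g x) = (\<Sum>y\<in>u ` A. LINT x:B y|L. g x)"
    proof (intro set_integral_finite_Union)
     show "set_integrable L (B y) g" for y using B[of y] s that unfolding set_integrable_def by (intro integrable_mult_indicator) auto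
    qed (use fin B s in \<open>auto simp: disjoint_family_on_def B_def\<close>)
    then show ?thesis unfolding un .
   qed
   have "(LINT x:A|L. norm (f x)) = (\<Sum>y\<in>u ` A. LINT x:B y|L. norm (f x))" using f by (intro split) auto
   also have "\<dots> \<le> (\<Sum>y\<in>u ` A. norm (q (B y)) + 2 * (LINT x:B y|L. norm (f x - u x)))" by (intro sum_mono piece)
   also have "\<dots> = (\<Sum>y\<in>u ` A. norm (q (B y))) + 2 * (LINT x:A|L. norm (f x - u x))" using fu by (simp add: split sum.distrib sum_distrib_left)
   also have "(LINT x:A|L. norm (f x - u x)) \<le> (LINT x|L. norm (f x - u x))" unfolding set_lebesgue_integral_def
   proof (intro integral_mono fu)
    show "integrable L (\<lambda>x. indicat_real A x *R norm (f x - u x))" using A s fu by (intro integrable_mult_indicator) auto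
   qed (auto simp: indicator_def)
   finally have "(LINT x:A|L. norm (f x)) \<le> (\<Sum>y\<in>u ` A. norm (q (B y))) + e" using fue by simp
   then have "emeasure ?D A \<le> ennreal ((\<Sum>y\<in>u ` A. norm (q (B y))) + e)" unfolding eD[OF A] by (rule ennreal_leI)
   also have "\<dots> = (\<Sum>y\<in>u ` A. ennreal (norm (q (B y)))) + ennreal e" using e by (simp add: sum_nonneg)
   also have "(\<Sum>y\<in>u ` A. ennreal (norm (q (B y)))) = (\<Sum>B\<in>B ` u ` A. ennreal (norm (q B)))" using inj by (simp add: sum.reindex)
   also have "\<dots> \<le> (SUP P\<in>?P A. \<Sum>B\<in>P. ennreal (norm (q B)))" using P by (rule SUP_upper)
   finally show "emeasure ?D A \<le> (SUP P\<in>?P A. \<Sum>B\<in>P. ennreal (norm (q B))) + ennreal e" by (simp add: add_right_mono)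
  qed
 qed
 have "total_variation q = measure_of UNIV (sets borel) (emeasure ?D)" unfolding total_variation_def
 proof (rule measure_of_eq)
  fix A :: "'a set" assume "A \<in> sigma_sets UNIV (sets borel)"
  then have "A \<in> sets borel" using sets.sigma_sets_eq[of "borel :: 'a measure"] by simp
  then show "(SUP P\<in>?P A. \<Sum>B\<in>P. ennreal (norm (q B))) = emeasure ?D A" by (rule main)
 qed auto
 also have "\<dots> = ?D" using measure_of_of_measure[of ?D] spL s by simp
 finally show eq: "total_variation q = ?D" .
 show "A \<in> sets borel ==> (SUP P\<in>?P A. \<Sum>B\<in>P. ennreal (norm (q B))) = emeasure (total_variation q) A" unfolding eq by (rule main)
qed

section \<open>Polar decomposition and approximation by continuous fields\<close>

lemma space_of_sets_borel: "sets M = sets (borel :: 'a::topological_space measure) ==> space M = UNIV" using sets_eq_imp_space_eq[of M borel] by simp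

text \<open>With |q| = |f| L the direction is h = sgn f, and the auxiliary base L disappears from
  here on. Since sgn 0 = 0, h has norm at most 1 everywhere but norm 1 only almost everywhere; the
  zero set of f is null for |q|.\<close>

lemma total_variation_polar:
 fixes q :: "'a::euclidean_space set => 'b::euclidean_space"
 assumes q: "borel_additive q"
 obtains h where "sets (total_variation q) = sets borel" "finite_measure (total_variation q)"
  "h \<in> \<B>" "\<And>x. norm (h x) \<le> 1"
  "AE x in total_variation q. norm (h x) = 1"
  "\<And>A. A \<in> sets borel ==> q A = (LINT x:A|total_variation q. h x)"
proof -
 obtain L f where L: "finite_measure L" "sets L = sets borel" and f: "integrable L f"
  and qf: "\<And>A. A \<in> sets borel ==> q A = (LINT x:A|L. f x)" using vmeasure_density_ex[OF q] by blast
 have T: "total_variation q = density L (\<lambda>x. ennreal (norm (f x)))" using total_variation_density(1)[OF L(2) f qf] .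
 have fm: "f \<in> borel_measurable L" using f by auto
 then have fm': "f \<in> \<B>" using L(2) by (simp cong: measurable_cong_sets)
 define h where "h x = sgn (f x)" for x
 have hm: "h \<in> \<B>" unfolding h_def[abs_def] sgn_div_norm using fm' by measurable
 have hm': "h \<in> borel_measurable L" using hm L(2) by (simp cong: measurable_cong_sets)
 show ?thesis
 proof (rule that[of h])
  show "sets (total_variation q) = sets borel" unfolding T using L(2) by simp
  show "finite_measure (total_variation q)" unfolding T using f by (intro finite_measure_density_real) auto
  show "AE x in total_variation q. norm (h x) = 1" unfolding T by (subst AE_density) (use fm in \<open>auto simp: h_def norm_sgn\<close>)
  fix A :: "'a set" assume A: "A \<in> sets borel"
  have "(LINT x:A|total_variation q. h x) = (LINT x|L. norm (f x) *R (indicator A x *R h x))" unfolding T set_lebesgue_integral_def using fm hm' A L(2)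
   by (intro integral_density) auto
  also have "\<dots> = (LINT x|L. indicator A x *R f x)" by (intro Bochner_Integration.integral_cong) (auto simp: h_def sgn_div_norm)
  finally show "q A = (LINT x:A|total_variation q. h x)" using qf[OF A] by (simp add: set_lebesgue_integral_def)
 qed (use hm in \<open>auto simp: h_def norm_sgn\<close>)
qed

lemma total_variation_zero_off:
 fixes q :: "'a::euclidean_space set => 'b::euclidean_space"
 assumes q: "q \<in> vmeasures K" and K: "K \<in> sets borel"
 shows "AE x in total_variation q. x \<in> K"
proof -
 obtain L f where L: "sets L = sets borel" and f: "integrable L f"
  and qf: "\<And>A. A \<in> sets borel ==> q A = (LINT x:A|L. f x)" using vmeasure_density_ex[OF vmeasures_borel_additive[OF q]] by metis
 have "(\<Sum>B\<in>P. ennreal (norm (q B))) = 0" if "P \<subseteq> sets borel" "partition_on (-K) P" for P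
 proof (rule sum.neutral, rule ballI)
  fix B assume "B \<in> P"
  then have "q B = 0" using that by (intro vmeasures_zero_off[OF q]) (auto simp: partition_on_def)
  then show "ennreal (norm (q B)) = 0" by simp
 qed
 then have "(SUP P\<in>{P. finite P \<and> P \<subseteq> sets borel \<and> partition_on (-K) P}. \<Sum>B\<in>P. ennreal (norm (q B))) \<le> 0" by (intro SUP_least) auto
 then have "emeasure (total_variation q) (-K) = 0" using total_variation_density(2)[OF L f qf, of "-K"] K by auto
 then show ?thesis using K by (intro AE_I[of _ _ "-K"]) (auto simp: total_variation_def)
qed

lemma vint_polar:
 fixes q :: "'a::euclidean_space set => 'b::euclidean_space"
 assumes "borel_additive q" "sets (total_variation q) = sets borel" "finite_measure (total_variation q)"
  "h \<in> \<B>" "\<And>x. norm (h x) \<le> 1"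
  "\<And>A. A \<in> sets borel ==> q A = (LINT x:A|total_variation q. h x)"
  and F: "(\<lambda>x. indicator K x *R F x) \<in> \<B>" "\<And>x. x \<in> K ==> norm (F x) \<le> C"
 shows "vint K q F = (LINT x:K|total_variation q. F x \<bullet> h x)" by (rule vint_density[OF assms(1,2) _ assms(6) F])
   (auto intro!: integrable_bounded_borel[where C=1] assms)

text \<open>For indicators, inner and outer regularity leave a compact and an open set of nearly
  equal mass, and Urysohn's lemma interpolates between them; sums and limits follow by induction
  over integrable functions. Boundedness of g keeps it integrable along the way.\<close>

lemma integrable_approx_continuous:
 fixes f :: "'a::euclidean_space => 'b::euclidean_space"
 assumes M: "finite_measure M" "sets M = sets borel" and f: "integrable M f" and e: "0 < e"
 shows "\<exists>g B. continuous_on UNIV g \<and> (\<forall>x. norm (g x) \<le> B) \<and> (LINT x|M. norm (g x - f x)) < e" using f e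
proof (induction arbitrary: e rule: integrable_induct)
 case (base A c)
 interpret finite_measure M by fact
 have A: "A \<in> sets borel" using base M by auto
 \<comment> \<open>The interpolation differs from the indicator only on U - C, whose mass is below 2
   d, so the error is at most 2 d |c| < e. The added 1 covers c = 0.\<close>
 define d where "d = e / (3 * (norm c + 1))"
 have d: "0 < d" using base unfolding d_def by (intro divide_pos_pos) (auto simp: add_nonneg_pos)
 have "\<exists>C. C \<subseteq> A \<and> compact C \<and> measure M A < measure M C + d"
 proof (cases "measure M A = 0")
  case True then show ?thesis using d by (intro exI[of _ "{}"]) auto
 next
  case False
  then have "0 < measure M A" using zero_less_measure_iff by blast
  then have "ennreal (measure M A - d) < emeasure M A" using d by (simp add: emeasure_eq_measure ennreal_lessI)
  also have "\<dots> = (SUP K \<in> {K. K \<subseteq> A \<and> compact K}. emeasure M K)" using inner_regular[OF M(2) _ A] emeasure_finite by auto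
  finally obtain C where C: "C \<subseteq> A" "compact C" "ennreal (measure M A - d) < emeasure M C" by (auto simp: less_SUP_iff)
  then have "measure M A - d < measure M C" by (auto simp: emeasure_eq_measure ennreal_less_iff) (metis ennreal_leI leD not_le)
  then show ?thesis using C by (intro exI[of _ C]) auto
 qed
 then obtain C where C: "C \<subseteq> A" "compact C" "measure M A < measure M C + d" by blast
 have "emeasure M A < ennreal (measure M A + d)" using d by (simp add: emeasure_eq_measure ennreal_less_iff)
 then have "(INF U \<in> {U. A \<subseteq> U \<and> open U}. emeasure M U) < ennreal (measure M A + d)" using outer_regular[OF M(2) _ A] emeasure_finite by auto
 then obtain U where U: "A \<subseteq> U" "open U" "emeasure M U < ennreal (measure M A + d)" by (auto simp: INF_less_iff)
 then have mU: "measure M U < measure M A + d" by (simp add: emeasure_eq_measure ennreal_less_iff)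
 obtain u :: "'a => real" where u: "continuous_on UNIV u" "\<And>x. u x \<in> closed_segment 1 0"
   "\<And>x. x \<in> C ==> u x = 1" "\<And>x. x \<in> - U ==> u x = 0" using Urysohn[of C "-U" 1 "0::real"] C U compact_imp_closed by blast
 have u01: "0 \<le> u x" "u x \<le> 1" for x using u(2)[of x] by (auto simp: closed_segment_eq_real_ivl)
 have mm: "C \<in> sets M" "U \<in> sets M" using C U M by (auto intro: borel_compact)
 have um: "u \<in> borel_measurable M" using u(1) M(2) by (simp add: borel_measurable_continuous_onI cong: measurable_cong_sets)
 have "(LINT x|M. norm (u x *R c - indicator A x *R c)) \<le> (LINT x|M. indicator (U - C) x * norm c)"
 proof (rule integral_mono)
  show "integrable M (\<lambda>x. norm (u x *R c - indicator A x *R c))"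
  proof -
   have "integrable M u" by (rule integrable_const_bound[where B=1]) (use um u01 in auto)
   then show ?thesis using base by auto
  qed
  show "integrable M (\<lambda>x. indicat_real (U - C) x * norm c)" using mm by (intro integrable_mult_left integrable_real_indicator) (auto simp: less_top[symmetric])
  fix x
  show "norm (u x *R c - indicator A x *R c) \<le> indicator (U - C) x * norm c"
  proof (cases "x \<in> U - C")
   case True
   have "norm (u x *R c - indicator A x *R c) = \<bar>u x - indicator A x\<bar> * norm c" by (simp flip: scaleR_diff_left)
   also have "\<dots> \<le> 1 * norm c" using u01[of x] by (intro mult_right_mono) (auto simp: indicator_def)
   finally show ?thesis using True by simp
  next
   case False
   then have "u x = indicator A x" using u(3,4)[of x] C U by (auto simp: indicator_def)
   then show ?thesis by simp
  qed
 qed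
 also have "\<dots> = (measure M U - measure M C) * norm c" using mm C U by (subst finite_measure_Diff[symmetric]) (auto simp: M space_of_sets_borel)
 also have "\<dots> \<le> (2 * d) * norm c" using C mU by (intro mult_right_mono) auto
 also have "\<dots> < e"
 proof -
  have "2 * d * norm c < 3 * (d * (norm c + 1))" using d by (simp add: algebra_simps) (smt (verit) mult_nonneg_nonneg norm_ge_zero)
  also have "\<dots> = e" 
  proof -
   have "0 < norm c + 1" by (smt (verit) norm_ge_zero)
   then show ?thesis unfolding d_def by (simp add: divide_simps)
  qed
  finally show ?thesis .
 qed
 finally have less: "(LINT x|M. norm (u x *R c - indicator A x *R c)) < e" .
 have "norm (u x *R c) \<le> norm c" for x using u01[of x] by (simp add: mult_left_le_one_le)
 with less show ?case using u(1) by (intro exI[of _ "\<lambda>x. u x *R c"] exI[of _ "norm c"]) (auto intro!: continuous_intros)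
next
 case (add f1 f2)
 interpret finite_measure M by fact
 obtain g1 B1 where g1: "continuous_on UNIV g1" "\<And>x. norm (g1 x) \<le> B1" "(LINT x|M. norm (g1 x - f1 x)) < e/2" using add.IH(1)[of "e/2"] add.prems by auto
 obtain g2 B2 where g2: "continuous_on UNIV g2" "\<And>x. norm (g2 x) \<le> B2" "(LINT x|M. norm (g2 x - f2 x)) < e/2" using add.IH(2)[of "e/2"] add.prems by auto
 have i: "integrable M g1" "integrable M g2" using g1 g2 M by (auto intro!: integrable_bounded_borel borel_measurable_continuous_onI)
 have "(LINT x|M. norm ((g1 x + g2 x) - (f1 x + f2 x))) \<le> (LINT x|M. norm (g1 x - f1 x) + norm (g2 x - f2 x))"
  using i add by (intro integral_mono) (auto intro!: integrable_norm norm_diff_triangle_ineq)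
 also have "\<dots> < e" using i add g1 g2 by (subst Bochner_Integration.integral_add) auto
 finally show ?case using g1 g2 by (intro exI[of _ "\<lambda>x. g1 x + g2 x"] exI[of _ "B1 + B2"]) (auto intro!: continuous_intros norm_add_rule_thm)
next
 case (lim f s)
 have "(\<lambda>i. \<integral>x. norm (s i x - f x) \<partial>M) \<longlonglongrightarrow> (LINT x|M. 0)"
 proof (rule integral_dominated_convergence[where w="\<lambda>x. 3 * norm (f x)"])
  show "AE x in M. (\<lambda>i. norm (s i x - f x)) \<longlonglongrightarrow> 0" using lim.hyps(2) by (intro AE_I2) (auto simp: tendsto_norm_zero_iff LIM_zero_iff)
  show "AE x in M. norm (norm (s i x - f x)) \<le> 3 * norm (f x)" for i
   using lim.hyps(3)[of _ i] norm_triangle_ineq4[of "s i _" "f _"] by (intro AE_I2) (smt (verit) norm_ge_zero real_norm_def)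
 qed (use lim in auto)
 then have "\<forall>\<^sub>F i in sequentially. (LINT x|M. norm (s i x - f x)) < e/2" using lim.prems by (intro order_tendstoD(2)[of _ 0]) auto
 then obtain i where i: "(LINT x|M. norm (s i x - f x)) < e/2" by (auto simp: eventually_sequentially)
 obtain g B where g: "continuous_on UNIV g" "\<And>x. norm (g x) \<le> B" "(LINT x|M. norm (g x - s i x)) < e/2" using lim.IH[of "e/2" i] lim.prems by auto
 have gi: "integrable M g" using g M by (auto intro!: integrable_bounded_borel borel_measurable_continuous_onI)
 have "(LINT x|M. norm (g x - f x)) \<le> (LINT x|M. norm (g x - s i x) + norm (s i x - f x))"
  using gi lim dist_triangle[of "g _" "f _" "s i _"] by (intro integral_mono) (auto simp: dist_norm)
 also have "\<dots> < e" using i gi g lim by (subst Bochner_Integration.integral_add) auto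
 finally show ?case using g by blast
qed

text \<open>The projection onto the closed unit ball is 1-Lipschitz and fixes the values of f, so
  composing with it bounds the approximation without increasing the error.\<close>

lemma integrable_approx_continuous_unit:
 fixes f :: "'a::euclidean_space => 'b::euclidean_space"
 assumes M: "finite_measure M" "sets M = sets borel" and f: "f \<in> \<B>" "\<And>x. norm (f x) \<le> 1" and e: "0 < e"
 obtains g where "continuous_on UNIV g" "\<And>x. norm (g x) \<le> 1" "(LINT x|M. norm (g x - f x)) < e"
proof -
 have fi: "integrable M f" using f M by (intro integrable_bounded_borel[where C=1])
 obtain g B where g: "continuous_on UNIV g" "\<And>x. norm (g x) \<le> B" "(LINT x|M. norm (g x - f x)) < e" using integrable_approx_continuous[OF M fi e] by blast
 let ?c = "closest_point (cball (0::'b) 1)"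
 have c: "continuous_on UNIV (\<lambda>x. ?c (g x))" using continuous_on_compose2[OF continuous_on_closest_point[of "cball (0::'b) 1" UNIV] g(1)] by auto
 have n: "norm (?c (g x)) \<le> 1" for x using closest_point_in_set[of "cball (0::'b) 1" "g x"] by auto
 have gi: "integrable M g" "integrable M (\<lambda>x. ?c (g x))" by (rule integrable_bounded_borel[OF M borel_measurable_continuous_onI[OF g(1)] g(2)],
    rule integrable_bounded_borel[OF M borel_measurable_continuous_onI[OF c] n])
 have "(LINT x|M. norm (?c (g x) - f x)) \<le> (LINT x|M. norm (g x - f x))"
 proof (rule integral_mono)
  fix x
  have "?c (f x) = f x" using f(2)[of x] by (intro closest_point_self) auto
  then show "norm (?c (g x) - f x) \<le> norm (g x - f x)" using closest_point_lipschitz[of "cball (0::'b) 1" "g x" "f x"] by (auto simp: dist_norm)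
 qed (use gi fi in auto)
 then show ?thesis using that[of "\<lambda>x. ?c (g x)"] c n g(3) by auto
qed

section \<open>Weighted variation and weak-* convergence\<close>

lemma continuous_on_compact_bounded:
 fixes F :: "'a::topological_space => 'b::real_normed_vector"
 assumes "compact K" "continuous_on K F"
 obtains C where "0 < C" "\<And>x. x \<in> K ==> norm (F x) \<le> C"
proof -
 have "bounded (F ` K)" using assms by (intro compact_imp_bounded compact_continuous_image)
 then obtain C where "0 < C" "\<And>y. y \<in> F ` K ==> norm y \<le> C" using bounded_pos by metis
 then show ?thesis using that by auto
qed

lemma integrable_indicator_continuous:
 fixes F :: "'a::euclidean_space => 'b::euclidean_space"
 assumes "compact K" "continuous_on K F" "finite_measure M" "sets M = sets borel"
 shows "integrable M (\<lambda>x. indicator K x *R F x)"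
proof -
 obtain C where C: "0 < C" "\<And>x. x \<in> K ==> norm (F x) \<le> C" using continuous_on_compact_bounded[OF assms(1,2)] by blast
 show ?thesis
 proof (rule integrable_bounded_borel[OF assms(3,4)])
  show "(\<lambda>x. indicator K x *R F x) \<in> \<B>" using assms by (intro borel_measurable_continuous_on_indicator borel_compact)
  show "norm (indicator K x *R F x) \<le> C" for x using C by (auto simp: indicator_def)
 qed
qed

lemma nn_set_integral_eq_integral:
 fixes W :: "'a::euclidean_space => real"
 assumes K: "compact K" and M: "finite_measure M" "sets M = sets borel"
  and W: "continuous_on K W" "\<And>x. x \<in> K ==> 0 \<le> W x"
 shows "(\<integral>\<^sup>+x\<in>K. ennreal (W x) \<partial>M) = ennreal (LINT x:K|M. W x)"
proof -
 have "(\<integral>\<^sup>+x\<in>K. ennreal (W x) \<partial>M) = (\<integral>\<^sup>+x. ennreal (indicator K x *R W x) \<partial>M)"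
  by (intro nn_integral_cong) (auto simp: indicator_def)
 also have "\<dots> = ennreal (LINT x|M. indicator K x *R W x)" using integrable_indicator_continuous[OF K W(1) M] W(2)
  by (intro nn_integral_eq_integral) (auto simp: indicator_def)
 finally show ?thesis by (simp add: set_lebesgue_integral_def)
qed

lemma vint_eq_integral_polar:
 fixes q :: "'a::euclidean_space set => 'b::euclidean_space"
 assumes q: "borel_additive q"
 obtains h where "sets (total_variation q) = sets borel" "finite_measure (total_variation q)"
  "h \<in> \<B>" "\<And>x. norm (h x) \<le> 1"
  "AE x in total_variation q. norm (h x) = 1"
  "\<And>A. A \<in> sets borel ==> q A = (LINT x:A|total_variation q. h x)"
  "\<And>K F. compact K ==> continuous_on K F ==>
    integrable (total_variation q) (\<lambda>x. indicator K x *R (F x \<bullet> h x)) \<and>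
    vint K q F = (LINT x:K|total_variation q. F x \<bullet> h x)"
proof -
 obtain h where h: "sets (total_variation q) = sets borel" "finite_measure (total_variation q)"
  "h \<in> \<B>" "\<And>x. norm (h x) \<le> 1"
  "AE x in total_variation q. norm (h x) = 1"
  "\<And>A. A \<in> sets borel ==> q A = (LINT x:A|total_variation q. h x)" by (rule total_variation_polar[OF q]) blast
 have "integrable (total_variation q) (\<lambda>x. indicator K x *R (F x \<bullet> h x)) \<and>
   vint K q F = (LINT x:K|total_variation q. F x \<bullet> h x)" if K: "compact K" "continuous_on K F" for K F
 proof
  obtain C where C: "0 < C" "\<And>x. x \<in> K ==> norm (F x) \<le> C" using continuous_on_compact_bounded[OF K] by blast
  have m: "(\<lambda>x. indicator K x *R F x) \<in> \<B>" using K by (auto intro!: borel_measurable_continuous_on_indicator borel_compact)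
  show "vint K q F = (LINT x:K|total_variation q. F x \<bullet> h x)" by (rule vint_polar[OF q h(1-4) h(6) m C(2)])
  have "(\<lambda>x. (indicator K x *R F x) \<bullet> h x) \<in> \<B>" using m h(3) by measurable
  moreover have "\<bar>F x \<bullet> h x\<bar> \<le> C" if "x \<in> K" for x
  proof -
   have "\<bar>F x \<bullet> h x\<bar> \<le> norm (F x) * norm (h x)" by (rule Cauchy_Schwarz_ineq2)
   also have "\<dots> \<le> C * 1" using C h(4)[of x] that by (intro mult_mono) auto
   finally show ?thesis by simp
  qed
  ultimately show "integrable (total_variation q) (\<lambda>x. indicator K x *R (F x \<bullet> h x))"
   using C(1) by (intro integrable_bounded_borel[OF h(2,1), where C=C]) (auto simp: indicator_def)
 qed
 then show ?thesis using that[OF h] by blast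
qed

lemma vint_weighted_le:
 fixes q :: "'a::euclidean_space set => 'b::euclidean_space"
 assumes q: "borel_additive q" and K: "compact K" and F: "continuous_on K F" and W: "continuous_on K W"
  and FW: "\<And>x. x \<in> K ==> norm (F x) \<le> W x"
 shows "vint K q F \<le> (LINT x:K|total_variation q. W x)"
proof -
 obtain h where h: "sets (total_variation q) = sets borel" "finite_measure (total_variation q)"
  "\<And>x. norm (h x) \<le> 1"
  "integrable (total_variation q) (\<lambda>x. indicator K x *R (F x \<bullet> h x))"
  "vint K q F = (LINT x:K|total_variation q. F x \<bullet> h x)" by (rule vint_eq_integral_polar[OF q]) (use K F in blast)
 show ?thesis unfolding h(5) set_lebesgue_integral_def
 proof (rule integral_mono[OF h(4) integrable_indicator_continuous[OF K W h(2,1)]])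
  fix x
  have "F x \<bullet> h x \<le> W x" if "x \<in> K"
  proof -
   have "F x \<bullet> h x \<le> norm (F x) * norm (h x)" by (rule norm_cauchy_schwarz)
   also have "\<dots> \<le> norm (F x) * 1" using h(3)[of x] by (intro mult_left_mono) auto
   finally show ?thesis using FW[OF that] by simp
  qed
  then show "indicator K x *R (F x \<bullet> h x) \<le> indicator K x *R W x" by (auto simp: indicator_def)
 qed
qed

text \<open>H is a continuous approximation of the polar direction h. Where |h| = 1, the product H .
  h is at least 1 - |H - h|, so the loss is at most the maximum of W times the L^1 error. Using W H,
  instead of approximating W h as a whole, keeps the test field pointwise below W as
  \<open>vint_weighted_le\<close> demands.\<close>

lemma vint_weighted_approx:
 fixes q :: "'a::euclidean_space set => 'b::euclidean_space"
 assumes q: "borel_additive q" and K: "compact K" and W: "continuous_on K W" "\<And>x. x \<in> K ==> 0 \<le> W x" and e: "0 < e"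
 obtains H where "continuous_on UNIV H" "\<And>x. norm (H x) \<le> 1"
  "(LINT x:K|total_variation q. W x) - e \<le> vint K q (\<lambda>x. W x *R H x)"
proof -
 let ?T = "total_variation q"
 obtain h where h: "sets ?T = sets borel" "finite_measure ?T"
  "h \<in> \<B>" "\<And>x. norm (h x) \<le> 1" "AE x in ?T. norm (h x) = 1"
  and v: "\<And>F. continuous_on K F ==> integrable ?T (\<lambda>x. indicator K x *R (F x \<bullet> h x)) \<and>
    vint K q F = (LINT x:K|?T. F x \<bullet> h x)" by (rule vint_eq_integral_polar[OF q]) (use K in blast)
 obtain C where C: "0 < C" "\<And>x. x \<in> K ==> norm (W x) \<le> C" using continuous_on_compact_bounded[OF K W(1)] by blast
 obtain H where H: "continuous_on UNIV H" "\<And>x. norm (H x) \<le> 1" "(LINT x|?T. norm (H x - h x)) < e / C"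
  using integrable_approx_continuous_unit[OF h(2,1,3,4), of "e / C"] e C by auto
 have hc: "continuous_on K (\<lambda>x. W x *R H x)" using W H by (intro continuous_intros continuous_on_subset[OF H(1)]) auto
 have iH: "integrable ?T (\<lambda>x. norm (H x - h x))" by (intro integrable_norm Bochner_Integration.integrable_diff integrable_bounded_borel[OF h(2,1), where C=1])
   (use H h in \<open>auto intro: borel_measurable_continuous_onI\<close>)
 have "(LINT x:K|?T. W x) - C * (LINT x|?T. norm (H x - h x))
   = (LINT x|?T. indicator K x *R W x - C * norm (H x - h x))" using integrable_indicator_continuous[OF K W(1) h(2,1)] iH
  by (simp add: set_lebesgue_integral_def)
 also have "\<dots> \<le> (LINT x|?T. indicator K x *R ((W x *R H x) \<bullet> h x))"
 proof (rule integral_mono_AE)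
  show "AE x in ?T. indicator K x *R W x - C * norm (H x - h x) \<le> indicator K x *R ((W x *R H x) \<bullet> h x)" using h(5)
  proof eventually_elim
   fix x assume n: "norm (h x) = 1"
   show "indicator K x *R W x - C * norm (H x - h x) \<le> indicator K x *R ((W x *R H x) \<bullet> h x)"
   proof (cases "x \<in> K")
    case True
    have "- (norm (H x - h x)) \<le> (H x - h x) \<bullet> h x" using Cauchy_Schwarz_ineq2[of "H x - h x" "h x"] n by simp
    then have "W x * (1 - norm (H x - h x)) \<le> W x * (H x \<bullet> h x)"
     using W(2)[OF True] n by (intro mult_left_mono) (auto simp: inner_diff_left dot_square_norm)
    moreover have "W x * norm (H x - h x) \<le> C * norm (H x - h x)" using C(2)[OF True] by (intro mult_right_mono) auto
    ultimately show ?thesis using True by (simp add: right_diff_distrib)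
   qed (use C in auto)
  qed
 qed (use integrable_indicator_continuous[OF K W(1) h(2,1)] iH v[OF hc] in auto)
 also have "\<dots> = vint K q (\<lambda>x. W x *R H x)" using v[OF hc] by (simp add: set_lebesgue_integral_def)
 finally have "(LINT x:K|?T. W x) - C * (LINT x|?T. norm (H x - h x)) \<le> vint K q (\<lambda>x. W x *R H x)" .
 moreover have "C * (LINT x|?T. norm (H x - h x)) < e" using H(3) C by (simp add: field_simps)
 ultimately show ?thesis using that[OF H(1,2)] by simp
qed

text \<open>By \<open>vint_weighted_le\<close> and \<open>vint_weighted_approx\<close> the weighted
  variation is a supremum of integrals of fixed continuous fields, each of which passes to the
  weak-* limit.\<close>

lemma weighted_variation_lsc:
 fixes q :: "'a::euclidean_space set => 'b::euclidean_space"
 assumes K: "compact K" and conv: "weakstar_conv K qs q"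
  and q: "borel_additive q" "\<And>n. borel_additive (qs n)"
  and W: "continuous_on K W" "\<And>x. x \<in> K ==> 0 \<le> W x"
 shows "(\<integral>\<^sup>+x\<in>K. ennreal (W x) \<partial>total_variation q)
   \<le> liminf (\<lambda>n. \<integral>\<^sup>+x\<in>K. ennreal (W x) \<partial>total_variation (qs n))"
proof -
 have nn: "(\<integral>\<^sup>+x\<in>K. ennreal (W x) \<partial>total_variation r) = ennreal (LINT x:K|total_variation r. W x)"
  if "borel_additive r" for r :: "'a set => 'b" by (rule total_variation_polar[OF that]) (use nn_set_integral_eq_integral[OF K _ _ W] in blast)
 show ?thesis unfolding nn[OF q(1)] nn[OF q(2)]
 proof (rule ennreal_le_epsilon)
  fix e :: real assume e: "0 < e"
  let ?I = "LINT x:K|total_variation q. W x"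
  obtain H where H: "continuous_on UNIV H" "\<And>x. norm (H x) \<le> 1" "?I - e/2 \<le> vint K q (\<lambda>x. W x *R H x)"
   using vint_weighted_approx[OF q(1) K W, of "e/2"] e by auto
  have hc: "continuous_on K (\<lambda>x. W x *R H x)" using W H by (intro continuous_intros continuous_on_subset[OF H(1)]) auto
  have "(\<lambda>n. vint K (qs n) (\<lambda>x. W x *R H x)) \<longlonglongrightarrow> vint K q (\<lambda>x. W x *R H x)"
   using conv hc by (auto simp: weakstar_conv_def)
  then have "\<forall>\<^sub>F n in sequentially. ?I - e < vint K (qs n) (\<lambda>x. W x *R H x)" using H(3) e by (intro order_tendstoD) auto
  then have "\<forall>\<^sub>F n in sequentially. ennreal (?I - e) \<le> ennreal (LINT x:K|total_variation (qs n). W x)"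
  proof eventually_elim
   fix n assume *: "?I - e < vint K (qs n) (\<lambda>x. W x *R H x)"
   have "vint K (qs n) (\<lambda>x. W x *R H x) \<le> (LINT x:K|total_variation (qs n). W x)"
    using W(2) H(2) by (intro vint_weighted_le q K hc W) (auto intro!: mult_left_le)
   with * show "ennreal (?I - e) \<le> ennreal (LINT x:K|total_variation (qs n). W x)" by (intro ennreal_leI) auto
  qed
  then have le: "ennreal (?I - e) \<le> liminf (\<lambda>n. ennreal (LINT x:K|total_variation (qs n). W x))" by (rule Liminf_bounded)
  have "ennreal ?I \<le> ennreal (?I - e) + ennreal e" using e by (cases "?I - e \<ge> 0") (auto simp: ennreal_neg intro!: ennreal_leI simp flip: ennreal_plus)
  also have "\<dots> \<le> liminf (\<lambda>n. ennreal (LINT x:K|total_variation (qs n). W x)) + ennreal e" using le by (rule add_right_mono)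
  finally show "ennreal ?I \<le> liminf (\<lambda>n. ennreal (LINT x:K|total_variation (qs n). W x)) + ennreal e" .
 qed
qed

text \<open>The uniform boundedness principle: convergent sequences of numbers are bounded, so the
  functionals are pointwise bounded, and Baire's theorem makes this uniform on a ball of test
  fields.\<close>

lemma weakstar_conv_bounded_variation:
 fixes qs :: "nat => 'a::euclidean_space set => 'b::euclidean_space"
 assumes K: "compact K" and conv: "weakstar_conv K qs q" and q: "\<And>n. borel_additive (qs n)"
 obtains C where "\<And>n. (LINT x:K|total_variation (qs n). (1::real)) \<le> C"
proof -
 \<comment> \<open>The functionals act on bounded continuous fields on the whole space, which form a
   complete space; integration over K sees only their restriction.\<close>
 define l where "l n F = vint K (qs n) (apply_bcontfun F)" for n and F :: "'a \<Rightarrow>\<^sub>C 'b"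
 have bl: "bounded_linear (l n)" for n
 proof -
  let ?T = "total_variation (qs n)"
  obtain h where h: "sets ?T = sets borel" "finite_measure ?T"
   "\<And>F. continuous_on K F ==> integrable ?T (\<lambda>x. indicator K x *R (F x \<bullet> h x)) \<and>
    vint K (qs n) F = (LINT x:K|?T. F x \<bullet> h x)" by (rule vint_eq_integral_polar[OF q[of n]]) (use K in blast)
  have v: "integrable ?T (\<lambda>x. indicator K x * (apply_bcontfun F x \<bullet> h x))"
    "l n F = (LINT x|?T. indicator K x * (apply_bcontfun F x \<bullet> h x))" for F using h(3)[of "apply_bcontfun F"] by (auto simp: l_def set_lebesgue_integral_def)
  show ?thesis
  proof (rule bounded_linear_intro)
   show "l n (F + G) = l n F + l n G" for F G unfolding v(2) using v(1)[of F] v(1)[of G] by (subst Bochner_Integration.integral_add[symmetric])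
     (auto simp: plus_bcontfun.rep_eq inner_add_left distrib_left)
   show "l n (r *R F) = r *R l n F" for r F unfolding v(2) by (simp add: scaleR_bcontfun.rep_eq mult.left_commute)
   show "norm (l n F) \<le> norm F * (LINT x:K|?T. 1)" for F
   proof -
    have *: "vint K (qs n) (apply_bcontfun G) \<le> norm F * (LINT x:K|?T. 1)" if "norm G = norm F" for G
     using vint_weighted_le[OF q K, of "apply_bcontfun G" "\<lambda>_. norm F" n] norm_bounded[of G] that by (auto simp: set_lebesgue_integral_def mult.commute)
    have "l n (-F) = - l n F" unfolding v(2) by (simp add: uminus_bcontfun.rep_eq)
    then show ?thesis using *[of F] *[of "-F"] by (auto simp: l_def)
   qed
  qed
 qed
 \<comment> \<open>Closed sets on which all functionals are bounded by m. They cover the space, so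
   one of them has an interior point.\<close>
 define A where "A m = {F. \<forall>n. \<bar>l n F\<bar> \<le> real m}" for m
 have cl: "closed (A m)" for m
 proof -
  have "A m = (\<Inter>n. {F. \<bar>l n F\<bar> \<le> real m})" by (auto simp: A_def)
  moreover have "closed {F. \<bar>l n F\<bar> \<le> real m}" for n using bl[of n] by (intro closed_Collect_le continuous_intros linear_continuous_on)
  ultimately show ?thesis by auto
 qed
 have un: "(\<Union>m. A m) = UNIV"
 proof -
  have "\<exists>m. F \<in> A m" for F
  proof -
   have "(\<lambda>n. l n F) \<longlonglongrightarrow> vint K q (apply_bcontfun F)" using conv by (simp add: weakstar_conv_def l_def)
   then have "Bseq (\<lambda>n. l n F)" by (intro convergent_imp_Bseq) (auto simp: convergent_def)
   then obtain B where "\<And>n. \<bar>l n F\<bar> \<le> B" by (auto simp: Bseq_def)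
   moreover obtain m where "B \<le> real m" using real_arch_simple by blast
   ultimately show ?thesis  unfolding A_def using order_trans by blast
  qed
  then show ?thesis by auto
 qed
 have "\<exists>m. interior (A m) \<noteq> {}"
 proof (rule ccontr)
  assume "\<not> ?thesis"
  then have "Met_TC.mtopology interior_of \<Union>(range A) = {}" using cl complete_UNIV by (intro Met_TC.metric_Baire_category_alt) auto
  then show False using un by simp
 qed
 then obtain m F0 r where r: "0 < r" "ball F0 r \<subseteq> A m" by (metis ex_in_conv mem_interior)
 \<comment> \<open>F0 and F0 + (r/2) F both lie in the ball, whose functional values are at most m
   in modulus; subtracting them bounds (r/2) l F by 2 m.\<close>
 have bd: "l n F \<le> 4 * real m / r" if F: "norm F \<le> 1" for n F
 proof -
  have "F0 \<in> ball F0 r" "F0 + (r/2) *R F \<in> ball F0 r" using r F mult_left_le[of "norm F" r] by (auto simp: dist_norm)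
  then have "\<bar>l n F0\<bar> \<le> real m" "\<bar>l n (F0 + (r/2) *R F)\<bar> \<le> real m" using r(2) unfolding A_def by blast+
  moreover have "l n (F0 + (r/2) *R F) = l n F0 + (r/2) * l n F" using bounded_linear.linear[OF bl[of n]] by (simp add: linear_add linear_scale)
  ultimately have "(r/2) * l n F \<le> 2 * real m" by linarith
  then show ?thesis using r by (simp add: field_simps)
 qed
 show ?thesis
 proof (rule that)
  fix n
  \<comment> \<open>A unit field that realises the variation up to 1, which is the additional 1 in
    the final bound.\<close>
  obtain H where H: "continuous_on UNIV H" "\<And>x. norm (H x) \<le> 1"
   "(LINT x:K|total_variation (qs n). 1) - 1 \<le> vint K (qs n) (\<lambda>x. 1 *R H x)" by (rule vint_weighted_approx[OF q K, of "\<lambda>_. 1" 1 n]) auto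
  have HB: "H \<in> bcontfun" using H by (intro bcontfun_normI)
  have "norm (Bcontfun H) \<le> 1" using H(2) HB by (intro norm_bound) (simp add: Bcontfun_inverse)
  then show "(LINT x:K|total_variation (qs n). 1) \<le> 4 * real m / r + 1" using bd[of "Bcontfun H" n] H(3) HB by (simp add: l_def Bcontfun_inverse)
 qed
qed

section \<open>Fields with prescribed divergence\<close>

text \<open>Young's inequality for f / a and g / b, integrated. Strictly positive upper bounds A and
  B replace the norms, so vanishing or infinite integrals never need a separate case.\<close>

lemma nn_integral_Holder:
 fixes f g :: "'a => real"
 assumes pq: "1 < p" "1 < q" "1 / p + 1 / q = 1"
  and [measurable]: "f \<in> borel_measurable M" "g \<in> borel_measurable M"
  and nn: "\<And>x. 0 \<le> f x" "\<And>x. 0 \<le> g x"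
  and A: "0 < A" "(\<integral>\<^sup>+x. ennreal (f x powr p) \<partial>M) \<le> ennreal A"
  and B: "0 < B" "(\<integral>\<^sup>+x. ennreal (g x powr q) \<partial>M) \<le> ennreal B"
 shows "(\<integral>\<^sup>+x. ennreal (f x * g x) \<partial>M) \<le> ennreal (A powr (1/p) * B powr (1/q))"
proof -
 define a b where "a = A powr (1/p)" and "b = B powr (1/q)"
 have ab: "0 < a" "0 < b" "a powr p = A" "b powr q = B" using A(1) B(1) pq by (auto simp: a_def b_def powr_powr)
 define c d where "c = a * b / (A * p)" and "d = a * b / (B * q)"
 have cd: "0 \<le> c" "0 \<le> d" using ab A B pq by (auto simp: c_def d_def)
 have "f x * g x \<le> c * f x powr p + d * g x powr q" for x
 proof -
  have "(f x / a) * (g x / b) \<le> (f x / a) powr p / p + (g x / b) powr q / q" using pq nn ab by (intro Youngs_inequality) auto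
  also have "(f x / a) powr p = f x powr p / A" using ab by (simp add: powr_divide nn)
  also have "(g x / b) powr q = g x powr q / B" using ab by (simp add: powr_divide nn)
  finally have "(a * b) * ((f x / a) * (g x / b)) \<le> (a * b) * (f x powr p / A / p + g x powr q / B / q)" using ab by (intro mult_left_mono) auto
  then show ?thesis using ab by (simp add: c_def d_def algebra_simps)
 qed
 then have "(\<integral>\<^sup>+x. ennreal (f x * g x) \<partial>M) \<le> (\<integral>\<^sup>+x. ennreal c * ennreal (f x powr p) + ennreal d * ennreal (g x powr q) \<partial>M)"
  using cd by (intro nn_integral_mono) (simp add: ennreal_leI flip: ennreal_mult ennreal_plus)
 also have "\<dots> = ennreal c * (\<integral>\<^sup>+x. ennreal (f x powr p) \<partial>M) + ennreal d * (\<integral>\<^sup>+x. ennreal (g x powr q) \<partial>M)"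
  by (simp add: nn_integral_add nn_integral_cmult)
 also have "\<dots> \<le> ennreal c * ennreal A + ennreal d * ennreal B" by (intro add_mono mult_left_mono A B) auto
 also have "\<dots> = ennreal (c * A + d * B)" using cd A B by (simp add: ennreal_mult)
 also have "c * A + d * B = a * b * (1 / p + 1 / q)" using A B pq by (simp add: c_def d_def field_simps)
 finally show ?thesis using pq by (simp add: a_def b_def)
qed

section \<open>Changes of variables and Lebesgue measure on balls\<close>

lemma nn_integral_affine:
 fixes f :: "'a::euclidean_space => ennreal"
 assumes c: "c \<noteq> 0" and [measurable]: "f \<in> \<B>"
 shows "(\<integral>\<^sup>+x. f (a + c *R x) \<partial>lborel) = ennreal (1 / \<bar>c\<bar> ^ DIM('a)) * (\<integral>\<^sup>+x. f x \<partial>lborel)"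
proof -
 have "(\<integral>\<^sup>+x. f x \<partial>lborel) = ennreal (\<bar>c\<bar> ^ DIM('a)) * (\<integral>\<^sup>+x. f (a + c *R x) \<partial>lborel)"
  by (subst lborel_affine[OF c, of a])
   (simp add: nn_integral_density nn_integral_distr nn_integral_cmult)
 then have "ennreal (1 / \<bar>c\<bar> ^ DIM('a)) * (\<integral>\<^sup>+x. f x \<partial>lborel)
   = (ennreal (1 / \<bar>c\<bar> ^ DIM('a)) * ennreal (\<bar>c\<bar> ^ DIM('a))) * (\<integral>\<^sup>+x. f (a + c *R x) \<partial>lborel)"
  by (simp add: mult.assoc)
 also have "ennreal (1 / \<bar>c\<bar> ^ DIM('a)) * ennreal (\<bar>c\<bar> ^ DIM('a)) = 1" using c by (simp flip: ennreal_mult)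
 finally show ?thesis by simp
qed

lemma ball_in_borel [measurable, simp]: "ball z r \<in> sets borel" by (simp add: borel_open)

text \<open>Restriction by a density keeps the Borel sets of the whole space, so that product
  measures and Fubini's theorem work with the usual \<open>borel\<close> measurability.\<close>

definition lborel_on :: "'a::euclidean_space set => 'a measure" where
 "lborel_on S = density lborel (\<lambda>x. ennreal (indicat_real S x))"

lemma sets_lborel_on [simp, measurable_cong]: "sets (lborel_on S) = sets borel" by (simp add: lborel_on_def)

lemma space_lborel_on [simp]: "space (lborel_on S) = UNIV" by (simp add: lborel_on_def)

lemma nn_integral_lborel_on:
 assumes [measurable]: "S \<in> sets borel" "f \<in> \<B>"
 shows "(\<integral>\<^sup>+x. f x \<partial>lborel_on S) = (\<integral>\<^sup>+x. f x * indicator S x \<partial>lborel)"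
 unfolding lborel_on_def by (subst nn_integral_density) (auto intro!: nn_integral_cong simp: indicator_def)

lemma finite_lborel_on:
 assumes "S \<in> sets borel" "bounded S"
 shows "finite_measure (lborel_on S)"
proof (rule finite_measureI)
 have "emeasure (lborel_on S) UNIV = emeasure lborel S" using nn_integral_lborel_on[OF assms(1), of "\<lambda>_. 1"] assms(1) by simp
 then show "emeasure (lborel_on S) (space (lborel_on S)) \<noteq> \<infinity>" using emeasure_bounded_finite[OF assms(2)] by (simp add: less_top)
qed

lemma AE_lborel_on: "S \<in> sets borel ==> AE x in lborel_on S. x \<in> S" unfolding lborel_on_def by (subst AE_density) (auto simp: indicator_def)

lemma integral_lborel_on:
 fixes f :: "'a::euclidean_space => 'b::{banach, second_countable_topology}"
 assumes [measurable]: "S \<in> sets borel" "f \<in> \<B>"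
 shows "(LINT x|lborel_on S. f x) = (LINT x:S|lborel. f x)" unfolding lborel_on_def set_lebesgue_integral_def by (subst integral_density) auto

abbreviation unit_lborel :: "real measure" where "unit_lborel \<equiv> lborel_on {0<..<1}"

lemma finite_unit_lborel: "finite_measure unit_lborel" by (rule finite_lborel_on) auto

lemma AE_unit_lborel: "AE t in unit_lborel. 0 < t \<and> t < 1" using AE_lborel_on[of "{0<..<1::real}"] by simp

lemma finite_ball_lborel: "finite_measure (lborel_on (ball z r))" by (rule finite_lborel_on) auto

text \<open>Used with s = d/p. The condition s < 1 is then p > d, the threshold on which both
  Morrey's estimate and the transport of point masses rest.\<close>

lemma nn_integral_unit_powr:
 assumes "s < 1"
 shows "(\<integral>\<^sup>+t. ennreal (t powr - s) \<partial>unit_lborel) = ennreal (1 / (1 - s))"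
proof -
 have "(\<integral>\<^sup>+t. ennreal (t powr - s) \<partial>unit_lborel) = (\<integral>\<^sup>+t. ennreal (t powr - s) * indicator {0..1} t \<partial>lborel)"
 proof (subst nn_integral_lborel_on)
  have *: "AE x in lborel. x \<noteq> (0::real)" "AE x in lborel. x \<noteq> (1::real)" by (rule AE_lborel_singleton)+
  then show "(\<integral>\<^sup>+x. ennreal (x powr - s) * indicator {0<..<1} x \<partial>lborel) = (\<integral>\<^sup>+t. ennreal (t powr - s) * indicator {0..1} t \<partial>lborel)"
   by (intro nn_integral_cong_AE, eventually_elim) (auto simp: indicator_def)
 qed auto
 also have "\<dots> = ennreal (1 powr (-s + 1) / (-s + 1))" using assms by (intro nn_integral_has_integral_lebesgue' has_integral_powr_from_0) auto
 finally show ?thesis by simp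
qed

text \<open>For fixed t, Hoelder's inequality on the ball and the change of variables y -> a t + c t
  y cost a factor (c t)^(-d/p). The integral over t is left open: c t = t describes segments from a
  point into a ball, singular at t = 0, and c t = 1 the parallel translation of a ball.\<close>

lemma path_estimate:
 fixes a :: "real => 'a::euclidean_space" and c :: "real => real"
 assumes pq: "1 < p" "1 < q" "1 / p + 1 / q = 1"
  and [measurable]: "a \<in> \<B>" "c \<in> \<B>" "u \<in> \<B>"
  and c: "\<And>t. 0 < t ==> t < 1 ==> 0 < c t" and r: "0 < r"
  and u: "\<And>x. 0 \<le> u x" "0 < A" "(\<integral>\<^sup>+x. ennreal (u x powr p) \<partial>lborel) \<le> ennreal A"
 shows "(\<integral>\<^sup>+y. \<integral>\<^sup>+t. ennreal (u (a t + c t *R y)) \<partial>unit_lborel \<partial>lborel_on (ball z r))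
  \<le> ennreal (A powr (1/p) * measure lborel (ball z r) powr (1/q)) *
   (\<integral>\<^sup>+t. ennreal (c t powr - (DIM('a) / p)) \<partial>unit_lborel)"
proof -
 let ?V = "measure lborel (ball z r)"
 have V: "0 < ?V" using r by (simp add: content_ball_pos)
 interpret pair_sigma_finite "lborel_on (ball z r)" unit_lborel
  by (intro pair_sigma_finite.intro finite_measure.axioms(1)[OF finite_unit_lborel] finite_measure.axioms(1)[OF finite_ball_lborel])
 have inner: "(\<integral>\<^sup>+y. ennreal (u (a t + c t *R y)) \<partial>lborel_on (ball z r))
   \<le> ennreal (A powr (1/p) * ?V powr (1/q)) * ennreal (c t powr - (DIM('a) / p))" if t: "0 < t" "t < 1" for t
 proof -
  note ct = c[OF t]
  have e: "(\<integral>\<^sup>+y. ennreal (u (a t + c t *R y) powr p) \<partial>lborel) \<le> ennreal (A / c t ^ DIM('a))"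
  proof -
   have "(\<integral>\<^sup>+y. ennreal (u (a t + c t *R y) powr p) \<partial>lborel) = ennreal (1 / c t ^ DIM('a)) * (\<integral>\<^sup>+y. ennreal (u y powr p) \<partial>lborel)"
    using nn_integral_affine[of "c t" "\<lambda>y. ennreal (u y powr p)" "a t"] ct by simp
   also have "\<dots> \<le> ennreal (1 / c t ^ DIM('a)) * ennreal A" by (intro mult_left_mono u) auto
   also have "\<dots> = ennreal (A / c t ^ DIM('a))" using ct u by (simp flip: ennreal_mult)
   finally show ?thesis .
  qed
  have b: "(\<integral>\<^sup>+y. ennreal (indicator (ball z r) y powr q) \<partial>lborel) \<le> ennreal ?V"
  proof -
   have "(\<integral>\<^sup>+y. ennreal (indicator (ball z r) y powr q) \<partial>lborel) = (\<integral>\<^sup>+y. indicator (ball z r) y \<partial>lborel)"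
    using pq by (intro nn_integral_cong) (auto simp: indicator_def)
   also have "\<dots> = ennreal ?V" using emeasure_lborel_ball_finite[of z r] by (simp add: emeasure_eq_ennreal_measure less_top)
   finally show ?thesis by simp
  qed
  have "(\<integral>\<^sup>+y. ennreal (u (a t + c t *R y)) \<partial>lborel_on (ball z r))
    = (\<integral>\<^sup>+y. ennreal (u (a t + c t *R y) * indicator (ball z r) y) \<partial>lborel)"
   by (subst nn_integral_lborel_on) (auto intro!: nn_integral_cong simp: indicator_def)
  also have "\<dots> \<le> ennreal ((A / c t ^ DIM('a)) powr (1/p) * ?V powr (1/q))" using u ct V by (intro nn_integral_Holder[OF pq] e b) auto
  also have "(A / c t ^ DIM('a)) powr (1/p) = A powr (1/p) * c t powr - (DIM('a) / p)"
   using ct u by (simp add: powr_divide powr_powr powr_minus_divide flip: powr_realpow)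
  finally show ?thesis using u by (simp add: ennreal_mult mult_ac)
 qed
 have "(\<integral>\<^sup>+y. \<integral>\<^sup>+t. ennreal (u (a t + c t *R y)) \<partial>unit_lborel \<partial>lborel_on (ball z r))
   = (\<integral>\<^sup>+t. \<integral>\<^sup>+y. ennreal (u (a t + c t *R y)) \<partial>lborel_on (ball z r) \<partial>unit_lborel)"
  by (rule Fubini'[symmetric]) simp
 also have "\<dots> \<le> (\<integral>\<^sup>+t. ennreal (A powr (1/p) * ?V powr (1/q)) * ennreal (c t powr - (DIM('a) / p)) \<partial>unit_lborel)"
 proof (rule nn_integral_mono_AE)
  show "AE t in unit_lborel. (\<integral>\<^sup>+y. ennreal (u (a t + c t *R y)) \<partial>lborel_on (ball z r))
    \<le> ennreal (A powr (1/p) * ?V powr (1/q)) * ennreal (c t powr - (DIM('a) / p))" using AE_unit_lborel by eventually_elim (auto intro!: inner)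
 qed
 also have "\<dots> = ennreal (A powr (1/p) * ?V powr (1/q)) * (\<integral>\<^sup>+t. ennreal (c t powr - (DIM('a) / p)) \<partial>unit_lborel)"
  by (rule nn_integral_cmult) simp
 finally show ?thesis .
qed

text \<open>The image under \<Phi> of the measure \<psi> M acts on nonnegative functions as a
  bounded functional on L^p, by \<open>est\<close>. Duality therefore gives it a density in L^q:
  absolute continuity comes from testing with indicators of null sets, the L^q bound from testing
  with powers of the density itself.\<close>

lemma path_density:
 fixes \<Phi> :: "'m => 'a::euclidean_space"
 assumes pq: "1 < p" "1 < q" "1 / p + 1 / q = 1"
  and M: "finite_measure M" and [measurable]: "\<Phi> \<in> borel_measurable M" "\<psi> \<in> borel_measurable M"
  and psi: "\<And>x. 0 \<le> \<psi> x" "\<And>x. \<psi> x \<le> D" and C: "0 < C"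
  and est: "\<And>u A. u \<in> \<B> ==> (\<And>x. 0 \<le> u x) ==> 0 < A ==>
   (\<integral>\<^sup>+x. ennreal (u x powr p) \<partial>lborel) \<le> ennreal A ==>
   (\<integral>\<^sup>+x. ennreal (u (\<Phi> x)) \<partial>M) \<le> ennreal (C * A powr (1/p))"
 obtains k :: "'a => real" where "k \<in> \<B>" "\<And>x. 0 \<le> k x" "integrable lborel k"
  "integrable lborel (\<lambda>x. k x powr q)"
  "\<And>g B. g \<in> \<B> ==> (\<And>x. \<bar>g x\<bar> \<le> B) ==> integrable lborel (\<lambda>x. g x * k x)"
  "\<And>g B. g \<in> \<B> ==> (\<And>x. \<bar>g x\<bar> \<le> B) ==>
    (LINT x|M. g (\<Phi> x) * \<psi> x) = (LBINT x. g x * k x)"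
proof -
 interpret M: finite_measure M by fact
 have D: "0 \<le> D" using psi[of undefined] by linarith
 have ipsi: "integrable M \<psi>" using psi by (intro M.integrable_const_bound[where B=D]) auto
 let ?P = "density M (\<lambda>x. ennreal (\<psi> x))"
 define N where "N = distr ?P borel \<Phi>"
 have sN: "sets N = sets lborel" by (simp add: N_def)
 interpret P: finite_measure ?P using ipsi psi(1) by (rule finite_measure_density_real)
 have fN: "finite_measure N" unfolding N_def by (rule P.finite_measure_distr) simp
 have nnN: "(\<integral>\<^sup>+x. ennreal (u x) \<partial>N) = (\<integral>\<^sup>+x. ennreal (\<psi> x) * ennreal (u (\<Phi> x)) \<partial>M)" if [measurable]: "u \<in> \<B>" for u
  unfolding N_def by (simp add: nn_integral_distr nn_integral_density)
 have estN: "(\<integral>\<^sup>+x. ennreal (u x) \<partial>N) \<le> ennreal (D * C * A powr (1/p))"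
  if u: "u \<in> \<B>" "\<And>x. 0 \<le> u x" "0 < A" "(\<integral>\<^sup>+x. ennreal (u x powr p) \<partial>lborel) \<le> ennreal A" for u A
 proof -
  have [measurable]: "u \<in> \<B>" by fact
  have "(\<integral>\<^sup>+x. ennreal (u x) \<partial>N) \<le> (\<integral>\<^sup>+x. ennreal D * ennreal (u (\<Phi> x)) \<partial>M)"
   unfolding nnN[OF u(1)] using psi by (intro nn_integral_mono mult_right_mono ennreal_leI) auto
  also have "\<dots> = ennreal D * (\<integral>\<^sup>+x. ennreal (u (\<Phi> x)) \<partial>M)" by (rule nn_integral_cmult) simp
  also have "\<dots> \<le> ennreal D * ennreal (C * A powr (1/p))" using u by (intro mult_left_mono est) auto
  finally show ?thesis using C D by (simp add: ennreal_mult mult.assoc)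
 qed
 have ac: "absolutely_continuous lborel N" unfolding absolutely_continuous_def
 proof
  fix S assume S: "S \<in> null_sets (lborel :: 'a measure)"
  then have [measurable]: "S \<in> sets borel" by auto
  have z: "(\<integral>\<^sup>+x. ennreal (indicator S x powr p) \<partial>lborel) = 0"
  proof -
   have "(\<integral>\<^sup>+x. ennreal (indicator S x powr p) \<partial>lborel) = (\<integral>\<^sup>+x. indicator S x \<partial>lborel)"
    using pq by (intro nn_integral_cong) (auto simp: indicator_def)
   then show ?thesis using S by auto
  qed
  have eN: "(\<integral>\<^sup>+x. ennreal (indicator S x) \<partial>N) = emeasure N S" using sN by (simp add: ennreal_indicator)
  have le: "emeasure N S \<le> ennreal e" if "0 < e" for e
  proof -
   \<comment> \<open>The indicator of a null set has L^p integral 0, but \<open>est\<close> asks for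
     a positive A. This A is chosen so that the resulting bound D C A^(1/p) is at most e.\<close>
   define A where "A = (e / (D * C + 1)) powr p"
   have DC: "0 < D * C + 1" using D C by (simp add: add_nonneg_pos)
   have "0 < A" using that DC by (simp add: A_def)
   then have "emeasure N S \<le> ennreal (D * C * A powr (1/p))" using estN[of "indicator S" A] z eN by auto
   also have "A powr (1/p) = e / (D * C + 1)" using that DC pq by (simp add: A_def powr_powr)
   also have "D * C * (e / (D * C + 1)) \<le> e" using that DC by (simp add: field_simps)
   finally show ?thesis using ennreal_leI order_trans by blast
  qed
  have "emeasure N S \<le> 0" by (rule ennreal_le_epsilon) (use le in auto)
  then show "S \<in> null_sets N" using S sN by (auto simp: null_sets_def)
 qed
 obtain k where k: "k \<in> borel_measurable lborel" "AE x in lborel. RN_deriv lborel N x = ennreal (k x)" "\<And>x. 0 \<le> k x"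
  using sigma_finite_measure.real_RN_deriv[OF sigma_finite_lborel fN ac sN] by metis
 have [measurable]: "k \<in> \<B>" using k(1) by simp
 have dN: "density lborel (\<lambda>x. ennreal (k x)) = N"
 proof -
  have "density lborel (\<lambda>x. ennreal (k x)) = density lborel (RN_deriv lborel N)" using k by (intro density_cong) auto
  also have "\<dots> = N" using ac sN by (intro sigma_finite_measure.density_RN_deriv[OF sigma_finite_lborel]) auto
  finally show ?thesis .
 qed
 have ik: "integrable lborel k"
 proof (rule integrableI_nonneg)
  have "(\<integral>\<^sup>+x. ennreal (k x) \<partial>lborel) = emeasure N UNIV" unfolding dN[symmetric] by (simp add: emeasure_density)
  then show "(\<integral>\<^sup>+x. ennreal (k x) \<partial>lborel) < \<infinity>" using finite_measure.emeasure_finite[OF fN, of UNIV] by (simp add: less_top)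
 qed (use k in auto)
 have kq: "(\<integral>\<^sup>+x. ennreal (k x powr q) \<partial>lborel) \<le> ennreal ((D * C) powr q)"
 proof -
  \<comment> \<open>Truncation in height and in space makes the L^q integral J finite a priori, so
    that one may divide by J^(1/p).\<close>
  define km where "km m x = min (k x) (real m) * indicator (ball 0 (real m)) x" for m x
  have [measurable]: "km m \<in> \<B>" for m unfolding km_def[abs_def] by measurable
  have km0: "0 \<le> km m x" "km m x \<le> k x" for m x using k(3)[of x] by (auto simp: km_def indicator_def)
  have bound: "(\<integral>\<^sup>+x. ennreal (km m x powr q) \<partial>lborel) \<le> ennreal ((D * C) powr q)" for m
  proof -
   let ?J = "\<integral>\<^sup>+x. ennreal (km m x powr q) \<partial>lborel"
   have "?J \<le> (\<integral>\<^sup>+x. ennreal (real m powr q) * indicator (ball (0::'a) (real m)) x \<partial>lborel)"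
    using k(3) pq by (intro nn_integral_mono) (auto simp: km_def indicator_def intro!: ennreal_leI powr_mono2)
   also have "\<dots> = ennreal (real m powr q) * emeasure lborel (ball (0::'a) (real m))" by (rule nn_integral_cmult_indicator) simp
   also have "\<dots> < \<infinity>" using emeasure_lborel_ball_finite[of "0::'a" "real m"] by (simp add: ennreal_mult_less_top)
   finally obtain J where J: "?J = ennreal J" "0 \<le> J" by (cases ?J) auto
   show ?thesis
   proof (cases "J = 0")
    case False
    then have Jp: "0 < J" using J by simp
    \<comment> \<open>The power q - 1 is the extremal choice in Hoelder's inequality: its p-th power
      is km^q. Testing with it yields J \<le> D C J^(1/p), that is J^(1/q) \<le> D C, uniformly in
      m.\<close>
    have pw: "(km m x powr (q - 1)) powr p = km m x powr q" for x
    proof -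
     have "(q - 1) * p = q" using pq by (simp add: field_simps)
     then show ?thesis by (simp add: powr_powr)
    qed
    have "?J \<le> (\<integral>\<^sup>+x. ennreal (k x) * ennreal (km m x powr (q - 1)) \<partial>lborel)"
    proof (intro nn_integral_mono)
     fix x
     have "km m x powr q = km m x * km m x powr (q - 1)" using km0[of m x] by (cases "km m x = 0") (auto simp: powr_diff)
     also have "\<dots> \<le> k x * km m x powr (q - 1)" using km0 by (intro mult_right_mono) auto
     finally show "ennreal (km m x powr q) \<le> ennreal (k x) * ennreal (km m x powr (q - 1))" using k(3) by (simp add: ennreal_leI flip: ennreal_mult)
    qed
    also have "\<dots> = (\<integral>\<^sup>+x. ennreal (km m x powr (q - 1)) \<partial>N)" unfolding dN[symmetric] by (simp add: nn_integral_density)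
    also have "\<dots> \<le> ennreal (D * C * J powr (1/p))" using J Jp by (intro estN) (auto simp: pw)
    finally have "J \<le> D * C * J powr (1/p)" using J C D by simp
    moreover have "J = J powr (1/p) * J powr (1/q)" using Jp pq by (simp flip: powr_add)
    ultimately have "J powr (1/p) * J powr (1/q) \<le> J powr (1/p) * (D * C)" by (simp add: mult.commute)
    then have "J powr (1/q) \<le> D * C" using Jp by simp
    then have "(J powr (1/q)) powr q \<le> (D * C) powr q" using pq by (intro powr_mono2) auto
    then have "J \<le> (D * C) powr q" using Jp pq by (simp add: powr_powr)
    then show ?thesis using J by (simp add: ennreal_leI)
   qed (use J in simp)
  qed
  have "(\<integral>\<^sup>+x. ennreal (k x powr q) \<partial>lborel) = (\<integral>\<^sup>+x. liminf (\<lambda>m. ennreal (km m x powr q)) \<partial>lborel)"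
  proof (rule nn_integral_cong)
   fix x
   obtain m0 where m0: "max (k x) (norm x + 1) \<le> real m0" using real_arch_simple by blast
   have "\<forall>\<^sub>F m in sequentially. ennreal (km m x powr q) = ennreal (k x powr q)" using eventually_ge_at_top[of m0]
   proof eventually_elim
    fix m assume "m0 \<le> m"
    then have "real m0 \<le> real m" by simp
    then have "k x \<le> real m" "norm x < real m" using m0 by linarith+
    then show "ennreal (km m x powr q) = ennreal (k x powr q)" by (simp add: km_def)
   qed
   then have "(\<lambda>m. ennreal (km m x powr q)) \<longlonglongrightarrow> ennreal (k x powr q)" by (rule tendsto_eventually)
   then show "ennreal (k x powr q) = liminf (\<lambda>m. ennreal (km m x powr q))" by (intro lim_imp_Liminf[symmetric]) simp_all
  qed
  also have "\<dots> \<le> liminf (\<lambda>m. \<integral>\<^sup>+x. ennreal (km m x powr q) \<partial>lborel)" by (rule nn_integral_liminf) simp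
  also have "\<dots> \<le> ennreal ((D * C) powr q)" by (rule order_trans[OF Liminf_le_Limsup Limsup_bounded]) (use bound in auto)
  finally show ?thesis .
 qed
 show ?thesis
 proof (rule that[of k])
  show "integrable lborel (\<lambda>x. k x powr q)" using kq by (intro integrableI_nonneg) (auto intro: le_less_trans)
  fix g :: "'a => real" and B assume g: "g \<in> \<B>" "\<And>x. \<bar>g x\<bar> \<le> B"
  have [measurable]: "g \<in> \<B>" by fact
  show "integrable lborel (\<lambda>x. g x * k x)"
  proof (rule Bochner_Integration.integrable_bound[of _ "\<lambda>x. B * k x"])
   show "AE x in lborel. norm (g x * k x) \<le> norm (B * k x)" using g(2) k(3) by (intro AE_I2) (auto simp: abs_mult intro!: mult_right_mono order_trans[OF g(2)])
  qed (use ik in auto)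
  have "(LINT x|M. g (\<Phi> x) * \<psi> x) = (LINT x|?P. g (\<Phi> x))" using psi by (subst integral_density) (auto simp: mult.commute)
  also have "\<dots> = (LINT x|N. g x)" unfolding N_def by (rule integral_distr[symmetric]) auto
  also have "\<dots> = (LBINT x. g x * k x)" unfolding dN[symmetric] using k by (subst integral_density) (auto simp: mult.commute)
  finally show "(LINT x|M. g (\<Phi> x) * \<psi> x) = (LBINT x. g x * k x)" .
 qed (use k ik in auto)
qed

text \<open>The starting point x may lie on the boundary, where f is merely continuous and G is only
  the continuous extension of the gradient. The fundamental theorem is therefore used in the form
  that asks for derivatives in the open interval. The indicator makes the integrand Borel on the
  whole space.\<close>

lemma segment_integral:
 fixes f :: "'a::euclidean_space => real"
 assumes f: "continuous_on K f" and G: "is_C1_gradient K f G" and x: "x \<in> K"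
  and seg: "\<And>t. 0 < t ==> t \<le> 1 ==> (1 - t) *R x + t *R y \<in> interior K"
 shows "integrable unit_lborel (\<lambda>t. (indicator (interior K) ((1 - t) *R x + t *R y) *R G ((1 - t) *R x + t *R y)) \<bullet> (y - x))"
  and "(LINT t|unit_lborel. (indicator (interior K) ((1 - t) *R x + t *R y) *R G ((1 - t) *R x + t *R y)) \<bullet> (y - x))
   = f y - f x"
proof -
 define \<gamma> where "\<gamma> t = (1 - t) *R x + t *R y" for t
 define g where "g z = indicator (interior K) z *R G z" for z
 have Gc: "continuous_on K G" and Gd: "\<And>z. z \<in> interior K ==> GDERIV f z :> G z" using G by (auto simp: is_C1_gradient_def)
 have gm [measurable]: "g \<in> \<B>" unfolding g_def[abs_def]
  by (intro borel_measurable_continuous_on_indicator continuous_on_subset[OF Gc]) (auto simp: interior_subset)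
 have gammac: "continuous_on S \<gamma>" for S unfolding \<gamma>_def[abs_def] by (intro continuous_intros)
 have \<gamma>K: "\<gamma> t \<in> K" if "t \<in> {0..1}" for t using seg[of t] x that interior_subset[of K] by (cases "t = 0") (auto simp: \<gamma>_def)
 let ?h = "\<lambda>t. G (\<gamma> t) \<bullet> (y - x)"
 have hc: "continuous_on {0..1} ?h" using \<gamma>K by (intro continuous_intros continuous_on_compose2[OF Gc gammac]) auto
 have "(?h has_integral (f (\<gamma> 1) - f (\<gamma> 0))) {0..1}"
 proof (rule fundamental_theorem_of_calculus_interior)
  show "continuous_on {0..1} (\<lambda>t. f (\<gamma> t))" using \<gamma>K by (intro continuous_on_compose2[OF f gammac]) auto
  fix t :: real assume t: "t \<in> {0<..<1}"
  then have "(f has_derivative (\<lambda>h. h \<bullet> G (\<gamma> t))) (at (\<gamma> t))" using Gd[of "\<gamma> t"] seg[of t] by (simp add: gderiv_def \<gamma>_def)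
  moreover have "(\<gamma> has_derivative (\<lambda>s. s *R (y - x))) (at t)"
   unfolding \<gamma>_def[abs_def] by (auto intro!: derivative_eq_intros simp: algebra_simps)
  ultimately have "(f \<circ> \<gamma> has_derivative (\<lambda>h. h \<bullet> G (\<gamma> t)) \<circ> (\<lambda>s. s *R (y - x))) (at t)"
   by (intro diff_chain_at)
  then show "((\<lambda>t. f (\<gamma> t)) has_vector_derivative ?h t) (at t)" by (simp add: has_vector_derivative_def o_def inner_commute)
 qed auto
 then have hi: "(?h has_integral (f y - f x)) {0..1}" by (simp add: \<gamma>_def)
 have si: "set_integrable lborel {0..1} ?h" using hc by (rule borel_integrable_atLeastAtMost')
 have eq: "(LINT t:{0..1}|lborel. ?h t) = f y - f x" using set_borel_integral_eq_integral(2)[OF si] hi by (simp add: integral_unique)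
 have \<gamma>m [measurable]: "\<gamma> \<in> \<B>" using gammac by (intro borel_measurable_continuous_onI)
 have ae: "AE t in lborel. indicator {0..1} t *R ?h t = indicator {0<..<1} t *R (g (\<gamma> t) \<bullet> (y - x))"
 proof -
  have "AE t in lborel. t \<noteq> (0::real)" "AE t in lborel. t \<noteq> (1::real)" by (rule AE_lborel_singleton)+
  then show ?thesis by eventually_elim (use seg in \<open>auto simp: indicator_def g_def \<gamma>_def\<close>)
 qed
 have "integrable lborel (\<lambda>t. indicator {0<..<1} t *R (g (\<gamma> t) \<bullet> (y - x)))" using si ae unfolding set_integrable_def
  by (subst integrable_cong_AE[where g="\<lambda>t. indicator {0..1} t *R ?h t"]) (auto elim: eventually_mono)
 then have "integrable unit_lborel (\<lambda>t. g (\<gamma> t) \<bullet> (y - x))" unfolding lborel_on_def by (subst integrable_density) auto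
 then show "integrable unit_lborel (\<lambda>t. (indicator (interior K) ((1 - t) *R x + t *R y) *R G ((1 - t) *R x + t *R y)) \<bullet> (y - x))"
  by (simp add: g_def \<gamma>_def)
 have "(LINT t|unit_lborel. g (\<gamma> t) \<bullet> (y - x)) = (LINT t:{0<..<1}|lborel. g (\<gamma> t) \<bullet> (y - x))" by (rule integral_lborel_on) auto
 also have "\<dots> = (LINT t:{0..1}|lborel. ?h t)" unfolding set_lebesgue_integral_def using si ae unfolding set_integrable_def
  by (intro integral_cong_AE) (auto elim: eventually_mono)
 finally show "(LINT t|unit_lborel. (indicator (interior K) ((1 - t) *R x + t *R y) *R G ((1 - t) *R x + t *R y)) \<bullet> (y - x))
   = f y - f x" unfolding eq by (simp add: g_def \<gamma>_def)
qed

section \<open>Fields in L^q, their flux, and transport along segments\<close>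

lemma powr_integrable_add:
 fixes f g :: "'a::euclidean_space => 'b::euclidean_space"
 assumes q: "1 \<le> q" and [measurable]: "f \<in> borel_measurable M" "g \<in> borel_measurable M"
  and i: "integrable M (\<lambda>x. norm (f x) powr q)" "integrable M (\<lambda>x. norm (g x) powr q)"
 shows "integrable M (\<lambda>x. norm (f x + g x) powr q)"
proof (rule Bochner_Integration.integrable_bound)
 show "integrable M (\<lambda>x. 2 powr q * (norm (f x) powr q + norm (g x) powr q))" using i by simp
 show "AE x in M. norm (norm (f x + g x) powr q) \<le> norm (2 powr q * (norm (f x) powr q + norm (g x) powr q))"
 proof (rule AE_I2)
  fix x
  let ?m = "max (norm (f x)) (norm (g x))"
  have "norm (f x + g x) \<le> 2 * ?m" using norm_triangle_ineq[of "f x" "g x"] by linarith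
  then have "norm (f x + g x) powr q \<le> (2 * ?m) powr q" using q by (intro powr_mono2) auto
  also have "\<dots> = 2 powr q * ?m powr q" by (simp add: powr_mult)
  also have "?m powr q \<le> norm (f x) powr q + norm (g x) powr q" by (auto simp: max_def)
  finally show "norm (norm (f x + g x) powr q) \<le> norm (2 powr q * (norm (f x) powr q + norm (g x) powr q))" by simp
 qed
qed auto

lemma powr_integrable_scaleR:
 fixes f :: "'a => 'b::euclidean_space"
 assumes "integrable M (\<lambda>x. norm (f x) powr q)"
 shows "integrable M (\<lambda>x. norm (c *R f x) powr q)" using assms by (simp add: powr_mult)

lemma powr_integrable_sum:
 fixes f :: "'i => 'a::euclidean_space => 'b::euclidean_space"
 assumes q: "1 \<le> q" and "finite I" and "\<And>i. i \<in> I ==> f i \<in> borel_measurable M"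
  and "\<And>i. i \<in> I ==> integrable M (\<lambda>x. norm (f i x) powr q)"
 shows "integrable M (\<lambda>x. norm (\<Sum>i\<in>I. f i x) powr q)" using assms(2-4)
proof (induction I rule: finite_induct)
 case (insert i I)
 have "integrable M (\<lambda>x. norm (f i x + (\<Sum>i\<in>I. f i x)) powr q)" using insert by (intro powr_integrable_add[OF q]) auto
 then show ?case using insert by simp
qed simp

text \<open>Fields are Borel functions on the whole space that vanish off the interior, so the zero
  extension to a larger domain is the same function.\<close>

definition Lq_field :: "'a::euclidean_space set => real => ('a => 'a) => bool" where
 "Lq_field K q v \<longleftrightarrow> v \<in> \<B> \<and> integrable lborel v \<and>
   integrable lborel (\<lambda>x. norm (v x) powr q) \<and> (\<forall>x. x \<notin> interior K \<longrightarrow> v x = 0)"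

definition flux :: "'a::euclidean_space set => ('a => 'a) => ('a => 'a) => real" where
 "flux K G v = (LBINT x. (indicator (interior K) x *R G x) \<bullet> v x)"

lemma Lq_field_add:
 assumes "1 \<le> q" "Lq_field K q v" "Lq_field K q w"
 shows "Lq_field K q (\<lambda>x. v x + w x)" using assms unfolding Lq_field_def by (auto intro!: powr_integrable_add)

lemma Lq_field_scaleR: "Lq_field K q v ==> Lq_field K q (\<lambda>x. c *R v x)"
 unfolding Lq_field_def by (auto intro!: powr_integrable_scaleR simp del: norm_scaleR)

lemma integrable_inner_bounded:
 fixes v w :: "'a => 'b::euclidean_space"
 assumes v: "integrable M v" and w: "w \<in> borel_measurable M" "\<And>x. norm (w x) \<le> B"
 shows "integrable M (\<lambda>x. w x \<bullet> v x)"
proof (rule Bochner_Integration.integrable_bound)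
 show "integrable M (\<lambda>x. B * norm (v x))" using v by simp
 show "AE x in M. norm (w x \<bullet> v x) \<le> norm (B * norm (v x))"
 proof (rule AE_I2)
  fix x
  have "0 \<le> B" using w(2)[of x] norm_ge_zero order_trans by blast
  have "\<bar>w x \<bullet> v x\<bar> \<le> norm (w x) * norm (v x)" by (rule Cauchy_Schwarz_ineq2)
  also have "\<dots> \<le> B * norm (v x)" using w by (intro mult_right_mono) auto
  finally show "norm (w x \<bullet> v x) \<le> norm (B * norm (v x))" using \<open>0 \<le> B\<close> by simp
 qed
qed (use v w in auto)

lemma C1_gradient_interior_bounded:
 fixes G :: "'a::euclidean_space => 'a"
 assumes K: "compact K" and G: "continuous_on K G"
 obtains B where "0 < B" "\<And>x. norm (indicat_real (interior K) x *R G x) \<le> B"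
  "(\<lambda>x. indicat_real (interior K) x *R G x) \<in> \<B>"
proof -
 obtain B where B: "0 < B" "\<And>x. x \<in> K ==> norm (G x) \<le> B" using continuous_on_compact_bounded[OF K G] by blast
 show ?thesis
 proof (rule that[OF B(1)])
  show "norm (indicat_real (interior K) x *R G x) \<le> B" for x using B interior_subset[of K] by (auto simp: indicator_def)
  show "(\<lambda>x. indicat_real (interior K) x *R G x) \<in> \<B>"
   by (intro borel_measurable_continuous_on_indicator continuous_on_subset[OF G]) (auto simp: interior_subset)
 qed
qed

lemma flux_add:
 assumes K: "compact K" and G: "continuous_on K G" and v: "integrable lborel v" "integrable lborel w"
 shows "flux K G (\<lambda>x. v x + w x) = flux K G v + flux K G w"
proof -
 obtain B where B: "\<And>x. norm (indicat_real (interior K) x *R G x) \<le> B"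
  "(\<lambda>x. indicat_real (interior K) x *R G x) \<in> \<B>" using C1_gradient_interior_bounded[OF K G] by metis
 show ?thesis unfolding flux_def inner_add_right using B by (intro Bochner_Integration.integral_add integrable_inner_bounded[where B=B] v) auto
qed

lemma flux_scaleR: "flux K G (\<lambda>x. c *R v x) = c * flux K G v" by (simp add: flux_def)

text \<open>P is a transport plan: mass moves from \<open>fst xy\<close> to \<open>snd xy\<close>
  along the segment with constant velocity. The field v is the momentum summed over time, so its
  flux against a gradient is the integral of the increments of f. \<open>est\<close> places it in
  L^q through \<open>path_density\<close>.\<close>

lemma transport_field:
 fixes P :: "('a::euclidean_space \<times> 'a) measure"
 assumes pq: "1 < p" "1 < q" "1 / p + 1 / q = 1" and K: "compact K"
  and P: "finite_measure P" "sets P = sets borel"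
  and seg: "AE xy in P. fst xy \<in> K \<and> (\<forall>t. 0 < t \<and> t \<le> 1 \<longrightarrow> (1 - t) *R fst xy + t *R snd xy \<in> interior K)"
  and C: "0 < C"
  and est: "\<And>u A. u \<in> \<B> ==> (\<And>x. 0 \<le> u x) ==> 0 < A ==>
   (\<integral>\<^sup>+x. ennreal (u x powr p) \<partial>lborel) \<le> ennreal A ==>
   (\<integral>\<^sup>+xy. \<integral>\<^sup>+t. ennreal (u ((1 - t) *R fst xy + t *R snd xy)) \<partial>unit_lborel \<partial>P) \<le> ennreal (C * A powr (1/p))"
 obtains v where "Lq_field K q v"
  "\<And>f G. continuous_on K f ==> is_C1_gradient K f G ==>
    flux K G v = (LINT xy|P. indicator K (snd xy) * f (snd xy) - indicator K (fst xy) * f (fst xy))"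
proof -
 interpret P: finite_measure P by fact
 interpret U: finite_measure unit_lborel by (rule finite_unit_lborel)
 interpret PU: pair_sigma_finite P unit_lborel by unfold_locales
 let ?M = "P \<Otimes>\<^sub>M unit_lborel"
 have fM: "finite_measure ?M" by (rule finite_measure_pair_measure) unfold_locales
 note P(2)[measurable_cong]
 have [measurable]: "fst \<in> borel_measurable P" "snd \<in> borel_measurable P"
  by (simp_all add: measurable_cong_sets[OF P(2) refl] borel_measurable_continuous_onI continuous_on_fst continuous_on_snd continuous_on_id)
 define \<Phi> where "\<Phi> z = (1 - snd z) *R fst (fst z) + snd z *R snd (fst z)" for z :: "('a \<times> 'a) \<times> real"
 have [measurable]: "\<Phi> \<in> borel_measurable ?M" unfolding \<Phi>_def[abs_def] by measurable
 obtain R where R: "0 < R" "\<And>x. x \<in> K ==> norm x \<le> R" using compact_imp_bounded[OF K] bounded_pos by metis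
 define D where "D = 2 * R"
 \<comment> \<open>\<open>path_density\<close> takes nonnegative bounded weights, so the velocity y
   - x is split into positive and negative parts of its components. The cap D = 2 R only serves
   pairs outside K; P-almost everywhere |y - x| \<le> D and it is inactive.\<close>
 define \<psi> where "\<psi> i z = min D (max 0 ((if snd i then 1 else -1) * ((snd (fst z) - fst (fst z)) \<bullet> fst i)))"
  for i :: "'a \<times> bool" and z :: "('a \<times> 'a) \<times> real"
 have [measurable]: "\<psi> i \<in> borel_measurable ?M" for i unfolding \<psi>_def[abs_def] by measurable
 have psi: "0 \<le> \<psi> i z" "\<psi> i z \<le> D" for i z using R by (auto simp: \<psi>_def D_def)
 define Q where "Q i k \<longleftrightarrow> k \<in> \<B> \<and> (\<forall>x. 0 \<le> k x) \<and> integrable lborel k \<and>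
  integrable lborel (\<lambda>x. k x powr q) \<and>
  (\<forall>g B. g \<in> \<B> \<longrightarrow> (\<forall>x. \<bar>g x\<bar> \<le> B) \<longrightarrow> integrable lborel (\<lambda>x. g x * k x) \<and>
    (LINT x|?M. g (\<Phi> x) * \<psi> i x) = (LBINT x. g x * k x))"
  for i and k :: "'a => real"
 have "\<exists>k. Q i k" for i
 proof (rule path_density[OF pq fM _ _ psi C])
  fix u :: "'a => real" and A :: real
  assume u: "u \<in> \<B>" "\<And>x. 0 \<le> u x" "0 < A" "(\<integral>\<^sup>+x. ennreal (u x powr p) \<partial>lborel) \<le> ennreal A"
  have [measurable]: "u \<in> \<B>" by fact
  have "(\<integral>\<^sup>+z. ennreal (u (\<Phi> z)) \<partial>?M) = (\<integral>\<^sup>+xy. \<integral>\<^sup>+t. ennreal (u (\<Phi> (xy, t))) \<partial>unit_lborel \<partial>P)"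
   by (rule U.nn_integral_fst[symmetric]) simp
  also have "\<dots> \<le> ennreal (C * A powr (1/p))" using est[OF u] by (simp add: \<Phi>_def)
  finally show "(\<integral>\<^sup>+z. ennreal (u (\<Phi> z)) \<partial>?M) \<le> ennreal (C * A powr (1/p))" .
 next
  fix k :: "'a => real"
  assume "k \<in> \<B>" "\<And>x. 0 \<le> k x" "integrable lborel k" "integrable lborel (\<lambda>x. k x powr q)"
   "\<And>g B. g \<in> \<B> ==> (\<And>x. \<bar>g x\<bar> \<le> B) ==> integrable lborel (\<lambda>x. g x * k x)"
   "\<And>g B. g \<in> \<B> ==> (\<And>x. \<bar>g x\<bar> \<le> B) ==> (LINT x|?M. g (\<Phi> x) * \<psi> i x) = (LBINT x. g x * k x)"
  then show ?thesis unfolding Q_def by (intro exI[of _ k]) blast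
 qed auto
 then obtain k where Q: "\<And>i. Q i (k i)" by metis
 have k: "\<And>i. k i \<in> \<B>" "\<And>i x. 0 \<le> k i x" "\<And>i. integrable lborel (k i)"
  "\<And>i. integrable lborel (\<lambda>x. k i x powr q)"
  "\<And>i g B. g \<in> \<B> ==> (\<And>x. \<bar>g x\<bar> \<le> B) ==> integrable lborel (\<lambda>x. g x * k i x) \<and>
    (LINT x|?M. g (\<Phi> x) * \<psi> i x) = (LBINT x. g x * k i x)" using Q unfolding Q_def by blast+
 have [measurable]: "k i \<in> \<B>" for i by (rule k)
 define v0 where "v0 x = (\<Sum>i\<in>Basis \<times> UNIV. ((if snd i then 1 else -1) * k i x) *R fst i)" for x :: 'a
 define v where "v x = indicat_real (interior K) x *R v0 x" for x
 have fin: "finite ((Basis :: 'a set) \<times> (UNIV :: bool set))" by simp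
 have i0: "integrable lborel v0" unfolding v0_def[abs_def] using k(3) by (intro Bochner_Integration.integrable_sum) auto
 have iq: "integrable lborel (\<lambda>x. norm (v0 x) powr q)" unfolding v0_def
 proof (rule powr_integrable_sum)
  fix i assume "i \<in> (Basis :: 'a set) \<times> (UNIV :: bool set)"
  then have "norm (((if snd i then 1 else - 1) * k i x) *R fst i) = k i x" for x using k(2)[of i x] by (auto simp: mem_Times_iff)
  then show "integrable lborel (\<lambda>x. norm (((if snd i then 1 else - 1) * k i x) *R fst i) powr q)" using k(4)[of i] by simp
 qed (use pq in auto)
 have io: "interior K \<in> sets borel" by simp
 have field: "Lq_field K q v" unfolding Lq_field_def
 proof (intro conjI allI impI)
  show "integrable lborel v" unfolding v_def[abs_def] using i0 by (intro integrable_mult_indicator) auto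
  have "(\<lambda>x. norm (v x) powr q) = (\<lambda>x. indicat_real (interior K) x *R norm (v0 x) powr q)" using pq by (auto simp: v_def indicator_def)
  then show "integrable lborel (\<lambda>x. norm (v x) powr q)" using iq integrable_mult_indicator[of "interior K" lborel "\<lambda>x. norm (v0 x) powr q"] by simp
 qed (use i0 in \<open>auto simp: v_def[abs_def]\<close>)
 have "flux K G v = (LINT xy|P. indicator K (snd xy) * f (snd xy) - indicator K (fst xy) * f (fst xy))"
  if f: "continuous_on K f" and G: "is_C1_gradient K f G" for f G
 proof -
  define g where "g x = indicat_real (interior K) x *R G x" for x
  have Gc: "continuous_on K G" using G by (simp add: is_C1_gradient_def)
  obtain B where B: "0 < B" "\<And>x. norm (g x) \<le> B" and gm [measurable]: "g \<in> \<B>"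
   using C1_gradient_interior_bounded[OF K Gc] unfolding g_def[symmetric] by metis
  have gb: "\<bar>g x \<bullet> b\<bar> \<le> B" if "b \<in> Basis" for x b using Basis_le_norm[OF that, of "g x"] B(2)[of x] by linarith
  have iM: "integrable ?M (\<lambda>z. (g (\<Phi> z) \<bullet> fst i) * \<psi> i z)" if "i \<in> Basis \<times> UNIV" for i
  proof (rule finite_measure.integrable_const_bound[OF fM, where B="B * D"])
   show "AE z in ?M. norm ((g (\<Phi> z) \<bullet> fst i) * \<psi> i z) \<le> B * D" using gb psi that B by (intro AE_I2) (auto simp: abs_mult intro!: mult_mono)
  qed measurable
  have kk: "integrable lborel (\<lambda>x. (g x \<bullet> fst i) * k i x)"
   "(LINT z|?M. (g (\<Phi> z) \<bullet> fst i) * \<psi> i z) = (LBINT x. (g x \<bullet> fst i) * k i x)"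
   if "i \<in> Basis \<times> UNIV" for i using k(5)[of "\<lambda>x. g x \<bullet> fst i" B i] gb that by auto
  have "flux K G v = (LBINT x. g x \<bullet> v0 x)" unfolding flux_def by (rule Bochner_Integration.integral_cong) (auto simp: g_def v_def indicator_def)
  also have "\<dots> = (LBINT x. (\<Sum>i\<in>Basis \<times> UNIV. (if snd i then 1 else -1) * ((g x \<bullet> fst i) * k i x)))"
   by (simp add: v0_def inner_sum_right mult_ac)
  also have "\<dots> = (\<Sum>i\<in>Basis \<times> UNIV. (if snd i then 1 else -1) * (LBINT x. (g x \<bullet> fst i) * k i x))"
   using kk(1) by (subst Bochner_Integration.integral_sum) auto
  also have "\<dots> = (\<Sum>i\<in>Basis \<times> UNIV. (if snd i then 1 else -1) * (LINT z|?M. (g (\<Phi> z) \<bullet> fst i) * \<psi> i z))"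
   using kk(2) by (intro sum.cong) auto
  also have "\<dots> = (LINT z|?M. (\<Sum>i\<in>Basis \<times> UNIV. (if snd i then 1 else -1) * ((g (\<Phi> z) \<bullet> fst i) * \<psi> i z)))"
   using iM by (subst Bochner_Integration.integral_sum) auto
  also have "\<dots> = (\<integral>xy. \<integral>t. (\<Sum>i\<in>Basis \<times> UNIV. (if snd i then 1 else -1) * ((g (\<Phi> (xy, t)) \<bullet> fst i) * \<psi> i (xy, t))) \<partial>unit_lborel \<partial>P)"
   using iM by (intro PU.integral_fst'[symmetric] Bochner_Integration.integrable_sum) auto
  also have "\<dots> = (LINT xy|P. indicator K (snd xy) * f (snd xy) - indicator K (fst xy) * f (fst xy))"
  proof (rule integral_cong_AE)
   show "AE xy in P. (LINT t|unit_lborel. (\<Sum>i\<in>Basis \<times> UNIV. (if snd i then 1 else -1) * ((g (\<Phi> (xy, t)) \<bullet> fst i) * \<psi> i (xy, t))))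
     = indicator K (snd xy) * f (snd xy) - indicator K (fst xy) * f (fst xy)" using seg
   proof eventually_elim
    fix xy :: "'a \<times> 'a"
    assume s: "fst xy \<in> K \<and> (\<forall>t. 0 < t \<and> t \<le> 1 \<longrightarrow> (1 - t) *R fst xy + t *R snd xy \<in> interior K)"
    define x y where "x = fst xy" and "y = snd xy"
    have xK: "x \<in> K" and sg: "\<And>t. 0 < t ==> t \<le> 1 ==> (1 - t) *R x + t *R y \<in> interior K"
     using s by (auto simp: x_def y_def)
    have yK: "y \<in> K" using sg[of 1] interior_subset by auto
    have nd: "norm (y - x) \<le> D" using R(2)[OF xK] R(2)[OF yK] norm_triangle_ineq4[of y x] by (simp add: D_def)
    have sum: "(\<Sum>i\<in>Basis \<times> UNIV. (if snd i then 1 else -1) * ((g (\<Phi> (xy, t)) \<bullet> fst i) * \<psi> i (xy, t)))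
      = g ((1 - t) *R x + t *R y) \<bullet> (y - x)" for t
    proof -
     have ps: "\<psi> (b, True) (xy, t) - \<psi> (b, False) (xy, t) = (y - x) \<bullet> b" if "b \<in> Basis" for b
      using Basis_le_norm[OF that, of "y - x"] nd R(1) by (auto simp: \<psi>_def x_def y_def D_def)
     have "(\<Sum>i\<in>Basis \<times> UNIV. (if snd i then 1 else -1) * ((g (\<Phi> (xy, t)) \<bullet> fst i) * \<psi> i (xy, t)))
       = (\<Sum>b\<in>Basis. \<Sum>s\<in>UNIV. (if s then 1 else -1) * ((g (\<Phi> (xy, t)) \<bullet> b) * \<psi> (b, s) (xy, t)))"
      by (auto simp: sum.cartesian_product intro!: sum.cong)
     also have "\<dots> = (\<Sum>b\<in>Basis. (g (\<Phi> (xy, t)) \<bullet> b) * (\<psi> (b, True) (xy, t) - \<psi> (b, False) (xy, t)))"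
      by (simp add: UNIV_bool algebra_simps)
     also have "\<dots> = (\<Sum>b\<in>Basis. (g (\<Phi> (xy, t)) \<bullet> b) * ((y - x) \<bullet> b))" using ps by (intro sum.cong) auto
     also have "\<dots> = g (\<Phi> (xy, t)) \<bullet> (y - x)" by (rule euclidean_inner[symmetric])
     finally show ?thesis by (simp add: \<Phi>_def x_def y_def)
    qed
    show "(LINT t|unit_lborel. (\<Sum>i\<in>Basis \<times> UNIV. (if snd i then 1 else -1) * ((g (\<Phi> (xy, t)) \<bullet> fst i) * \<psi> i (xy, t))))
     = indicator K (snd xy) * f (snd xy) - indicator K (fst xy) * f (fst xy)"
     unfolding sum using segment_integral(2)[OF f G xK sg] xK yK by (simp add: x_def y_def g_def)
   qed
   have fm [measurable]: "(\<lambda>x. indicat_real K x * f x) \<in> \<B>"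
    using borel_measurable_continuous_on_indicator[OF borel_compact[OF K] f] by simp
   show "(\<lambda>xy. indicator K (snd xy) * f (snd xy) - indicator K (fst xy) * f (fst xy)) \<in> borel_measurable P"
    by (intro borel_measurable_diff measurable_compose[OF _ fm]) auto
  qed measurable
  finally show ?thesis .
 qed
 then show ?thesis using that[OF field] by blast
qed

section \<open>Morrey's estimate on a ball; draining measures into a ball\<close>

lemma borel_measurable_indicator_mult_continuous:
 fixes f :: "'a::euclidean_space => real"
 assumes "compact K" "continuous_on K f"
 shows "(\<lambda>x. indicat_real K x * f x) \<in> \<B>" using borel_measurable_continuous_on_indicator[OF borel_compact[OF assms(1)] assms(2)] by simp

lemma integrable_ball_indicator:
 fixes f :: "'a::euclidean_space => real"
 assumes "compact K" "continuous_on K f"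
 shows "integrable (lborel_on (ball z r)) (\<lambda>y. indicat_real K y * f y)"
proof -
 obtain C where C: "0 < C" "\<And>x. x \<in> K ==> norm (f x) \<le> C" using continuous_on_compact_bounded[OF assms] by metis
 show ?thesis by (rule integrable_bounded_borel[OF finite_ball_lborel, where C=C])
   (use C in \<open>auto simp: indicator_def intro!: borel_measurable_indicator_mult_continuous[OF assms, unfolded indicator_def]\<close>)
qed

text \<open>Morrey's estimate: averaging the segment formula over a ball and applying
 Holder's inequality on each dilated copy of the ball.\<close>

lemma morrey_ball:
 fixes f :: "'a::euclidean_space => real"
 assumes pq: "1 < p" "1 < q" "1 / p + 1 / q = 1" and p: "real DIM('a) < p"
  and K: "compact K" and f: "continuous_on K f" and G: "is_C1_gradient K f G" and x: "x \<in> K" and r: "0 < r"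
  and seg: "\<And>y t. y \<in> ball z r ==> 0 < t ==> t \<le> 1 ==> (1 - t) *R x + t *R y \<in> interior K"
  and D: "\<And>y. y \<in> ball z r ==> norm (y - x) \<le> D"
  and A: "0 < A" "(\<integral>\<^sup>+x. ennreal (norm (indicat_real (interior K) x *R G x) powr p) \<partial>lborel) \<le> ennreal A"
 shows "\<bar>(LINT y|lborel_on (ball z r). indicat_real K y * f y) - measure lborel (ball z r) * f x\<bar>
  \<le> D * (A powr (1/p) * measure lborel (ball z r) powr (1/q) * (1 / (1 - real DIM('a) / p)))"
proof -
 let ?B = "lborel_on (ball z r)" and ?V = "measure lborel (ball z r)"
 interpret B: finite_measure ?B by (rule finite_ball_lborel)
 have Gc: "continuous_on K G" using G by (simp add: is_C1_gradient_def)
 define g where "g x = indicat_real (interior K) x *R G x" for x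
 have gm [measurable]: "g \<in> \<B>" using C1_gradient_interior_bounded[OF K Gc] unfolding g_def[abs_def] by metis
 have D0: "0 \<le> D" using D[of z] r norm_ge_zero order_trans by (metis centre_in_ball)
 have fm [measurable]: "(\<lambda>y. indicat_real K y * f y) \<in> \<B>" by (rule borel_measurable_indicator_mult_continuous[OF K f])
 have iF: "integrable ?B (\<lambda>y. indicat_real K y * f y - f x)" by (intro Bochner_Integration.integrable_diff integrable_ball_indicator K f) simp
 have mV: "measure ?B UNIV = ?V"
 proof -
  have "emeasure ?B UNIV = emeasure lborel (ball z r)" using nn_integral_lborel_on[of "ball z r" "\<lambda>_. 1"] by simp
  then show ?thesis by (simp add: measure_def)
 qed
 have "(LINT y|?B. indicat_real K y * f y) - ?V * f x = (LINT y|?B. indicat_real K y * f y - f x)" using integrable_ball_indicator[OF K f] by (simp add: mV)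
 also have "ennreal \<bar>\<dots>\<bar> \<le> (\<integral>\<^sup>+y. ennreal (norm (indicat_real K y * f y - f x)) \<partial>?B)"
  using integral_norm_bound_ennreal[OF iF] by simp
 also have "\<dots> \<le> (\<integral>\<^sup>+y. ennreal D * (\<integral>\<^sup>+t. ennreal (norm (g ((1 - t) *R x + t *R y))) \<partial>unit_lborel) \<partial>?B)"
 proof (rule nn_integral_mono_AE)
  have "AE y in ?B. y \<in> ball z r" by (rule AE_lborel_on) simp
  then show "AE y in ?B. ennreal (norm (indicat_real K y * f y - f x))
    \<le> ennreal D * (\<integral>\<^sup>+t. ennreal (norm (g ((1 - t) *R x + t *R y))) \<partial>unit_lborel)"
  proof eventually_elim
   fix y assume y: "y \<in> ball z r"
   then have yK: "y \<in> K" using seg[of y 1] interior_subset by auto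
   have I: "integrable unit_lborel (\<lambda>t. g ((1 - t) *R x + t *R y) \<bullet> (y - x))"
     "(LINT t|unit_lborel. g ((1 - t) *R x + t *R y) \<bullet> (y - x)) = f y - f x" using segment_integral[OF f G x seg[OF y]] by (simp_all add: g_def)
   have "ennreal (norm (f y - f x)) \<le> (\<integral>\<^sup>+t. ennreal (norm (g ((1 - t) *R x + t *R y) \<bullet> (y - x))) \<partial>unit_lborel)"
    using integral_norm_bound_ennreal[OF I(1)] I(2) by simp
   also have "\<dots> \<le> (\<integral>\<^sup>+t. ennreal D * ennreal (norm (g ((1 - t) *R x + t *R y))) \<partial>unit_lborel)"
   proof (rule nn_integral_mono)
    fix t
    have "\<bar>g ((1 - t) *R x + t *R y) \<bullet> (y - x)\<bar> \<le> norm (g ((1 - t) *R x + t *R y)) * norm (y - x)"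
     by (rule Cauchy_Schwarz_ineq2)
    also have "\<dots> \<le> norm (g ((1 - t) *R x + t *R y)) * D" using D[OF y] by (intro mult_left_mono) auto
    finally show "ennreal (norm (g ((1 - t) *R x + t *R y) \<bullet> (y - x))) \<le> ennreal D * ennreal (norm (g ((1 - t) *R x + t *R y)))"
     using D0 by (simp add: mult.commute ennreal_leI flip: ennreal_mult)
   qed
   also have "\<dots> = ennreal D * (\<integral>\<^sup>+t. ennreal (norm (g ((1 - t) *R x + t *R y))) \<partial>unit_lborel)"
    by (rule nn_integral_cmult) simp
   finally show "ennreal (norm (indicat_real K y * f y - f x))
    \<le> ennreal D * (\<integral>\<^sup>+t. ennreal (norm (g ((1 - t) *R x + t *R y))) \<partial>unit_lborel)" using yK by simp
  qed
 qed
 also have "\<dots> = ennreal D * (\<integral>\<^sup>+y. \<integral>\<^sup>+t. ennreal (norm (g ((1 - t) *R x + t *R y))) \<partial>unit_lborel \<partial>?B)"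
  by (rule nn_integral_cmult)
   (use finite_measure.axioms(1)[OF finite_unit_lborel] in \<open>auto intro!: sigma_finite_measure.borel_measurable_nn_integral\<close>)
 \<comment> \<open>Here the paths are a t = (1 - t) x and c t = t, whence the weight t^(-d/p),
   integrable because p > d.\<close>
 also have "\<dots> \<le> ennreal D * (ennreal (A powr (1/p) * ?V powr (1/q)) * (\<integral>\<^sup>+t. ennreal (t powr - (DIM('a) / p)) \<partial>unit_lborel))"
  using A r by (intro mult_left_mono path_estimate[OF pq, where u="\<lambda>x. norm (g x)"]) (auto simp: g_def[symmetric] simp del: norm_scaleR)
 also have "(\<integral>\<^sup>+t. ennreal (t powr - (DIM('a) / p)) \<partial>unit_lborel) = ennreal (1 / (1 - real DIM('a) / p))"
  using p pq by (intro nn_integral_unit_powr) (auto simp: field_simps)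
 also have "ennreal D * (ennreal (A powr (1/p) * ?V powr (1/q)) * ennreal (1 / (1 - real DIM('a) / p)))
   = ennreal (D * (A powr (1/p) * ?V powr (1/q) * (1 / (1 - real DIM('a) / p))))" using p pq D0 by (simp add: ennreal_mult[symmetric] field_simps)
 finally show ?thesis using p pq D0 by (subst (asm) ennreal_le_iff) (auto simp: field_simps)
qed

text \<open>A cone condition at every small scale h: one ball of radius h at distance of order h is
  visible through the interior from all points of K within h of p. That a single ball serves all
  nearby points is what lets two values of a function be compared, and a whole piece of a measure be
  moved to one target.\<close>

definition cone_at :: "'a::euclidean_space set => 'a => bool" where
 "cone_at K p \<longleftrightarrow> (\<exists>C>0. \<exists>r>0. \<forall>h. 0 < h \<and> h < r \<longrightarrow> (\<exists>z. dist z p \<le> C * h \<and>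
   (\<forall>x \<in> K \<inter> ball p h. \<forall>y \<in> ball z h. \<forall>t. 0 < t \<and> t \<le> 1 \<longrightarrow> (1 - t) *R x + t *R y \<in> interior K)))"

text \<open>v carries the mass of \<nu> to the uniform distribution of the same mass on the ball of
  radius r about the origin; the quotient is the mean of f over that ball.\<close>

definition drain_field :: "'a::euclidean_space set => real => real => 'a measure => ('a => 'a) => bool" where
 "drain_field K q r \<nu> v \<longleftrightarrow> Lq_field K q v \<and> (\<forall>f G. continuous_on K f \<and> is_C1_gradient K f G \<longrightarrow>
   flux K G v = measure \<nu> UNIV * ((LINT y|lborel_on (ball 0 r). indicat_real K y * f y) / measure lborel (ball (0::'a) r))
    - (LINT x|\<nu>. indicat_real K x * f x))"

definition drains :: "'a::euclidean_space set => real => 'a set => bool" where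
 "drains K q E \<longleftrightarrow> (\<exists>r0>0. \<forall>r. 0 < r \<and> r \<le> r0 \<longrightarrow>
   (\<forall>\<nu>. finite_measure \<nu> \<and> sets \<nu> = sets borel \<and> (AE x in \<nu>. x \<in> E) \<longrightarrow> (\<exists>v. drain_field K q r \<nu> v)))"

lemma drains_empty: "drains K q {}" unfolding drains_def
proof (intro exI[of _ 1] conjI allI impI)
 fix r :: real and \<nu> :: "'a measure"
 assume nu: "finite_measure \<nu> \<and> sets \<nu> = sets borel \<and> (AE x in \<nu>. x \<in> {})"
 then have "emeasure \<nu> (space \<nu>) = 0" using AE_iff_measurable[of "space \<nu>" \<nu> "\<lambda>x. False"] by auto
 then have z: "measure \<nu> UNIV = 0" using nu space_of_sets_borel[of \<nu>] by (simp add: measure_def)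
 have "(LINT x|\<nu>. indicat_real K x * f x) = 0" for f by (rule integral_eq_zero_AE) (use nu in auto)
 then show "\<exists>v. drain_field K q r \<nu> v" by (intro exI[of _ "\<lambda>_. 0"]) (auto simp: drain_field_def Lq_field_def flux_def z)
qed auto

text \<open>\<nu> is cut into its parts on E and off E, so the overlap is not counted twice; the
  part off E is carried by F. Both drain into the same ball, hence the fields add up.\<close>

lemma drains_Un:
 assumes K: "compact K" and q: "1 \<le> q" and E: "drains K q E" "drains K q F" "E \<in> sets borel"
 shows "drains K q (E \<union> F)"
proof -
 obtain r1 where r1: "0 < r1" "\<And>r \<nu>. 0 < r ==> r \<le> r1 ==> finite_measure \<nu> ==> sets \<nu> = sets borel ==> (AE x in \<nu>. x \<in> E) ==> \<exists>v. drain_field K q r \<nu> v"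
  using E(1) by (auto simp: drains_def)
 obtain r2 where r2: "0 < r2" "\<And>r \<nu>. 0 < r ==> r \<le> r2 ==> finite_measure \<nu> ==> sets \<nu> = sets borel ==> (AE x in \<nu>. x \<in> F) ==> \<exists>v. drain_field K q r \<nu> v"
  using E(2) by (auto simp: drains_def)
 have "\<exists>v. drain_field K q r \<nu> v"
  if r: "0 < r" "r \<le> min r1 r2" and nu: "finite_measure \<nu>" "sets \<nu> = sets borel" "AE x in \<nu>. x \<in> E \<union> F" for r \<nu>
 proof -
  interpret finite_measure \<nu> by fact
  note nu(2)[measurable_cong]
  note E(3)[measurable]
  have sp: "space \<nu> = UNIV" by (rule space_of_sets_borel[OF nu(2)])
  define \<nu>1 \<nu>2 where "\<nu>1 = density \<nu> (\<lambda>x. ennreal (indicat_real E x))" and "\<nu>2 = density \<nu> (\<lambda>x. ennreal (indicat_real (-E) x))"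
  have i: "integrable \<nu> (indicat_real E)" "integrable \<nu> (indicat_real (-E))" by (auto intro!: integrable_const_bound[where B=1] simp: indicator_def)
  have f: "finite_measure \<nu>1" "finite_measure \<nu>2" unfolding \<nu>1_def \<nu>2_def by (auto intro!: finite_measure_density_real i)
  have s: "sets \<nu>1 = sets borel" "sets \<nu>2 = sets borel" using nu(2) by (auto simp: \<nu>1_def \<nu>2_def)
  have a1: "AE x in \<nu>1. x \<in> E" unfolding \<nu>1_def by (subst AE_density) (auto simp: indicator_def)
  have a2: "AE x in \<nu>2. x \<in> F" unfolding \<nu>2_def using nu(3) by (subst AE_density) (auto simp: indicator_def)
  obtain v1 where v1: "drain_field K q r \<nu>1 v1" using r1(2)[OF r(1) _ f(1) s(1) a1] r by auto
  obtain v2 where v2: "drain_field K q r \<nu>2 v2" using r2(2)[OF r(1) _ f(2) s(2) a2] r by auto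
  have split: "(LINT x|\<nu>. g x) = (LINT x|\<nu>1. g x) + (LINT x|\<nu>2. g x)" if g: "integrable \<nu> g" for g :: "'a => real"
  proof -
   have [measurable]: "g \<in> borel_measurable \<nu>" using g by auto
   have "(LINT x|\<nu>. g x) = (LINT x|\<nu>. indicat_real E x *R g x + indicat_real (-E) x *R g x)"
    by (rule Bochner_Integration.integral_cong) (auto simp: indicator_def)
   also have "\<dots> = (LINT x|\<nu>. indicat_real E x *R g x) + (LINT x|\<nu>. indicat_real (-E) x *R g x)"
    using g by (intro Bochner_Integration.integral_add integrable_mult_indicator) auto
   also have "(LINT x|\<nu>. indicat_real E x *R g x) = (LINT x|\<nu>1. g x)" unfolding \<nu>1_def by (rule integral_density[symmetric]) auto
   also have "(LINT x|\<nu>. indicat_real (-E) x *R g x) = (LINT x|\<nu>2. g x)" unfolding \<nu>2_def by (rule integral_density[symmetric]) auto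
   finally show ?thesis .
  qed
  have m: "measure \<nu> UNIV = measure \<nu>1 UNIV + measure \<nu>2 UNIV"
   using split[of "\<lambda>_. 1"] sp by (simp add: space_of_sets_borel[OF s(1)] space_of_sets_borel[OF s(2)])
  have "drain_field K q r \<nu> (\<lambda>x. v1 x + v2 x)" unfolding drain_field_def
  proof (intro conjI allI impI)
   show "Lq_field K q (\<lambda>x. v1 x + v2 x)" using v1 v2 by (intro Lq_field_add q) (auto simp: drain_field_def)
   fix f :: "'a => real" and G assume fG: "continuous_on K f \<and> is_C1_gradient K f G"
   have "flux K G (\<lambda>x. v1 x + v2 x) = flux K G v1 + flux K G v2"
    using v1 v2 fG by (intro flux_add K) (auto simp: drain_field_def Lq_field_def is_C1_gradient_def)
   moreover have "(LINT x|\<nu>. indicat_real K x * f x) = (LINT x|\<nu>1. indicat_real K x * f x) + (LINT x|\<nu>2. indicat_real K x * f x)"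
    using integrable_indicator_continuous[OF K _ nu(1,2), of f] fG by (intro split) auto
   ultimately show "flux K G (\<lambda>x. v1 x + v2 x) = measure \<nu> UNIV * ((LINT y|lborel_on (ball 0 r). indicat_real K y * f y) / measure lborel (ball (0::'a) r))
      - (LINT x|\<nu>. indicat_real K x * f x)" using v1 v2 fG unfolding drain_field_def m by (simp add: algebra_simps add_divide_distrib)
  qed
  then show ?thesis by blast
 qed
 then show ?thesis unfolding drains_def  using r1(1) r2(1) by (intro exI[of _ "min r1 r2"]) auto
qed

text \<open>A star shaped domain with cones in place of Lipschitz charts: these hypotheses are
  stable under dilation, so \<Omega> and every enlarged domain are instances of the same
  locale.\<close>

locale conic_star =
 fixes K :: "'a::euclidean_space set"
 assumes compact: "compact K" and nonempty: "K \<noteq> {}"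
  and star: "\<And>x t. x \<in> K ==> 0 \<le> t ==> t < 1 ==> t *R x \<in> interior K"
  and cone: "\<And>p. p \<in> K ==> cone_at K p"
begin

lemma zero_in_interior: "0 \<in> interior K" using nonempty star[of _ 0] by auto

lemma subset_closure_interior: "K \<subseteq> closure (interior K)"
proof
 fix x assume x: "x \<in> K"
 have "(\<lambda>n. (1 - 1 / real (Suc n)) *R x) \<longlonglongrightarrow> (1 - 0) *R x" by (intro tendsto_intros LIMSEQ_Suc[OF lim_1_over_n])
 moreover have "(1 - 1 / real (Suc n)) *R x \<in> interior K" for n by (rule star[OF x]) auto
 ultimately show "x \<in> closure (interior K)" unfolding closure_sequential by (intro exI conjI) auto
qed

text \<open>A frontier point multiplied by a factor below 1 lies in the interior, so each ray from
  the origin meets the frontier at most once.\<close>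

lemma negligible_frontier: "negligible (frontier K)"
proof (rule starlike_negligible_strong[of _ 0])
 fix c :: real and x assume c: "0 \<le> c" "c < 1" and x: "0 + x \<in> frontier K"
 then have "x \<in> K" using compact compact_imp_closed frontier_subset_closed by auto
 then have "c *R x \<in> interior K" using c by (rule star)
 then show "0 + c *R x \<notin> frontier K" by (simp add: frontier_def)
qed simp

text \<open>Transport in two legs. Mass at x is first spread over a ball around z, which is visible
  from x by the cone condition; then that ball is translated to the origin, which the star shape
  permits. Only the first leg is singular, and its cost is finite since p > d.\<close>

lemma drains_local:
 assumes pq: "1 < p" "1 < q" "1 / p + 1 / q = 1" and pd: "real DIM('a) < p" and b: "b \<in> K"
 shows "\<exists>h>0. drains K q (K \<inter> ball b h)"
proof -
 obtain C r where C: "0 < C" "0 < r" "\<And>h. 0 < h ==> h < r ==> \<exists>z. dist z b \<le> C * h \<and>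
   (\<forall>x \<in> K \<inter> ball b h. \<forall>y \<in> ball z h. \<forall>t. 0 < t \<and> t \<le> 1 \<longrightarrow> (1 - t) *R x + t *R y \<in> interior K)"
  using cone[OF b] unfolding cone_at_def by blast
 define h where "h = r / 2"
 have h: "0 < h" "h < r" using C by (auto simp: h_def)
 obtain z where z: "\<And>x y t. x \<in> K ==> x \<in> ball b h ==> y \<in> ball z h ==> 0 < t ==> t \<le> 1 ==> (1 - t) *R x + t *R y \<in> interior K"
  using C(3)[OF h] by blast
 have Bz: "ball z h \<subseteq> interior K" using z[OF b, of _ 1] h by auto
 then have zK: "z \<in> interior K" using h by auto
 \<comment> \<open>The segment from the origin to z is compact in the interior, so it has a
   neighbourhood of some width e there: the corridor for the second leg.\<close>
 have "compact ((\<lambda>s. s *R z) ` {0..1})" by (intro compact_continuous_image continuous_intros) auto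
 moreover have "(\<lambda>s. s *R z) ` {0..1} \<subseteq> interior K"
 proof clarify
  fix s :: real assume "s \<in> {0..1}"
  then show "s *R z \<in> interior K" using zK star[of z s] interior_subset[of K] by (cases "s = 1") auto
 qed
 ultimately obtain e where e: "0 < e" "(\<Union>x\<in>(\<lambda>s. s *R z) ` {0..1}. ball x e) \<subseteq> interior K"
  using compact_subset_open_imp_ball_epsilon_subset[of "(\<lambda>s. s *R z) ` {0..1}" "interior K"] by auto
 have "drains K q (K \<inter> ball b h)" unfolding drains_def
 \<comment> \<open>r \<le> h puts the target of the first leg inside the visible ball, and r \<le> e
   keeps the moving ball inside the corridor of the second leg.\<close>
 proof (intro exI[of _ "min h e"] conjI allI impI)
  fix r :: real and \<nu> :: "'a measure"
  assume r: "0 < r \<and> r \<le> min h e" and nu: "finite_measure \<nu> \<and> sets \<nu> = sets borel \<and> (AE x in \<nu>. x \<in> K \<inter> ball b h)"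
  interpret nu: finite_measure \<nu> using nu by simp
  have snu: "sets \<nu> = sets borel" and spn: "space \<nu> = UNIV" using nu space_of_sets_borel[of \<nu>] by auto
  note snu[measurable_cong]
  let ?Z = "lborel_on (ball z r)" and ?O = "lborel_on (ball (0::'a) r)"
  interpret B: finite_measure ?Z by (rule finite_ball_lborel)
  interpret B0: finite_measure ?O by (rule finite_ball_lborel)
  interpret U: finite_measure unit_lborel by (rule finite_unit_lborel)
  interpret PB: pair_sigma_finite \<nu> ?Z by unfold_locales
  define V where "V = measure lborel (ball (0::'a) r)"
  have Vz: "measure lborel (ball z r) = V" using r by (simp add: V_def content_ball)
  have V: "0 < V" using r by (simp add: V_def content_ball_pos)
  define c where "c = 1 / (1 - real DIM('a) / p)"
  have c: "0 < c" using pd pq by (simp add: c_def field_simps)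
  have mB: "measure ?Z UNIV = V" "measure ?O UNIV = V"
   using nn_integral_lborel_on[of "ball z r" "\<lambda>_. 1"] nn_integral_lborel_on[of "ball (0::'a) r" "\<lambda>_. 1"] Vz by (simp_all add: measure_def V_def)
  \<comment> \<open>First leg: every x of \<nu> is joined to every point of the ball around
    z.\<close>
  define P where "P = \<nu> \<Otimes>\<^sub>M ?Z"
  have fP: "finite_measure P" unfolding P_def by (rule finite_measure_pair_measure) unfold_locales
  have sP: "sets P = sets (borel :: ('a \<times> 'a) measure)"
  proof -
   have "sets P = sets ((borel :: 'a measure) \<Otimes>\<^sub>M (borel :: 'a measure))" unfolding P_def by (rule sets_pair_measure_cong[OF snu sets_lborel_on])
   then show ?thesis by (simp only: borel_prod)
  qed
  note sP[measurable_cong]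
  have "AE xy in P. fst xy \<in> K \<inter> ball b h \<and> snd xy \<in> ball z r" unfolding P_def
  proof (rule PB.AE_pair_measure)
   have [measurable]: "K \<in> sets borel" using compact by (rule borel_compact)
   show "{x \<in> space (\<nu> \<Otimes>\<^sub>M ?Z). fst x \<in> K \<inter> ball b h \<and> snd x \<in> ball z r} \<in> sets (\<nu> \<Otimes>\<^sub>M ?Z)" by measurable
   have "AE y in ?Z. y \<in> ball z r" by (rule AE_lborel_on) simp
   then show "AE x in \<nu>. AE y in ?Z. fst (x, y) \<in> K \<inter> ball b h \<and> snd (x, y) \<in> ball z r" using nu by auto
  qed
  then have segP: "AE xy in P. fst xy \<in> K \<and> (\<forall>t. 0 < t \<and> t \<le> 1 \<longrightarrow> (1 - t) *R fst xy + t *R snd xy \<in> interior K)"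
   by eventually_elim (use z r in auto)
  \<comment> \<open>The total mass of \<nu> enters with an added 1 so that the constant is positive
    even if \<nu> vanishes.\<close>
  define C1 where "C1 = V powr (1/q) * c * (measure \<nu> UNIV + 1)"
  have C1: "0 < C1" using V c by (simp add: C1_def add_nonneg_pos)
  obtain v1 where v1: "Lq_field K q v1"
   "\<And>f G. continuous_on K f ==> is_C1_gradient K f G ==>
    flux K G v1 = (LINT xy|P. indicator K (snd xy) * f (snd xy) - indicator K (fst xy) * f (fst xy))"
  proof (rule transport_field[OF pq compact fP sP segP C1])
   fix u :: "'a => real" and A :: real
   assume u: "u \<in> \<B>" "\<And>x. 0 \<le> u x" "0 < A" "(\<integral>\<^sup>+x. ennreal (u x powr p) \<partial>lborel) \<le> ennreal A"
   have [measurable]: "u \<in> \<B>" by fact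
   have "(\<integral>\<^sup>+xy. \<integral>\<^sup>+t. ennreal (u ((1 - t) *R fst xy + t *R snd xy)) \<partial>unit_lborel \<partial>P)
     = (\<integral>\<^sup>+x. \<integral>\<^sup>+y. \<integral>\<^sup>+t. ennreal (u ((1 - t) *R x + t *R y)) \<partial>unit_lborel \<partial>?Z \<partial>\<nu>)"
    unfolding P_def by (subst B.nn_integral_fst[symmetric]) auto
   also have "\<dots> \<le> (\<integral>\<^sup>+x. ennreal (A powr (1/p) * V powr (1/q) * c) \<partial>\<nu>)"
   proof (rule nn_integral_mono)
    fix x
    have "(\<integral>\<^sup>+y. \<integral>\<^sup>+t. ennreal (u ((1 - t) *R x + t *R y)) \<partial>unit_lborel \<partial>?Z)
     \<le> ennreal (A powr (1/p) * V powr (1/q)) * (\<integral>\<^sup>+t. ennreal (t powr - (DIM('a) / p)) \<partial>unit_lborel)"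
     unfolding Vz[symmetric] by (rule path_estimate[OF pq]) (use u(1,2,3,4) r in \<open>simp_all only:\<close>, measurable)
    also have "(\<integral>\<^sup>+t. ennreal (t powr - (DIM('a) / p)) \<partial>unit_lborel) = ennreal c"
     unfolding c_def using pd pq by (intro nn_integral_unit_powr) (auto simp: field_simps)
    finally show "(\<integral>\<^sup>+y. \<integral>\<^sup>+t. ennreal (u ((1 - t) *R x + t *R y)) \<partial>unit_lborel \<partial>?Z)
     \<le> ennreal (A powr (1/p) * V powr (1/q) * c)" using c by (simp add: ennreal_mult')
   qed
   also have "\<dots> = ennreal (A powr (1/p) * V powr (1/q) * c * measure \<nu> UNIV)" using c by (simp add: spn nu.emeasure_eq_measure ennreal_mult)
   also have "\<dots> \<le> ennreal (C1 * A powr (1/p))" using c by (intro ennreal_leI) (auto simp: C1_def algebra_simps)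
   finally show "(\<integral>\<^sup>+xy. \<integral>\<^sup>+t. ennreal (u ((1 - t) *R fst xy + t *R snd xy)) \<partial>unit_lborel \<partial>P) \<le> ennreal (C1 * A powr (1/p))" .
  qed blast
  \<comment> \<open>Second leg: each point z + y is joined to its translate y, so the ball moves
    rigidly.\<close>
  define P2 where "P2 = distr ?O borel (\<lambda>y. (z + y, y))"
  have pm [measurable]: "(\<lambda>y. (z + y, y)) \<in> borel_measurable ?O"
   by (simp add: measurable_cong_sets[OF sets_lborel_on refl] borel_measurable_continuous_onI continuous_intros)
  have fP2: "finite_measure P2" unfolding P2_def by (rule B0.finite_measure_distr) simp
  have sP2: "sets P2 = sets (borel :: ('a \<times> 'a) measure)" by (simp add: P2_def)
  \<comment> \<open>The relation between start and end point is expressed by a vanishing norm, whose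
    measurability is immediate.\<close>
  have "AE xy in P2. snd xy \<in> ball 0 r \<and> norm (fst xy - z - snd xy) = 0"
  proof -
   have "AE y in ?O. y \<in> ball 0 r" by (rule AE_lborel_on) simp
   moreover have "{xy \<in> space borel. snd xy \<in> ball 0 r \<and> norm (fst xy - z - snd xy) = 0} \<in> sets (borel :: ('a \<times> 'a) measure)"
    unfolding borel_prod[symmetric] by measurable
   ultimately show ?thesis unfolding P2_def by (subst AE_distr_iff) auto
  qed
  then have segP2: "AE xy in P2. fst xy \<in> K \<and> (\<forall>t. 0 < t \<and> t \<le> 1 \<longrightarrow> (1 - t) *R fst xy + t *R snd xy \<in> interior K)"
  proof eventually_elim
   fix xy :: "'a \<times> 'a" assume a: "snd xy \<in> ball 0 r \<and> norm (fst xy - z - snd xy) = 0"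
   define y where "y = snd xy"
   have y: "norm y < r" and x: "fst xy = z + y" using a by (auto simp: y_def algebra_simps)
   have "z + y \<in> K" using Bz interior_subset[of K] y r by (auto simp: subset_eq dist_norm)
   moreover have "(1 - t) *R (z + y) + t *R y \<in> interior K" if "0 < t" "t \<le> 1" for t
   proof -
    have "(1 - t) *R z + y \<in> ball ((1 - t) *R z) e" using y r by (simp add: dist_norm)
    then have "(1 - t) *R z + y \<in> interior K" using e(2) that by force
    then show ?thesis by (simp add: algebra_simps)
   qed
   ultimately show "fst xy \<in> K \<and> (\<forall>t. 0 < t \<and> t \<le> 1 \<longrightarrow> (1 - t) *R fst xy + t *R snd xy \<in> interior K)"
    by (simp add: x y_def[symmetric])
  qed
  define C2 where "C2 = V powr (1/q)"
  have C2: "0 < C2" using V by (simp add: C2_def)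
  obtain v2 where v2: "Lq_field K q v2"
   "\<And>f G. continuous_on K f ==> is_C1_gradient K f G ==>
    flux K G v2 = (LINT xy|P2. indicator K (snd xy) * f (snd xy) - indicator K (fst xy) * f (fst xy))"
  proof (rule transport_field[OF pq compact fP2 sP2 segP2 C2])
   fix u :: "'a => real" and A :: real
   assume u: "u \<in> \<B>" "\<And>x. 0 \<le> u x" "0 < A" "(\<integral>\<^sup>+x. ennreal (u x powr p) \<partial>lborel) \<le> ennreal A"
   have [measurable]: "u \<in> \<B>" by fact
   have m: "(\<lambda>xy. \<integral>\<^sup>+t. ennreal (u ((1 - t) *R fst xy + t *R snd xy)) \<partial>unit_lborel) \<in> borel_measurable (borel :: ('a \<times> 'a) measure)"
    unfolding borel_prod[symmetric] by measurable
   have "(\<integral>\<^sup>+xy. \<integral>\<^sup>+t. ennreal (u ((1 - t) *R fst xy + t *R snd xy)) \<partial>unit_lborel \<partial>P2)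
     = (\<integral>\<^sup>+y. \<integral>\<^sup>+t. ennreal (u ((1 - t) *R (z + y) + t *R y)) \<partial>unit_lborel \<partial>?O)"
    unfolding P2_def by (subst nn_integral_distr[OF pm]) (use m in auto)
   \<comment> \<open>The path from z + y to y is (1 - t) z + y, so c t = 1 in
     \<open>path_estimate\<close> and no singularity arises.\<close>
   also have "\<dots> = (\<integral>\<^sup>+y. \<integral>\<^sup>+t. ennreal (u ((1 - t) *R z + 1 *R y)) \<partial>unit_lborel \<partial>?O)"
    by (simp add: algebra_simps)
   also have "\<dots> \<le> ennreal (A powr (1/p) * V powr (1/q)) * (\<integral>\<^sup>+t. ennreal (1 powr - (DIM('a) / p)) \<partial>unit_lborel)"
    unfolding V_def using u r by (intro path_estimate[OF pq]) auto
   also have "(\<integral>\<^sup>+t. ennreal (1 powr - (DIM('a) / p)) \<partial>unit_lborel) = 1"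
    using nn_integral_lborel_on[of "{0<..<1::real}" "\<lambda>_. 1"] by simp
   finally show "(\<integral>\<^sup>+xy. \<integral>\<^sup>+t. ennreal (u ((1 - t) *R fst xy + t *R snd xy)) \<partial>unit_lborel \<partial>P2) \<le> ennreal (C2 * A powr (1/p))"
    by (simp add: C2_def mult.commute)
  qed blast
  define m where "m = measure \<nu> UNIV"
  \<comment> \<open>v1 carries V times \<nu> to m times Lebesgue measure on the ball around z, and
    v2 carries Lebesgue measure from there to the ball around the origin; dividing by the volume V
    restores \<nu>.\<close>
  define v where "v x = (1 / V) *R (v1 x + m *R v2 x)" for x
  have "drain_field K q r \<nu> v" unfolding drain_field_def
  proof (intro conjI allI impI)
   show "Lq_field K q v" unfolding v_def[abs_def] using v1 v2 pq by (intro Lq_field_scaleR Lq_field_add) auto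
   fix f :: "'a => real" and G assume fG: "continuous_on K f \<and> is_C1_gradient K f G"
   define F where "F x = indicat_real K x * f x" for x
   have Fm [measurable]: "F \<in> \<B>" unfolding F_def[abs_def] by (rule borel_measurable_indicator_mult_continuous[OF compact]) (use fG in auto)
   obtain M where M: "0 < M" "\<And>x. x \<in> K ==> norm (f x) \<le> M" using continuous_on_compact_bounded[OF compact, of f] fG by metis
   have FM: "\<bar>F x\<bar> \<le> M" for x using M by (auto simp: F_def indicator_def)
   have i1: "integrable P (\<lambda>xy. F (snd xy))" "integrable P (\<lambda>xy. F (fst xy))"
    unfolding P_def by (rule finite_measure.integrable_const_bound[OF fP[unfolded P_def], where B=M]; use FM in auto)+
   have f1: "flux K G v1 = m * (LINT y|?Z. F y) - V * (LINT x|\<nu>. F x)"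
   proof -
    have "flux K G v1 = (LINT xy|P. F (snd xy) - F (fst xy))" using v1(2)[of f G] fG by (simp add: F_def)
    also have "\<dots> = (LINT xy|P. F (snd xy)) - (LINT xy|P. F (fst xy))" using i1 by simp
    also have "(LINT xy|P. F (snd xy)) = (\<integral>x. \<integral>y. F y \<partial>?Z \<partial>\<nu>)"
     using PB.integral_fst'[OF i1(1)[unfolded P_def]] by (simp add: P_def)
    also have "(LINT xy|P. F (fst xy)) = (\<integral>x. \<integral>y. F x \<partial>?Z \<partial>\<nu>)"
     using PB.integral_fst'[OF i1(2)[unfolded P_def]] by (simp add: P_def)
    finally show ?thesis by (simp add: spn mB m_def)
   qed
   have f2: "flux K G v2 = (LINT y|?O. F y) - (LINT y|?Z. F y)"
   proof -
    have i2: "integrable ?O F" "integrable ?O (\<lambda>y. F (z + y))" by (rule B0.integrable_const_bound[where B=M]; use FM in auto)+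
    have mm: "(\<lambda>xy. F (snd xy) - F (fst xy)) \<in> borel_measurable (borel :: ('a \<times> 'a) measure)" unfolding borel_prod[symmetric] by measurable
    have "flux K G v2 = (LINT xy|P2. F (snd xy) - F (fst xy))" using v2(2)[of f G] fG by (simp add: F_def)
    also have "\<dots> = (LINT y|?O. F y - F (z + y))" unfolding P2_def by (subst integral_distr[OF pm mm]) simp
    also have "\<dots> = (LINT y|?O. F y) - (LINT y|?O. F (z + y))" using i2 by simp
    also have "(LINT y|?O. F (z + y)) = (LBINT y. indicator (ball z r) (z + y) *R F (z + y))" by (subst integral_lborel_on)
      (auto simp: set_lebesgue_integral_def indicator_def dist_norm intro!: Bochner_Integration.integral_cong)
    also have "\<dots> = (LINT y|distr lborel borel ((+) z). indicator (ball z r) y *R F y)" by (subst integral_distr) auto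
    also have "\<dots> = (LINT y|?Z. F y)" unfolding lborel_distr_plus by (subst integral_lborel_on) (auto simp: set_lebesgue_integral_def)
    finally show ?thesis .
   qed
   have Gc: "continuous_on K G" using fG by (simp add: is_C1_gradient_def)
   have "flux K G v = (1 / V) * (flux K G v1 + m * flux K G v2)" unfolding v_def[abs_def] flux_scaleR
    using v1(1) v2(1) by (subst flux_add[OF compact Gc]) (auto simp: Lq_field_def flux_scaleR)
   also have "\<dots> = m * ((LINT y|?O. F y) / V) - (LINT x|\<nu>. F x)" using V by (simp add: f1 f2 field_simps)
   finally show "flux K G v = measure \<nu> UNIV * ((LINT y|?O. indicat_real K y * f y) / measure lborel (ball (0::'a) r)) - (LINT x|\<nu>. indicat_real K x * f x)"
    by (simp add: F_def V_def m_def)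
  qed
  then show "\<exists>v. drain_field K q r \<nu> v" by blast
 qed (use h e in auto)
 then show ?thesis using h by blast
qed

lemma drains_all:
 assumes pq: "1 < p" "1 < q" "1 / p + 1 / q = 1" and pd: "real DIM('a) < p"
 shows "drains K q K"
proof -
 obtain h where h: "\<And>b. b \<in> K ==> 0 < h b \<and> drains K q (K \<inter> ball b (h b))" using drains_local[OF assms] by metis
 obtain T where T: "T \<subseteq> K" "finite T" "K \<subseteq> (\<Union>b\<in>T. ball b (h b))"
 proof (rule compactE_image[OF compact, of K "\<lambda>b. ball b (h b)"])
  show "K \<subseteq> (\<Union>b\<in>K. ball b (h b))" using h by force
 qed auto
 have "drains K q (\<Union>b\<in>T. K \<inter> ball b (h b))" using T(2,1)
 proof (induction T rule: finite_induct)
  case (insert b T)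
  have "drains K q ((K \<inter> ball b (h b)) \<union> (\<Union>b\<in>T. K \<inter> ball b (h b)))"
  proof (rule drains_Un[OF compact])
   show "K \<inter> ball b (h b) \<in> sets borel" using borel_compact[OF compact] by simp
  qed (use insert h pq in auto)
  then show ?case by (simp only: UN_insert)
 qed (simp add: drains_empty)
 moreover have "(\<Union>b\<in>T. K \<inter> ball b (h b)) = K" using T(3) by auto
 ultimately show ?thesis by simp
qed

lemma field_with_divergence:
 assumes pq: "1 < p" "1 < q" "1 / p + 1 / q = 1" and pd: "real DIM('a) < p"
  and M: "finite_measure M" "sets M = sets borel" "AE x in M. x \<in> K"
  and N: "finite_measure N" "sets N = sets borel" "AE x in N. x \<in> K"
  and eq: "measure M UNIV = measure N UNIV"
 obtains v where "Lq_field K q v"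
  "\<And>f G. continuous_on K f ==> is_C1_gradient K f G ==>
    flux K G v = - ((LINT x|M. indicat_real K x * f x) - (LINT x|N. indicat_real K x * f x))"
proof -
 obtain r where r: "0 < r" "\<And>\<nu>. finite_measure \<nu> ==> sets \<nu> = sets borel ==> (AE x in \<nu>. x \<in> K) ==> \<exists>v. drain_field K q r \<nu> v"
  using drains_all[OF pq pd] unfolding drains_def by (metis order_refl)
 obtain v where v: "drain_field K q r M v" using r(2)[OF M] by blast
 obtain v' where v': "drain_field K q r N v'" using r(2)[OF N] by blast
 show ?thesis
 proof (rule that[of "\<lambda>x. v x + (-1) *R v' x"])
  show "Lq_field K q (\<lambda>x. v x + (-1) *R v' x)" using v v' pq unfolding drain_field_def by (intro Lq_field_add Lq_field_scaleR) auto
  fix f G assume fG: "continuous_on K f" "is_C1_gradient K f G"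
  then have Gc: "continuous_on K G" by (simp add: is_C1_gradient_def)
  have "flux K G (\<lambda>x. v x + (-1) *R v' x) = flux K G v + (-1) * flux K G v'" using v v' unfolding drain_field_def Lq_field_def
   by (subst flux_add[OF compact Gc]) (auto simp: flux_scaleR[of K G "-1", simplified])
  also have "\<dots> = - ((LINT x|M. indicat_real K x * f x) - (LINT x|N. indicat_real K x * f x))" using v v' fG unfolding drain_field_def eq by simp
  finally show "flux K G (\<lambda>x. v x + (-1) *R v' x)
    = - ((LINT x|M. indicat_real K x * f x) - (LINT x|N. indicat_real K x * f x))" .
 qed
qed

end

section \<open>Cone condition for Lipschitz domains and their dilates\<close>

lemma interior_scaleR_image:
 fixes S :: "'a::euclidean_space set"
 assumes "c \<noteq> 0"
 shows "interior ((\<lambda>x. c *R x) ` S) = (\<lambda>x. c *R x) ` interior S"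
 using assms by (intro interior_injective_linear_image) (auto simp: inj_on_def linear_scale_self)

lemma cone_atI:
 assumes "0 < C" "0 < r"
  and "\<And>h. 0 < h ==> h < r ==> \<exists>z. dist z p \<le> C * h \<and>
   (\<forall>x \<in> K \<inter> ball p h. \<forall>y \<in> ball z h. \<forall>t. 0 < t \<and> t \<le> 1 \<longrightarrow> (1 - t) *R x + t *R y \<in> interior K)"
 shows "cone_at K p" using assms unfolding cone_at_def by blast

lemma cone_at_interior:
 assumes "p \<in> interior K" shows "cone_at K p"
proof -
 obtain e where e: "0 < e" "ball p e \<subseteq> interior K" using assms open_interior open_contains_ball by blast
 show ?thesis
 proof (rule cone_atI[of 1 e])
  fix h :: real assume h: "0 < h" "h < e"
  show "\<exists>z. dist z p \<le> 1 * h \<and> (\<forall>x\<in>K \<inter> ball p h. \<forall>y\<in>ball z h. \<forall>t. 0 < t \<and> t \<le> 1 \<longrightarrow> (1 - t) *R x + t *R y \<in> interior K)"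
  proof (intro exI[of _ p] conjI ballI allI impI)
   fix x y and t :: real assume xy: "x \<in> K \<inter> ball p h" "y \<in> ball p h" "0 < t \<and> t \<le> 1"
   have "(1 - t) *R x + t *R y \<in> ball p h" using xy convex_ball[of p h] by (intro convexD) auto
   then show "(1 - t) *R x + t *R y \<in> interior K" using e h by auto
  qed (use h in auto)
 qed (use e in auto)
qed

text \<open>Moving in the axis direction of a Lipschitz chart by \<open>M h\<close> with \<open>M\<close> larger than the slope
 dominates lateral displacements of order \<open>h\<close>.\<close>

lemma cone_at_lipschitz_boundary:
 fixes K :: "'a::euclidean_space set"
 assumes lip: "lipschitz_domain (interior K)" and K: "K \<subseteq> closure (interior K)" and p: "p \<in> K" "p \<notin> interior K"
 shows "cone_at K p"
proof -
 let ?U = "interior K"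
 have "p \<in> frontier ?U" using p K by (auto simp: frontier_def)
 then obtain r e \<gamma> L where r: "0 < r" and e: "norm e = 1" and lipg: "L-lipschitz_on {y. y \<bullet> e = 0} \<gamma>"
  and U: "?U \<inter> ball p r = {x \<in> ball p r. x \<bullet> e > \<gamma> (x - (x \<bullet> e) *R e)}" using lip unfolding lipschitz_domain_def by blast
 define pr where "pr x = x - (x \<bullet> e) *R e" for x
 have ee: "e \<bullet> e = 1" using e by (simp add: dot_square_norm)
 have prH: "pr x \<in> {y. y \<bullet> e = 0}" for x by (simp add: pr_def inner_diff_left ee)
 have L0: "0 \<le> L" using lipg by (rule lipschitz_on_nonneg)
 have gl: "\<bar>\<gamma> (pr x) - \<gamma> (pr y)\<bar> \<le> L * norm (pr x - pr y)" for x y using lipschitz_onD[OF lipg prH prH, of x y] by (simp add: dist_norm)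
 have cg: "continuous_on UNIV (\<lambda>x. \<gamma> (pr x))"
 proof (rule continuous_on_compose2[OF lipschitz_on_continuous_on[OF lipg]])
  show "continuous_on UNIV pr" unfolding pr_def[abs_def] by (intro continuous_intros)
 qed (use prH in auto)
 \<comment> \<open>The chart describes interior points only; points of K are limits of these, so the
   weak inequality persists by continuity of \<gamma>.\<close>
 have ge: "x \<bullet> e \<ge> \<gamma> (pr x)" if x: "x \<in> K" "x \<in> ball p r" for x
 proof -
  have "x \<in> ball p r \<inter> closure ?U" using x K by auto
  then have "x \<in> closure (ball p r \<inter> ?U)" using open_Int_closure_subset[OF open_ball] by blast
  moreover have "closed {x. \<gamma> (pr x) \<le> x \<bullet> e}" by (intro closed_Collect_le cg continuous_intros)
  moreover have "ball p r \<inter> ?U \<subseteq> {x. \<gamma> (pr x) \<le> x \<bullet> e}"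
  proof
   fix x assume "x \<in> ball p r \<inter> ?U"
   then have "x \<in> ?U \<inter> ball p r" by blast
   then show "x \<in> {x. \<gamma> (pr x) \<le> x \<bullet> e}" unfolding U by (simp add: pr_def)
  qed
  ultimately show ?thesis using closure_minimal[of "ball p r \<inter> ?U" "{x. \<gamma> (pr x) \<le> x \<bullet> e}"] by auto
 qed
 \<comment> \<open>With |d| < 2 h the lateral displacement after time t is below 4 h t, so the graph
   rises by at most 4 L h t, while the gain along the axis is t (M h + d . e). The difference is t
   (3 h + d . e), positive because |d . e| < 2 h.\<close>
 define M where "M = 4 * L + 3"
 have M: "0 < M" using L0 by (simp add: M_def)
 show ?thesis
 \<comment> \<open>The path stays within (M + 3) h of p, from |x - p| < h, the axis displacement M h
   and |d| < 2 h; this must remain inside the chart.\<close>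
 proof (rule cone_atI[of M "r / (M + 3)"])
  fix h assume h: "0 < h" "h < r / (M + 3)"
  then have hr: "(M + 3) * h < r" using M by (simp add: field_simps)
  define z where "z = p + (M * h) *R e"
  show "\<exists>z. dist z p \<le> M * h \<and> (\<forall>x\<in>K \<inter> ball p h. \<forall>y\<in>ball z h. \<forall>t. 0 < t \<and> t \<le> 1 \<longrightarrow> (1 - t) *R x + t *R y \<in> ?U)"
  proof (intro exI[of _ z] conjI ballI allI impI)
   show "dist z p \<le> M * h" using h M e by (simp add: z_def dist_norm)
   fix x y and t :: real assume x: "x \<in> K \<inter> ball p h" and y: "y \<in> ball z h" and t: "0 < t \<and> t \<le> 1"
   define d where "d = y - x - (M * h) *R e"
   have nd: "norm d < 2 * h"
   proof -
    have "d = (y - z) - (x - p)" by (simp add: d_def z_def)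
    then have "norm d \<le> norm (y - z) + norm (x - p)" by (simp add: norm_triangle_ineq4)
    then show ?thesis using x y by (simp add: dist_norm norm_minus_commute)
   qed
   define w where "w = (1 - t) *R x + t *R y"
   have w: "w = x + t *R ((M * h) *R e + d)" by (simp add: w_def d_def algebra_simps)
   have Mh: "0 < M * h" using M h by simp
   have "norm (w - p) \<le> norm (x - p) + norm (t *R ((M * h) *R e + d))"
    unfolding w using norm_triangle_ineq[of "x - p" "t *R ((M * h) *R e + d)"] by (simp add: algebra_simps)
   also have "norm (t *R ((M * h) *R e + d)) \<le> 1 * norm ((M * h) *R e + d)"
    using t mult_right_mono[of t 1 "norm ((M * h) *R e + d)"] by simp
   also have "norm ((M * h) *R e + d) \<le> M * h + norm d" using norm_triangle_ineq[of "(M * h) *R e" d] e Mh by simp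
   finally have "norm (w - p) < h + (M * h + 2 * h)" using x nd by (simp add: dist_norm norm_minus_commute)
   then have wr: "w \<in> ball p r" using hr by (simp add: dist_norm norm_minus_commute algebra_simps)
   have "h < r" using hr h M by (smt (verit, best) mult_le_cancel_right1)
   then have gx: "\<gamma> (pr x) \<le> x \<bullet> e" using x by (intro ge) auto
   have de: "\<bar>d \<bullet> e\<bar> \<le> norm d" using Cauchy_Schwarz_ineq2[of d e] e by simp
   have "pr w - pr x = t *R (d - (d \<bullet> e) *R e)" unfolding w pr_def by (simp add: inner_add_left ee algebra_simps)
   then have "norm (pr w - pr x) = t * norm (d - (d \<bullet> e) *R e)" using t by simp
   also have "norm (d - (d \<bullet> e) *R e) \<le> norm d + \<bar>d \<bullet> e\<bar>" using norm_triangle_ineq4[of d "(d \<bullet> e) *R e"] e by simp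
   also have "t * (norm d + \<bar>d \<bullet> e\<bar>) \<le> t * (4 * h)" using de nd t by (intro mult_left_mono) auto
   finally have "norm (pr w - pr x) \<le> t * (4 * h)" using t by (simp add: mult_left_mono)
   then have "L * norm (pr w - pr x) \<le> L * (t * (4 * h))" using L0 by (rule mult_left_mono)
   then have "\<gamma> (pr w) \<le> \<gamma> (pr x) + L * (t * (4 * h))" using gl[of w x] by linarith
   also have "\<dots> \<le> x \<bullet> e + L * (t * (4 * h))" using gx by simp
   also have "\<dots> < x \<bullet> e + t * (M * h + d \<bullet> e)"
   proof -
    have "t * (M * h + d \<bullet> e) - L * (t * (4 * h)) = t * (3 * h + d \<bullet> e)" by (simp add: M_def algebra_simps)
    moreover have "0 < t * (3 * h + d \<bullet> e)" using t de nd h by (intro mult_pos_pos) auto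
    ultimately show ?thesis by linarith
   qed
   also have "\<dots> = w \<bullet> e" unfolding w by (simp add: inner_add_left ee)
   finally have "w \<in> ?U \<inter> ball p r" unfolding U using wr by (simp add: pr_def)
   then show "(1 - t) *R x + t *R y \<in> ?U" by (simp add: w_def)
  qed
 qed (use M r in auto)
qed

lemma conic_star_lipschitz:
 fixes K :: "'a::euclidean_space set"
 assumes "compact K" "lipschitz_domain (interior K)"
  and star: "\<And>x t. x \<in> K ==> 0 \<le> t ==> t < 1 ==> t *R x \<in> interior K"
 shows "conic_star K"
proof
 have ne: "interior K \<noteq> {}" using assms(2) by (simp add: lipschitz_domain_def)
 then show "K \<noteq> {}" using interior_subset by auto
 have cl: "K \<subseteq> closure (interior K)"
 proof
  fix x assume x: "x \<in> K"
  have "(\<lambda>n. (1 - 1 / real (Suc n)) *R x) \<longlonglongrightarrow> (1 - 0) *R x" by (intro tendsto_intros LIMSEQ_Suc[OF lim_1_over_n])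
  moreover have "(1 - 1 / real (Suc n)) *R x \<in> interior K" for n by (rule star[OF x]) auto
  ultimately show "x \<in> closure (interior K)" unfolding closure_sequential by (intro exI conjI) auto
 qed
 show "cone_at K p" if "p \<in> K" for p using cone_at_interior cone_at_lipschitz_boundary[OF assms(2) cl that] by blast
qed (use assms in auto)

text \<open>Dilation by c multiplies the admissible scales r by c and leaves the constant C of the
  cones unchanged.\<close>

lemma (in conic_star) conic_star_scale:
 assumes c: "0 < c"
 shows "conic_star ((\<lambda>x. c *R x) ` K)"
proof
 have int: "interior ((\<lambda>x. c *R x) ` K) = (\<lambda>x. c *R x) ` interior K" using c by (intro interior_scaleR_image) auto
 show "compact ((\<lambda>x. c *R x) ` K)" by (intro compact_scaling compact)
 show "(\<lambda>x. c *R x) ` K \<noteq> {}" using nonempty by simp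
 show "t *R x \<in> interior ((\<lambda>x. c *R x) ` K)" if "x \<in> (\<lambda>x. c *R x) ` K" "0 \<le> t" "t < 1" for x t
  using that star unfolding int by (auto simp: mult.commute intro!: image_eqI[where x="t *R _"])
 fix p' assume "p' \<in> (\<lambda>x. c *R x) ` K"
 then obtain p where p: "p \<in> K" "p' = c *R p" by auto
 obtain C r where C: "0 < C" "0 < r" "\<And>h. 0 < h ==> h < r ==> \<exists>z. dist z p \<le> C * h \<and>
   (\<forall>x \<in> K \<inter> ball p h. \<forall>y \<in> ball z h. \<forall>t. 0 < t \<and> t \<le> 1 \<longrightarrow> (1 - t) *R x + t *R y \<in> interior K)"
  using cone[OF p(1)] unfolding cone_at_def by blast
 show "cone_at ((\<lambda>x. c *R x) ` K) p'"
 proof (rule cone_atI[of C "c * r"])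
  fix h assume h: "0 < h" "h < c * r"
  then obtain z where z: "dist z p \<le> C * (h / c)"
   "\<And>x y t. x \<in> K \<inter> ball p (h / c) ==> y \<in> ball z (h / c) ==> 0 < t \<and> t \<le> 1 ==> (1 - t) *R x + t *R y \<in> interior K"
   using C(3)[of "h / c"] c by (auto simp: field_simps)
  have dc: "dist (c *R a) (c *R b) = c * dist a b" for a b :: 'a using c by (simp add: dist_norm flip: scaleR_diff_right)
  show "\<exists>z. dist z p' \<le> C * h \<and> (\<forall>x\<in>(\<lambda>x. c *R x) ` K \<inter> ball p' h. \<forall>y\<in>ball z h. \<forall>t. 0 < t \<and> t \<le> 1 \<longrightarrow>
    (1 - t) *R x + t *R y \<in> interior ((\<lambda>x. c *R x) ` K))"
  proof (intro exI[of _ "c *R z"] conjI ballI allI impI)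
   show "dist (c *R z) p' \<le> C * h" using z(1) c by (simp add: p dc field_simps)
   fix x y and t :: real assume x: "x \<in> (\<lambda>x. c *R x) ` K \<inter> ball p' h" and y: "y \<in> ball (c *R z) h" and t: "0 < t \<and> t \<le> 1"
   obtain x0 where x0: "x = c *R x0" "x0 \<in> K" using x by auto
   define y0 where "y0 = (1 / c) *R y"
   have y0: "y = c *R y0" using c by (simp add: y0_def)
   have "(1 - t) *R x0 + t *R y0 \<in> interior K" using x y x0 c t by (intro z) (auto simp: p y0 dc field_simps)
   moreover have "(1 - t) *R x + t *R y = c *R ((1 - t) *R x0 + t *R y0)" by (simp add: x0 y0 algebra_simps)
   ultimately show "(1 - t) *R x + t *R y \<in> interior ((\<lambda>x. c *R x) ` K)" unfolding int by blast
  qed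
 qed (use c C in auto)
qed

section \<open>Gradients, test functions and convolutions\<close>

lemma GDERIV_unique: "GDERIV f x :> D ==> GDERIV f x :> E ==> D = (E :: 'a::euclidean_space)"
proof (rule euclidean_eqI)
 fix b :: 'a assume "GDERIV f x :> D" "GDERIV f x :> E"
 then have "(\<lambda>h. h \<bullet> D) = (\<lambda>h. h \<bullet> E)" unfolding gderiv_def by (rule has_derivative_unique)
 then have "b \<bullet> D = b \<bullet> E" by (rule fun_cong)
 then show "D \<bullet> b = E \<bullet> b" by (simp add: inner_commute)
qed

lemma gradient_eq: "GDERIV f x :> D ==> gradient f x = D" unfolding gradient_def by (rule the_equality) (auto intro: GDERIV_unique)

lemma GDERIV_gradient:
 fixes f :: "'a::euclidean_space => real"
 assumes "f differentiable (at x)"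
 shows "GDERIV f x :> gradient f x"
proof -
 obtain f' where f': "(f has_derivative f') (at x)" using assms by (auto simp: differentiable_def)
 then have lin: "linear f'" by (simp add: has_derivative_linear)
 have "f' = (\<lambda>h. h \<bullet> (\<Sum>b\<in>Basis. f' b *R b))"
 proof
  fix h
  have "f' h = f' (\<Sum>b\<in>Basis. (h \<bullet> b) *R b)" by (simp add: euclidean_representation)
  also have "\<dots> = (\<Sum>b\<in>Basis. (h \<bullet> b) * f' b)" using lin by (simp add: linear_sum linear_scale)
  finally show "f' h = h \<bullet> (\<Sum>b\<in>Basis. f' b *R b)" by (simp add: inner_sum_right mult.commute)
 qed
 then have "GDERIV f x :> (\<Sum>b\<in>Basis. f' b *R b)" using f' by (simp add: gderiv_def)
 then show ?thesis using gradient_eq by metis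
qed

lemma gradient_translate:
 fixes f :: "'a::euclidean_space => real"
 assumes "f differentiable (at (x - u))"
 shows "GDERIV (\<lambda>y. f (y - u)) x :> gradient f (x - u)"
proof -
 have "(f has_derivative (\<lambda>h. h \<bullet> gradient f (x - u))) (at (x - u))" using GDERIV_gradient[OF assms] by (simp add: gderiv_def)
 moreover have "((\<lambda>y. y - u) has_derivative (\<lambda>h. h)) (at x)" by (auto intro!: derivative_eq_intros)
 ultimately have "(f \<circ> (\<lambda>y. y - u) has_derivative (\<lambda>h. h \<bullet> gradient f (x - u)) \<circ> (\<lambda>h. h)) (at x)" by (intro diff_chain_at)
 then show ?thesis by (simp add: gderiv_def o_def)
qed

lemma Ck_translate:
 fixes f :: "'a::euclidean_space => real"
 shows "Ck k f ==> Ck k (\<lambda>y. f (y - u))"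
proof (induction k arbitrary: f)
 case 0
 then show ?case by (auto intro!: continuous_on_compose2[of UNIV f] continuous_intros)
next
 case (Suc k)
 then have d: "\<And>x. f differentiable (at x)" by simp
 have g: "gradient (\<lambda>y. f (y - u)) x = gradient f (x - u)" for x by (rule gradient_eq[OF gradient_translate[OF d]])
 have "(\<lambda>y. f (y - u)) differentiable (at x)" for x using gradient_translate[of f x u] d by (auto simp: gderiv_def differentiable_def)
 moreover have "Ck k (\<lambda>x. gradient f (x - u) \<bullet> b)" if "b \<in> Basis" for b
  using Suc.IH[of "\<lambda>x. gradient f x \<bullet> b"] Suc.prems that by simp
 ultimately show ?case by (simp add: g)
qed

lemma test_function_translate:
 assumes "\<eta> \<in> test_functions UNIV" "\<And>w. w \<in> supp \<eta> ==> u + w \<in> U"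
 shows "(\<lambda>y. \<eta> (y - u)) \<in> test_functions U"
proof -
 have "{x. \<eta> (x - u) \<noteq> 0} = (+) u ` {x. \<eta> x \<noteq> 0}" by (auto simp: image_iff) (metis add_diff_cancel_left' diff_add_cancel add.commute)
 then have s: "supp (\<lambda>y. \<eta> (y - u)) = (+) u ` supp \<eta>" by (simp add: supp_def closure_translation)
 have "compact ((+) u ` supp \<eta>)" using assms(1) by (intro compact_translation) (auto simp: test_functions_def)
 then show ?thesis using assms by (auto simp: test_functions_def s intro: Ck_translate)
qed

lemma test_function_smooth:
 assumes "\<eta> \<in> test_functions U"
 shows "continuous_on UNIV \<eta>" "continuous_on UNIV (gradient \<eta>)" "GDERIV \<eta> x :> gradient \<eta> x"
  "x \<notin> supp \<eta> ==> \<eta> x = 0" "x \<notin> supp \<eta> ==> gradient \<eta> x = 0" "compact (supp \<eta>)"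
proof -
 have C: "Ck k \<eta>" for k using assms by (simp add: test_functions_def)
 show "continuous_on UNIV \<eta>" using C[of 0] by simp
 show "continuous_on UNIV (gradient \<eta>)" using C[of 1] by (subst continuous_on_componentwise) simp
 show d: "GDERIV \<eta> x :> gradient \<eta> x" for x using C[of 1] by (intro GDERIV_gradient) simp
 show z: "\<eta> x = 0" if "x \<notin> supp \<eta>" for x using that closure_subset by (force simp: supp_def)
 show "compact (supp \<eta>)" using assms by (simp add: test_functions_def)
 show "gradient \<eta> x = 0" if x: "x \<notin> supp \<eta>"
 proof (rule gradient_eq)
  have "open (- supp \<eta>)" by (simp add: supp_def open_Compl)
  then have "((\<lambda>_. 0) has_derivative (\<lambda>h. 0)) (at x) ==> (\<eta> has_derivative (\<lambda>h. 0)) (at x)"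
   using x z by (rule_tac has_derivative_transform_within_open[of _ _ _ _ "- supp \<eta>"]) auto
  then show "GDERIV \<eta> x :> 0" by (simp add: gderiv_def)
 qed
qed

lemma uniformly_continuous_compact_support:
 fixes f :: "'a::euclidean_space => 'b::real_normed_vector"
 assumes "continuous_on UNIV f" "compact S" "\<And>x. x \<notin> S ==> f x = 0"
 shows "uniformly_continuous_on UNIV f" "\<exists>B>0. \<forall>x. norm (f x) \<le> B"
proof -
 obtain R where R: "0 < R" "\<And>x. x \<in> S ==> norm x \<le> R" using compact_imp_bounded[OF assms(2)] bounded_pos by metis
 \<comment> \<open>The radius R + 1 leaves room: two points at distance below 1, one of them in the
   ball of radius R, both lie in the larger ball.\<close>
 have "uniformly_continuous_on (cball 0 (R + 1)) f" by (intro compact_uniformly_continuous continuous_on_subset[OF assms(1)]) auto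
 then have u: "\<exists>d>0. \<forall>x\<in>cball 0 (R+1). \<forall>y\<in>cball 0 (R+1). dist y x < d \<longrightarrow> dist (f y) (f x) < e" if "0 < e" for e
  using that unfolding uniformly_continuous_on_def by blast
 show "uniformly_continuous_on UNIV f" unfolding uniformly_continuous_on_def
 proof (intro allI impI)
  fix e :: real assume e: "0 < e"
  obtain d where d: "0 < d" "\<And>x y. x \<in> cball 0 (R+1) ==> y \<in> cball 0 (R+1) ==> dist y x < d ==> dist (f y) (f x) < e"
   using u[OF e] by blast
  show "\<exists>d>0. \<forall>x\<in>UNIV. \<forall>x'\<in>UNIV. dist x' x < d \<longrightarrow> dist (f x') (f x) < e"
  proof (intro exI[of _ "min d 1"] conjI ballI impI)
   fix x y :: 'a assume xy: "dist y x < min d 1"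
   show "dist (f y) (f x) < e"
   proof (cases "norm x \<le> R \<or> norm y \<le> R")
    case True
    have "norm x \<le> norm y + dist y x" "norm y \<le> norm x + dist y x"
     using norm_triangle_ineq2[of x y] norm_triangle_ineq2[of y x] by (auto simp: dist_norm norm_minus_commute)
    then show ?thesis using True xy by (intro d) auto
   next
    case False
    then have "f x = 0" "f y = 0" using R(2) assms(3) by blast+
    then show ?thesis using e by simp
   qed
  qed (use d in auto)
 qed
 obtain B where B: "0 < B" "\<And>x. x \<in> S ==> norm (f x) \<le> B"
  using continuous_on_compact_bounded[OF assms(2) continuous_on_subset[OF assms(1)]] by auto
 have "norm (f x) \<le> B" for x using B assms(3)[of x] by (cases "x \<in> S") auto
 then show "\<exists>B>0. \<forall>x. norm (f x) \<le> B" using B(1) by blast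
qed

lemma integrable_scaled_bounded:
 fixes g :: "'a => 'b::euclidean_space"
 assumes g: "integrable M g" and w: "w \<in> borel_measurable M" "\<And>x. \<bar>w x\<bar> \<le> B"
 shows "integrable M (\<lambda>x. w x *R g x)"
proof (rule Bochner_Integration.integrable_bound)
 show "integrable M (\<lambda>x. B * norm (g x))" using g by simp
 show "AE x in M. norm (w x *R g x) \<le> norm (B * norm (g x))"
 proof (rule AE_I2)
  fix x
  have "0 \<le> B" using w(2)[of x] by linarith
  then show "norm (w x *R g x) \<le> norm (B * norm (g x))" using w(2)[of x] by (simp add: mult_right_mono)
 qed
qed (use g w in auto)

lemma convolution_continuous:
 fixes g :: "'a::euclidean_space => 'b::euclidean_space" and \<eta> :: "'a => real"
 assumes L: "sets L = sets borel" and g: "integrable L g" and uc: "uniformly_continuous_on UNIV \<eta>" and B: "\<And>x. \<bar>\<eta> x\<bar> \<le> B"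
 shows "continuous_on UNIV (\<lambda>u. \<integral>z. \<eta> (z - u) *R g z \<partial>L)"
proof -
 have em: "(\<lambda>z. \<eta> (z - u)) \<in> borel_measurable L" for u unfolding measurable_cong_sets[OF L refl]
  by (intro borel_measurable_continuous_onI continuous_on_compose2[OF uniformly_continuous_imp_continuous[OF uc]] continuous_intros) auto
 have i: "integrable L (\<lambda>z. \<eta> (z - u) *R g z)" for u by (rule integrable_scaled_bounded[OF g em B])
 define I where "I = (LINT z|L. norm (g z))"
 have I0: "0 \<le> I" unfolding I_def by (intro Bochner_Integration.integral_nonneg) auto
 show ?thesis unfolding continuous_on_iff
 proof (intro ballI allI impI)
  fix u :: 'a and e :: real assume e: "0 < e"
  obtain d where d: "0 < d" "\<And>x y. dist x y < d ==> dist (\<eta> x) (\<eta> y) < e / (I + 1)" using uc e I0 unfolding uniformly_continuous_on_def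
   by (metis UNIV_I add_nonneg_pos divide_pos_pos zero_less_one)
  show "\<exists>d>0. \<forall>x'\<in>UNIV. dist x' u < d \<longrightarrow> dist (LINT z|L. \<eta> (z - x') *R g z) (LINT z|L. \<eta> (z - u) *R g z) < e"
  proof (intro exI[of _ d] conjI ballI impI d)
   fix u' assume u': "dist u' u < d"
   have "(LINT z|L. \<eta> (z - u') *R g z) - (LINT z|L. \<eta> (z - u) *R g z) = (LINT z|L. (\<eta> (z - u') - \<eta> (z - u)) *R g z)"
    using i by (simp add: scaleR_diff_left)
   also have "norm \<dots> \<le> (LINT z|L. e / (I + 1) * norm (g z))"
   proof (rule Bochner_Integration.integral_norm_bound_integral)
    show "integrable L (\<lambda>z. (\<eta> (z - u') - \<eta> (z - u)) *R g z)" using i by (simp add: scaleR_diff_left)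
    fix z
    have "dist (z - u') (z - u) < d" using u' by (simp add: dist_norm norm_minus_commute)
    then have "\<bar>\<eta> (z - u') - \<eta> (z - u)\<bar> \<le> e / (I + 1)" using d(2) by (simp add: dist_real_def less_imp_le)
    then show "norm ((\<eta> (z - u') - \<eta> (z - u)) *R g z) \<le> e / (I + 1) * norm (g z)" using mult_right_mono[of _ "e / (I + 1)" "norm (g z)"] by simp
   qed (use g in auto)
   also have "\<dots> = e * (I / (I + 1))" by (simp add: I_def)
   also have "\<dots> < e" using e I0 by (simp add: field_simps)
   finally show "dist (LINT z|L. \<eta> (z - u') *R g z) (LINT z|L. \<eta> (z - u) *R g z) < e" by (simp add: dist_norm)
  qed
 qed
qed

text \<open>The gradient of \<eta> is uniformly continuous, so the remainder of its first order
  expansion is bounded uniformly in z and can be integrated against \<phi>. The sign comes from u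
  entering as z - u.\<close>

lemma convolution_gradient:
 fixes \<phi> :: "'a::euclidean_space => real"
 assumes \<phi>: "integrable lborel \<phi>" and \<eta>: "\<eta> \<in> test_functions UNIV"
 shows "GDERIV (\<lambda>u. \<integral>z. \<eta> (z - u) *R \<phi> z \<partial>lborel) u :> - (LBINT z. \<phi> z *R gradient \<eta> (z - u))"
proof -
 note sm = test_function_smooth[OF \<eta>]
 have ucg: "uniformly_continuous_on UNIV (gradient \<eta>)" "\<exists>B>0. \<forall>x. norm (gradient \<eta> x) \<le> B"
  using uniformly_continuous_compact_support[OF sm(2) sm(6) sm(5)] by auto
 obtain Bg where Bg: "\<And>x. norm (gradient \<eta> x) \<le> Bg" using ucg(2) by blast
 obtain B where B: "\<And>x. \<bar>\<eta> x\<bar> \<le> B" using uniformly_continuous_compact_support(2)[OF sm(1) sm(6) sm(4)] by auto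
 have em: "(\<lambda>z. \<eta> (z - u)) \<in> borel_measurable lborel" for u
  using sm(1) by (auto intro!: borel_measurable_continuous_onI continuous_on_compose2[OF sm(1)] continuous_intros)
 have gm: "(\<lambda>z. gradient \<eta> (z - u)) \<in> borel_measurable lborel" for u
  by (auto intro!: borel_measurable_continuous_onI continuous_on_compose2[OF sm(2)] continuous_intros)
 have i: "integrable lborel (\<lambda>z. \<eta> (z - u) *R \<phi> z)" for u by (rule integrable_scaled_bounded[OF \<phi> em B])
 have ig: "integrable lborel (\<lambda>z. \<phi> z *R gradient \<eta> (z - u))" for u
 proof (rule Bochner_Integration.integrable_bound)
  show "integrable lborel (\<lambda>z. Bg * norm (\<phi> z))" using \<phi> by simp
  show "AE z in lborel. norm (\<phi> z *R gradient \<eta> (z - u)) \<le> norm (Bg * norm (\<phi> z))"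
  proof (rule AE_I2)
   fix z
   have "\<bar>\<phi> z\<bar> * norm (gradient \<eta> (z - u)) \<le> \<bar>\<phi> z\<bar> * \<bar>Bg\<bar>" using Bg[of "z - u"] by (intro mult_left_mono) auto
   then show "norm (\<phi> z *R gradient \<eta> (z - u)) \<le> norm (Bg * norm (\<phi> z))" by (simp add: abs_mult mult.commute)
  qed
 qed (use \<phi> gm in auto)
 define I where "I = (LBINT z. norm (\<phi> z))"
 have I0: "0 \<le> I" unfolding I_def by (intro Bochner_Integration.integral_nonneg) auto
 let ?F = "\<lambda>u. \<integral>z. \<eta> (z - u) *R \<phi> z \<partial>lborel" and ?D = "- (LBINT z. \<phi> z *R gradient \<eta> (z - u))"
 show ?thesis unfolding gderiv_def has_derivative_at_alt
 proof (intro conjI allI impI)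
  show "bounded_linear (\<lambda>h. h \<bullet> ?D)" by (rule bounded_linear_inner_left)
  fix e :: real assume e: "0 < e"
  define e1 where "e1 = e / (I + 1)"
  have e1: "0 < e1" using e I0 by (simp add: e1_def)
  obtain d where d: "0 < d" "\<And>x y. dist x y < d ==> dist (gradient \<eta> x) (gradient \<eta> y) < e1"
   using ucg(1) e1 unfolding uniformly_continuous_on_def by blast
  have tay: "\<bar>\<eta> (w - h) - \<eta> w + h \<bullet> gradient \<eta> w\<bar> \<le> norm h * e1" if h: "norm h < d" for w h
  proof -
   have "norm (\<eta> (w - h) - \<eta> w - (w - h - w) \<bullet> gradient \<eta> w) \<le> norm (w - h - w) * e1"
   proof (rule differentiable_bound_linearization[where S="ball w d" and f'="\<lambda>x h. h \<bullet> gradient \<eta> x"])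
    show "w + t *R (w - h - w) \<in> ball w d" if "t \<in> {0..1}" for t using that h mult_right_mono[of "\<bar>t\<bar>" 1 "norm h"] by (auto simp: dist_norm)
    show "(\<eta> has_derivative (\<lambda>h. h \<bullet> gradient \<eta> x)) (at x within ball w d)" for x
     using sm(3)[of x] unfolding gderiv_def by (rule has_derivative_at_withinI)
    fix x assume x: "x \<in> ball w d"
    have "onorm (\<lambda>i. i \<bullet> gradient \<eta> x - i \<bullet> gradient \<eta> w) \<le> e1"
    proof (rule onorm_le)
     fix i
     have "norm (i \<bullet> gradient \<eta> x - i \<bullet> gradient \<eta> w) \<le> norm i * norm (gradient \<eta> x - gradient \<eta> w)"
      using Cauchy_Schwarz_ineq2[of i "gradient \<eta> x - gradient \<eta> w"] by (simp add: inner_diff_right)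
     also have "\<dots> \<le> norm i * e1" using d(2)[of x w] x by (intro mult_left_mono) (auto simp: dist_norm norm_minus_commute)
     finally show "norm (i \<bullet> gradient \<eta> x - i \<bullet> gradient \<eta> w) \<le> e1 * norm i" by (simp add: mult.commute)
    qed
    then show "onorm ((\<lambda>h. h \<bullet> gradient \<eta> x) - (\<lambda>h. h \<bullet> gradient \<eta> w)) \<le> e1" by (simp add: fun_diff_def)
   qed (use d in auto)
   then show ?thesis by (simp add: inner_minus_left)
  qed
  show "\<exists>d>0. \<forall>y. norm (y - u) < d \<longrightarrow> norm (?F y - ?F u - (y - u) \<bullet> ?D) \<le> e * norm (y - u)"
  proof (intro exI[of _ d] conjI allI impI d)
   fix y assume y: "norm (y - u) < d"
   define h where "h = y - u"
   have "(y - u) \<bullet> ?D = - (LBINT z. h \<bullet> (\<phi> z *R gradient \<eta> (z - u)))" using ig[of u] by (simp add: h_def del: inner_scaleR_right)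
   then have "?F y - ?F u - (y - u) \<bullet> ?D = (LBINT z. \<eta> (z - y) *R \<phi> z - \<eta> (z - u) *R \<phi> z + h \<bullet> (\<phi> z *R gradient \<eta> (z - u)))"
    using i ig[of u] by (simp del: inner_scaleR_right real_scaleR_def)
   also have "norm \<dots> \<le> (LBINT z. (norm h * e1) * norm (\<phi> z))"
   proof (rule Bochner_Integration.integral_norm_bound_integral)
    show "integrable lborel (\<lambda>z. \<eta> (z - y) *R \<phi> z - \<eta> (z - u) *R \<phi> z + h \<bullet> (\<phi> z *R gradient \<eta> (z - u)))"
     using i ig[of u] by (simp del: inner_scaleR_right real_scaleR_def)
    fix z
    have "\<eta> (z - y) *R \<phi> z - \<eta> (z - u) *R \<phi> z + h \<bullet> (\<phi> z *R gradient \<eta> (z - u))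
     = \<phi> z * (\<eta> ((z - u) - h) - \<eta> (z - u) + h \<bullet> gradient \<eta> (z - u))" by (simp add: h_def algebra_simps)
    then have "norm (\<eta> (z - y) *R \<phi> z - \<eta> (z - u) *R \<phi> z + h \<bullet> (\<phi> z *R gradient \<eta> (z - u)))
      = \<bar>\<phi> z\<bar> * \<bar>\<eta> ((z - u) - h) - \<eta> (z - u) + h \<bullet> gradient \<eta> (z - u)\<bar>" by (simp only: real_norm_def abs_mult)
    also have "\<dots> \<le> \<bar>\<phi> z\<bar> * (norm h * e1)" using y by (intro mult_left_mono tay) (auto simp: h_def)
    finally show "norm (\<eta> (z - y) *R \<phi> z - \<eta> (z - u) *R \<phi> z + h \<bullet> (\<phi> z *R gradient \<eta> (z - u))) \<le> (norm h * e1) * norm (\<phi> z)"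
     by (simp add: mult.commute)
   qed (use \<phi> in auto)
   also have "\<dots> = norm h * (e * (I / (I + 1)))" by (simp add: I_def e1_def)
   also have "\<dots> \<le> norm h * e" using e I0 by (intro mult_left_mono) (auto simp: field_simps)
   finally show "norm (?F y - ?F u - (y - u) \<bullet> ?D) \<le> e * norm (y - u)" by (simp add: h_def mult.commute)
  qed
 qed
qed

text \<open>The integration by parts clause of \<open>is_weak_gradient\<close>, for Borel
  representatives that are extended by zero, with all integrals against
  \<open>lborel\<close>.\<close>

definition weak_grad :: "'a::euclidean_space set => ('a => real) => ('a => 'a) => bool" where
 "weak_grad U \<phi> g \<longleftrightarrow> (\<forall>\<psi>\<in>test_functions U.
   (LBINT x. \<phi> x *R gradient \<psi> x) = - (LBINT x. \<psi> x *R g x))"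

text \<open>The mollification of g evaluated at the shrunken point c y. Since c y stays away from
  the boundary, a function known only inside K is smoothed up to the boundary of K.\<close>

definition moll :: "real => ('a => real) => ('a => 'b) => 'a::euclidean_space => 'b::euclidean_space" where
 "moll c \<eta> g y = (LBINT z. \<eta> (z - c *R y) *R g z)"

text \<open>For y in K the translate of \<eta> to c y is a test function on U, so the definition of
  the weak gradient moves the derivative from \<eta> to \<phi>. The factor c in the gradient is the
  chain rule for y -> c y.\<close>

lemma moll_C1:
 assumes \<phi>: "integrable lborel \<phi>" and g: "integrable lborel g" and w: "weak_grad U \<phi> g"
  and \<eta>: "\<eta> \<in> test_functions UNIV" and sub: "\<And>y w. y \<in> K ==> w \<in> supp \<eta> ==> c *R y + w \<in> U"
 shows "continuous_on K (moll c \<eta> \<phi>)" "is_C1_gradient K (moll c \<eta> \<phi>) (\<lambda>y. c *R moll c \<eta> g y)"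
proof -
 note sm = test_function_smooth[OF \<eta>]
 obtain B where B: "\<And>x. \<bar>\<eta> x\<bar> \<le> B" using uniformly_continuous_compact_support(2)[OF sm(1) sm(6) sm(4)] by auto
 have uc: "uniformly_continuous_on UNIV \<eta>" using uniformly_continuous_compact_support(1)[OF sm(1) sm(6) sm(4)] .
 have cont: "continuous_on S (moll c \<eta> k)" if "integrable lborel k" for S and k :: "'a => 'c::euclidean_space" unfolding moll_def
  by (rule continuous_on_compose2[OF convolution_continuous[OF _ that uc B], of S "\<lambda>y. c *R y"]) (auto intro!: continuous_intros)
 show "continuous_on K (moll c \<eta> \<phi>)" by (rule cont[OF \<phi>])
 show "is_C1_gradient K (moll c \<eta> \<phi>) (\<lambda>y. c *R moll c \<eta> g y)" unfolding is_C1_gradient_def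
 proof (intro conjI ballI)
  show "continuous_on K (\<lambda>y. c *R moll c \<eta> g y)" by (intro continuous_intros cont g)
  fix y assume "y \<in> interior K"
  then have y: "y \<in> K" using interior_subset by auto
  let ?u = "c *R y"
  have t: "(\<lambda>z. \<eta> (z - ?u)) \<in> test_functions U" using sub[OF y] by (intro test_function_translate[OF \<eta>]) auto
  have gr: "gradient (\<lambda>z. \<eta> (z - ?u)) x = gradient \<eta> (x - ?u)" for x
  proof (rule gradient_eq[OF gradient_translate])
   show "\<eta> differentiable at (x - ?u)" using sm(3)[of "x - ?u"] by (auto simp: gderiv_def differentiable_def)
  qed
  have "- (LBINT z. \<phi> z *R gradient \<eta> (z - ?u)) = moll c \<eta> g y" using w t unfolding weak_grad_def moll_def by (auto simp: gr)
  then have "((\<lambda>u. \<integral>z. \<eta> (z - u) *R \<phi> z \<partial>lborel) has_derivative (\<lambda>h. h \<bullet> moll c \<eta> g y)) (at ?u)"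
   using convolution_gradient[OF \<phi> \<eta>, of ?u] by (simp add: gderiv_def)
  moreover have "((\<lambda>y. c *R y) has_derivative (\<lambda>h. c *R h)) (at y)" by (auto intro!: derivative_eq_intros)
  ultimately have "((\<lambda>u. \<integral>z. \<eta> (z - u) *R \<phi> z \<partial>lborel) \<circ> (\<lambda>y. c *R y) has_derivative (\<lambda>h. h \<bullet> moll c \<eta> g y) \<circ> (\<lambda>h. c *R h)) (at y)"
   by (intro diff_chain_at)
  then show "GDERIV (moll c \<eta> \<phi>) y :> c *R moll c \<eta> g y" by (simp add: gderiv_def o_def moll_def[abs_def])
 qed
qed

section \<open>Mollifiers: bounds in L^p and convergence in L^1\<close>

definition mollifier :: "real => ('a::euclidean_space => real) => bool" where
 "mollifier d \<eta> \<longleftrightarrow> \<eta> \<in> test_functions UNIV \<and> (\<forall>x. 0 \<le> \<eta> x) \<and> (LBINT x. \<eta> x) = 1 \<and> supp \<eta> \<subseteq> ball 0 d"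

lemma mollifierD:
 assumes "mollifier d \<eta>"
 shows "\<eta> \<in> test_functions UNIV" "0 \<le> \<eta> x" "\<eta> \<in> \<B>" "integrable lborel \<eta>"
  "(LBINT x. \<eta> x) = 1" "(\<integral>\<^sup>+x. ennreal (\<eta> x) \<partial>lborel) = 1" "\<eta> x \<noteq> 0 ==> norm x < d" "\<exists>B>0. \<forall>x. \<bar>\<eta> x\<bar> \<le> B"
  "uniformly_continuous_on UNIV \<eta>"
proof -
 show t: "\<eta> \<in> test_functions UNIV" and one: "(LBINT x. \<eta> x) = 1" using assms by (auto simp: mollifier_def)
 show nn: "0 \<le> \<eta> x" for x using assms by (auto simp: mollifier_def)
 note sm = test_function_smooth[OF t]
 show [measurable]: "\<eta> \<in> \<B>" using sm(1) by (rule borel_measurable_continuous_onI)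
 show i: "integrable lborel \<eta>" using one not_integrable_integral_eq[of lborel \<eta>] by auto
 show "(\<integral>\<^sup>+x. ennreal (\<eta> x) \<partial>lborel) = 1" using nn_integral_eq_integral[OF i] nn one by auto
 show "norm x < d" if "\<eta> x \<noteq> 0"
 proof -
  have "x \<in> supp \<eta>" using sm(4) that by blast
  then have "x \<in> ball 0 d" using assms by (auto simp: mollifier_def)
  then show ?thesis by simp
 qed
 show "\<exists>B>0. \<forall>x. \<bar>\<eta> x\<bar> \<le> B" using uniformly_continuous_compact_support(2)[OF sm(1) sm(6) sm(4)] by auto
 show "uniformly_continuous_on UNIV \<eta>" using uniformly_continuous_compact_support(1)[OF sm(1) sm(6) sm(4)] .
qed

text \<open>\<eta> is a probability density; writing it as \<eta>^(1/p) \<eta>^(1/q) turns Hoelder's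
  inequality into Jensen's inequality at each point. Integrating in y first then gives the Jacobian
  |c|^(-d).\<close>

lemma moll_jensen:
 fixes g :: "'a::euclidean_space => 'b::euclidean_space"
 assumes pq: "1 < p" "1 < q" "1 / p + 1 / q = 1"
  and \<eta>: "mollifier d \<eta>" and g: "integrable lborel g" and c: "c \<noteq> 0"
 shows "(\<integral>\<^sup>+y. ennreal (norm (moll c \<eta> g y) powr p) \<partial>lborel) \<le> ennreal (1 / \<bar>c\<bar> ^ DIM('a)) * (\<integral>\<^sup>+z. ennreal (norm (g z) powr p) \<partial>lborel)"
proof -
 note m = mollifierD[OF \<eta>]
 note m(3)[measurable]
 have [measurable]: "g \<in> \<B>" using g by auto
 obtain B where B: "\<And>x. \<bar>\<eta> x\<bar> \<le> B" using m(8) by blast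
 have pt: "ennreal (norm (moll c \<eta> g y) powr p) \<le> (\<integral>\<^sup>+z. ennreal (\<eta> (z - c *R y)) * ennreal (norm (g z) powr p) \<partial>lborel)" for y
 proof -
  let ?u = "c *R y"
  let ?I = "\<integral>\<^sup>+z. ennreal (\<eta> (z - ?u)) * ennreal (norm (g z) powr p) \<partial>lborel"
  have i: "integrable lborel (\<lambda>z. \<eta> (z - ?u) *R g z)" by (rule integrable_scaled_bounded[OF g _ B]) simp
  \<comment> \<open>Stated for a positive bound A because Hoelder's inequality is; the integral
    itself may vanish, hence the application with a + e.\<close>
  have key: "ennreal (norm (moll c \<eta> g y) powr p) \<le> ennreal A" if A: "0 < A" "?I \<le> ennreal A" for A
  proof -
   have one: "(\<integral>\<^sup>+z. ennreal (\<eta> (z - ?u)) \<partial>lborel) = 1"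
    using nn_integral_affine[of 1 "\<lambda>z. ennreal (\<eta> z)" "- ?u"] m(6) by (simp add: algebra_simps)
   have "ennreal (norm (moll c \<eta> g y)) \<le> (\<integral>\<^sup>+z. ennreal (norm (\<eta> (z - ?u) *R g z)) \<partial>lborel)"
    unfolding moll_def by (rule integral_norm_bound_ennreal[OF i])
   also have "\<dots> = (\<integral>\<^sup>+z. ennreal ((\<eta> (z - ?u) powr (1/p) * norm (g z)) * \<eta> (z - ?u) powr (1/q)) \<partial>lborel)"
   proof (intro nn_integral_cong arg_cong[where f=ennreal])
    fix z
    have "\<eta> (z - ?u) powr (1/p) * \<eta> (z - ?u) powr (1/q) = \<eta> (z - ?u)" using pq m(2)[of "z - ?u"] by (simp flip: powr_add)
    then show "norm (\<eta> (z - ?u) *R g z) = (\<eta> (z - ?u) powr (1/p) * norm (g z)) * \<eta> (z - ?u) powr (1/q)"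
     using m(2)[of "z - ?u"] by (simp add: mult_ac)
   qed
   also have "\<dots> \<le> ennreal (A powr (1/p) * 1 powr (1/q))"
   proof (rule nn_integral_Holder[OF pq])
    have "(\<integral>\<^sup>+z. ennreal ((\<eta> (z - ?u) powr (1/p) * norm (g z)) powr p) \<partial>lborel) = ?I"
     using pq m(2) by (intro nn_integral_cong) (simp add: powr_mult powr_powr ennreal_mult)
    then show "(\<integral>\<^sup>+z. ennreal ((\<eta> (z - ?u) powr (1/p) * norm (g z)) powr p) \<partial>lborel) \<le> ennreal A" using A by simp
    have "(\<integral>\<^sup>+z. ennreal ((\<eta> (z - ?u) powr (1/q)) powr q) \<partial>lborel) = (\<integral>\<^sup>+z. ennreal (\<eta> (z - ?u)) \<partial>lborel)"
     using pq m(2) by (intro nn_integral_cong) (simp add: powr_powr)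
    then show "(\<integral>\<^sup>+z. ennreal ((\<eta> (z - ?u) powr (1/q)) powr q) \<partial>lborel) \<le> ennreal 1" using one by simp
   qed (use A in auto)
   finally have "norm (moll c \<eta> g y) \<le> A powr (1/p)" by simp
   then have "norm (moll c \<eta> g y) powr p \<le> (A powr (1/p)) powr p" using pq by (intro powr_mono2) auto
   then show ?thesis using A pq by (simp add: powr_powr ennreal_leI)
  qed
  show ?thesis
  proof (cases "?I = \<infinity>")
   case False
   then obtain a where a: "?I = ennreal a" "0 \<le> a" by (cases ?I) auto
   show ?thesis
   proof (rule ennreal_le_epsilon)
    fix e :: real assume "0 < e"
    then show "ennreal (norm (moll c \<eta> g y) powr p) \<le> ?I + ennreal e" using key[of "a + e"] a by (simp add: ennreal_leI)
   qed
  qed simp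
 qed
 have "(\<integral>\<^sup>+y. ennreal (norm (moll c \<eta> g y) powr p) \<partial>lborel)
   \<le> (\<integral>\<^sup>+y. \<integral>\<^sup>+z. ennreal (\<eta> (z - c *R y)) * ennreal (norm (g z) powr p) \<partial>lborel \<partial>lborel)"
  by (intro nn_integral_mono pt)
 also have "\<dots> = (\<integral>\<^sup>+z. \<integral>\<^sup>+y. ennreal (\<eta> (z - c *R y)) * ennreal (norm (g z) powr p) \<partial>lborel \<partial>lborel)"
  by (rule lborel_pair.Fubini') measurable
 also have "\<dots> = (\<integral>\<^sup>+z. ennreal (1 / \<bar>c\<bar> ^ DIM('a)) * ennreal (norm (g z) powr p) \<partial>lborel)"
 proof (rule nn_integral_cong)
  fix z
  have "(\<integral>\<^sup>+y. ennreal (\<eta> (z - c *R y)) * ennreal (norm (g z) powr p) \<partial>lborel)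
    = (\<integral>\<^sup>+y. ennreal (\<eta> (z + (- c) *R y)) \<partial>lborel) * ennreal (norm (g z) powr p)" by (subst nn_integral_multc) auto
  also have "(\<integral>\<^sup>+y. ennreal (\<eta> (z + (- c) *R y)) \<partial>lborel) = ennreal (1 / \<bar>c\<bar> ^ DIM('a))"
   using nn_integral_affine[of "- c" "\<lambda>z. ennreal (\<eta> z)" z] c m(6) by simp
  finally show "(\<integral>\<^sup>+y. ennreal (\<eta> (z - c *R y)) * ennreal (norm (g z) powr p) \<partial>lborel)
   = ennreal (1 / \<bar>c\<bar> ^ DIM('a)) * ennreal (norm (g z) powr p)" .
 qed
 also have "\<dots> = ennreal (1 / \<bar>c\<bar> ^ DIM('a)) * (\<integral>\<^sup>+z. ennreal (norm (g z) powr p) \<partial>lborel)"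
  by (rule nn_integral_cmult) measurable
 finally show ?thesis .
qed

lemma cball_in_borel [measurable, simp]: "cball z r \<in> sets borel" by (simp add: borel_closed)

lemma ennreal_tendsto_0I:
 fixes f :: "nat => ennreal"
 assumes "\<And>e::real. 0 < e ==> \<forall>\<^sub>F k in sequentially. f k \<le> ennreal e"
 shows "f \<longlonglongrightarrow> 0"
proof (rule order_tendstoI)
 fix a :: ennreal assume "0 < a"
 then obtain b where b: "0 < b" "b < a" using dense by blast
 then obtain e where e: "b = ennreal e" "0 < e" by (cases b) (auto simp: ennreal_less_zero_iff)
 show "\<forall>\<^sub>F k in sequentially. f k < a" using assms[OF e(2)] by eventually_elim (use b e in auto)
qed auto

text \<open>A common approximate identity argument for the two kernels that arise, one mollifying at
  shrunken points and one shrinking fields before mollifying. Column integrals bounded by C control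
  the L^1 norm of the operator, row integrals tending to 1 reproduce constants, and concentration
  near the diagonal reproduces a continuous H close to u.\<close>

lemma kernel_L1_convergence:
 fixes u :: "'a::euclidean_space => 'b::euclidean_space" and \<kappa> :: "nat => 'a => 'a => real"
 assumes u: "integrable lborel u" "\<And>x. R < norm x ==> u x = 0"
  and km [measurable]: "\<And>k. (\<lambda>(x, y). \<kappa> k x y) \<in> borel_measurable (borel \<Otimes>\<^sub>M borel)"
  and nn: "\<And>k x y. 0 \<le> \<kappa> k x y" and bdd: "\<And>k x y. \<kappa> k x y \<le> b k"
  and col: "\<And>k y. (\<integral>\<^sup>+x. ennreal (\<kappa> k x y) \<partial>lborel) \<le> ennreal C" and C: "0 \<le> C"
  and row: "\<And>k x. norm x \<le> R' ==> integrable lborel (\<kappa> k x) \<and> (LBINT y. \<kappa> k x y) = c k" and c: "c \<longlonglongrightarrow> 1"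
  and loc: "\<And>k x y. norm x \<le> R' ==> \<kappa> k x y \<noteq> 0 ==> dist x y \<le> \<delta> k" and \<delta>: "\<delta> \<longlonglongrightarrow> 0"
 shows "(\<lambda>k. \<integral>\<^sup>+x\<in>cball 0 R'. ennreal (norm ((LBINT y. \<kappa> k x y *R u y) - u x)) \<partial>lborel) \<longlonglongrightarrow> 0"
proof (rule ennreal_tendsto_0I)
 fix e :: real assume e: "0 < e"
 have [measurable]: "u \<in> \<B>" using u(1) by auto
 have km1 [measurable]: "(\<lambda>y. \<kappa> k x y) \<in> \<B>" for k x using measurable_compose[OF measurable_Pair1' km[of k], of x] by simp
 \<comment> \<open>Large enough to contain the support of u and every point within distance 1 of the
   ball on which convergence is claimed.\<close>
 define R2 where "R2 = max R (R' + 1)"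
 let ?M = "lborel_on (cball (0::'a) R2)"
 have fM: "finite_measure ?M" by (rule finite_lborel_on) auto
 have uM: "integrable ?M u" unfolding lborel_on_def using u(1) by (subst integrable_density) (auto intro!: integrable_mult_indicator simp: mult.commute)
 define vol where "vol = measure lborel (cball (0::'a) R')"
 have vol: "0 \<le> vol" by (simp add: vol_def)
 define e1 where "e1 = e / (3 * (C + 1))"
 have e1: "0 < e1" "(C + 1) * e1 = e / 3" 
 proof -
  have "0 < C + 1" using C by simp
  then show "0 < e1" "(C + 1) * e1 = e / 3" using e by (simp_all add: e1_def divide_simps) (simp add: algebra_simps)?
 qed
 obtain H B0 where H: "continuous_on UNIV H" "\<And>x. norm (H x) \<le> B0" "(LINT x|?M. norm (H x - u x)) < e1"
  using integrable_approx_continuous[OF fM _ uM e1(1)] by auto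
 define B where "B = max B0 1"
 have B: "0 < B" "\<And>x. norm (H x) \<le> B" using H(2) by (auto simp: B_def le_max_iff_disj)
 have Hm [measurable]: "H \<in> \<B>" using H(1) by (rule borel_measurable_continuous_onI)
 \<comment> \<open>Error budget: (C + 1) e1 = e/3 covers replacing u by H under the kernel and at x.
   Since c k \<le> 2 eventually, the oscillation of H contributes at most 2 e2 and the mass defect
   e3 B, each at most e/3 after integration over the ball.\<close>
 define e2 where "e2 = e / (6 * (vol + 1))"
 define e3 where "e3 = e / (3 * (vol + 1) * B)"
 have e23: "0 < e2" "0 < e3" using e vol B by (auto simp: e2_def e3_def)
 have "uniformly_continuous_on (cball 0 R2) H" by (intro compact_uniformly_continuous continuous_on_subset[OF H(1)]) auto
 then obtain d where d: "0 < d" "\<And>x y. x \<in> cball 0 R2 ==> y \<in> cball 0 R2 ==> dist x y < d ==> dist (H x) (H y) < e2"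
  using e23(1) unfolding uniformly_continuous_on_def by metis
 have "\<forall>\<^sub>F k in sequentially. \<delta> k < min 1 d" using \<delta> d by (intro order_tendstoD) auto
 moreover have "\<forall>\<^sub>F k in sequentially. \<bar>c k - 1\<bar> < min 1 e3" using tendstoD[OF c, of "min 1 e3"] e23 by (simp add: dist_real_def)
 ultimately show "\<forall>\<^sub>F k in sequentially. (\<integral>\<^sup>+x\<in>cball 0 R'. ennreal (norm ((LBINT y. \<kappa> k x y *R u y) - u x)) \<partial>lborel) \<le> ennreal e"
 proof eventually_elim
  fix k assume dk: "\<delta> k < min 1 d" and ck: "\<bar>c k - 1\<bar> < min 1 e3"
  define w where "w y = indicat_real (cball 0 R2) y * norm (H y - u y)" for y
  have w0: "0 \<le> w y" for y by (simp add: w_def)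
  have wm [measurable]: "w \<in> \<B>" unfolding w_def[abs_def] by measurable
  have wi: "(\<integral>\<^sup>+y. ennreal (w y) \<partial>lborel) \<le> ennreal e1"
  proof -
   have HM: "integrable ?M (\<lambda>x. norm (H x - u x))" using uM integrable_bounded_borel[OF fM _ Hm B(2)] by auto
   have "(\<integral>\<^sup>+y. ennreal (w y) \<partial>lborel) = (\<integral>\<^sup>+y. ennreal (norm (H y - u y)) \<partial>?M)"
    by (subst nn_integral_lborel_on) (auto simp: w_def indicator_def intro!: nn_integral_cong)
   also have "\<dots> = ennreal (LINT y|?M. norm (H y - u y))" by (rule nn_integral_eq_integral[OF HM]) auto
   also have "\<dots> \<le> ennreal e1" using H(3) by (intro ennreal_leI) auto
   finally show ?thesis .
  qed
  define K0 where "K0 = c k * e2 + \<bar>c k - 1\<bar> * B"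
  have ck0: "0 \<le> c k" "c k \<le> 2" using ck by auto
  have K00: "0 \<le> K0" using ck0 e23 B by (simp add: K0_def)
  have pt: "ennreal (norm ((LBINT y. \<kappa> k x y *R u y) - u x))
    \<le> (\<integral>\<^sup>+y. ennreal (\<kappa> k x y) * ennreal (w y) \<partial>lborel) + (ennreal K0 + ennreal (w x))" if x: "norm x \<le> R'" for x
  proof -
   have near: "y \<in> cball 0 R2 \<and> dist (H y) (H x) < e2" if "\<kappa> k x y \<noteq> 0" for y
   proof -
    have xy: "dist x y < min 1 d" using loc[OF x that] dk by simp
    have "norm y \<le> norm x + dist x y" using norm_triangle_ineq2[of y x] by (simp add: dist_norm norm_minus_commute)
    then have "y \<in> cball 0 R2" "x \<in> cball 0 R2" using x xy by (auto simp: R2_def)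
    then show ?thesis using d(2)[of y x] xy by (simp add: dist_commute)
   qed
   have iu: "integrable lborel (\<lambda>y. \<kappa> k x y *R u y)"
    by (rule integrable_scaled_bounded[OF u(1), where B="b k"]) (use nn bdd in \<open>auto simp: abs_le_iff intro: order_trans[OF _ nn]\<close>)
   have ik: "integrable lborel (\<kappa> k x)" "(LBINT y. \<kappa> k x y) = c k" using row[OF x] by auto
   have iH: "integrable lborel (\<lambda>y. \<kappa> k x y *R H y)"
   proof (rule Bochner_Integration.integrable_bound)
    show "integrable lborel (\<lambda>y. B * \<kappa> k x y)" using ik by simp
    show "AE y in lborel. norm (\<kappa> k x y *R H y) \<le> norm (B * \<kappa> k x y)"
     using B nn by (intro AE_I2) (auto simp: abs_mult mult.commute[of _ "\<kappa> k x _"] intro!: mult_left_mono)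
   qed simp
   have iHx: "integrable lborel (\<lambda>y. \<kappa> k x y *R H x)" using ik by simp
   \<comment> \<open>Four errors: approximation of u under the kernel, oscillation of H, defect of
     the row integral from 1, and approximation of u at x.\<close>
   have eq: "(LBINT y. \<kappa> k x y *R u y) - u x = (LBINT y. \<kappa> k x y *R (u y - H y))
     + (LBINT y. \<kappa> k x y *R (H y - H x)) + (c k - 1) *R H x + (H x - u x)" using iu iH iHx ik by (simp add: scaleR_diff_right scaleR_diff_left)
   have t1: "ennreal (norm (LBINT y. \<kappa> k x y *R (u y - H y))) \<le> (\<integral>\<^sup>+y. ennreal (\<kappa> k x y) * ennreal (w y) \<partial>lborel)"
   proof -
    have "ennreal (norm (LBINT y. \<kappa> k x y *R (u y - H y))) \<le> (\<integral>\<^sup>+y. ennreal (norm (\<kappa> k x y *R (u y - H y))) \<partial>lborel)"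
     using iu iH by (intro integral_norm_bound_ennreal) (simp add: scaleR_diff_right)
    also have "\<dots> = (\<integral>\<^sup>+y. ennreal (\<kappa> k x y) * ennreal (w y) \<partial>lborel)"
    proof (rule nn_integral_cong)
     fix y
     have "norm (\<kappa> k x y *R (u y - H y)) = \<kappa> k x y * w y"
      using near[of y] nn[of k x y] by (cases "\<kappa> k x y = 0") (auto simp: w_def norm_minus_commute)
     then show "ennreal (norm (\<kappa> k x y *R (u y - H y))) = ennreal (\<kappa> k x y) * ennreal (w y)" by (simp only: ennreal_mult[OF nn w0])
    qed
    finally show ?thesis .
   qed
   have t2: "norm (LBINT y. \<kappa> k x y *R (H y - H x)) \<le> c k * e2"
   proof -
    have "norm (LBINT y. \<kappa> k x y *R (H y - H x)) \<le> (LBINT y. \<kappa> k x y * e2)"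
    proof (rule Bochner_Integration.integral_norm_bound_integral)
     show "integrable lborel (\<lambda>y. \<kappa> k x y *R (H y - H x))" using iH iHx by (simp add: scaleR_diff_right)
     fix y show "norm (\<kappa> k x y *R (H y - H x)) \<le> \<kappa> k x y * e2"
      using near[of y] nn[of k x y] by (cases "\<kappa> k x y = 0") (auto simp: dist_norm intro!: mult_left_mono less_imp_le)
    qed (use ik in simp)
    then show ?thesis using ik by simp
   qed
   have t3: "norm ((c k - 1) *R H x) \<le> \<bar>c k - 1\<bar> * B" using B by (auto intro!: mult_left_mono)
   have xR2: "x \<in> cball 0 R2" using x by (auto simp: R2_def)
   have "norm ((LBINT y. \<kappa> k x y *R u y) - u x) \<le> norm (LBINT y. \<kappa> k x y *R (u y - H y)) + (K0 + w x)" unfolding eq using t2 t3 xR2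
     norm_triangle_ineq[of "(LBINT y. \<kappa> k x y *R (u y - H y)) + (LBINT y. \<kappa> k x y *R (H y - H x)) + (c k - 1) *R H x" "H x - u x"]
     norm_triangle_ineq[of "(LBINT y. \<kappa> k x y *R (u y - H y)) + (LBINT y. \<kappa> k x y *R (H y - H x))" "(c k - 1) *R H x"]
     norm_triangle_ineq[of "\<integral>y. \<kappa> k x y *R (u y - H y) \<partial>lborel" "\<integral>y. \<kappa> k x y *R (H y - H x) \<partial>lborel"]
    by (simp add: K0_def w_def)
   then have "ennreal (norm ((LBINT y. \<kappa> k x y *R u y) - u x))
     \<le> ennreal (norm (LBINT y. \<kappa> k x y *R (u y - H y)) + (K0 + w x))" by (rule ennreal_leI)
   also have "\<dots> = ennreal (norm (LBINT y. \<kappa> k x y *R (u y - H y))) + (ennreal K0 + ennreal (w x))" using K00 w0 by simp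
   finally show ?thesis using add_right_mono[OF t1] by (rule order_trans)
  qed
  have "(\<integral>\<^sup>+x\<in>cball 0 R'. ennreal (norm ((LBINT y. \<kappa> k x y *R u y) - u x)) \<partial>lborel)
    \<le> (\<integral>\<^sup>+x. (\<integral>\<^sup>+y. ennreal (\<kappa> k x y) * ennreal (w y) \<partial>lborel) + (ennreal K0 * indicator (cball 0 R') x + ennreal (w x)) \<partial>lborel)"
  proof (rule nn_integral_mono)
   fix x
   show "ennreal (norm ((LBINT y. \<kappa> k x y *R u y) - u x)) * indicator (cball 0 R') x
    \<le> (\<integral>\<^sup>+y. ennreal (\<kappa> k x y) * ennreal (w y) \<partial>lborel) + (ennreal K0 * indicator (cball 0 R') x + ennreal (w x))"
    using pt[of x] by (cases "x \<in> cball 0 R'") (auto simp: indicator_def)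
  qed
  also have "\<dots> = (\<integral>\<^sup>+x. \<integral>\<^sup>+y. ennreal (\<kappa> k x y) * ennreal (w y) \<partial>lborel \<partial>lborel) + (ennreal K0 * emeasure lborel (cball (0::'a) R') + (\<integral>\<^sup>+x. ennreal (w x) \<partial>lborel))"
   by (simp add: nn_integral_add nn_integral_cmult_indicator)
  also have "(\<integral>\<^sup>+x. \<integral>\<^sup>+y. ennreal (\<kappa> k x y) * ennreal (w y) \<partial>lborel \<partial>lborel) \<le> ennreal C * ennreal e1"
  proof -
   have "(\<integral>\<^sup>+x. \<integral>\<^sup>+y. ennreal (\<kappa> k x y) * ennreal (w y) \<partial>lborel \<partial>lborel) = (\<integral>\<^sup>+y. \<integral>\<^sup>+x. ennreal (\<kappa> k x y) * ennreal (w y) \<partial>lborel \<partial>lborel)"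
    by (rule lborel_pair.Fubini'[symmetric]) simp
   also have "\<dots> = (\<integral>\<^sup>+y. (\<integral>\<^sup>+x. ennreal (\<kappa> k x y) \<partial>lborel) * ennreal (w y) \<partial>lborel)"
    by (intro nn_integral_cong nn_integral_multc) simp
   also have "\<dots> \<le> (\<integral>\<^sup>+y. ennreal C * ennreal (w y) \<partial>lborel)" by (intro nn_integral_mono mult_right_mono col) auto
   also have "\<dots> = ennreal C * (\<integral>\<^sup>+y. ennreal (w y) \<partial>lborel)" by (rule nn_integral_cmult) simp
   also have "\<dots> \<le> ennreal C * ennreal e1" using wi by (intro mult_left_mono) auto
   finally show ?thesis .
  qed
  also have "emeasure lborel (cball (0::'a) R') = ennreal vol"
   unfolding vol_def by (intro emeasure_eq_ennreal_measure) (metis emeasure_lborel_cball_finite less_irrefl infinity_ennreal_def)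
  also have "ennreal C * ennreal e1 + (ennreal K0 * ennreal vol + (\<integral>\<^sup>+x. ennreal (w x) \<partial>lborel))
    \<le> ennreal C * ennreal e1 + (ennreal K0 * ennreal vol + ennreal e1)" using wi by (intro add_left_mono) auto
  also have "\<dots> = ennreal (C * e1 + (K0 * vol + e1))" using C e1 K00 vol by (simp add: ennreal_mult)
  also have "\<dots> \<le> ennreal e"
  proof (rule ennreal_leI)
   have "K0 \<le> 2 * e2 + e3 * B" unfolding K0_def using ck ck0 e23 B by (intro add_mono mult_right_mono) auto
   then have "K0 * vol \<le> (2 * e2 + e3 * B) * (vol + 1)" using vol K00 e23 B by (intro mult_mono) auto
   also have "\<dots> = 2 * (e2 * (vol + 1)) + e3 * B * (vol + 1)" by (simp add: algebra_simps)
   also have "e2 * (vol + 1) = e / 6"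
   proof -
    have "vol + 1 \<noteq> 0" using vol by simp
    then show ?thesis unfolding e2_def by (simp add: divide_simps) (simp add: algebra_simps)?
   qed
   also have "e3 * B * (vol + 1) = e / 3"
   proof -
    have "(vol + 1) * B \<noteq> 0" using vol B by simp
    moreover have "e3 * B * (vol + 1) = e * ((vol + 1) * B) / (3 * ((vol + 1) * B))" by (simp add: e3_def mult_ac)
    ultimately show ?thesis by simp
   qed
   finally have "K0 * vol \<le> 2 * e / 3" by simp
   then show "C * e1 + (K0 * vol + e1) \<le> e" using e1(2) by (simp add: algebra_simps)
  qed
  finally show "(\<integral>\<^sup>+x\<in>cball 0 R'. ennreal (norm ((LBINT y. \<kappa> k x y *R u y) - u x)) \<partial>lborel) \<le> ennreal e"
   by (simp add: add_right_mono)
 qed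
qed

lemma mollifier_translate:
 assumes "mollifier d \<eta>"
 shows "integrable lborel (\<lambda>y. \<eta> (y - u))" "(LBINT y. \<eta> (y - u)) = 1"
proof -
 note m = mollifierD[OF assms]
 note m(3)[measurable]
 have d: "distr lborel borel ((+) (- u)) = (lborel :: 'a measure)" by (rule lborel_distr_plus)
 have "integrable (distr lborel borel ((+) (- u))) \<eta>" unfolding d by (rule m)
 then show "integrable lborel (\<lambda>y. \<eta> (y - u))" by (subst (asm) integrable_distr_eq) (auto simp: algebra_simps)
 have "(LINT y|distr lborel borel ((+) (- u)). \<eta> y) = (LBINT y. \<eta> (y - u))" by (subst integral_distr) (auto simp: algebra_simps)
 then show "(LBINT y. \<eta> (y - u)) = 1" unfolding d using m by simp
qed

text \<open>For the kernel \<eta> (y - c x) the rows integrate to 1 and the columns to c^(-d), which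
  c \<ge> 1/2 bounds by 2^d.\<close>

lemma moll_L1_convergence:
 fixes g :: "'a::euclidean_space => 'b::euclidean_space"
 assumes g: "integrable lborel g" "\<And>x. R < norm x ==> g x = 0" and R': "0 \<le> R'"
  and c: "\<And>k. 1/2 \<le> c k" "\<And>k. c k \<le> 1" "c \<longlonglongrightarrow> 1"
  and \<eta>: "\<And>k. mollifier (d k) (\<eta> k)" and d: "d \<longlonglongrightarrow> 0"
 shows "(\<lambda>k. \<integral>\<^sup>+x\<in>cball 0 R'. ennreal (norm (moll (c k) (\<eta> k) g x - g x)) \<partial>lborel) \<longlonglongrightarrow> 0"
proof -
 have [measurable]: "\<eta> k \<in> \<B>" for k by (rule mollifierD[OF \<eta>])
 obtain b where b: "\<And>k x. \<bar>\<eta> k x\<bar> \<le> b k" using mollifierD(8)[OF \<eta>] by metis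
 show ?thesis unfolding moll_def
 proof (rule kernel_L1_convergence[where \<kappa>="\<lambda>k x y. \<eta> k (y - c k *R x)" and R=R and b=b and C="2 ^ DIM('a)" and c="\<lambda>_. 1"
    and \<delta>="\<lambda>k. d k + (1 - c k) * R'"])
  show "(\<integral>\<^sup>+x. ennreal (\<eta> k (y - c k *R x)) \<partial>lborel) \<le> ennreal (2 ^ DIM('a))" for k y
  proof -
   have "(\<integral>\<^sup>+x. ennreal (\<eta> k (y - c k *R x)) \<partial>lborel) = ennreal (1 / c k ^ DIM('a))"
    using nn_integral_affine[of "- c k" "\<lambda>z. ennreal (\<eta> k z)" y] c(1)[of k] mollifierD(6)[OF \<eta>[of k]] by simp
   moreover have "1 / c k ^ DIM('a) \<le> 2 ^ DIM('a)"
   proof -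
    have "1 \<le> (2 * c k) ^ DIM('a)" using c(1)[of k] by (intro one_le_power) auto
    then show ?thesis using c(1)[of k] by (simp add: power_mult_distrib field_simps)
   qed
   ultimately show ?thesis by (simp add: ennreal_leI)
  qed
  show "integrable lborel (\<lambda>y. \<eta> k (y - c k *R x)) \<and> (LBINT y. \<eta> k (y - c k *R x)) = 1" for k x
   using mollifier_translate[OF \<eta>] by simp
  show "dist x y \<le> d k + (1 - c k) * R'" if "norm x \<le> R'" "\<eta> k (y - c k *R x) \<noteq> 0" for k x y
  proof -
   have "norm (y - c k *R x) < d k" using mollifierD(7)[OF \<eta> that(2)] .
   moreover have "x - y = (1 - c k) *R x - (y - c k *R x)" by (simp add: algebra_simps)
   then have "dist x y \<le> norm ((1 - c k) *R x) + norm (y - c k *R x)" by (simp only: dist_norm norm_triangle_ineq4)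
   moreover have "norm ((1 - c k) *R x) \<le> (1 - c k) * R'" using c(2)[of k] that(1) by (simp add: mult_left_mono)
   ultimately show ?thesis by linarith
  qed
  have "(\<lambda>k. d k + (1 - c k) * R') \<longlonglongrightarrow> 0 + (1 - 1) * R'" by (intro tendsto_intros d c)
  then show "(\<lambda>k. d k + (1 - c k) * R') \<longlonglongrightarrow> 0" by simp
 qed (use g b mollifierD(2)[OF \<eta>] in \<open>auto intro: order_trans[OF abs_ge_self b]\<close>)
qed

text \<open>The adjoint of g -> \<open>c *R moll c \<eta> g\<close>: the field is pushed forward by
  the contraction y -> c y and then mollified. The factor c is the derivative of the contraction,
  with which a push-forward of fields maps divergence to the push-forward of the divergence.\<close>

definition smoll :: "real => ('a => real) => ('a => 'b) => 'a::euclidean_space => 'b::euclidean_space" where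
 "smoll c \<eta> v x = (LBINT y. (c * \<eta> (x - c *R y)) *R v y)"

text \<open>For the kernel c \<eta> (x - c y) the columns integrate to c \<le> 1 and the rows to
  c^(1-d), which tends to 1 but is not 1: this is why \<open>kernel_L1_convergence\<close> admits a
  varying row integral.\<close>

lemma smoll_L1_convergence:
 fixes v :: "'a::euclidean_space => 'b::euclidean_space"
 assumes v: "integrable lborel v" "\<And>x. R < norm x ==> v x = 0" and R': "0 \<le> R'"
  and c: "\<And>k. 1/2 \<le> c k" "\<And>k. c k \<le> 1" "c \<longlonglongrightarrow> 1"
  and \<eta>: "\<And>k. mollifier (d k) (\<eta> k)" and d: "d \<longlonglongrightarrow> 0" "\<And>k. d k \<le> 1"
 shows "(\<lambda>k. \<integral>\<^sup>+x\<in>cball 0 R'. ennreal (norm (smoll (c k) (\<eta> k) v x - v x)) \<partial>lborel) \<longlonglongrightarrow> 0"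
proof -
 have [measurable]: "\<eta> k \<in> \<B>" for k by (rule mollifierD[OF \<eta>])
 obtain b where b: "\<And>k x. \<bar>\<eta> k x\<bar> \<le> b k" using mollifierD(8)[OF \<eta>] by metis
 have c0: "0 < c k" for k using c(1)[of k] by linarith
 have nn: "0 \<le> c k * \<eta> k z" for k z using c0[of k] mollifierD(2)[OF \<eta>[of k]] by simp
 have row: "(\<integral>\<^sup>+y. ennreal (c k * \<eta> k (x - c k *R y)) \<partial>lborel) = ennreal (c k / c k ^ DIM('a))" for k x
 proof -
  have "(\<integral>\<^sup>+y. ennreal (c k * \<eta> k (x - c k *R y)) \<partial>lborel) = ennreal (c k) * (\<integral>\<^sup>+y. ennreal (\<eta> k (x - c k *R y)) \<partial>lborel)"
   using c0[of k] mollifierD(2)[OF \<eta>[of k]] by (subst nn_integral_cmult[symmetric]) (auto simp: ennreal_mult)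
  also have "(\<integral>\<^sup>+y. ennreal (\<eta> k (x - c k *R y)) \<partial>lborel) = ennreal (1 / c k ^ DIM('a))"
   using nn_integral_affine[of "- c k" "\<lambda>z. ennreal (\<eta> k z)" x] c0[of k] mollifierD(6)[OF \<eta>[of k]] by simp
  finally show ?thesis using c0[of k] by (simp flip: ennreal_mult)
 qed
 show ?thesis unfolding smoll_def
 proof (rule kernel_L1_convergence[where \<kappa>="\<lambda>k x y. c k * \<eta> k (x - c k *R y)" and R=R and b=b and C=1
    and c="\<lambda>k. c k / c k ^ DIM('a)" and \<delta>="\<lambda>k. d k + (1 - c k) * (2 * (R' + 1))"])
  show "(\<integral>\<^sup>+x. ennreal (c k * \<eta> k (x - c k *R y)) \<partial>lborel) \<le> ennreal 1" for k y
  proof -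
   have "(\<integral>\<^sup>+x. ennreal (c k * \<eta> k (x - c k *R y)) \<partial>lborel) = ennreal (c k) * (\<integral>\<^sup>+x. ennreal (\<eta> k (- (c k *R y) + 1 *R x)) \<partial>lborel)"
    using c0[of k] mollifierD(2)[OF \<eta>[of k]] by (subst nn_integral_cmult[symmetric]) (auto simp: ennreal_mult)
   also have "(\<integral>\<^sup>+x. ennreal (\<eta> k (- (c k *R y) + 1 *R x)) \<partial>lborel) = 1"
    using nn_integral_affine[of 1 "\<lambda>z. ennreal (\<eta> k z)" "- (c k *R y)"] mollifierD(6)[OF \<eta>[of k]] by simp
   finally show ?thesis using c(2)[of k] by (simp add: ennreal_leI)
  qed
  show "integrable lborel (\<lambda>y. c k * \<eta> k (x - c k *R y)) \<and> (LBINT y. c k * \<eta> k (x - c k *R y)) = c k / c k ^ DIM('a)" for k x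
  proof
   show "integrable lborel (\<lambda>y. c k * \<eta> k (x - c k *R y))" using row[of k x] nn by (intro integrableI_nonneg) auto
   show "(LBINT y. c k * \<eta> k (x - c k *R y)) = c k / c k ^ DIM('a)" using row[of k x] nn c0[of k] by (subst integral_eq_nn_integral) auto
  qed
  show "dist x y \<le> d k + (1 - c k) * (2 * (R' + 1))" if "norm x \<le> R'" "c k * \<eta> k (x - c k *R y) \<noteq> 0" for k x y
  proof -
   have a: "norm (x - c k *R y) < d k" using mollifierD(7)[OF \<eta>, of k "x - c k *R y"] that(2) by auto
   \<comment> \<open>Rows are located by x, but the displacement (1 - c) y involves y. From c \<ge>
     1/2 and a mollifier radius of at most 1 one gets |y| \<le> 2 (R' + 1).\<close>
   have "norm (c k *R y) \<le> norm x + norm (x - c k *R y)" using norm_triangle_ineq4[of x "x - c k *R y"] by simp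
   then have "c k * norm y \<le> R' + 1" using a d(2)[of k] that(1) c0[of k] by simp
   moreover have "norm y / 2 \<le> c k * norm y" using c(1)[of k] mult_right_mono[of "1/2" "c k" "norm y"] by simp
   ultimately have "norm y / 2 \<le> R' + 1" by (rule order_trans[rotated])
   then have "norm y \<le> 2 * (R' + 1)" by simp
   then have "norm ((1 - c k) *R y) \<le> (1 - c k) * (2 * (R' + 1))" using c(2)[of k] by (simp add: mult_left_mono)
   moreover have "x - y = (x - c k *R y) - (1 - c k) *R y" by (simp add: algebra_simps)
   then have "dist x y \<le> norm (x - c k *R y) + norm ((1 - c k) *R y)" by (simp only: dist_norm norm_triangle_ineq4)
   ultimately show ?thesis using a by linarith
  qed
  have "(\<lambda>k. d k + (1 - c k) * (2 * (R' + 1))) \<longlonglongrightarrow> 0 + (1 - 1) * (2 * (R' + 1))" by (intro tendsto_intros d c)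
  then show "(\<lambda>k. d k + (1 - c k) * (2 * (R' + 1))) \<longlonglongrightarrow> 0" by simp
  have "(\<lambda>k. c k / c k ^ DIM('a)) \<longlonglongrightarrow> 1 / 1 ^ DIM('a)" by (intro tendsto_intros c) auto
  then show "(\<lambda>k. c k / c k ^ DIM('a)) \<longlonglongrightarrow> 1" by simp
  show "c k * \<eta> k (x - c k *R y) \<le> b k" for k x y
  proof -
   have "c k * \<eta> k (x - c k *R y) \<le> 1 * \<eta> k (x - c k *R y)" using c(2)[of k] mollifierD(2)[OF \<eta>[of k]] by (intro mult_right_mono) auto
   then show ?thesis using b[of k "x - c k *R y"] by linarith
  qed
 qed (use v nn in auto)
qed

section \<open>The fundamental lemma; classical gradients are weak gradients\<close>

lemma compact_neighbourhood:
 fixes C :: "'a::euclidean_space set"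
 assumes "compact C" "open U" "C \<subseteq> U"
 obtains e C' where "0 < e" "compact C'" "C' \<subseteq> U" "\<And>x y. x \<in> C ==> dist x y \<le> e ==> y \<in> C'"
proof (cases "C = {}")
 case True then show ?thesis using that[of 1 "{}"] by auto
next
 case False
 obtain e where e: "0 < e" "{x. infdist x C \<le> e} \<subseteq> U" using compact_in_open_separated[OF False assms] by blast
 show ?thesis
 proof (rule that[of e "{x. infdist x C \<le> e}"])
  show "compact {x. infdist x C \<le> e}" by (rule compact_infdist_le[OF False assms(1) e(1)])
  show "y \<in> {x. infdist x C \<le> e}" if "x \<in> C" "dist x y \<le> e" for x y using infdist_le2[of x C y e] that by (simp add: dist_commute)
 qed (use e in auto)
qed

text \<open>At a point of C a mollification of h is an integral against a test function, hence 0,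
  while mollifications tend to h in L^1. As h is only locally integrable it is first cut off to a
  compact neighbourhood of C. The mollifiers are passed as an argument, so none have to be
  constructed.\<close>

lemma weak_zero:
 fixes h :: "'a::euclidean_space => 'b::euclidean_space" and \<eta> :: "nat => 'a => real"
 assumes U: "open U" and hm [measurable]: "h \<in> \<B>"
  and loc: "\<And>C. compact C ==> C \<subseteq> U ==> integrable lborel (\<lambda>x. indicat_real C x *R h x)"
  and z: "\<And>\<psi>. \<psi> \<in> test_functions U ==> (LBINT x. \<psi> x *R h x) = 0"
  and \<eta>: "\<And>k. mollifier (d k) (\<eta> k)" and d: "d \<longlonglongrightarrow> 0"
 shows "AE x in lborel. x \<in> U \<longrightarrow> h x = 0"
proof -
 have comp: "AE x in lborel. x \<in> C \<longrightarrow> h x = 0" if C: "compact C" "C \<subseteq> U" for C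
 proof -
  obtain e C' where e: "0 < e" "compact C'" "C' \<subseteq> U" "\<And>x y. x \<in> C ==> dist x y \<le> e ==> y \<in> C'"
   using compact_neighbourhood[OF C(1) U C(2)] by metis
  define h0 where "h0 x = indicat_real C' x *R h x" for x
  have ih: "integrable lborel h0" unfolding h0_def[abs_def] by (rule loc[OF e(2,3)])
  obtain R where R: "0 < R" "\<And>x. x \<in> C' \<union> C ==> norm x \<le> R"
   using compact_imp_bounded[OF compact_Un[OF e(2) C(1)]] bounded_pos by metis
  have h00: "h0 x = 0" if "R < norm x" for x using that R(2)[of x] by (auto simp: h0_def indicator_def)
  have lim: "(\<lambda>k. \<integral>\<^sup>+x\<in>cball 0 R. ennreal (norm (moll 1 (\<eta> k) h0 x - h0 x)) \<partial>lborel) \<longlonglongrightarrow> 0"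
   using R(1) by (intro moll_L1_convergence[OF ih h00 _ _ _ _ \<eta> d]) auto
  have [measurable]: "C \<in> sets borel" using C(1) by (rule borel_compact)
  have ev: "\<forall>\<^sub>F k in sequentially. (\<integral>\<^sup>+x\<in>C. ennreal (norm (h x)) \<partial>lborel)
    \<le> (\<integral>\<^sup>+x\<in>cball 0 R. ennreal (norm (moll 1 (\<eta> k) h0 x - h0 x)) \<partial>lborel)" using order_tendstoD(2)[OF d e(1)]
  proof eventually_elim
   fix k assume k: "d k < e"
   note m = mollifierD[OF \<eta>[of k]]
   show "(\<integral>\<^sup>+x\<in>C. ennreal (norm (h x)) \<partial>lborel)
    \<le> (\<integral>\<^sup>+x\<in>cball 0 R. ennreal (norm (moll 1 (\<eta> k) h0 x - h0 x)) \<partial>lborel)"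
   proof (rule nn_integral_mono)
    fix x
    have "moll 1 (\<eta> k) h0 x = 0 \<and> h0 x = h x \<and> x \<in> cball 0 R" if x: "x \<in> C"
    proof (intro conjI)
     have "x + w \<in> C'" if "w \<in> supp (\<eta> k)" for w
     proof -
      have "w \<in> ball 0 (d k)" using \<eta>[of k] that by (auto simp: mollifier_def)
      then show ?thesis using k by (intro e(4)[OF x]) (auto simp: dist_norm)
     qed
     then have "(\<lambda>z. \<eta> k (z - x)) \<in> test_functions U" using e(3) by (intro test_function_translate[OF m(1)]) auto
     then have "(LBINT z. \<eta> k (z - x) *R h z) = 0" by (rule z)
     moreover have "(\<lambda>z. \<eta> k (z - x) *R h0 z) = (\<lambda>z. \<eta> k (z - x) *R h z)"
     proof
      fix z show "\<eta> k (z - x) *R h0 z = \<eta> k (z - x) *R h z"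
      proof (cases "\<eta> k (z - x) = 0")
      case False
      then have "norm (z - x) < d k" by (rule m(7))
      then have "z \<in> C'" using k by (intro e(4)[OF x]) (auto simp: dist_norm norm_minus_commute)
      then show ?thesis by (simp add: h0_def)
      qed simp
     qed
     ultimately show "moll 1 (\<eta> k) h0 x = 0" by (simp only: moll_def scaleR_one)
     have "x \<in> C'" using e(1) by (intro e(4)[OF x]) auto
     then show "h0 x = h x" by (simp add: h0_def)
     show "x \<in> cball 0 R" using R(2)[of x] x by auto
    qed
    then show "ennreal (norm (h x)) * indicator C x \<le> ennreal (norm (moll 1 (\<eta> k) h0 x - h0 x)) * indicator (cball 0 R) x" by (cases "x \<in> C") auto
   qed
  qed
  have "(\<integral>\<^sup>+x\<in>C. ennreal (norm (h x)) \<partial>lborel) \<le> 0" by (rule tendsto_lowerbound[OF lim ev]) simp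
  then have "(\<integral>\<^sup>+x. ennreal (norm (h x)) * indicator C x \<partial>lborel) = 0" by simp
  then have "AE x in lborel. ennreal (norm (h x)) * indicator C x = 0" by (subst (asm) nn_integral_0_iff_AE) auto
  then show ?thesis by eventually_elim (auto simp: indicator_def)
 qed
 obtain C :: "nat => 'a set" where C: "\<And>n. compact (C n)" "\<And>n. C n \<subseteq> U" "\<Union>(range C) = U"
  using open_Union_compact_subsets[OF U] by metis
 have "AE x in lborel. \<forall>n. x \<in> C n \<longrightarrow> h x = 0" unfolding AE_all_countable using comp C by auto
 then show ?thesis by eventually_elim (use C(3) in auto)
qed

text \<open>Integration by parts without boundary terms: u -> \<integral> \<psi>(z - u) f(z) dz is
  differentiated at 0 in two ways, on \<psi> and, after a translation of the variable, on f.\<close>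

lemma C1_weak_grad:
 fixes f :: "'a::euclidean_space => real"
 assumes K: "compact K" and f: "continuous_on K f" and G: "is_C1_gradient K f G"
 shows "weak_grad (interior K) (\<lambda>x. indicat_real (interior K) x * f x) (\<lambda>x. indicat_real (interior K) x *R G x)" unfolding weak_grad_def
proof
 fix \<psi> assume psi: "\<psi> \<in> test_functions (interior K)"
 note sm = test_function_smooth[OF psi]
 have psiU: "\<psi> \<in> test_functions UNIV" using psi by (auto simp: test_functions_def)
 have Gc: "continuous_on K G" and Gd: "\<And>z. z \<in> interior K ==> GDERIV f z :> G z" using G by (auto simp: is_C1_gradient_def)
 have S: "compact (supp \<psi>)" "supp \<psi> \<subseteq> interior K" using psi by (auto simp: test_functions_def)
 obtain e C' where e: "0 < e" "compact C'" "C' \<subseteq> interior K" "\<And>x y. x \<in> supp \<psi> ==> dist x y \<le> e ==> y \<in> C'"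
  using compact_neighbourhood[OF S(1) open_interior S(2)] by metis
 have C'K: "C' \<subseteq> K" using e(3) interior_subset by auto
 define f0 where "f0 x = indicat_real C' x *R f x" for x
 define G0 where "G0 x = indicat_real C' x *R G x" for x
 have fm [measurable]: "f0 \<in> \<B>" unfolding f0_def[abs_def]
  by (intro borel_measurable_continuous_on_indicator borel_compact e continuous_on_subset[OF f] C'K)
 have Gm [measurable]: "G0 \<in> \<B>" unfolding G0_def[abs_def]
  by (intro borel_measurable_continuous_on_indicator borel_compact e continuous_on_subset[OF Gc] C'K)
 have if0: "integrable lborel f0" unfolding f0_def[abs_def] using borel_integrable_compact[OF e(2) continuous_on_subset[OF f C'K]] by (simp add: set_integrable_def)
 have iG0: "integrable lborel G0" unfolding G0_def[abs_def] using borel_integrable_compact[OF e(2) continuous_on_subset[OF Gc C'K]] by (simp add: set_integrable_def)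
 have pm [measurable]: "\<psi> \<in> \<B>" using sm(1) by (rule borel_measurable_continuous_onI)
 obtain B where B: "\<And>x. \<bar>\<psi> x\<bar> \<le> B" using uniformly_continuous_compact_support(2)[OF sm(1) sm(6) sm(4)] by auto
 have ip: "integrable lborel \<psi>"
 proof -
  have "integrable lborel (\<lambda>x. indicat_real (supp \<psi>) x *R \<psi> x)" by (intro borel_integrable_compact S continuous_on_subset[OF sm(1)]) auto
  moreover have "(\<lambda>x. indicat_real (supp \<psi>) x *R \<psi> x) = \<psi>" using sm(4) by (intro ext) (metis indicator_simps scaleR_one scaleR_zero_left)
  ultimately show ?thesis by (simp only:)
 qed
 define I where "I = (LBINT z. norm (\<psi> z))"
 have I0: "0 \<le> I" unfolding I_def by (intro Bochner_Integration.integral_nonneg) auto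
 let ?F = "\<lambda>u. \<integral>z. \<psi> (z - u) *R f0 z \<partial>lborel" and ?D = "\<integral>z. \<psi> z *R G0 z \<partial>lborel"
 \<comment> \<open>Translation invariance of Lebesgue measure moves the shift from \<psi> to
   f.\<close>
 have F: "?F u = (LBINT z. \<psi> z * f0 (z + u))" and iF: "integrable lborel (\<lambda>z. \<psi> z * f0 (z + u))" for u
 proof -
  have d: "distr lborel borel ((+) u) = (lborel :: 'a measure)" by (rule lborel_distr_plus)
  have "?F u = (LINT z|distr lborel borel ((+) u). \<psi> (z - u) * f0 z)" unfolding d by simp
  also have "\<dots> = (LBINT z. \<psi> z * f0 (z + u))" by (subst integral_distr) (auto simp: algebra_simps)
  finally show "?F u = (LBINT z. \<psi> z * f0 (z + u))" .
  have "integrable lborel (\<lambda>z. \<psi> (z - u) *R f0 z)" by (rule integrable_scaled_bounded[OF if0 _ B]) simp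
  then have "integrable (distr lborel borel ((+) u)) (\<lambda>z. \<psi> (z - u) * f0 z)" unfolding d by simp
  then show "integrable lborel (\<lambda>z. \<psi> z * f0 (z + u))" by (subst (asm) integrable_distr_eq) (auto simp: algebra_simps)
 qed
 have iD: "integrable lborel (\<lambda>z. \<psi> z *R G0 z)" by (rule integrable_scaled_bounded[OF iG0 _ B]) simp
 \<comment> \<open>The derivative falls on f: its first order expansion is uniform near the support
   of \<psi>, where G is uniformly continuous.\<close>
 have "GDERIV ?F 0 :> ?D" unfolding gderiv_def has_derivative_at_alt
 proof (intro conjI allI impI)
  show "bounded_linear (\<lambda>h. h \<bullet> ?D)" by (rule bounded_linear_inner_left)
  fix r :: real assume r: "0 < r"
  define e1 where "e1 = r / (I + 1)"
  have e1: "0 < e1" using r I0 by (simp add: e1_def)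
  have "uniformly_continuous_on C' G" using continuous_on_subset[OF Gc C'K] e(2) by (rule compact_uniformly_continuous)
  then obtain d where d: "0 < d" "\<And>x y. x \<in> C' ==> y \<in> C' ==> dist x y < d ==> dist (G x) (G y) < e1"
   using e1 unfolding uniformly_continuous_on_def by metis
  have tay: "\<bar>f (w + h) - f w - h \<bullet> G w\<bar> \<le> norm h * e1" if h: "norm h < min d e" and w: "w \<in> supp \<psi>" for w h
  proof -
   have inC: "x \<in> C'" if "x \<in> ball w (min d e)" for x using e(4)[OF w, of x] that by auto
   have "norm (f (w + h) - f w - (w + h - w) \<bullet> G w) \<le> norm (w + h - w) * e1"
   proof (rule differentiable_bound_linearization[where S="ball w (min d e)" and f'="\<lambda>x h. h \<bullet> G x"])
    show "w + t *R (w + h - w) \<in> ball w (min d e)" if "t \<in> {0..1}" for t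
     using that h mult_right_mono[of "\<bar>t\<bar>" 1 "norm h"] by (auto simp: dist_norm)
    show "(f has_derivative (\<lambda>h. h \<bullet> G x)) (at x within ball w (min d e))" if "x \<in> ball w (min d e)" for x
     using Gd[of x] inC[OF that] e(3) unfolding gderiv_def by (auto intro: has_derivative_at_withinI)
    fix x assume x: "x \<in> ball w (min d e)"
    have "onorm (\<lambda>i. i \<bullet> G x - i \<bullet> G w) \<le> e1"
    proof (rule onorm_le)
     fix i
     have "norm (i \<bullet> G x - i \<bullet> G w) \<le> norm i * norm (G x - G w)" using Cauchy_Schwarz_ineq2[of i "G x - G w"] by (simp add: inner_diff_right)
     also have "\<dots> \<le> norm i * e1" using d(2)[of x w] x inC[OF x] inC[of w] d(1) e(1) by (intro mult_left_mono) (auto simp: dist_norm norm_minus_commute)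
     finally show "norm (i \<bullet> G x - i \<bullet> G w) \<le> e1 * norm i" by (simp add: mult.commute)
    qed
    then show "onorm ((\<lambda>h. h \<bullet> G x) - (\<lambda>h. h \<bullet> G w)) \<le> e1" by (simp add: fun_diff_def)
   qed (use d e in auto)
   then show ?thesis by simp
  qed
  show "\<exists>d>0. \<forall>y. norm (y - 0) < d \<longrightarrow> norm (?F y - ?F 0 - (y - 0) \<bullet> ?D) \<le> r * norm (y - 0)"
  proof (intro exI[of _ "min d e"] conjI allI impI)
   fix h :: 'a assume h: "norm (h - 0) < min d e"
   have "?F h - ?F 0 - (h - 0) \<bullet> ?D = (LBINT z. \<psi> z * f0 (z + h) - \<psi> z * f0 z - h \<bullet> (\<psi> z *R G0 z))"
    unfolding F using iF[of h] iF[of 0] iD by (simp del: inner_scaleR_right)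
   also have "norm \<dots> \<le> (LBINT z. (norm h * e1) * norm (\<psi> z))"
   proof (rule Bochner_Integration.integral_norm_bound_integral)
    show "integrable lborel (\<lambda>z. \<psi> z * f0 (z + h) - \<psi> z * f0 z - h \<bullet> (\<psi> z *R G0 z))"
     using iF[of h] iF[of 0] iD by (simp del: inner_scaleR_right)
    fix z
    show "norm (\<psi> z * f0 (z + h) - \<psi> z * f0 z - h \<bullet> (\<psi> z *R G0 z)) \<le> (norm h * e1) * norm (\<psi> z)"
    proof (cases "z \<in> supp \<psi>")
     case True
     have "z \<in> C'" "z + h \<in> C'" using e(4)[OF True] h e(1) by (auto simp: dist_norm)
     then have "\<psi> z * f0 (z + h) - \<psi> z * f0 z - h \<bullet> (\<psi> z *R G0 z) = \<psi> z * (f (z + h) - f z - h \<bullet> G z)"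
      by (simp add: f0_def G0_def algebra_simps)
     then have "norm (\<psi> z * f0 (z + h) - \<psi> z * f0 z - h \<bullet> (\<psi> z *R G0 z)) = \<bar>\<psi> z\<bar> * \<bar>f (z + h) - f z - h \<bullet> G z\<bar>"
      by (simp only: real_norm_def abs_mult)
     also have "\<dots> \<le> \<bar>\<psi> z\<bar> * (norm h * e1)" using h by (intro mult_left_mono tay True) auto
     finally show ?thesis by (simp add: mult.commute)
    qed (use sm(4) e1 in simp)
   qed (use ip in auto)
   also have "\<dots> = norm h * (r * (I / (I + 1)))" by (simp add: I_def e1_def)
   also have "\<dots> \<le> norm h * r" using r I0 by (intro mult_left_mono) (auto simp: field_simps)
   finally show "norm (?F h - ?F 0 - (h - 0) \<bullet> ?D) \<le> r * norm (h - 0)" by (simp add: mult.commute)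
  qed (use d e in auto)
 qed
 \<comment> \<open>The same derivative with \<psi> differentiated; uniqueness of gradients then
   gives the formula.\<close>
 moreover have "GDERIV ?F 0 :> - (LBINT z. f0 z *R gradient \<psi> (z - 0))" by (rule convolution_gradient[OF if0 psiU])
 ultimately have "?D = - (LBINT z. f0 z *R gradient \<psi> z)" using GDERIV_unique by fastforce
 moreover have "(\<lambda>z. f0 z *R gradient \<psi> z) = (\<lambda>x. (indicat_real (interior K) x * f x) *R gradient \<psi> x)"
 proof
  fix z
  have "z \<in> C' \<and> z \<in> interior K" if "z \<in> supp \<psi>" using e(4)[OF that, of z] e(1) that S(2) by auto
  then show "f0 z *R gradient \<psi> z = (indicat_real (interior K) z * f z) *R gradient \<psi> z"
   using sm(5)[of z] by (cases "z \<in> supp \<psi>") (auto simp: f0_def)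
 qed
 moreover have "(\<lambda>z. \<psi> z *R G0 z) = (\<lambda>x. \<psi> x *R indicat_real (interior K) x *R G x)"
 proof
  fix z
  have "z \<in> C' \<and> z \<in> interior K" if "z \<in> supp \<psi>" using e(4)[OF that, of z] e(1) that S(2) by auto
  then show "\<psi> z *R G0 z = \<psi> z *R indicat_real (interior K) z *R G z"
   using sm(4)[of z] by (cases "z \<in> supp \<psi>") (auto simp: G0_def)
 qed
 ultimately show "(LBINT x. (indicat_real (interior K) x * f x) *R gradient \<psi> x)
   = - (LBINT x. \<psi> x *R indicat_real (interior K) x *R G x)" by simp
qed

section \<open>Sobolev functions\<close>

lemma AE_lebesgue_on_iff:
 "U \<in> sets borel ==> (AE x in lebesgue_on U. P x) \<longleftrightarrow> (AE x in lborel. x \<in> U \<longrightarrow> P x)"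
 by (subst AE_restrict_space_iff) (auto simp: AE_completion_iff)

text \<open>The Sobolev notions are phrased with \<open>lebesgue_on\<close>, the transport and
  mollification arguments with Borel functions and \<open>lborel\<close>. This lemma and
  \<open>lint_lebesgue_on\<close> are the bridge between them.\<close>

lemma lebesgue_on_borel_version:
 fixes f :: "'a::euclidean_space => 'b::euclidean_space"
 assumes U: "U \<in> sets borel" and f: "f \<in> borel_measurable (lebesgue_on U)"
 obtains f' where "f' \<in> \<B>" "\<And>x. x \<notin> U ==> f' x = 0" "AE x in lborel. x \<in> U \<longrightarrow> f x = f' x"
proof -
 have m: "(\<lambda>x. indicat_real U x *R f x) \<in> borel_measurable lebesgue" using f U by (subst (asm) borel_measurable_restrict_space_iff) auto
 have "\<exists>g\<in>borel_measurable lborel. AE x in lborel. (indicat_real U x *R f x) \<bullet> b = g x" for b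
  by (rule completion_ex_borel_measurable_real) (use m in measurable)
 then obtain g where g: "\<And>b. g b \<in> borel_measurable lborel" "\<And>b. AE x in lborel. (indicat_real U x *R f x) \<bullet> b = g b x" by metis
 have [measurable]: "g b \<in> \<B>" for b using g(1) by simp
 note U[measurable]
 define f' where "f' x = indicat_real U x *R (\<Sum>b\<in>Basis. g b x *R b)" for x
 have "AE x in lborel. \<forall>b\<in>Basis. (indicat_real U x *R f x) \<bullet> b = g b x" using g(2) by (intro AE_finite_allI) auto
 then have "AE x in lborel. x \<in> U \<longrightarrow> f x = f' x"
 proof eventually_elim
  fix x assume a: "\<forall>b\<in>Basis. (indicat_real U x *R f x) \<bullet> b = g b x"
  show "x \<in> U \<longrightarrow> f x = f' x"
  proof
   assume x: "x \<in> U"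
   have "(\<Sum>b\<in>Basis. g b x *R b) = (\<Sum>b\<in>Basis. (f x \<bullet> b) *R b)" using a x by (intro sum.cong) auto
   then show "f x = f' x" using x by (simp add: f'_def euclidean_representation)
  qed
 qed
 then show ?thesis using that[of f'] by (auto simp: f'_def[abs_def])
qed

lemma lint_lebesgue_on:
 fixes F :: "'a::euclidean_space => 'b::euclidean_space"
 assumes U: "U \<in> sets borel" and F: "F \<in> borel_measurable (lebesgue_on U)"
  and F': "F' \<in> \<B>" "\<And>x. x \<notin> U ==> F' x = 0" and ae: "AE x in lborel. x \<in> U \<longrightarrow> F x = F' x"
 shows "(LINT x|lebesgue_on U. F x) = (LBINT x. F' x)" "integrable (lebesgue_on U) F \<longleftrightarrow> integrable lborel F'"
proof -
 have m: "F' \<in> borel_measurable (lebesgue_on U)" using F'(1) by (intro measurable_restrict_space1 measurable_completion) simp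
 have ae': "AE x in lebesgue_on U. F x = F' x" using ae U by (simp add: AE_lebesgue_on_iff)
 have ind: "(\<lambda>x. indicat_real U x *R F' x) = F'" using F'(2) by (intro ext) (metis indicator_simps scaleR_one scaleR_zero_left)
 have "(LINT x|lebesgue_on U. F x) = (LINT x|lebesgue_on U. F' x)" by (rule integral_cong_AE[OF F m ae'])
 also have "\<dots> = (LINT x|lebesgue. indicat_real U x *R F' x)" using U by (intro integral_restrict_space) auto
 also have "\<dots> = (LBINT x. F' x)" unfolding ind by (rule integral_completion) (use F' in simp)
 finally show "(LINT x|lebesgue_on U. F x) = (LBINT x. F' x)" .
 have "integrable (lebesgue_on U) F \<longleftrightarrow> integrable (lebesgue_on U) F'" by (rule integrable_cong_AE[OF F m ae'])
 also have "\<dots> \<longleftrightarrow> integrable lebesgue (\<lambda>x. indicat_real U x *R F' x)" using U by (intro integrable_restrict_space) auto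
 also have "\<dots> \<longleftrightarrow> integrable lborel F'" unfolding ind by (rule integrable_completion) (use F' in simp)
 finally show "integrable (lebesgue_on U) F \<longleftrightarrow> integrable lborel F'" .
qed

lemma borel_measurable_lebesgue_on: "f \<in> \<B> ==> f \<in> borel_measurable (lebesgue_on U)"
 by (intro measurable_restrict_space1 measurable_completion) simp

text \<open>Local integrability yields measurability only on compact subsets; an exhaustion of U by
  compact sets glues the pieces together.\<close>

lemma loc_integrable_version:
 fixes w :: "'a::euclidean_space => 'b::euclidean_space"
 assumes U: "open U" and w: "loc_integrable U w"
 obtains w' where "w \<in> borel_measurable (lebesgue_on U)" "w' \<in> \<B>" "\<And>x. x \<notin> U ==> w' x = 0"
  "AE x in lborel. x \<in> U \<longrightarrow> w x = w' x"
  "\<And>C. compact C ==> C \<subseteq> U ==> integrable lborel (\<lambda>x. indicat_real C x *R w' x)"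
proof -
 have Ub [simp]: "U \<in> sets borel" using U by simp
 obtain C :: "nat => 'a set" where C: "\<And>n. compact (C n)" "\<And>n. C n \<subseteq> U" "\<And>n. C n \<subseteq> interior (C (Suc n))" "\<Union>(range C) = U"
  using open_Union_compact_subsets[OF U] by metis
 have mono: "C m \<subseteq> C n" if "m \<le> n" for m n using that by (induction rule: dec_induct) (use C(3) interior_subset in blast)+
 have wm: "(\<lambda>x. indicat_real (C n) x *R w x) \<in> borel_measurable lebesgue" for n
 proof -
  have "integrable (lebesgue_on (C n)) w" using w C(1,2) by (auto simp: loc_integrable_def)
  then have "w \<in> borel_measurable (lebesgue_on (C n))" by (rule borel_measurable_integrable)
  then show ?thesis using borel_compact[OF C(1)] by (subst (asm) borel_measurable_restrict_space_iff) auto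
 qed
 have "(\<lambda>x. indicat_real U x *R w x) \<in> borel_measurable lebesgue"
 proof (rule borel_measurable_LIMSEQ_metric[OF wm])
  fix x
  show "(\<lambda>n. indicat_real (C n) x *R w x) \<longlonglongrightarrow> indicat_real U x *R w x"
  proof (cases "x \<in> U")
   case True
   then obtain m where m: "x \<in> C m" using C(4) by auto
   have "\<forall>\<^sub>F n in sequentially. indicat_real (C n) x *R w x = indicat_real U x *R w x" using eventually_ge_at_top[of m]
   proof eventually_elim
    fix n assume "m \<le> n"
    then have "x \<in> C n" using mono m by blast
    then show "indicat_real (C n) x *R w x = indicat_real U x *R w x" using True by simp
   qed
   then show ?thesis by (rule tendsto_eventually)
  next
   case False
   then have "x \<notin> C n" for n using C(2) by auto
   then show ?thesis using False by simp
  qed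
 qed
 then have m: "w \<in> borel_measurable (lebesgue_on U)" by (subst borel_measurable_restrict_space_iff) auto
 obtain w' where w': "w' \<in> \<B>" "\<And>x. x \<notin> U ==> w' x = 0" "AE x in lborel. x \<in> U \<longrightarrow> w x = w' x"
  using lebesgue_on_borel_version[OF Ub m] by blast
 show ?thesis
 proof (rule that[OF m w'])
  fix D assume D: "compact D" "D \<subseteq> U"
  have Db [measurable]: "D \<in> sets borel" using D by (simp add: borel_compact)
  have i: "integrable (lebesgue_on D) w" using w D by (auto simp: loc_integrable_def)
  show "integrable lborel (\<lambda>x. indicat_real D x *R w' x)"
  proof (subst lint_lebesgue_on(2)[OF Db, of w, symmetric])
   show "AE x in lborel. x \<in> D \<longrightarrow> w x = indicat_real D x *R w' x" using w'(3) by eventually_elim (use D in auto)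
   show "(\<lambda>x. indicat_real D x *R w' x) \<in> \<B>" using w'(1) by measurable
  qed (use i in auto)
 qed
qed

text \<open>\<open>weak_gradient\<close> is an arbitrary choice. Uniqueness, by the fundamental
  lemma applied to the difference, lets any concretely known weak gradient stand in for it almost
  everywhere.\<close>

lemma is_weak_gradient_unique:
 fixes f :: "'a::euclidean_space => real" and \<eta> :: "nat => 'a => real"
 assumes U: "open U" and g: "is_weak_gradient U f g1" "is_weak_gradient U f g2"
  and \<eta>: "\<And>k. mollifier (d k) (\<eta> k)" and d: "d \<longlonglongrightarrow> 0"
 shows "AE x in lborel. x \<in> U \<longrightarrow> g1 x = g2 x"
proof -
 have Ub: "U \<in> sets borel" using U by simp
 have l: "loc_integrable U g1" "loc_integrable U g2" using g by (auto simp: is_weak_gradient_def)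
 obtain h1 where h1: "g1 \<in> borel_measurable (lebesgue_on U)" "h1 \<in> \<B>" "\<And>x. x \<notin> U ==> h1 x = 0"
  "AE x in lborel. x \<in> U \<longrightarrow> g1 x = h1 x" "\<And>C. compact C ==> C \<subseteq> U ==> integrable lborel (\<lambda>x. indicat_real C x *R h1 x)"
  by (rule loc_integrable_version[OF U l(1)]) blast
 obtain h2 where h2: "g2 \<in> borel_measurable (lebesgue_on U)" "h2 \<in> \<B>" "\<And>x. x \<notin> U ==> h2 x = 0"
  "AE x in lborel. x \<in> U \<longrightarrow> g2 x = h2 x" "\<And>C. compact C ==> C \<subseteq> U ==> integrable lborel (\<lambda>x. indicat_real C x *R h2 x)"
  by (rule loc_integrable_version[OF U l(2)]) blast
 note [measurable] = h1(2) h2(2)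
 have "AE x in lborel. x \<in> U \<longrightarrow> h1 x - h2 x = 0"
 proof (rule weak_zero[OF U _ _ _ \<eta> d])
  show "integrable lborel (\<lambda>x. indicat_real C x *R (h1 x - h2 x))" if "compact C" "C \<subseteq> U" for C
   using h1(5)[OF that] h2(5)[OF that] by (simp add: scaleR_diff_right)
  fix \<psi> assume psi: "\<psi> \<in> test_functions U"
  note sm = test_function_smooth[OF psi]
  have [measurable]: "\<psi> \<in> \<B>" using sm(1) by (rule borel_measurable_continuous_onI)
  obtain B where B: "\<And>x. \<bar>\<psi> x\<bar> \<le> B" using uniformly_continuous_compact_support(2)[OF sm(1) sm(6) sm(4)] by auto
  have S: "compact (supp \<psi>)" "supp \<psi> \<subseteq> U" using psi by (auto simp: test_functions_def)
  have i: "integrable lborel (\<lambda>x. \<psi> x *R h x)"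
   if h: "integrable lborel (\<lambda>x. indicat_real (supp \<psi>) x *R h x)" for h :: "'a => 'a"
  proof -
   have "(\<lambda>x. \<psi> x *R (indicat_real (supp \<psi>) x *R h x)) = (\<lambda>x. \<psi> x *R h x)"
    using sm(4) by (intro ext) (metis indicator_simps scaleR_one scaleR_zero_left)
   moreover have "integrable lborel (\<lambda>x. \<psi> x *R (indicat_real (supp \<psi>) x *R h x))" by (rule integrable_scaled_bounded[OF h _ B]) simp
   ultimately show ?thesis by (simp only:)
  qed
  have e: "(LINT x|lebesgue_on U. \<psi> x *R g x) = (LBINT x. \<psi> x *R h x)"
   if g: "g \<in> borel_measurable (lebesgue_on U)" and [measurable]: "h \<in> \<B>" and h: "\<And>x. x \<notin> U ==> h x = 0"
    and ae: "AE x in lborel. x \<in> U \<longrightarrow> g x = h x" for g h :: "'a => 'a"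
  proof (rule lint_lebesgue_on[OF Ub])
   have "\<psi> \<in> borel_measurable (lebesgue_on U)" by (intro borel_measurable_lebesgue_on) simp
   then show "(\<lambda>x. \<psi> x *R g x) \<in> borel_measurable (lebesgue_on U)" using g by measurable
   show "AE x in lborel. x \<in> U \<longrightarrow> \<psi> x *R g x = \<psi> x *R h x" using ae by eventually_elim auto
  qed (use h in auto)
  have "(LINT x|lebesgue_on U. \<psi> x *R g1 x) = (LINT x|lebesgue_on U. \<psi> x *R g2 x)"
   using g psi unfolding is_weak_gradient_def by (metis minus_equation_iff)
  then show "(LBINT x. \<psi> x *R (h1 x - h2 x)) = 0" using e[OF h1(1-4)] e[OF h2(1-4)] i[OF h1(5)[OF S]] i[OF h2(5)[OF S]] by (simp add: scaleR_diff_right)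
 qed measurable
 then show ?thesis using h1(4) h2(4) by eventually_elim auto
qed

text \<open>The form in which an element of \<open>W1\<close> enters the estimates: Borel
  representatives of the function and of its weak gradient, both extended by zero.
  \<open>W1_data\<close> produces them.\<close>

definition sobolev_data :: "'a::euclidean_space set => real => ('a => real) => ('a => 'a) => bool" where
 "sobolev_data U p \<phi> g \<longleftrightarrow> integrable lborel \<phi> \<and> integrable lborel g \<and> (\<forall>x. x \<notin> U \<longrightarrow> \<phi> x = 0 \<and> g x = 0) \<and>
   (\<integral>\<^sup>+x. ennreal (norm (g x) powr p) \<partial>lborel) < \<infinity> \<and> weak_grad U \<phi> g"

lemma Lp_version:
 fixes f :: "'a::euclidean_space => 'b::euclidean_space"
 assumes U: "U \<in> sets borel" "bounded U" and p: "1 < p" and f: "f \<in> Lp p U"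
  and f': "f' \<in> \<B>" "\<And>x. x \<notin> U ==> f' x = 0" "AE x in lborel. x \<in> U \<longrightarrow> f x = f' x"
 shows "integrable lborel f'" "integrable lborel (\<lambda>x. norm (f' x) powr p)"
proof -
 note f'(1)[measurable]
 have fm: "f \<in> borel_measurable (lebesgue_on U)" and fi: "integrable (lebesgue_on U) (\<lambda>x. norm (f x) powr p)" using f by (auto simp: Lp_def)
 show i: "integrable lborel (\<lambda>x. norm (f' x) powr p)"
 proof (subst lint_lebesgue_on(2)[OF U(1), of "\<lambda>x. norm (f x) powr p", symmetric])
  show "AE x in lborel. x \<in> U \<longrightarrow> norm (f x) powr p = norm (f' x) powr p" using f'(3) by eventually_elim auto
 qed (use fi f'(2) in auto)
 show "integrable lborel f'"
 proof (rule Bochner_Integration.integrable_bound)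
  have "integrable lborel (indicat_real U)" using U emeasure_bounded_finite[OF U(2)] by (intro integrable_real_indicator) auto
  then show "integrable lborel (\<lambda>x. indicat_real U x + norm (f' x) powr p)" using i by simp
  show "AE x in lborel. norm (f' x) \<le> norm (indicat_real U x + norm (f' x) powr p)"
  proof (rule AE_I2)
   fix x
   show "norm (f' x) \<le> norm (indicat_real U x + norm (f' x) powr p)"
   proof (cases "x \<in> U")
    case True
    have "norm (f' x) \<le> 1 + norm (f' x) powr p"
    proof (cases "norm (f' x) \<le> 1")
     case False
     then have "norm (f' x) powr 1 \<le> norm (f' x) powr p" using p by (intro powr_mono) auto
     then show ?thesis by simp
    qed (rule add_increasing2; simp)
    then show ?thesis using True by simp
   qed (use f'(2) in auto)
  qed
 qed simp
qed

lemma W1_data: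
 fixes f :: "'a::euclidean_space => real" and \<eta> :: "nat => 'a => real"
 assumes K: "compact K" and p: "1 < p" and f: "f \<in> W1 p K"
  and \<eta>: "\<And>k. mollifier (d k) (\<eta> k)" and d: "d \<longlonglongrightarrow> 0"
 obtains \<phi> g where "sobolev_data (interior K) p \<phi> g" "AE x in lborel. x \<in> interior K \<longrightarrow> f x = \<phi> x"
  "f \<in> borel_measurable (lebesgue_on (interior K))"
  "AE x in lborel. x \<in> interior K \<longrightarrow> weak_gradient (interior K) f x = g x"
  "weak_gradient (interior K) f \<in> borel_measurable (lebesgue_on (interior K))"
proof -
 let ?U = "interior K"
 have U: "?U \<in> sets borel" "bounded ?U" "open ?U" using compact_imp_bounded[OF K] bounded_subset interior_subset by (auto intro: bounded_interior)
 obtain g0 where fL: "f \<in> Lp p ?U" and gL: "g0 \<in> Lp p ?U" and wg: "is_weak_gradient ?U f g0" using f by (auto simp: W1_def)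
 have fm: "f \<in> borel_measurable (lebesgue_on ?U)" and gm: "g0 \<in> borel_measurable (lebesgue_on ?U)" using fL gL by (auto simp: Lp_def)
 obtain \<phi> where \<phi>: "\<phi> \<in> \<B>" "\<And>x. x \<notin> ?U ==> \<phi> x = 0" "AE x in lborel. x \<in> ?U \<longrightarrow> f x = \<phi> x"
  using lebesgue_on_borel_version[OF U(1) fm] by blast
 obtain g where g: "g \<in> \<B>" "\<And>x. x \<notin> ?U ==> g x = 0" "AE x in lborel. x \<in> ?U \<longrightarrow> g0 x = g x"
  using lebesgue_on_borel_version[OF U(1) gm] by blast
 note \<phi>(1)[measurable] g(1)[measurable]
 note i = Lp_version[OF U(1,2) p fL \<phi>] Lp_version[OF U(1,2) p gL g]
 have wgr: "weak_grad ?U \<phi> g" unfolding weak_grad_def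
 proof
  fix \<psi> assume psi: "\<psi> \<in> test_functions ?U"
  note sm = test_function_smooth[OF psi]
  have [measurable]: "\<psi> \<in> \<B>" "gradient \<psi> \<in> \<B>" using sm(1,2) by (auto intro: borel_measurable_continuous_onI)
  have m: "\<psi> \<in> borel_measurable (lebesgue_on ?U)" "gradient \<psi> \<in> borel_measurable (lebesgue_on ?U)" by (intro borel_measurable_lebesgue_on; simp)+
  have "(LINT x|lebesgue_on ?U. f x *R gradient \<psi> x) = (LBINT x. \<phi> x *R gradient \<psi> x)"
  proof (rule lint_lebesgue_on[OF U(1)])
   show "(\<lambda>x. f x *R gradient \<psi> x) \<in> borel_measurable (lebesgue_on ?U)" using fm m by measurable
   show "AE x in lborel. x \<in> ?U \<longrightarrow> f x *R gradient \<psi> x = \<phi> x *R gradient \<psi> x" using \<phi>(3) by eventually_elim auto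
  qed (use \<phi> in auto)
  moreover have "(LINT x|lebesgue_on ?U. \<psi> x *R g0 x) = (LBINT x. \<psi> x *R g x)"
  proof (rule lint_lebesgue_on[OF U(1)])
   show "(\<lambda>x. \<psi> x *R g0 x) \<in> borel_measurable (lebesgue_on ?U)" using gm m by measurable
   show "AE x in lborel. x \<in> ?U \<longrightarrow> \<psi> x *R g0 x = \<psi> x *R g x" using g(3) by eventually_elim auto
  qed (use g in auto)
  ultimately show "(LBINT x. \<phi> x *R gradient \<psi> x) = - (LBINT x. \<psi> x *R g x)" using wg psi by (simp add: is_weak_gradient_def)
 qed
 have sd: "sobolev_data ?U p \<phi> g" unfolding sobolev_data_def using i wgr \<phi>(2) g(2) by (auto simp: nn_integral_eq_integral)
 have w: "is_weak_gradient ?U f (weak_gradient ?U f)" unfolding weak_gradient_def by (rule someI[where P="is_weak_gradient ?U f", OF wg])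
 then have "loc_integrable ?U (weak_gradient ?U f)" by (simp add: is_weak_gradient_def)
 then have wm: "weak_gradient ?U f \<in> borel_measurable (lebesgue_on ?U)" by (rule loc_integrable_version[OF U(3)]) blast
 have "AE x in lborel. x \<in> ?U \<longrightarrow> weak_gradient ?U f x = g0 x" by (rule is_weak_gradient_unique[OF U(3) w wg \<eta> d])
 then have "AE x in lborel. x \<in> ?U \<longrightarrow> weak_gradient ?U f x = g x" using g(3) by eventually_elim auto
 then show ?thesis using that[OF sd \<phi>(3) fm _ wm] by blast
qed

text \<open>Lets C^1 functions be inserted into a constraint that is formulated with Sobolev test
  functions, and replaces the chosen weak gradient by the classical one.\<close>

lemma C1_W1:
 fixes f :: "'a::euclidean_space => real" and \<eta> :: "nat => 'a => real"
 assumes K: "compact K" and p: "1 < p" and f: "continuous_on K f" and G: "is_C1_gradient K f G"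
  and \<eta>: "\<And>k. mollifier (d k) (\<eta> k)" and d: "d \<longlonglongrightarrow> 0"
 shows "f \<in> W1 p K" "AE x in lborel. x \<in> interior K \<longrightarrow> weak_gradient (interior K) f x = G x"
  "weak_gradient (interior K) f \<in> borel_measurable (lebesgue_on (interior K))"
proof -
 let ?U = "interior K"
 have Gc: "continuous_on K G" using G by (simp add: is_C1_gradient_def)
 have U: "?U \<in> sets borel" "open ?U" "bounded ?U" using compact_imp_bounded[OF K] by (auto intro: bounded_interior)
 have cm: "h \<in> borel_measurable (lebesgue_on S)" if "S \<subseteq> K" "S \<in> sets borel" "continuous_on K h" for h :: "'a => 'c::euclidean_space" and S
  using that by (intro continuous_imp_measurable_on_sets_lebesgue) (auto intro: continuous_on_subset)
 have bm: "(\<lambda>x. indicat_real S x *R h x) \<in> \<B>" if "S \<subseteq> K" "S \<in> sets borel" "continuous_on K h" for h :: "'a => 'c::euclidean_space" and S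
  using that by (intro borel_measurable_continuous_on_indicator) (auto intro: continuous_on_subset)
 have ip: "integrable lborel (\<lambda>x. indicat_real S x *R h x)" if "S \<subseteq> K" "S \<in> sets borel" "continuous_on K h" for h :: "'a => 'c::euclidean_space" and S
 proof (rule Bochner_Integration.integrable_bound[OF borel_integrable_compact[OF K that(3)]])
  show "AE x in lborel. norm (indicat_real S x *R h x) \<le> norm (indicat_real K x *R h x)" using that by (intro AE_I2) (auto simp: indicator_def)
 qed (use bm[OF that] in simp)
 have loc: "loc_integrable ?U h" if h: "continuous_on K h" for h :: "'a => 'c::euclidean_space" unfolding loc_integrable_def
 proof (intro allI impI)
  fix C assume C: "compact C \<and> C \<subseteq> ?U"
  then have CK: "C \<subseteq> K" "C \<in> sets borel" using interior_subset by (auto simp: borel_compact)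
  show "integrable (lebesgue_on C) h" by (subst lint_lebesgue_on(2)[OF CK(2) cm[OF CK h] bm[OF CK h]]) (use ip[OF CK h] in auto)
 qed
 have Lp: "h \<in> Lp p ?U" if h: "continuous_on K h" for h :: "'a => 'c::euclidean_space"
 proof -
  have UK: "?U \<subseteq> K" by (rule interior_subset)
  have c: "continuous_on K (\<lambda>x. norm (h x) powr p)" using p h by (intro continuous_on_powr' continuous_intros) auto
  have "integrable (lebesgue_on ?U) (\<lambda>x. norm (h x) powr p)"
   by (subst lint_lebesgue_on(2)[OF U(1) cm[OF UK U(1) c] bm[OF UK U(1) c]]) (use ip[OF UK U(1) c] in auto)
  then show ?thesis using cm[OF UK U(1) h] by (simp add: Lp_def)
 qed
 have UK: "?U \<subseteq> K" by (rule interior_subset)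
 have wg: "is_weak_gradient ?U f G" unfolding is_weak_gradient_def
 proof (intro conjI loc f Gc ballI)
  fix \<psi> assume psi: "\<psi> \<in> test_functions ?U"
  note sm = test_function_smooth[OF psi]
  have [measurable]: "\<psi> \<in> \<B>" "gradient \<psi> \<in> \<B>" using sm(1,2) by (auto intro: borel_measurable_continuous_onI)
  have m: "\<psi> \<in> borel_measurable (lebesgue_on ?U)" "gradient \<psi> \<in> borel_measurable (lebesgue_on ?U)" by (intro borel_measurable_lebesgue_on; simp)+
  have [measurable]: "(\<lambda>x. indicat_real ?U x * f x) \<in> \<B>" "(\<lambda>x. indicat_real ?U x *R G x) \<in> \<B>"
   using bm[OF UK U(1) f] bm[OF UK U(1) Gc] by simp_all
  have "(LINT x|lebesgue_on ?U. f x *R gradient \<psi> x) = (LBINT x. (indicat_real ?U x * f x) *R gradient \<psi> x)"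
   using cm[OF UK U(1) f] m by (intro lint_lebesgue_on(1)[OF U(1)]) auto
  moreover have "(LINT x|lebesgue_on ?U. \<psi> x *R G x) = (LBINT x. \<psi> x *R (indicat_real ?U x *R G x))"
  proof (rule lint_lebesgue_on(1)[OF U(1)])
   show "(\<lambda>x. \<psi> x *R G x) \<in> borel_measurable (lebesgue_on ?U)" using cm[OF UK U(1) Gc] m by measurable
   show "(\<lambda>x. \<psi> x *R (indicat_real ?U x *R G x)) \<in> \<B>" by measurable
  qed auto
  ultimately show "(LINT x|lebesgue_on ?U. f x *R gradient \<psi> x) = - (LINT x|lebesgue_on ?U. \<psi> x *R G x)"
   using C1_weak_grad[OF K f G] psi by (simp only: weak_grad_def)
 qed
 show "f \<in> W1 p K" using Lp[OF f] Lp[OF Gc] wg by (auto simp: W1_def)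
 have w: "is_weak_gradient ?U f (weak_gradient ?U f)" unfolding weak_gradient_def by (rule someI[where P="is_weak_gradient ?U f", OF wg])
 then show "AE x in lborel. x \<in> ?U \<longrightarrow> weak_gradient ?U f x = G x" by (rule is_weak_gradient_unique[OF U(2) _ wg \<eta> d])
 have "loc_integrable ?U (weak_gradient ?U f)" using w by (simp add: is_weak_gradient_def)
 then show "weak_gradient ?U f \<in> borel_measurable (lebesgue_on ?U)" by (rule loc_integrable_version[OF U(2)]) blast
qed

section \<open>Continuous representatives of Sobolev functions\<close>

lemma AE_open_nonempty:
 fixes S :: "'a::euclidean_space set"
 assumes "AE x in lborel. P x" "open S" "S \<noteq> {}"
 shows "\<exists>x\<in>S. P x"
proof (rule ccontr)
 assume no: "\<not> ?thesis"
 obtain x e where e: "0 < e" "ball x e \<subseteq> S" using assms(2,3) open_contains_ball by (metis ex_in_conv)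
 have "AE x' in lborel. x' \<notin> ball x e" using assms(1) by eventually_elim (use no e in auto)
 then have "emeasure lborel (ball x e) = 0" by (subst (asm) AE_iff_measurable[of "ball x e"]) auto
 then show False using content_ball_pos[OF e(1), of x] by (simp add: measure_def)
qed

context conic_star
begin

text \<open>The contraction is fixed first: c k K is compact in the interior, and r k is then an
  index whose mollifier fits into the remaining gap and also has radius at most 1 / (k + 1).\<close>

lemma approximating_sequence:
 assumes \<eta>: "\<And>k. mollifier (d k) (\<eta> k)" and d: "d \<longlonglongrightarrow> 0"
 obtains c r where "\<And>k. 1/2 \<le> c k" "\<And>k. c k \<le> 1" "c \<longlonglongrightarrow> 1" "(\<lambda>k. d (r k)) \<longlonglongrightarrow> 0" "\<And>k. d (r k) \<le> 1"
  "\<And>k y w. y \<in> K ==> w \<in> supp (\<eta> (r k)) ==> c k *R y + w \<in> interior K"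
proof -
 \<comment> \<open>The factors start at 1/2, the lower bound needed for uniform Jacobians, and
   increase to 1.\<close>
 define c where "c k = 1 - inverse (real (Suc (Suc k)))" for k
 have c: "1/2 \<le> c k" "c k < 1" for k by (auto simp: c_def field_simps)
 have "(\<lambda>k. 1 - inverse (real (Suc (Suc k)))) \<longlonglongrightarrow> 1 - 0" by (intro tendsto_intros LIMSEQ_Suc[OF LIMSEQ_inverse_real_of_nat])
 then have c1: "c \<longlonglongrightarrow> 1" by (simp add: c_def[abs_def])
 have "\<exists>j. d j \<le> inverse (real (Suc k)) \<and> (\<forall>y\<in>K. \<forall>w\<in>supp (\<eta> j). c k *R y + w \<in> interior K)" for k
 proof -
  have "compact ((\<lambda>y. c k *R y) ` K)" by (rule compact_scaling[OF compact])
  moreover have "(\<lambda>y. c k *R y) ` K \<subseteq> interior K" using star c[of k] by fastforce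
  ultimately obtain e C' where e: "0 < e" "C' \<subseteq> interior K" "\<And>x y. x \<in> (\<lambda>y. c k *R y) ` K ==> dist x y \<le> e ==> y \<in> C'"
   using compact_neighbourhood[of "(\<lambda>y. c k *R y) ` K" "interior K"] by (metis open_interior)
  have "\<forall>\<^sub>F j in sequentially. d j < min e (inverse (real (Suc k)))" using d e(1) by (intro order_tendstoD(2)) auto
  then obtain j where j: "d j < min e (inverse (real (Suc k)))" by (auto simp: eventually_sequentially)
  have "c k *R y + w \<in> interior K" if "y \<in> K" "w \<in> supp (\<eta> j)" for y w
  proof -
   have "w \<in> ball 0 (d j)" using \<eta>[of j] that by (auto simp: mollifier_def)
   then have "dist (c k *R y) (c k *R y + w) \<le> e" using j by (simp add: dist_norm)
   then show ?thesis using e(2) e(3)[of "c k *R y"] that(1) by blast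
  qed
  then show ?thesis using j by (intro exI[of _ j]) auto
 qed
 then obtain r where r: "\<And>k. d (r k) \<le> inverse (real (Suc k))" "\<And>k y w. y \<in> K ==> w \<in> supp (\<eta> (r k)) ==> c k *R y + w \<in> interior K"
  by metis
 \<comment> \<open>A negative radius would make the mollifier vanish identically, against its
   integral being 1; nonnegativity is needed for squeezing d (r k) to 0.\<close>
 have d0: "0 \<le> d k" for k
 proof (rule ccontr)
  assume "\<not> ?thesis"
  then have "\<eta> k = (\<lambda>_. 0)" using mollifierD(7)[OF \<eta>[of k]] norm_ge_zero by (metis less_le_not_le order_le_less_trans not_le_imp_less)
  then show False using mollifierD(5)[OF \<eta>[of k]] by simp
 qed
 have "(\<lambda>k. d (r k)) \<longlonglongrightarrow> 0" by (rule tendsto_sandwich[OF _ _ tendsto_const LIMSEQ_inverse_real_of_nat]) (use r d0 in auto)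
 moreover have "d (r k) \<le> 1" for k using r(1)[of k] by (rule order_trans) (simp add: field_simps)
 ultimately show ?thesis using that[of c r] c c1 r(2) less_imp_le by metis
qed

lemma moll_gradient_bound:
 fixes g :: "'a => 'a"
 assumes pq: "1 < p" "1 < q" "1 / p + 1 / q = 1" and \<eta>: "mollifier d \<eta>" and g: "integrable lborel g" and c: "1/2 \<le> c" "c \<le> 1"
  and a: "(\<integral>\<^sup>+x. ennreal (norm (g x) powr p) \<partial>lborel) = ennreal a" "0 \<le> a"
 shows "(\<integral>\<^sup>+x. ennreal (norm (indicat_real S x *R (c *R moll c \<eta> g x)) powr p) \<partial>lborel) \<le> ennreal (2 ^ DIM('a) * (a + 1))"
proof -
 have "(\<integral>\<^sup>+x. ennreal (norm (indicat_real S x *R (c *R moll c \<eta> g x)) powr p) \<partial>lborel) \<le> (\<integral>\<^sup>+x. ennreal (norm (moll c \<eta> g x) powr p) \<partial>lborel)"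
 proof (intro nn_integral_mono ennreal_leI powr_mono2)
  fix x
  have "c * norm (moll c \<eta> g x) \<le> 1 * norm (moll c \<eta> g x)" using c by (intro mult_right_mono) auto
  then show "norm (indicat_real S x *R (c *R moll c \<eta> g x)) \<le> norm (moll c \<eta> g x)" using c by (auto simp: indicator_def)
 qed (use pq in auto)
 also have "\<dots> \<le> ennreal (1 / \<bar>c\<bar> ^ DIM('a)) * ennreal a" using moll_jensen[OF pq \<eta> g, of c] c a by simp
 also have "\<dots> = ennreal (1 / c ^ DIM('a) * a)" using c a by (subst ennreal_mult[symmetric]) auto
 also have "\<dots> \<le> ennreal (2 ^ DIM('a) * (a + 1))"
 proof (intro ennreal_leI mult_mono)
  have "1 \<le> (2 * c) ^ DIM('a)" using c by (intro one_le_power) auto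
  then show "1 / c ^ DIM('a) \<le> 2 ^ DIM('a)" using c by (simp add: power_mult_distrib field_simps)
 qed (use a in auto)
 finally show ?thesis .
qed

text \<open>Equicontinuity is Morrey's estimate at both points with one common ball.\<close>

lemma morrey_equicontinuous:
 assumes pq: "1 < p" "1 < q" "1 / p + 1 / q = 1" and pd: "real DIM('a) < p"
  and b: "b \<in> K" and e: "0 < e" and A: "0 < A"
 obtains h where "0 < h" "\<And>f G x. continuous_on K f ==> is_C1_gradient K f G ==>
  (\<integral>\<^sup>+x. ennreal (norm (indicat_real (interior K) x *R G x) powr p) \<partial>lborel) \<le> ennreal A ==>
  x \<in> K \<inter> ball b h ==> \<bar>f x - f b\<bar> \<le> e"
proof -
 obtain C r where C: "0 < C" "0 < r" "\<And>h. 0 < h ==> h < r ==> \<exists>z. dist z b \<le> C * h \<and>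
   (\<forall>x \<in> K \<inter> ball b h. \<forall>y \<in> ball z h. \<forall>t. 0 < t \<and> t \<le> 1 \<longrightarrow> (1 - t) *R x + t *R y \<in> interior K)"
  using cone[OF b] unfolding cone_at_def by blast
 define s where "s = 1 - real DIM('a) / p"
 have s: "0 < s" using pd pq by (simp add: s_def field_simps)
 define \<omega> where "\<omega> = measure lborel (ball (0::'a) 1)"
 have \<omega>: "0 < \<omega>" by (simp add: \<omega>_def content_ball_pos)
 \<comment> \<open>The constants of the final estimate: 2 for the two points compared, C + 2 from
   the distance bound D = (C + 2) h, 1/s from the time integral, and \<omega>^(-1/p) from V^(1/q -
   1) with V = \<omega> h^d. What remains is the Hoelder modulus h^s with s = 1 - d/p.\<close>
 define M where "M = 2 * (C + 2) * A powr (1/p) * (1/s) * \<omega> powr - (1/p)"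
 have M: "0 < M" using C A s \<omega> by (simp add: M_def)
 define h where "h = min (r / 2) ((e / M) powr (1/s))"
 have h: "0 < h" "h < r" using C e M by (auto simp: h_def min_less_iff_disj)
 have Mh: "M * h powr s \<le> e"
 proof -
  have "h powr s \<le> ((e / M) powr (1/s)) powr s" using h s by (intro powr_mono2) (auto simp: h_def)
  also have "\<dots> = e / M" using s e M by (simp add: powr_powr)
  finally show ?thesis using M by (simp add: field_simps)
 qed
 obtain z where z: "dist z b \<le> C * h" "\<And>x y t. x \<in> K ==> x \<in> ball b h ==> y \<in> ball z h ==> 0 < t ==> t \<le> 1 ==> (1 - t) *R x + t *R y \<in> interior K"
  using C(3)[OF h] by blast
 define V where "V = measure lborel (ball z h)"
 have Vh: "V = h ^ DIM('a) * \<omega>" unfolding V_def \<omega>_def using h by (intro content_ball_conv_unit_ball) auto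
 have V: "0 < V" using h \<omega> by (simp add: Vh)
 define D where "D = (C + 2) * h"
 show ?thesis
 proof (rule that[OF h(1)])
  fix f :: "'a => real" and G x assume f: "continuous_on K f" "is_C1_gradient K f G"
   and GA: "(\<integral>\<^sup>+x. ennreal (norm (indicat_real (interior K) x *R G x) powr p) \<partial>lborel) \<le> ennreal A"
   and x: "x \<in> K \<inter> ball b h"
  define B where "B = D * (A powr (1/p) * V powr (1/q) * (1/s))"
  have est: "\<bar>(LINT y|lborel_on (ball z h). indicat_real K y * f y) - V * f x'\<bar> \<le> B" if x': "x' \<in> K" "x' \<in> ball b h" for x'
   unfolding V_def B_def s_def
  proof (rule morrey_ball[OF pq pd compact f x'(1) h(1) _ _ A GA])
   show "(1 - t) *R x' + t *R y \<in> interior K" if "y \<in> ball z h" "0 < t" "t \<le> 1" for y t using z(2)[OF x'] that by blast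
   show "norm (y - x') \<le> D" if y: "y \<in> ball z h" for y
   proof -
    have "dist y x' \<le> dist y z + dist z b + dist b x'" by (smt (verit) dist_triangle)
    also have "\<dots> \<le> h + C * h + h" using y z(1) x'(2) by (simp add: dist_commute)
    finally show ?thesis by (simp add: D_def dist_norm algebra_simps)
   qed
  qed
  have "\<bar>V * f x - V * f b\<bar> \<le> 2 * B" using est[of x] est[of b] x b h by fastforce
  then have "V * \<bar>f x - f b\<bar> \<le> 2 * B" using V by (simp add: abs_mult flip: right_diff_distrib)
  then have "\<bar>f x - f b\<bar> \<le> 2 * B / V" using V by (simp add: field_simps)
  also have "2 * B / V = M * h powr s"
  proof -
   have "V powr (1/q) / V = V powr (1/q - 1)" using V by (simp add: powr_diff)
   also have "1/q - 1 = - (1/p)" using pq by linarith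
   also have "V powr - (1/p) = h powr - (real DIM('a) / p) * \<omega> powr - (1/p)" unfolding Vh using h \<omega> by (simp add: powr_mult powr_powr flip: powr_realpow)
   finally have v: "V powr (1/q) / V = h powr - (real DIM('a) / p) * \<omega> powr - (1/p)" .
   have "2 * B / V = 2 * ((C + 2) * h) * A powr (1/p) * (1/s) * (V powr (1/q) / V)" by (simp add: B_def D_def)
   also have "\<dots> = M * (h * h powr - (real DIM('a) / p))" unfolding v by (simp add: M_def)
   also have "h * h powr - (real DIM('a) / p) = h powr s" using h by (simp add: s_def powr_diff powr_minus_divide)
   finally show ?thesis .
  qed
  finally show "\<bar>f x - f b\<bar> \<le> e" using Mh by simp
 qed
qed

text \<open>The mollifications are C^1 on K with gradients bounded in L^p, hence equicontinuous by
  Morrey's estimate. They converge in L^1, so a subsequence converges almost everywhere in the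
  interior; equicontinuity extends the convergence to all of K and makes the limit
  continuous.\<close>

lemma sobolev_continuous_version:
 fixes \<eta> :: "nat => 'a => real"
 assumes pq: "1 < p" "1 < q" "1 / p + 1 / q = 1" and pd: "real DIM('a) < p"
  and sd: "sobolev_data (interior K) p \<phi> g" and \<eta>: "\<And>k. mollifier (d k) (\<eta> k)" and d: "d \<longlonglongrightarrow> 0"
 obtains F where "continuous_on K F" "AE x in lborel. x \<in> interior K \<longrightarrow> F x = \<phi> x"
proof -
 let ?U = "interior K"
 have \<phi>: "integrable lborel \<phi>" "\<And>x. x \<notin> ?U ==> \<phi> x = 0" and g: "integrable lborel g" and wg: "weak_grad ?U \<phi> g"
  and fin: "(\<integral>\<^sup>+x. ennreal (norm (g x) powr p) \<partial>lborel) < \<infinity>" using sd by (auto simp: sobolev_data_def)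
 obtain a where a: "(\<integral>\<^sup>+x. ennreal (norm (g x) powr p) \<partial>lborel) = ennreal a" "0 \<le> a"
  using fin by (cases "\<integral>\<^sup>+x. ennreal (norm (g x) powr p) \<partial>lborel") auto
 obtain c r where c: "\<And>k. 1/2 \<le> c k" "\<And>k. c k \<le> 1" "c \<longlonglongrightarrow> 1" and r: "(\<lambda>k. d (r k)) \<longlonglongrightarrow> 0" "\<And>k. d (r k) \<le> 1"
  and sub: "\<And>k y w. y \<in> K ==> w \<in> supp (\<eta> (r k)) ==> c k *R y + w \<in> ?U"
  using approximating_sequence[of d \<eta>, OF \<eta> d] by metis
 define f where "f k = moll (c k) (\<eta> (r k)) \<phi>" for k
 define G where "G k y = c k *R moll (c k) (\<eta> (r k)) g y" for k y
 have C1: "continuous_on K (f k)" "is_C1_gradient K (f k) (G k)" for k unfolding f_def G_def[abs_def]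
  using moll_C1[OF \<phi>(1) g wg mollifierD(1)[OF \<eta>[of "r k"]], of K "c k"] sub by auto
 define A where "A = 2 ^ DIM('a) * (a + 1)"
 have A: "0 < A" using a by (simp add: A_def)
 have GA: "(\<integral>\<^sup>+x. ennreal (norm (indicat_real ?U x *R G k x) powr p) \<partial>lborel) \<le> ennreal A" for k
  unfolding G_def A_def by (rule moll_gradient_bound[OF pq \<eta> g c(1,2) a])
 have eqc: "\<exists>h>0. \<forall>k. \<forall>x\<in>K \<inter> ball b h. \<bar>f k x - f k b\<bar> \<le> e" if bK: "b \<in> K" and e0: "0 < e" for b e
 proof -
  obtain h where "0 < h" "\<And>f G x. continuous_on K f ==> is_C1_gradient K f G ==>
   (\<integral>\<^sup>+x. ennreal (norm (indicat_real (interior K) x *R G x) powr p) \<partial>lborel) \<le> ennreal A ==>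
   x \<in> K \<inter> ball b h ==> \<bar>f x - f b\<bar> \<le> e" using morrey_equicontinuous[OF pq pd bK e0 A] by blast
  then show ?thesis using C1 GA by blast
 qed
 obtain R where R: "0 < R" "\<And>x. x \<in> K ==> norm x \<le> R" using compact_imp_bounded[OF compact] bounded_pos by metis
 have \<phi>R: "\<phi> x = 0" if "R < norm x" for x using that R(2)[of x] \<phi>(2)[of x] interior_subset[of K] by force
 have lim: "(\<lambda>k. \<integral>\<^sup>+x\<in>cball 0 R. ennreal (norm (f k x - \<phi> x)) \<partial>lborel) \<longlonglongrightarrow> 0"
  unfolding f_def using R(1) by (intro moll_L1_convergence[OF \<phi>(1) \<phi>R _ c(1,2,3) \<eta> r(1)]) auto
 define u where "u k x = indicat_real ?U x *R (f k x - \<phi> x)" for k x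
 have iu: "integrable lborel (u k)" for k
 proof -
  have [measurable]: "(\<lambda>x. indicat_real ?U x *R f k x) \<in> \<B>"
   by (intro borel_measurable_continuous_on_indicator continuous_on_subset[OF C1(1)] interior_subset) auto
  have "integrable lborel (\<lambda>x. indicat_real ?U x *R f k x)"
  proof (rule Bochner_Integration.integrable_bound[OF borel_integrable_compact[OF compact C1(1)[of k]]])
   show "AE x in lborel. norm (indicat_real ?U x *R f k x) \<le> norm (indicat_real K x *R f k x)"
    using interior_subset[of K] by (intro AE_I2) (auto simp: indicator_def)
  qed measurable
  moreover have "integrable lborel (\<lambda>x. indicat_real ?U x *R \<phi> x)" using \<phi>(1) by (intro integrable_mult_indicator) auto
  ultimately show ?thesis unfolding u_def[abs_def] by (simp add: right_diff_distrib)
 qed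
 have "(\<lambda>k. ennreal (LBINT x. norm (u k x))) \<longlonglongrightarrow> ennreal 0"
 proof (rule tendsto_sandwich[OF _ _ tendsto_const])
  show "\<forall>\<^sub>F k in sequentially. ennreal (LBINT x. norm (u k x)) \<le> (\<integral>\<^sup>+x\<in>cball 0 R. ennreal (norm (f k x - \<phi> x)) \<partial>lborel)"
  proof (rule always_eventually, rule allI)
   fix k
   have "ennreal (LBINT x. norm (u k x)) = (\<integral>\<^sup>+x. ennreal (norm (u k x)) \<partial>lborel)"
    using iu[of k] by (intro nn_integral_eq_integral[symmetric]) auto
   also have "\<dots> \<le> (\<integral>\<^sup>+x\<in>cball 0 R. ennreal (norm (f k x - \<phi> x)) \<partial>lborel)"
    using R(2) interior_subset[of K] by (intro nn_integral_mono) (auto simp: u_def indicator_def)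
   finally show "ennreal (LBINT x. norm (u k x)) \<le> (\<integral>\<^sup>+x\<in>cball 0 R. ennreal (norm (f k x - \<phi> x)) \<partial>lborel)" .
  qed
  show "(\<lambda>k. \<integral>\<^sup>+x\<in>cball 0 R. ennreal (norm (f k x - \<phi> x)) \<partial>lborel) \<longlonglongrightarrow> ennreal 0" using lim by simp
 qed auto
 then have "(\<lambda>k. \<integral>x. norm (u k x) \<partial>lborel) \<longlonglongrightarrow> 0" by (rule tendsto_ennrealD) (auto intro!: always_eventually)
 then have "\<exists>s. strict_mono s \<and> (AE x in lborel. (\<lambda>k. u (s k) x) \<longlonglongrightarrow> 0)"
  using tendsto_L1_AE_subseq[of lborel u, OF iu] by simp
 then obtain s where s: "strict_mono s" "AE x in lborel. (\<lambda>k. u (s k) x) \<longlonglongrightarrow> 0" by (elim exE conjE)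
 have ae: "AE x in lborel. x \<in> ?U \<longrightarrow> (\<lambda>k. f (s k) x) \<longlonglongrightarrow> \<phi> x" using s(2)
 proof eventually_elim
  fix x assume l: "(\<lambda>k. u (s k) x) \<longlonglongrightarrow> 0"
  show "x \<in> ?U \<longrightarrow> (\<lambda>k. f (s k) x) \<longlonglongrightarrow> \<phi> x" using l by (auto simp: u_def LIM_zero_iff)
 qed
 \<comment> \<open>At an exceptional or boundary point x, compare with a nearby interior point y
   where the sequence converges; equicontinuity bounds the two differences between x and y uniformly
   in k.\<close>
 have conv: "convergent (\<lambda>k. f (s k) x)" if x: "x \<in> K" for x
 proof -
  have "Cauchy (\<lambda>k. f (s k) x)"
  proof (rule metric_CauchyI)
   fix e :: real assume e: "0 < e"
   obtain h where h: "0 < h" "\<And>k y. y \<in> K \<inter> ball x h ==> \<bar>f k y - f k x\<bar> \<le> e / 4" using eqc[OF x, of "e / 4"] e by auto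
   have "x \<in> closure ?U" using x subset_closure_interior by auto
   then have "?U \<inter> ball x h \<noteq> {}" using h(1) by (auto simp: closure_approachable dist_commute disjoint_iff)
   then have "\<exists>y \<in> ?U \<inter> ball x h. y \<in> ?U \<longrightarrow> (\<lambda>k. f (s k) y) \<longlonglongrightarrow> \<phi> y"
    by (intro AE_open_nonempty[OF ae] open_Int open_interior open_ball)
   then obtain y where y: "y \<in> ?U \<inter> ball x h" "y \<in> ?U \<longrightarrow> (\<lambda>k. f (s k) y) \<longlonglongrightarrow> \<phi> y" by (elim bexE)
   then have "Cauchy (\<lambda>k. f (s k) y)" by (auto intro: LIMSEQ_imp_Cauchy)
   then obtain N where N: "\<And>m n. m \<ge> N ==> n \<ge> N ==> \<bar>f (s m) y - f (s n) y\<bar> < e / 4"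
    using metric_CauchyD[of "\<lambda>k. f (s k) y" "e / 4"] e unfolding dist_real_def by auto
   have yK: "y \<in> K \<inter> ball x h" using y(1) interior_subset by auto
   have "dist (f (s m) x) (f (s n) x) < e" if "m \<ge> N" "n \<ge> N" for m n
    using N[OF that] h(2)[OF yK, of "s m"] h(2)[OF yK, of "s n"] e unfolding dist_real_def abs_le_iff abs_less_iff by (intro conjI; linarith)
   then show "\<exists>M. \<forall>m\<ge>M. \<forall>n\<ge>M. dist (f (s m) x) (f (s n) x) < e" by blast
  qed
  then show ?thesis by (rule Cauchy_convergent)
 qed
 define F where "F x = lim (\<lambda>k. f (s k) x)" for x
 have Fl: "(\<lambda>k. f (s k) x) \<longlonglongrightarrow> F x" if "x \<in> K" for x unfolding F_def using conv[OF that] by (simp add: convergent_LIMSEQ_iff)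
 show ?thesis
 proof (rule that[of F])
  show "continuous_on K F" unfolding continuous_on_iff
  proof (intro ballI allI impI)
   fix b and e :: real assume b: "b \<in> K" and e: "0 < e"
   obtain h where h: "0 < h" "\<And>k y. y \<in> K \<inter> ball b h ==> \<bar>f k y - f k b\<bar> \<le> e / 2" using eqc[OF b, of "e / 2"] e by auto
   show "\<exists>d>0. \<forall>x'\<in>K. dist x' b < d \<longrightarrow> dist (F x') (F b) < e"
   proof (intro exI[of _ h] conjI ballI impI h)
    fix x assume x: "x \<in> K" "dist x b < h"
    have "(\<lambda>k. \<bar>f (s k) x - f (s k) b\<bar>) \<longlonglongrightarrow> \<bar>F x - F b\<bar>" by (intro tendsto_intros Fl x b)
    then have "\<bar>F x - F b\<bar> \<le> e / 2" by (rule tendsto_upperbound) (use h(2)[of x] x in \<open>auto simp: dist_commute\<close>)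
    then show "dist (F x) (F b) < e" using e by (simp add: dist_real_def)
   qed
  qed
  show "AE x in lborel. x \<in> ?U \<longrightarrow> F x = \<phi> x" using ae
  proof eventually_elim
   fix x assume l: "x \<in> ?U \<longrightarrow> (\<lambda>k. f (s k) x) \<longlonglongrightarrow> \<phi> x"
   show "x \<in> ?U \<longrightarrow> F x = \<phi> x" using l Fl[of x] interior_subset[of K] LIMSEQ_unique by blast
  qed
 qed
qed

end

text \<open>Convergence in L^1 together with a bound in L^p suffices against v in L^q. Where |v|
  \<le> M the L^1 convergence acts; the part of v above M is small in L^q and is handled by
  Hoelder's inequality.\<close>

lemma inner_integral_tendsto_weak:
 fixes v g :: "'a::euclidean_space => 'b::euclidean_space"
 assumes pq: "1 < p" "1 < q" "1 / p + 1 / q = 1"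
  and v: "integrable lborel v" "integrable lborel (\<lambda>x. norm (v x) powr q)"
  and [measurable]: "\<And>k. G k \<in> \<B>" "g \<in> \<B>"
  and A: "0 < A" "\<And>k. (\<integral>\<^sup>+x. ennreal (norm (G k x - g x) powr p) \<partial>lborel) \<le> ennreal A"
  and lim: "(\<lambda>k. \<integral>\<^sup>+x. ennreal (norm (G k x - g x)) \<partial>lborel) \<longlonglongrightarrow> 0"
 shows "(\<lambda>k. \<integral>\<^sup>+x. ennreal (norm (G k x - g x) * norm (v x)) \<partial>lborel) \<longlonglongrightarrow> 0"
proof (rule ennreal_tendsto_0I)
 fix e :: real assume e: "0 < e"
 have [measurable]: "v \<in> \<B>" using v(1) by auto
 \<comment> \<open>Chosen so that Hoelder's bound A^(1/p) \<beta>^(1/q) for the part above M equals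
   e/2.\<close>
 define \<beta> where "\<beta> = (e / 2 / A powr (1/p)) powr q"
 have \<beta>: "0 < \<beta>" "A powr (1/p) * \<beta> powr (1/q) = e / 2" using e A pq by (auto simp: \<beta>_def powr_powr)
 define w where "w M x = indicat_real {x. real M < norm (v x)} x * norm (v x)" for M :: nat and x
 have [measurable]: "w M \<in> \<B>" for M unfolding w_def[abs_def] by measurable
 have w0: "0 \<le> w M x" for M x by (auto simp: w_def)
 have "(\<lambda>M. \<integral>x. w M x powr q \<partial>lborel) \<longlonglongrightarrow> (LINT x|(lborel :: 'a measure). 0)"
 proof (rule integral_dominated_convergence[where w="\<lambda>x. norm (v x) powr q"])
  show "AE x in lborel. (\<lambda>M. w M x powr q) \<longlonglongrightarrow> 0"
  proof (rule AE_I2)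
   fix x
   obtain m where m: "norm (v x) \<le> real m" using real_arch_simple by blast
   have "\<forall>\<^sub>F M in sequentially. w M x powr q = 0" using eventually_ge_at_top[of m]
   proof eventually_elim
    fix M assume "m \<le> M"
    then have "norm (v x) \<le> real M" using m by (simp add: order_trans[OF m])
    then show "w M x powr q = 0" using pq by (simp add: w_def)
   qed
   then show "(\<lambda>M. w M x powr q) \<longlonglongrightarrow> 0" by (rule tendsto_eventually)
  qed
  show "AE x in lborel. norm (w M x powr q) \<le> norm (v x) powr q" for M by (rule AE_I2) (auto simp: w_def indicator_def)
 qed (use v in auto)
 then have "\<forall>\<^sub>F M in sequentially. (LBINT x. w M x powr q) < \<beta>" using \<beta>(1) by (intro order_tendstoD(2)) auto
 then obtain M where M: "(LBINT x. w M x powr q) < \<beta>" by (auto simp: eventually_sequentially)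
 have iw: "integrable lborel (\<lambda>x. w M x powr q)" by (rule Bochner_Integration.integrable_bound[OF v(2)]) (auto simp: w_def indicator_def)
 have nw: "(\<integral>\<^sup>+x. ennreal (w M x powr q) \<partial>lborel) \<le> ennreal \<beta>" using nn_integral_eq_integral[OF iw] M by (simp add: ennreal_leI)
 have "\<forall>\<^sub>F k in sequentially. (\<integral>\<^sup>+x. ennreal (norm (G k x - g x)) \<partial>lborel) < ennreal (e / (2 * (real M + 1)))"
  using lim e by (intro order_tendstoD(2)[OF lim]) auto
 then show "\<forall>\<^sub>F k in sequentially. (\<integral>\<^sup>+x. ennreal (norm (G k x - g x) * norm (v x)) \<partial>lborel) \<le> ennreal e"
 proof eventually_elim
  fix k assume k: "(\<integral>\<^sup>+x. ennreal (norm (G k x - g x)) \<partial>lborel) < ennreal (e / (2 * (real M + 1)))"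
  have "(\<integral>\<^sup>+x. ennreal (norm (G k x - g x) * norm (v x)) \<partial>lborel)
    \<le> (\<integral>\<^sup>+x. ennreal (real M) * ennreal (norm (G k x - g x)) + ennreal (norm (G k x - g x) * w M x) \<partial>lborel)"
  proof (rule nn_integral_mono)
   fix x
   have "norm (G k x - g x) * norm (v x) \<le> real M * norm (G k x - g x) + norm (G k x - g x) * w M x"
    by (cases "real M < norm (v x)") (auto simp: w_def mult.commute[of "real M"] intro!: mult_left_mono)
   then show "ennreal (norm (G k x - g x) * norm (v x)) \<le> ennreal (real M) * ennreal (norm (G k x - g x)) + ennreal (norm (G k x - g x) * w M x)"
    using w0[of M x] by (simp add: ennreal_leI flip: ennreal_mult ennreal_plus)
  qed
  also have "\<dots> = ennreal (real M) * (\<integral>\<^sup>+x. ennreal (norm (G k x - g x)) \<partial>lborel) + (\<integral>\<^sup>+x. ennreal (norm (G k x - g x) * w M x) \<partial>lborel)"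
   by (simp add: nn_integral_add nn_integral_cmult)
  also have "\<dots> \<le> ennreal (real M) * ennreal (e / (2 * (real M + 1))) + ennreal (A powr (1/p) * \<beta> powr (1/q))"
   using k A w0 by (intro add_mono mult_left_mono nn_integral_Holder[OF pq] nw \<beta>) auto
  also have "\<dots> = ennreal (real M * (e / (2 * (real M + 1))) + e / 2)"
   unfolding \<beta>(2) using e by (subst ennreal_mult[symmetric], simp, simp, subst ennreal_plus[symmetric]) auto
  also have "\<dots> \<le> ennreal e"
  proof (rule ennreal_leI)
   have "real M * (e / (2 * (real M + 1))) \<le> e / 2" using e by (simp add: field_simps)
   then show "real M * (e / (2 * (real M + 1))) + e / 2 \<le> e" by linarith
  qed
  finally show "(\<integral>\<^sup>+x. ennreal (norm (G k x - g x) * norm (v x)) \<partial>lborel) \<le> ennreal e" .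
 qed
qed

section \<open>Pointwise limits of mollifications; divergence tested on Sobolev functions\<close>

lemma integral_norm_bound_integral_AE:
 fixes f :: "'a => 'b::{banach, second_countable_topology}"
 assumes "integrable M f" "integrable M g" "AE x in M. norm (f x) \<le> g x"
 shows "norm (LINT x|M. f x) \<le> (LINT x|M. g x)" using integral_norm_bound[of M f] integral_mono_AE[OF integrable_norm[OF assms(1)] assms(2,3)] by linarith

lemma integrable_inner_Lp:
 fixes g v :: "'a::euclidean_space => 'b::euclidean_space"
 assumes pq: "1 < p" "1 < q" "1 / p + 1 / q = 1" and [measurable]: "g \<in> \<B>" "v \<in> \<B>"
  and g: "(\<integral>\<^sup>+x. ennreal (norm (g x) powr p) \<partial>lborel) < \<infinity>" and v: "integrable lborel (\<lambda>x. norm (v x) powr q)"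
 shows "integrable lborel (\<lambda>x. g x \<bullet> v x)"
proof (rule integrableI_bounded)
 obtain a where a: "(\<integral>\<^sup>+x. ennreal (norm (g x) powr p) \<partial>lborel) = ennreal a" "0 \<le> a"
  using g by (cases "\<integral>\<^sup>+x. ennreal (norm (g x) powr p) \<partial>lborel") auto
 define b where "b = (LBINT x. norm (v x) powr q)"
 have b: "(\<integral>\<^sup>+x. ennreal (norm (v x) powr q) \<partial>lborel) = ennreal b" "0 \<le> b" using nn_integral_eq_integral[OF v] by (auto simp: b_def)
 have "(\<integral>\<^sup>+x. ennreal (norm (g x \<bullet> v x)) \<partial>lborel) \<le> (\<integral>\<^sup>+x. ennreal (norm (g x) * norm (v x)) \<partial>lborel)"
  by (intro nn_integral_mono ennreal_leI) (simp add: Cauchy_Schwarz_ineq2)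
 also have "\<dots> \<le> ennreal ((a + 1) powr (1/p) * (b + 1) powr (1/q))" by (rule nn_integral_Holder[OF pq]) (use a b in \<open>auto intro: ennreal_leI\<close>)
 finally show "(\<integral>\<^sup>+x. ennreal (norm (g x \<bullet> v x)) \<partial>lborel) < \<infinity>" by (rule order_le_less_trans) simp
qed measurable

lemma moll_near:
 fixes g :: "'a::euclidean_space => 'b::euclidean_space"
 assumes \<eta>: "mollifier d \<eta>" and g: "integrable lborel g"
  and e: "AE z in lborel. \<eta> (z - c *R y) \<noteq> 0 \<longrightarrow> norm (g z - b) \<le> e"
 shows "norm (moll c \<eta> g y - b) \<le> e"
proof -
 note m = mollifierD[OF \<eta>]
 note m(3)[measurable]
 obtain B where B: "\<And>x. \<bar>\<eta> x\<bar> \<le> B" using m(8) by blast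
 note tr = mollifier_translate[OF \<eta>, of "c *R y"]
 have i1: "integrable lborel (\<lambda>z. \<eta> (z - c *R y) *R g z)" by (rule integrable_scaled_bounded[OF g, of _ B]) (use B in auto)
 have i2: "integrable lborel (\<lambda>z. \<eta> (z - c *R y) *R b)" using tr(1) by simp
 have "moll c \<eta> g y - b = (LBINT z. \<eta> (z - c *R y) *R g z - \<eta> (z - c *R y) *R b)" using i1 i2 tr by (simp add: moll_def)
 also have "norm \<dots> \<le> (LBINT z. \<eta> (z - c *R y) * e)"
 proof (rule integral_norm_bound_integral_AE[OF Bochner_Integration.integrable_diff[OF i1 i2]])
  show "AE z in lborel. norm (\<eta> (z - c *R y) *R g z - \<eta> (z - c *R y) *R b) \<le> \<eta> (z - c *R y) * e" using e
  proof eventually_elim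
   fix z assume z: "\<eta> (z - c *R y) \<noteq> 0 \<longrightarrow> norm (g z - b) \<le> e"
   have "norm (\<eta> (z - c *R y) *R g z - \<eta> (z - c *R y) *R b) = \<eta> (z - c *R y) * norm (g z - b)"
    using m(2) by (simp flip: scaleR_diff_right)
   also have "\<dots> \<le> \<eta> (z - c *R y) * e" using z m(2) by (cases "\<eta> (z - c *R y) = 0") (auto intro!: mult_left_mono)
   finally show "norm (\<eta> (z - c *R y) *R g z - \<eta> (z - c *R y) *R b) \<le> \<eta> (z - c *R y) * e" .
  qed
 qed (use tr in simp)
 also have "\<dots> = e" using tr by simp
 finally show ?thesis .
qed

lemma moll_continuous:
 assumes g: "integrable lborel g" and \<eta>: "mollifier d \<eta>"
 shows "continuous_on UNIV (moll c \<eta> g)"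
proof -
 obtain B where B: "\<And>x. \<bar>\<eta> x\<bar> \<le> B" using mollifierD(8)[OF \<eta>] by blast
 have "continuous_on UNIV (\<lambda>y. \<integral>z. \<eta> (z - y) *R g z \<partial>lborel)" by (rule convolution_continuous[OF _ g mollifierD(9)[OF \<eta>] B]) simp
 then show ?thesis unfolding moll_def[abs_def] by (rule continuous_on_compose2) (auto intro!: continuous_intros)
qed

text \<open>The averages at c y only use points of the interior, where g agrees almost everywhere
  with the continuous F. So the limit holds at every point of K, also on the boundary, as is needed
  for measures that charge null sets.\<close>

lemma (in conic_star) moll_tendsto:
 fixes F g :: "'a => 'b::euclidean_space"
 assumes c: "\<And>k. c k \<le> 1" "c \<longlonglongrightarrow> 1" and \<eta>: "\<And>k. mollifier (d k) (\<eta> k)" and d: "d \<longlonglongrightarrow> 0"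
  and sub: "\<And>k y w. y \<in> K ==> w \<in> supp (\<eta> k) ==> c k *R y + w \<in> interior K"
  and g: "integrable lborel g" and F: "continuous_on K F" "AE x in lborel. x \<in> interior K \<longrightarrow> F x = g x" and y: "y \<in> K"
 shows "(\<lambda>k. moll (c k) (\<eta> k) g y) \<longlonglongrightarrow> F y"
  and "(\<And>x. x \<in> K ==> norm (F x) \<le> B) ==> norm (moll (c k) (\<eta> k) g y) \<le> B"
proof -
 have near: "norm (moll (c k) (\<eta> k) g y - b) \<le> e" if e: "\<And>z. z \<in> K ==> norm (z - c k *R y) < d k ==> norm (F z - b) \<le> e" for k b e
 proof (rule moll_near[OF \<eta> g])
  show "AE z in lborel. \<eta> k (z - c k *R y) \<noteq> 0 \<longrightarrow> norm (g z - b) \<le> e" using F(2)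
  proof eventually_elim
   fix z assume z: "z \<in> interior K \<longrightarrow> F z = g z"
   show "\<eta> k (z - c k *R y) \<noteq> 0 \<longrightarrow> norm (g z - b) \<le> e"
   proof
    assume n: "\<eta> k (z - c k *R y) \<noteq> 0"
    then have "z - c k *R y \<in> supp (\<eta> k)" using closure_subset by (force simp: supp_def)
    then have "c k *R y + (z - c k *R y) \<in> interior K" by (rule sub[OF y])
    then have zU: "z \<in> interior K" by simp
    then have "norm (F z - b) \<le> e" using mollifierD(7)[OF \<eta> n] interior_subset by (intro e) auto
    then show "norm (g z - b) \<le> e" using z zU by simp
   qed
  qed
 qed
 show "norm (moll (c k) (\<eta> k) g y) \<le> B" if "\<And>x. x \<in> K ==> norm (F x) \<le> B" using near[of k 0 B] that by simp
 show "(\<lambda>k. moll (c k) (\<eta> k) g y) \<longlonglongrightarrow> F y"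
 proof (rule LIMSEQ_I)
  fix e :: real assume e: "0 < e"
  obtain h where h: "0 < h" "\<And>z. z \<in> K ==> dist z y < h ==> dist (F z) (F y) < e / 2"
   using F(1) y e unfolding continuous_on_iff by (metis half_gt_zero)
  have "(\<lambda>k. d k + (1 - c k) * norm y) \<longlonglongrightarrow> 0 + (1 - 1) * norm y" by (intro tendsto_intros d c)
  then have "\<forall>\<^sub>F k in sequentially. d k + (1 - c k) * norm y < h" using h(1) by (intro order_tendstoD(2)) auto
  then have "\<forall>\<^sub>F k in sequentially. norm (moll (c k) (\<eta> k) g y - F y) < e"
  proof eventually_elim
   fix k assume k: "d k + (1 - c k) * norm y < h"
   have "norm (moll (c k) (\<eta> k) g y - F y) \<le> e / 2"
   proof (rule near)
    fix z assume zK: "z \<in> K" and z: "norm (z - c k *R y) < d k"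
    have "z - y = (z - c k *R y) - (1 - c k) *R y" by (simp add: algebra_simps)
    then have "dist z y \<le> norm (z - c k *R y) + norm ((1 - c k) *R y)" by (simp only: dist_norm norm_triangle_ineq4)
    also have "\<dots> < h" using z k c(1)[of k] by simp
    finally show "norm (F z - F y) \<le> e / 2" using h(2)[OF zK] by (simp add: dist_norm less_imp_le)
   qed
   then show "norm (moll (c k) (\<eta> k) g y - F y) < e" using e by linarith
  qed
  then show "\<exists>no. \<forall>k\<ge>no. norm (moll (c k) (\<eta> k) g y - F y) < e" by (simp add: eventually_sequentially)
 qed
qed

lemma is_C1_gradient_diff_const:
 assumes "is_C1_gradient K f G"
 shows "is_C1_gradient K (\<lambda>x. f x - c) G" unfolding is_C1_gradient_def
proof (intro conjI ballI)
 show "continuous_on K G" using assms by (simp add: is_C1_gradient_def)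
 fix x assume "x \<in> interior K"
 then have "GDERIV f x :> G x" using assms by (simp add: is_C1_gradient_def)
 from GDERIV_diff[OF this GDERIV_const[of c x]] show "GDERIV (\<lambda>x. f x - c) x :> G x" by simp
qed

text \<open>Extends the flux identity from C^1 functions on \<Omega> to Sobolev functions on the
  larger K by shrinking and mollifying the test function. The gradients converge in L^1 and are
  bounded in L^p, enough against v in L^q; the functions converge everywhere on \<Omega>, enough for
  the possibly singular M and N.\<close>

lemma (in conic_star) divergence_sobolev:
 fixes \<eta> :: "nat => 'a => real"
 assumes pq: "1 < p" "1 < q" "1 / p + 1 / q = 1"
  and \<Omega>: "compact \<Omega>" "\<Omega> \<subseteq> K" and v: "Lq_field \<Omega> q v"
  and flux: "\<And>f G. continuous_on \<Omega> f ==> is_C1_gradient \<Omega> f G ==>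
    flux \<Omega> G v = - ((LINT x|M. indicat_real \<Omega> x * f x) - (LINT x|N. indicat_real \<Omega> x * f x))"
  and M: "finite_measure M" "sets M = sets borel" and N: "finite_measure N" "sets N = sets borel"
  and sd: "sobolev_data (interior K) p \<phi> g" and F: "continuous_on K F" "AE x in lborel. x \<in> interior K \<longrightarrow> F x = \<phi> x"
  and \<eta>: "\<And>k. mollifier (d k) (\<eta> k)" and d: "d \<longlonglongrightarrow> 0"
 shows "flux \<Omega> g v = - ((LINT x|M. indicat_real \<Omega> x * F x) - (LINT x|N. indicat_real \<Omega> x * F x))"
proof -
 let ?U = "interior K"
 have \<phi>: "integrable lborel \<phi>" "\<And>x. x \<notin> ?U ==> \<phi> x = 0" and g: "integrable lborel g" "\<And>x. x \<notin> ?U ==> g x = 0" and wg: "weak_grad ?U \<phi> g"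
  and fin: "(\<integral>\<^sup>+x. ennreal (norm (g x) powr p) \<partial>lborel) < \<infinity>" using sd by (auto simp: sobolev_data_def)
 have [measurable]: "g \<in> \<B>" "\<phi> \<in> \<B>" using g \<phi> by auto
 have vi: "integrable lborel v" "integrable lborel (\<lambda>x. norm (v x) powr q)" and [measurable]: "v \<in> \<B>"
  and v0: "\<And>x. x \<notin> interior \<Omega> ==> v x = 0" using v by (auto simp: Lq_field_def)
 obtain a where a: "(\<integral>\<^sup>+x. ennreal (norm (g x) powr p) \<partial>lborel) = ennreal a" "0 \<le> a"
  using fin by (cases "\<integral>\<^sup>+x. ennreal (norm (g x) powr p) \<partial>lborel") auto
 obtain c r where c: "\<And>k. 1/2 \<le> c k" "\<And>k. c k \<le> 1" "c \<longlonglongrightarrow> 1" and r: "(\<lambda>k. d (r k)) \<longlonglongrightarrow> 0" "\<And>k. d (r k) \<le> 1"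
  and sub: "\<And>k y w. y \<in> K ==> w \<in> supp (\<eta> (r k)) ==> c k *R y + w \<in> ?U"
  using approximating_sequence[of d \<eta>, OF \<eta> d] by metis
 define f where "f k = moll (c k) (\<eta> (r k)) \<phi>" for k
 define G where "G k y = c k *R moll (c k) (\<eta> (r k)) g y" for k y
 have C1K: "continuous_on K (f k)" "is_C1_gradient K (f k) (G k)" for k unfolding f_def G_def[abs_def]
  using moll_C1[OF \<phi>(1) g(1) wg mollifierD(1)[OF \<eta>[of "r k"]], of K "c k"] sub by auto
 have int: "interior \<Omega> \<subseteq> ?U" using \<Omega>(2) by (rule interior_mono)
 have C1: "continuous_on \<Omega> (f k)" "is_C1_gradient \<Omega> (f k) (G k)" for k
  using C1K[of k] \<Omega>(2) int unfolding is_C1_gradient_def by (auto intro: continuous_on_subset)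
 have Gc: "continuous_on \<Omega> (G k)" for k using C1(2)[of k] by (simp add: is_C1_gradient_def)
 define Gi where "Gi k x = indicat_real (interior \<Omega>) x *R G k x" for k x
 define gi where "gi x = indicat_real (interior \<Omega>) x *R g x" for x
 have Gim [measurable]: "Gi k \<in> \<B>" for k unfolding Gi_def[abs_def] using C1_gradient_interior_bounded[OF \<Omega>(1) Gc[of k]] by metis
 have gim [measurable]: "gi \<in> \<B>" unfolding gi_def[abs_def] by measurable
 define A where "A = 2 ^ DIM('a) * (a + 1)"
 have GA: "(\<integral>\<^sup>+x. ennreal (norm (Gi k x) powr p) \<partial>lborel) \<le> ennreal A" for k
  unfolding Gi_def G_def A_def by (rule moll_gradient_bound[OF pq \<eta> g(1) c(1,2) a])
 have gA: "(\<integral>\<^sup>+x. ennreal (norm (gi x) powr p) \<partial>lborel) \<le> ennreal A"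
 proof -
  have "(\<integral>\<^sup>+x. ennreal (norm (gi x) powr p) \<partial>lborel) \<le> ennreal a"
   unfolding a(1)[symmetric] using pq by (intro nn_integral_mono ennreal_leI powr_mono2) (auto simp: gi_def indicator_def)
  also have "\<dots> \<le> ennreal A"
  proof (rule ennreal_leI)
   have "1 * a \<le> 2 ^ DIM('a) * (a + 1)" using a(2) by (intro mult_mono) auto
   then show "a \<le> A" by (simp add: A_def)
  qed
  finally show ?thesis .
 qed
 have A0: "0 < A" using a(2) by (simp add: A_def)
 \<comment> \<open>The factor 2^p comes from |a - b|^p \<le> 2^p max(|a|, |b|)^p, and A + A from
   bounding the maximum by the sum.\<close>
 have diffA: "(\<integral>\<^sup>+x. ennreal (norm (Gi k x - gi x) powr p) \<partial>lborel) \<le> ennreal (2 powr p * (A + A))" for k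
 proof -
  have "(\<integral>\<^sup>+x. ennreal (norm (Gi k x - gi x) powr p) \<partial>lborel)
    \<le> (\<integral>\<^sup>+x. ennreal (2 powr p) * (ennreal (norm (Gi k x) powr p) + ennreal (norm (gi x) powr p)) \<partial>lborel)"
  proof (rule nn_integral_mono)
   fix x
   let ?m = "max (norm (Gi k x)) (norm (gi x))"
   have "norm (Gi k x - gi x) \<le> 2 * ?m" using norm_triangle_ineq4[of "Gi k x" "gi x"] by linarith
   then have "norm (Gi k x - gi x) powr p \<le> (2 * ?m) powr p" using pq by (intro powr_mono2) auto
   also have "\<dots> = 2 powr p * ?m powr p" by (simp add: powr_mult)
   also have "\<dots> \<le> 2 powr p * (norm (Gi k x) powr p + norm (gi x) powr p)" by (intro mult_left_mono) (auto simp: max_def)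
   finally show "ennreal (norm (Gi k x - gi x) powr p) \<le> ennreal (2 powr p) * (ennreal (norm (Gi k x) powr p) + ennreal (norm (gi x) powr p))"
    by (simp add: ennreal_leI flip: ennreal_mult ennreal_plus)
  qed
  also have "\<dots> = ennreal (2 powr p) * ((\<integral>\<^sup>+x. ennreal (norm (Gi k x) powr p) \<partial>lborel) + (\<integral>\<^sup>+x. ennreal (norm (gi x) powr p) \<partial>lborel))"
   by (simp add: nn_integral_cmult nn_integral_add)
  also have "\<dots> \<le> ennreal (2 powr p) * (ennreal A + ennreal A)" using GA gA by (intro mult_left_mono add_mono) auto
  also have "\<dots> = ennreal (2 powr p * (A + A))" using A0 by (simp flip: ennreal_mult ennreal_plus)
  finally show ?thesis .
 qed
 obtain R where R: "0 < R" "\<And>x. x \<in> K ==> norm x \<le> R" using compact_imp_bounded[OF compact] bounded_pos by metis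
 have gR: "g x = 0" if "R < norm x" for x using that R(2)[of x] g(2)[of x] interior_subset[of K] by force
 have limg: "(\<lambda>k. \<integral>\<^sup>+x\<in>cball 0 R. ennreal (norm (moll (c k) (\<eta> (r k)) g x - g x)) \<partial>lborel) \<longlonglongrightarrow> 0"
  using R(1) by (intro moll_L1_convergence[OF g(1) gR _ c(1,2,3) \<eta> r(1)]) auto
 \<comment> \<open>The gradient carries the chain rule factor c k, so beside the mollification error
   there is the term (1 - c k) g, which tends to 0 in L^1.\<close>
 have lim: "(\<lambda>k. \<integral>\<^sup>+x. ennreal (norm (Gi k x - gi x)) \<partial>lborel) \<longlonglongrightarrow> 0"
 proof (rule tendsto_sandwich[OF _ _ tendsto_const])
  let ?I = "\<integral>x. norm (g x) \<partial>lborel"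
  show "\<forall>\<^sub>F k in sequentially. (\<integral>\<^sup>+x. ennreal (norm (Gi k x - gi x)) \<partial>lborel)
    \<le> (\<integral>\<^sup>+x\<in>cball 0 R. ennreal (norm (moll (c k) (\<eta> (r k)) g x - g x)) \<partial>lborel) + ennreal ((1 - c k) * ?I)"
  proof (rule always_eventually, rule allI)
   fix k
   have mm [measurable]: "moll (c k) (\<eta> (r k)) g \<in> \<B>"
   proof -
    note m = mollifierD[OF \<eta>[of "r k"]]
    obtain B where B: "\<And>x. \<bar>\<eta> (r k) x\<bar> \<le> B" using m(8) by blast
    have "continuous_on UNIV (moll (c k) (\<eta> (r k)) g)" unfolding moll_def
     by (rule continuous_on_compose2[OF convolution_continuous[OF _ g(1) m(9) B], of UNIV "\<lambda>y. c k *R y"]) (auto intro!: continuous_intros)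
    then show ?thesis by (rule borel_measurable_continuous_onI)
   qed
   have "(\<integral>\<^sup>+x. ennreal (norm (Gi k x - gi x)) \<partial>lborel)
    \<le> (\<integral>\<^sup>+x. ennreal (norm (moll (c k) (\<eta> (r k)) g x - g x)) * indicator (cball 0 R) x + ennreal ((1 - c k) * norm (g x)) \<partial>lborel)"
   proof (rule nn_integral_mono)
    fix x
    show "ennreal (norm (Gi k x - gi x)) \<le> ennreal (norm (moll (c k) (\<eta> (r k)) g x - g x)) * indicator (cball 0 R) x + ennreal ((1 - c k) * norm (g x))"
    proof (cases "x \<in> interior \<Omega>")
     case True
     then have xR: "x \<in> cball 0 R" using R(2)[of x] int interior_subset[of K] by auto
     have "Gi k x - gi x = c k *R (moll (c k) (\<eta> (r k)) g x - g x) - (1 - c k) *R g x" using True by (simp add: Gi_def gi_def G_def algebra_simps)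
     then have "norm (Gi k x - gi x) \<le> c k * norm (moll (c k) (\<eta> (r k)) g x - g x) + (1 - c k) * norm (g x)"
      using norm_triangle_ineq4[of "c k *R (moll (c k) (\<eta> (r k)) g x - g x)" "(1 - c k) *R g x"] c(1)[of k] c(2)[of k] by simp
     also have "c k * norm (moll (c k) (\<eta> (r k)) g x - g x) \<le> 1 * norm (moll (c k) (\<eta> (r k)) g x - g x)"
      using c(2)[of k] by (intro mult_right_mono) auto
     finally show ?thesis using xR c(2)[of k] by (simp add: ennreal_leI flip: ennreal_plus)
    next
     case False
     then show ?thesis by (simp add: Gi_def gi_def)
    qed
   qed
   also have "\<dots> = (\<integral>\<^sup>+x\<in>cball 0 R. ennreal (norm (moll (c k) (\<eta> (r k)) g x - g x)) \<partial>lborel) + (\<integral>\<^sup>+x. ennreal ((1 - c k) * norm (g x)) \<partial>lborel)"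
    by (subst nn_integral_add) auto
   also have "(\<integral>\<^sup>+x. ennreal ((1 - c k) * norm (g x)) \<partial>lborel) = ennreal (LBINT x. (1 - c k) * norm (g x))"
    using g(1) c(2)[of k] by (intro nn_integral_eq_integral) auto
   finally show "(\<integral>\<^sup>+x. ennreal (norm (Gi k x - gi x)) \<partial>lborel)
    \<le> (\<integral>\<^sup>+x\<in>cball 0 R. ennreal (norm (moll (c k) (\<eta> (r k)) g x - g x)) \<partial>lborel) + ennreal ((1 - c k) * ?I)" by simp
  qed
  have "(\<lambda>k. ennreal ((1 - c k) * ?I)) \<longlonglongrightarrow> ennreal ((1 - 1) * ?I)" by (intro tendsto_intros tendsto_ennrealI c)
  then show "(\<lambda>k. (\<integral>\<^sup>+x\<in>cball 0 R. ennreal (norm (moll (c k) (\<eta> (r k)) g x - g x)) \<partial>lborel) + ennreal ((1 - c k) * ?I)) \<longlonglongrightarrow> 0"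
   using tendsto_add[OF limg] by fastforce
 qed auto
 have wk: "(\<lambda>k. \<integral>\<^sup>+x. ennreal (norm (Gi k x - gi x) * norm (v x)) \<partial>lborel) \<longlonglongrightarrow> 0"
  by (rule inner_integral_tendsto_weak[OF pq vi _ _ _ diffA lim]) (use A0 in auto)
 have iGv: "integrable lborel (\<lambda>x. Gi k x \<bullet> v x)" for k
 proof -
  obtain B where "\<And>x. norm (Gi k x) \<le> B" using C1_gradient_interior_bounded[OF \<Omega>(1) Gc[of k]] unfolding Gi_def by metis
  then show ?thesis by (intro integrable_inner_bounded[OF vi(1)]) auto
 qed
 have igv: "integrable lborel (\<lambda>x. gi x \<bullet> v x)" using order_le_less_trans[OF gA] by (intro integrable_inner_Lp[OF pq _ _ _ vi(2)]) auto
 have "(\<lambda>k. ennreal \<bar>flux \<Omega> (G k) v - flux \<Omega> g v\<bar>) \<longlonglongrightarrow> ennreal 0"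
 proof (rule tendsto_sandwich[OF _ _ tendsto_const])
  show "\<forall>\<^sub>F k in sequentially. ennreal \<bar>flux \<Omega> (G k) v - flux \<Omega> g v\<bar> \<le> (\<integral>\<^sup>+x. ennreal (norm (Gi k x - gi x) * norm (v x)) \<partial>lborel)"
  proof (rule always_eventually, rule allI)
   fix k
   have "flux \<Omega> (G k) v - flux \<Omega> g v = (LBINT x. (Gi k x - gi x) \<bullet> v x)"
    using iGv[of k] igv by (simp add: flux_def Gi_def[symmetric] gi_def[symmetric] inner_diff_left)
   also have "ennreal \<bar>\<dots>\<bar> \<le> (\<integral>\<^sup>+x. ennreal (norm ((Gi k x - gi x) \<bullet> v x)) \<partial>lborel)"
    using integral_norm_bound_ennreal[of lborel "\<lambda>x. (Gi k x - gi x) \<bullet> v x"] iGv[of k] igv by (simp add: inner_diff_left)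
   also have "\<dots> \<le> (\<integral>\<^sup>+x. ennreal (norm (Gi k x - gi x) * norm (v x)) \<partial>lborel)"
    by (intro nn_integral_mono ennreal_leI) (simp add: Cauchy_Schwarz_ineq2)
   finally show "ennreal \<bar>flux \<Omega> (G k) v - flux \<Omega> g v\<bar> \<le> (\<integral>\<^sup>+x. ennreal (norm (Gi k x - gi x) * norm (v x)) \<partial>lborel)" .
  qed
  show "(\<lambda>k. \<integral>\<^sup>+x. ennreal (norm (Gi k x - gi x) * norm (v x)) \<partial>lborel) \<longlonglongrightarrow> ennreal 0" using wk by simp
 qed auto
 then have "(\<lambda>k. \<bar>flux \<Omega> (G k) v - flux \<Omega> g v\<bar>) \<longlonglongrightarrow> 0" by (rule tendsto_ennrealD) auto
 then have lim1: "(\<lambda>k. flux \<Omega> (G k) v) \<longlonglongrightarrow> flux \<Omega> g v" by (simp add: tendsto_rabs_zero_iff LIM_zero_iff)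
 obtain B where B: "0 < B" "\<And>x. x \<in> K ==> norm (F x) \<le> B" using continuous_on_compact_bounded[OF compact F(1)] by metis
 have fB: "\<bar>f k y\<bar> \<le> B" if "y \<in> K" for k y unfolding f_def real_norm_def[symmetric]
  by (rule moll_tendsto(2)[where \<eta>="\<lambda>k. \<eta> (r k)" and d="\<lambda>k. d (r k)" and F=F]) (fact c \<eta> r sub \<phi>(1) F B(2) that)+
 have fl: "(\<lambda>k. f k y) \<longlonglongrightarrow> F y" if "y \<in> K" for y
  unfolding f_def by (rule moll_tendsto(1)[where \<eta>="\<lambda>k. \<eta> (r k)" and d="\<lambda>k. d (r k)"]) (fact c \<eta> r sub \<phi>(1) F that)+
 \<comment> \<open>Dominated convergence with the uniform bound B; the pointwise limit is known at
   every point of \<Omega>, so L need not be absolutely continuous.\<close>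
 have lim2: "(\<lambda>k. \<integral>x. indicat_real \<Omega> x * f k x \<partial>L) \<longlonglongrightarrow> (LINT x|L. indicat_real \<Omega> x * F x)"
  if L: "finite_measure L" "sets L = sets borel" for L
 proof (rule integral_dominated_convergence[where w="\<lambda>_. B"])
  interpret finite_measure L by fact
  show "integrable L (\<lambda>_. B)" by simp
  show "(\<lambda>x. indicat_real \<Omega> x * F x) \<in> borel_measurable L"
   using borel_measurable_indicator_mult_continuous[OF \<Omega>(1) continuous_on_subset[OF F(1) \<Omega>(2)]] by (simp cong: measurable_cong_sets[OF L(2) refl])
  show "(\<lambda>x. indicat_real \<Omega> x * f k x) \<in> borel_measurable L" for k
   using borel_measurable_indicator_mult_continuous[OF \<Omega>(1) C1(1)] by (simp cong: measurable_cong_sets[OF L(2) refl])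
  show "AE x in L. (\<lambda>k. indicat_real \<Omega> x * f k x) \<longlonglongrightarrow> indicat_real \<Omega> x * F x"
   using fl \<Omega>(2) by (intro AE_I2) (auto simp: indicator_def)
  show "AE x in L. norm (indicat_real \<Omega> x * f k x) \<le> B" for k using fB \<Omega>(2) B(1) by (intro AE_I2) (auto simp: indicator_def)
 qed
 have "(\<lambda>k. flux \<Omega> (G k) v) \<longlonglongrightarrow> - ((LINT x|M. indicat_real \<Omega> x * F x) - (LINT x|N. indicat_real \<Omega> x * F x))"
  unfolding flux[OF C1] by (intro tendsto_intros lim2 M N)
 then show ?thesis using lim1 LIMSEQ_unique by blast
qed

text \<open>M and N may have common mass and so need not be the Jordan parts of their difference;
  \<open>integral_eq_of_measure_diff\<close> makes this harmless.\<close>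

lemma vint_measure_diff:
 fixes M N :: "'a::euclidean_space measure"
 assumes M: "finite_measure M" "sets M = sets borel" and N: "finite_measure N" "sets N = sets borel"
  and K: "compact K" "continuous_on K F"
 shows "vint K (\<lambda>A. measure M A - measure N A) F = (LINT x|M. indicat_real K x * F x) - (LINT x|N. indicat_real K x * F x)"
proof -
 interpret M: finite_measure M by fact
 interpret N: finite_measure N by fact
 define \<mu> where "\<mu> A = measure M A - measure N A" for A
 have ba: "borel_additive \<mu>" unfolding borel_additive_def \<mu>_def using M N by (auto intro!: sums_diff M.finite_measure_UNION N.finite_measure_UNION)
 obtain C where C: "0 < C" "\<And>x. x \<in> K ==> norm (F x) \<le> C" using continuous_on_compact_bounded[OF K] by metis
 have "(LINT x|jordan_pos \<mu>. indicat_real K x * F x) - (LINT x|jordan_neg \<mu>. indicat_real K x * F x)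
   = (LINT x|M. indicat_real K x * F x) - (LINT x|N. indicat_real K x * F x)"
 proof (rule integral_eq_of_measure_diff[where C=C])
  show "measure (jordan_pos \<mu>) A - measure (jordan_neg \<mu>) A = measure M A - measure N A" if "A \<in> sets borel" for A
   using jordan_decomposition[OF ba that] by (simp add: \<mu>_def)
  show "\<bar>indicat_real K x * F x\<bar> \<le> C" for x using C by (auto simp: indicator_def)
 qed (use M N jordan_pos_measure[OF ba] jordan_pos_measure[OF borel_additive_minus[OF ba]] borel_measurable_indicator_mult_continuous[OF K] in \<open>auto simp: jordan_neg_def\<close>)
 then show ?thesis unfolding \<mu>_def[symmetric] by (simp add: vint_def set_lebesgue_integral_def)
qed

section \<open>Restriction and linearity of \<open>vint\<close>; Radon-Nikodym derivatives\<close>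

lemma vint_restrict:
 fixes q :: "'a::euclidean_space set => 'b::euclidean_space"
 assumes q: "q \<in> vmeasures C" and C: "compact C" "C \<subseteq> D" "compact D" and F: "continuous_on D F"
 shows "vint D q F = vint C q F"
proof -
 let ?T = "total_variation q"
 obtain h where h: "sets ?T = sets borel" "finite_measure ?T" "h \<in> \<B>"
  "\<And>K F. compact K ==> continuous_on K F ==> integrable ?T (\<lambda>x. indicator K x *R (F x \<bullet> h x)) \<and>
    vint K q F = (LINT x:K|?T. F x \<bullet> h x)" by (rule vint_eq_integral_polar[OF vmeasures_borel_additive[OF q]]) blast
 have Fc: "continuous_on C F" using F C(2) by (rule continuous_on_subset)
 have ae: "AE x in ?T. x \<in> C" using total_variation_zero_off[OF q borel_compact[OF C(1)]] .
 have "(LINT x:D|?T. F x \<bullet> h x) = (LINT x:C|?T. F x \<bullet> h x)" unfolding set_lebesgue_integral_def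
 proof (rule integral_cong_AE)
  show "AE x in ?T. indicat_real D x *R (F x \<bullet> h x) = indicat_real C x *R (F x \<bullet> h x)" using ae by eventually_elim (use C(2) in auto)
 qed (use h(4)[OF C(3) F] h(4)[OF C(1) Fc] in auto)
 then show ?thesis using h(4)[OF C(3) F] h(4)[OF C(1) Fc] by simp
qed

lemma vint_diff:
 fixes q :: "'a::euclidean_space set => 'b::euclidean_space"
 assumes q: "borel_additive q" and K: "compact K" and F: "continuous_on K F" "continuous_on K G"
 shows "vint K q (\<lambda>x. F x - G x) = vint K q F - vint K q G"
proof -
 let ?T = "total_variation q"
 obtain h where h: "\<And>F. continuous_on K F ==> integrable ?T (\<lambda>x. indicator K x *R (F x \<bullet> h x)) \<and>
    vint K q F = (LINT x:K|?T. F x \<bullet> h x)" by (rule vint_eq_integral_polar[OF q]) (use K in blast)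
 have "continuous_on K (\<lambda>x. F x - G x)" using F by (intro continuous_intros)
 then show ?thesis using h[OF F(1)] h[OF F(2)] h[of "\<lambda>x. F x - G x"] by (simp add: set_lebesgue_integral_def inner_diff_left right_diff_distrib)
qed

lemma vint_cong: "(\<And>x. x \<in> K ==> F x = G x) ==> vint K q F = vint K q G" unfolding vint_def set_lebesgue_integral_def
 by (intro sum.cong arg_cong2[where f="(-)"] Bochner_Integration.integral_cong) (auto simp: indicator_def)

lemma total_variation_absolutely_continuous:
 fixes q :: "'a::euclidean_space set => 'b::euclidean_space"
 assumes q: "borel_additive q" and ac: "abs_cont_dx q"
 shows "absolutely_continuous lborel (total_variation q)" unfolding absolutely_continuous_def
proof
 fix A assume "A \<in> null_sets (lborel :: 'a measure)"
 then have A: "A \<in> sets borel" "emeasure lborel A = 0" by auto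
 obtain L f where L: "finite_measure L" "sets L = sets borel" and f: "integrable L f"
  and qf: "\<And>A. A \<in> sets borel ==> q A = (LINT x:A|L. f x)" using vmeasure_density_ex[OF q] by blast
 have "(\<Sum>B\<in>P. ennreal (norm (q B))) = 0" if "P \<subseteq> sets borel" "partition_on A P" for P
 proof (rule sum.neutral, rule ballI)
  fix B assume "B \<in> P"
  then have B: "B \<in> sets borel" "B \<subseteq> A" using that by (auto simp: partition_on_def)
  then have "emeasure lborel B = 0" using A emeasure_mono[of B A lborel] by auto
  then show "ennreal (norm (q B)) = 0" using ac B(1) by (simp add: abs_cont_dx_def)
 qed
 then have "(SUP P\<in>{P. finite P \<and> P \<subseteq> sets borel \<and> partition_on A P}. \<Sum>B\<in>P. ennreal (norm (q B))) \<le> 0" by (intro SUP_least) auto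
 then have "emeasure (total_variation q) A = 0" using total_variation_density(2)[OF L(2) f qf A(1)] by simp
 then show "A \<in> null_sets (total_variation q)" using A(1) by (auto simp: null_sets_def total_variation_def)
qed

text \<open>\<open>dq_dx\<close> is a choice, so a density must be exhibited: k h, with k the
  density of the total variation and h the polar direction.\<close>

lemma dq_dx_density:
 fixes q :: "'a::euclidean_space set => 'b::euclidean_space"
 assumes q: "borel_additive q" and ac: "abs_cont_dx q"
 shows "integrable lborel (dq_dx q)" "A \<in> sets borel ==> q A = (LINT x:A|lborel. dq_dx q x)"
proof -
 let ?T = "total_variation q"
 obtain h where h: "sets ?T = sets borel" "finite_measure ?T" "h \<in> \<B>" "\<And>x. norm (h x) \<le> 1"
  "\<And>A. A \<in> sets borel ==> q A = (LINT x:A|?T. h x)" by (rule total_variation_polar[OF q]) blast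
 have ac': "absolutely_continuous lborel ?T" by (rule total_variation_absolutely_continuous[OF q ac])
 obtain k where k: "k \<in> borel_measurable lborel" "AE x in lborel. RN_deriv lborel ?T x = ennreal (k x)" "\<And>x. 0 \<le> k x"
  using sigma_finite_measure.real_RN_deriv[OF sigma_finite_lborel h(2) ac'] h(1) by (metis sets_lborel)
 have km [measurable]: "k \<in> \<B>" using k(1) by simp
 note h(3)[measurable]
 have dT: "density lborel (\<lambda>x. ennreal (k x)) = ?T"
 proof -
  have "density lborel (\<lambda>x. ennreal (k x)) = density lborel (RN_deriv lborel ?T)" using k by (intro density_cong) auto
  also have "\<dots> = ?T" using ac' h(1) by (intro sigma_finite_measure.density_RN_deriv[OF sigma_finite_lborel]) auto
  finally show ?thesis .
 qed
 have hi: "integrable ?T h" by (rule integrable_bounded_borel[OF h(2,1,3,4)])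
 have "integrable lborel (\<lambda>x. k x *R h x)" using hi k(3) unfolding dT[symmetric] by (subst (asm) integrable_density) auto
 moreover have "q A = (LINT x:A|lborel. k x *R h x)" if A [measurable]: "A \<in> sets borel" for A
 proof -
  have "q A = (LINT x|density lborel (\<lambda>x. ennreal (k x)). indicat_real A x *R h x)"
   unfolding dT using h(5)[OF A] by (simp add: set_lebesgue_integral_def)
  also have "\<dots> = (LBINT x. k x *R (indicat_real A x *R h x))" using k(3) by (subst integral_density) auto
  finally show ?thesis by (simp add: set_lebesgue_integral_def mult.commute)
 qed
 ultimately have "\<exists>g. integrable lborel g \<and> (\<forall>A\<in>sets borel. q A = (LINT x:A|lborel. g x))" by blast
 then have "integrable lborel (dq_dx q) \<and> (\<forall>A\<in>sets borel. q A = (LINT x:A|lborel. dq_dx q x))" unfolding dq_dx_def by (rule someI_ex)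
 then show "integrable lborel (dq_dx q)" "A \<in> sets borel ==> q A = (LINT x:A|lborel. dq_dx q x)" by auto
qed

section \<open>The functionals\<close>

definition density_vmeasure :: "('a::euclidean_space => 'a) => 'a set => 'a" where
 "density_vmeasure Q A = (if A \<in> sets borel then LINT x:A|lborel. Q x else 0)"

lemma density_vmeasure_vmeasures:
 assumes "integrable lborel Q" "\<And>x. x \<notin> K ==> Q x = 0" "K \<in> sets borel"
 shows "density_vmeasure Q \<in> vmeasures K" unfolding density_vmeasure_def[abs_def] using assms by (intro density_set_function_vmeasures) auto

lemma density_vmeasure_dq_dx:
 assumes Q: "integrable lborel Q"
 shows "borel_additive (density_vmeasure Q)" "abs_cont_dx (density_vmeasure Q)"
  "total_variation (density_vmeasure Q) = density lborel (\<lambda>x. ennreal (norm (Q x)))"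
  "AE x in lborel. dq_dx (density_vmeasure Q) x = Q x"
proof -
 show ba: "borel_additive (density_vmeasure Q)" by (rule vmeasures_borel_additive[OF density_vmeasure_vmeasures[OF Q, of UNIV]]) auto
 show ac: "abs_cont_dx (density_vmeasure Q)" unfolding abs_cont_dx_def
 proof (intro ballI impI)
  fix A :: "'a set" assume A: "A \<in> sets borel" "emeasure lborel A = 0"
  then have "AE x in lborel. x \<notin> A" by (intro AE_not_in) (auto simp: null_sets_def)
  then have "AE x in lborel. indicat_real A x *R Q x = 0" by eventually_elim auto
  then have "(LBINT x. indicat_real A x *R Q x) = 0" by (rule integral_eq_zero_AE)
  then show "density_vmeasure Q A = 0" by (simp add: density_vmeasure_def set_lebesgue_integral_def)
 qed
 show "total_variation (density_vmeasure Q) = density lborel (\<lambda>x. ennreal (norm (Q x)))"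
  by (rule total_variation_density(1)[OF _ Q]) (auto simp: density_vmeasure_def)
 show "AE x in lborel. dq_dx (density_vmeasure Q) x = Q x"
 proof (rule sigma_finite_measure.density_unique_banach[OF sigma_finite_lborel dq_dx_density(1)[OF ba ac] Q])
  fix A :: "'a set" assume "A \<in> sets lborel"
  then show "(LINT x:A|lborel. dq_dx (density_vmeasure Q) x) = (LINT x:A|lborel. Q x)" using dq_dx_density(2)[OF ba ac, of A] by (simp add: density_vmeasure_def)
 qed
qed

lemma vint_density_vmeasure:
 assumes Q: "integrable lborel Q" and K: "compact K" "continuous_on K F"
 shows "vint K (density_vmeasure Q) F = (LBINT x. (indicat_real K x *R F x) \<bullet> Q x)"
proof -
 obtain C where C: "\<And>x. x \<in> K ==> norm (F x) \<le> C" using continuous_on_compact_bounded[OF K] by metis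
 have "vint K (density_vmeasure Q) F = (LINT x:K|lborel. F x \<bullet> Q x)"
  using K by (intro vint_density[OF density_vmeasure_dq_dx(1)[OF Q] _ Q _ _ C] borel_measurable_continuous_on_indicator)
   (auto simp: density_vmeasure_def borel_compact)
 then show ?thesis by (simp add: set_lebesgue_integral_def)
qed

context conic_star
begin

text \<open>K lies in the closure of its interior, so a disagreement at x would persist on a
  nonempty open subset of the interior. It makes the choices in \<open>cont_rep\<close> and
  \<open>C1_gradient\<close> harmless on all of K.\<close>

lemma continuous_eq_of_AE:
 assumes "continuous_on K F" "continuous_on K f" "AE x in lborel. x \<in> interior K \<longrightarrow> F x = f x" and x: "x \<in> K"
 shows "F x = (f x :: real)"
proof (rule ccontr)
 assume ne: "F x \<noteq> f x"
 have "continuous_on K (\<lambda>x. \<bar>F x - f x\<bar>)" using assms by (intro continuous_intros)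
 moreover have "0 < \<bar>F x - f x\<bar>" using ne by simp
 ultimately obtain r where r: "0 < r" "\<And>y. y \<in> K ==> dist y x < r ==> dist \<bar>F y - f y\<bar> \<bar>F x - f x\<bar> < \<bar>F x - f x\<bar>"
  unfolding continuous_on_iff using x by metis
 have "x \<in> closure (interior K)" using x subset_closure_interior by auto
 then have "interior K \<inter> ball x r \<noteq> {}" using r(1) by (auto simp: closure_approachable dist_commute disjoint_iff)
 then have "\<exists>y\<in>interior K \<inter> ball x r. y \<in> interior K \<longrightarrow> F y = f y"
  by (intro AE_open_nonempty[OF assms(3)] open_Int open_interior open_ball)
 then obtain y where y: "y \<in> interior K" "dist x y < r" "F y = f y" by auto
 then show False using r(2)[of y] interior_subset[of K] by (auto simp: dist_commute)
qed

lemma AE_interior: "AE x in lborel. x \<in> K \<longrightarrow> x \<in> interior K"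
proof -
 have "frontier K \<in> null_sets lebesgue" using negligible_frontier by (simp add: negligible_iff_null_sets)
 moreover have "frontier K \<in> sets borel" by simp
 ultimately have "frontier K \<in> null_sets lborel" by (auto simp: null_sets_def)
 then have "AE x in lborel. x \<notin> frontier K" by (rule AE_not_in)
 then show ?thesis by eventually_elim (use closure_subset in \<open>auto simp: frontier_def\<close>)
qed

end

text \<open>The sequence of parameters is replaced by its index: s n, d n and \<eta> n belong to
  \<tau> n, with d n a radius for the support of \<eta> n. M and N are the two probability measures,
  W the extended weight and p the exponent conjugate to \<alpha>.\<close>

locale gamma_setting = conic_star \<Omega> for \<Omega> :: "'a::euclidean_space set" +
 fixes s \<tau> d :: "nat => real" and \<eta> :: "nat => 'a => real" and p \<alpha> :: real
  and M N :: "'a measure" and W :: "'a => real" and K :: "nat => 'a set"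
 assumes s: "\<And>n. 0 < s n" "s \<longlonglongrightarrow> 0" and \<tau>: "\<And>n. 0 < \<tau> n" "\<tau> \<longlonglongrightarrow> 0"
  and \<eta>: "\<And>n. mollifier (d n) (\<eta> n)" and d: "d \<longlonglongrightarrow> 0"
  and pq: "1 < p" "1 < \<alpha>" "1 / p + 1 / \<alpha> = 1" and pd: "real DIM('a) < p" and conj: "conj_exp \<alpha> = p"
  and prob: "borel_prob_on \<Omega> M" "borel_prob_on \<Omega> N"
 defines "K \<equiv> \<lambda>n. (\<lambda>x. (1 + s n) *R x) ` \<Omega>"
 assumes W: "continuous_on (\<Union>n. K n) W" "\<And>x. x \<in> (\<Union>n. K n) ==> 0 \<le> W x"
begin

definition \<mu> :: "'a set => real" where "\<mu> A = measure M A - measure N A"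

text \<open>The integral of f against \<mu>, written with the two given measures; both the
  constraint on K n and the one on \<Omega> are reduced to it.\<close>

definition pairing :: "('a => real) => real" where
 "pairing f = (LINT x|M. indicat_real \<Omega> x * f x) - (LINT x|N. indicat_real \<Omega> x * f x)"

lemma conic_star_K: "conic_star (K n)" unfolding K_def using s(1)[of n] by (intro conic_star_scale) auto

lemma compact_K: "compact (K n)" by (rule conic_star.compact[OF conic_star_K])

lemma subset_interior_K: "\<Omega> \<subseteq> interior (K n)"
proof
 fix x assume x: "x \<in> \<Omega>"
 have "(1 / (1 + s n)) *R x \<in> interior \<Omega>" using s(1)[of n] by (intro star x) auto
 then have "(1 + s n) *R ((1 / (1 + s n)) *R x) \<in> (\<lambda>x. (1 + s n) *R x) ` interior \<Omega>" by (rule imageI)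
 then show "x \<in> interior (K n)" using s(1)[of n] unfolding K_def by (subst interior_scaleR_image) auto
qed

lemma subset_K: "\<Omega> \<subseteq> K n" using subset_interior_K interior_subset by blast

lemma scale_K: "x \<in> K n ==> (1 / (1 + s n)) *R x \<in> \<Omega>" using s(1)[of n] by (auto simp: K_def)

lemma K_mono: "s n \<le> s m ==> K n \<subseteq> K m"
proof
 fix y assume le: "s n \<le> s m" and "y \<in> K n"
 then obtain x where x: "x \<in> \<Omega>" "y = (1 + s n) *R x" by (auto simp: K_def)
 have "((1 + s n) / (1 + s m)) *R x \<in> \<Omega>"
  using star[OF x(1), of "(1 + s n) / (1 + s m)"] interior_subset[of \<Omega>] le x(1) s(1)[of n] by (cases "s n = s m") auto
 then have "(1 + s m) *R (((1 + s n) / (1 + s m)) *R x) \<in> K m" unfolding K_def by (rule imageI)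
 then show "y \<in> K m" using s(1)[of m] x(2) by auto
qed

text \<open>s is positive and tends to 0, so it attains its maximum, and the corresponding dilate
  contains all others by the star shape. Hence the union is compact, which the boundedness and
  semicontinuity arguments for weak-* convergence require.\<close>

lemma Union_K: obtains m where "(\<Union>n. K n) = K m"
proof -
 have "\<forall>\<^sub>F n in sequentially. s n < s 0" using s by (intro order_tendstoD(2)) auto
 then obtain n0 where n0: "\<And>n. n \<ge> n0 ==> s n < s 0" by (auto simp: eventually_sequentially)
 have "Max (s ` {..n0}) \<in> s ` {..n0}" by (intro Max_in) auto
 then obtain m where m: "s m = Max (s ` {..n0})" by (elim imageE) simp
 have le: "s n \<le> s m" if "n \<le> n0" for n unfolding m using that by (intro Max_ge) auto
 have "s n \<le> s m" for n using le[of n] le[of 0] n0[of n] by (cases "n \<le> n0") auto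
 then show ?thesis using K_mono by (intro that[of m]) blast
qed

lemma W_K: "continuous_on (K n) W" "x \<in> K n ==> 0 \<le> W x" using W by (auto intro: continuous_on_subset)

lemma W_\<Omega>: "continuous_on \<Omega> W" "x \<in> \<Omega> ==> 0 \<le> W x"
 using W_K[of 0] W_K(2)[of x 0] subset_K[of 0] by (auto intro: continuous_on_subset)

lemma prob_measure:
 assumes "borel_prob_on \<Omega> L"
 shows "finite_measure L" "sets L = sets borel" "AE x in L. x \<in> \<Omega>" "measure L UNIV = 1"
proof -
 show sL: "sets L = sets borel" using assms by (simp add: borel_prob_on_def)
 have sp: "space L = UNIV" by (rule space_of_sets_borel[OF sL])
 show "finite_measure L" using assms sp by (intro finite_measureI) (simp add: borel_prob_on_def)
 show "measure L UNIV = 1" using assms by (simp add: borel_prob_on_def measure_def)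
 have O: "\<Omega> \<in> sets L" using compact sL by (simp add: borel_compact)
 have "emeasure L (UNIV - \<Omega>) = 0" using emeasure_compl[OF O] assms sp by (simp add: borel_prob_on_def)
 then have "UNIV - \<Omega> \<in> null_sets L" using O sp sets.compl_sets[OF O] by (auto simp: null_sets_def)
 then have "AE x in L. x \<notin> UNIV - \<Omega>" by (rule AE_not_in)
 then show "AE x in L. x \<in> \<Omega>" by eventually_elim auto
qed

lemma pairing_integral_eq:
 assumes "continuous_on (K n) F" "borel_prob_on \<Omega> L"
 shows "(LINT x|L. indicat_real (K n) x * F x) = (LINT x|L. indicat_real \<Omega> x * F x)"
proof (rule integral_cong_AE)
 note L = prob_measure[OF assms(2)]
 show "AE x in L. indicat_real (K n) x * F x = indicat_real \<Omega> x * F x" using L(3) by eventually_elim (use subset_K[of n] in auto)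
 show "(\<lambda>x. indicat_real (K n) x * F x) \<in> borel_measurable L"
  using borel_measurable_indicator_mult_continuous[OF compact_K assms(1)] by (simp cong: measurable_cong_sets[OF L(2) refl])
 show "(\<lambda>x. indicat_real \<Omega> x * F x) \<in> borel_measurable L"
  using borel_measurable_indicator_mult_continuous[OF compact continuous_on_subset[OF assms(1) subset_K]] by (simp cong: measurable_cong_sets[OF L(2) refl])
qed

lemma vint_K_eq_pairing: "continuous_on (K n) F ==> vint (K n) \<mu> F = pairing F" unfolding \<mu>_def[abs_def] pairing_def using prob_measure prob
 by (subst vint_measure_diff) (auto simp: compact_K pairing_integral_eq)

lemma vint_eq_pairing: "continuous_on \<Omega> F ==> vint \<Omega> \<mu> F = pairing F"
 unfolding \<mu>_def[abs_def] pairing_def using prob_measure prob compact by (subst vint_measure_diff) auto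

text \<open>Both measures have mass 1, so constants cancel. This removes the zero mean condition on
  the test functions of both constraints.\<close>

lemma pairing_add_const:
 assumes "continuous_on \<Omega> f"
 shows "pairing (\<lambda>x. f x - c) = pairing f"
proof -
 have "(LINT x|L. indicat_real \<Omega> x * (f x - c)) = (LINT x|L. indicat_real \<Omega> x * f x) - c" if L: "borel_prob_on \<Omega> L" for L
 proof -
  note m = prob_measure[OF L]
  interpret finite_measure L by (rule m)
  have i: "integrable L (\<lambda>x. indicat_real \<Omega> x * f x)" using integrable_indicator_continuous[OF compact assms m(1,2)] by simp
  have [measurable]: "\<Omega> \<in> sets L" using compact m(2) by (simp add: borel_compact)
  have "measure L \<Omega> = 1" using L by (simp add: borel_prob_on_def measure_def)
  then show ?thesis using i by (simp add: right_diff_distrib space_of_sets_borel[OF m(2)] less_top[symmetric])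
 qed
 then show ?thesis using prob by (simp add: pairing_def)
qed

text \<open>Verifies all admissibility conditions for a field supported in \<Omega> and evaluates
  its energy on K n. The hypothesis \<open>div\<close> speaks of representatives, so that it applies
  to whichever versions \<open>weak_gradient\<close> and \<open>cont_rep\<close> select.\<close>

lemma recovery_energy:
 assumes Q: "Lq_field \<Omega> \<alpha> Q"
  and div: "\<And>\<phi> g F. sobolev_data (interior (K n)) p \<phi> g ==> continuous_on (K n) F ==>
   (AE x in lborel. x \<in> interior (K n) \<longrightarrow> F x = \<phi> x) ==> flux \<Omega> g Q = - pairing F"
 shows "H_eps \<alpha> W \<mu> (K n) e (density_vmeasure Q)
  = (\<integral>\<^sup>+x\<in>\<Omega>. ennreal (W x * norm (Q x)) \<partial>lborel) + ennreal (e / \<alpha> * (LBINT x. norm (Q x) powr \<alpha>))"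
proof -
 let ?q = "density_vmeasure Q" and ?U = "interior (K n)"
 interpret Kn: conic_star "K n" by (rule conic_star_K)
 have Qi: "integrable lborel Q" and Qa: "integrable lborel (\<lambda>x. norm (Q x) powr \<alpha>)"
  and Qm [measurable]: "Q \<in> \<B>" and Q0: "\<And>x. x \<notin> interior \<Omega> ==> Q x = 0" using Q by (auto simp: Lq_field_def)
 have Q1: "Q x = 0" if "x \<notin> \<Omega>" for x using that Q0 interior_subset[of \<Omega>] by blast
 have Q2: "Q x = 0" if "x \<notin> K n" for x using that Q1 subset_K by blast
 note D = density_vmeasure_dq_dx[OF Qi]
 have Kb: "K n \<in> sets borel" by (rule borel_compact[OF compact_K])
 have dm [measurable]: "dq_dx ?q \<in> \<B>" using dq_dx_density(1)[OF D(1,2)] by auto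
 have q: "?q \<in> vmeasures (K n)" by (rule density_vmeasure_vmeasures[OF Qi Q2 Kb])
 have L: "(LINT x|lebesgue_on (K n). norm (dq_dx ?q x) powr \<alpha>) = (LBINT x. norm (Q x) powr \<alpha>)"
  "integrable (lebesgue_on (K n)) (\<lambda>x. norm (dq_dx ?q x) powr \<alpha>)"
 proof -
  have m: "(\<lambda>x. norm (dq_dx ?q x) powr \<alpha>) \<in> borel_measurable (lebesgue_on (K n))" by (intro borel_measurable_lebesgue_on) measurable
  have ae: "AE x in lborel. x \<in> K n \<longrightarrow> norm (dq_dx ?q x) powr \<alpha> = norm (Q x) powr \<alpha>" using D(4) by eventually_elim auto
  note l = lint_lebesgue_on[OF Kb m _ _ ae]
  show "(LINT x|lebesgue_on (K n). norm (dq_dx ?q x) powr \<alpha>) = (LBINT x. norm (Q x) powr \<alpha>)" using Q2 pq by (intro l) auto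
  show "integrable (lebesgue_on (K n)) (\<lambda>x. norm (dq_dx ?q x) powr \<alpha>)" using Q2 pq Qa by (subst l) auto
 qed
 have Lp: "dq_dx ?q \<in> Lp \<alpha> (K n)" unfolding Lp_def using L borel_measurable_lebesgue_on[OF dm] by auto
 have nrm: "Lp_norm \<alpha> (K n) (dq_dx ?q) powr \<alpha> = (LBINT x. norm (Q x) powr \<alpha>)"
  unfolding Lp_norm_def L(1) using pq by (simp add: powr_powr integral_nonneg_AE)
 have ediv: "eq_Wm1_perp \<alpha> (K n) (div_Lp (K n) (dq_dx ?q)) (measure_as_Wm1 (K n) \<mu>)" unfolding eq_Wm1_perp_def conj
 proof (rule ballI)
  fix f assume "f \<in> W1_mean0 p (K n)"
  then have f: "f \<in> W1 p (K n)" by (simp add: W1_mean0_def)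
  obtain \<phi> g where sd: "sobolev_data ?U p \<phi> g" and f\<phi>: "AE x in lborel. x \<in> ?U \<longrightarrow> f x = \<phi> x"
   and wg: "AE x in lborel. x \<in> ?U \<longrightarrow> weak_gradient ?U f x = g x"
   and wm: "weak_gradient ?U f \<in> borel_measurable (lebesgue_on ?U)" by (rule W1_data[OF compact_K pq(1) f \<eta> d]) blast
  obtain h where h: "continuous_on (K n) h" "AE x in lborel. x \<in> ?U \<longrightarrow> h x = \<phi> x"
   by (rule Kn.sobolev_continuous_version[OF pq pd sd \<eta> d]) blast
  have hf: "AE x in lborel. x \<in> ?U \<longrightarrow> h x = f x" using h(2) f\<phi> by eventually_elim auto
  \<comment> \<open>Only the existence of a continuous representative, obtained from p > d, tells
    anything about the value chosen by \<open>cont_rep\<close>.\<close>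
  have "\<exists>h. continuous_on (K n) h \<and> (AE x in lebesgue_on ?U. h x = f x)" using h(1) hf by (intro exI[of _ h]) (simp add: AE_lebesgue_on_iff)
  then have "continuous_on (K n) (cont_rep (K n) f) \<and> (AE x in lebesgue_on ?U. cont_rep (K n) f x = f x)" unfolding cont_rep_def by (rule someI_ex)
  then have F: "continuous_on (K n) (cont_rep (K n) f)" "AE x in lborel. x \<in> ?U \<longrightarrow> cont_rep (K n) f x = f x" by (auto simp: AE_lebesgue_on_iff)
  have F\<phi>: "AE x in lborel. x \<in> ?U \<longrightarrow> cont_rep (K n) f x = \<phi> x" using F(2) f\<phi> by eventually_elim auto
  have [measurable]: "g \<in> \<B>" and g0: "\<And>x. x \<notin> ?U ==> g x = 0" using sd by (auto simp: sobolev_data_def)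
  have "(LINT x|lebesgue_on ?U. dq_dx ?q x \<bullet> weak_gradient ?U f x) = (LBINT x. Q x \<bullet> g x)"
  proof (rule lint_lebesgue_on(1))
   show "(\<lambda>x. dq_dx ?q x \<bullet> weak_gradient ?U f x) \<in> borel_measurable (lebesgue_on ?U)"
    using wm borel_measurable_lebesgue_on[OF dm, of ?U] by (intro borel_measurable_inner)
   show "AE x in lborel. x \<in> ?U \<longrightarrow> dq_dx ?q x \<bullet> weak_gradient ?U f x = Q x \<bullet> g x" using D(4) wg by eventually_elim auto
  qed (use g0 in auto)
  also have "\<dots> = flux \<Omega> g Q"
   unfolding flux_def by (intro Bochner_Integration.integral_cong refl) (use Q0 in \<open>auto simp: indicator_def inner_commute\<close>)
  also have "\<dots> = - pairing (cont_rep (K n) f)" by (rule div[OF sd F(1) F\<phi>])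
  finally show "div_Lp (K n) (dq_dx ?q) f = measure_as_Wm1 (K n) \<mu> f" by (simp add: div_Lp_def measure_as_Wm1_def vint_K_eq_pairing[OF F(1)])
 qed
 have [measurable]: "(\<lambda>x. indicator (K n) x * ennreal (W x)) \<in> \<B>"
 proof -
  have "(\<lambda>x. ennreal (indicat_real (K n) x * W x)) \<in> \<B>"
   using borel_measurable_indicator_mult_continuous[OF compact_K W_K(1)[of n]] by measurable
  moreover have "ennreal (indicat_real (K n) x * W x) = indicator (K n) x * ennreal (W x)" for x by (auto simp: indicator_def)
  ultimately show ?thesis by simp
 qed
 have "(\<integral>\<^sup>+x\<in>K n. ennreal (W x) \<partial>total_variation ?q) = (\<integral>\<^sup>+x. ennreal (norm (Q x)) * (indicator (K n) x * ennreal (W x)) \<partial>lborel)"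
  unfolding D(3) by (subst mult.commute, subst nn_integral_density) auto
 also have "\<dots> = (\<integral>\<^sup>+x\<in>\<Omega>. ennreal (W x * norm (Q x)) \<partial>lborel)"
 proof (intro nn_integral_cong)
  fix x show "ennreal (norm (Q x)) * (indicator (K n) x * ennreal (W x)) = ennreal (W x * norm (Q x)) * indicator \<Omega> x"
   using subset_K[of n] W_\<Omega>(2)[of x] Q1[of x] by (cases "x \<in> \<Omega>") (auto simp: ennreal_mult mult.commute)
 qed
 finally show ?thesis unfolding H_eps_def using q D(2) Lp ediv nrm by simp
qed

text \<open>Translates the constraint from mean zero Sobolev functions and the density of q to
  arbitrary C^1 functions on K n and the measure q itself, the form in which it survives a weak-*
  limit.\<close>

lemma finite_energy_divergence:
 assumes fin: "H_eps \<alpha> W \<mu> (K n) e q < \<infinity>"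
 shows "q \<in> vmeasures (K n)"
  and "continuous_on (K n) f ==> is_C1_gradient (K n) f G ==> vint (K n) q G = - pairing f"
proof -
 let ?U = "interior (K n)"
 interpret Kn: conic_star "K n" by (rule conic_star_K)
 have q: "q \<in> vmeasures (K n)" and ac: "abs_cont_dx q" and ediv: "eq_Wm1_perp \<alpha> (K n) (div_Lp (K n) (dq_dx q)) (measure_as_Wm1 (K n) \<mu>)"
  using fin by (auto simp: H_eps_def split: if_splits)
 then show "q \<in> vmeasures (K n)" by simp
 assume f: "continuous_on (K n) f" and G: "is_C1_gradient (K n) f G"
 have ba: "borel_additive q" by (rule vmeasures_borel_additive[OF q])
 note D = dq_dx_density[OF ba ac]
 have dm [measurable]: "dq_dx q \<in> \<B>" using D(1) by auto
 define m where "m = measure lborel ?U"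
 have Ub: "bounded ?U" using Kn.compact compact_imp_bounded bounded_interior by blast
 have Ufin: "emeasure lborel ?U < \<infinity>" using Ub by (rule emeasure_bounded_finite)
 have m0: "m > 0"
 proof -
  obtain r where r: "0 < r" "ball 0 r \<subseteq> ?U" using Kn.zero_in_interior open_contains_ball[of ?U] by auto
  have "0 < measure lborel (ball (0::'a) r)" using r by (intro content_ball_pos)
  also have "\<dots> \<le> m" unfolding m_def using r Ufin by (intro measure_mono_fmeasurable) (auto simp: fmeasurable_def)
  finally show ?thesis .
 qed
 have ifU: "integrable lborel (\<lambda>x. indicat_real ?U x * f x)"
 proof (rule Bochner_Integration.integrable_bound[OF borel_integrable_compact[OF Kn.compact f]])
  show "(\<lambda>x. indicat_real ?U x * f x) \<in> borel_measurable lborel"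
   using borel_measurable_continuous_on_indicator[OF _ continuous_on_subset[OF f interior_subset]] by simp
  show "AE x in lborel. norm (indicat_real ?U x * f x) \<le> norm (indicat_real (K n) x *R f x)"
   using interior_subset[of "K n"] by (intro AE_I2) (auto simp: indicator_def)
 qed
 \<comment> \<open>The mean of f over the interior is subtracted to obtain an admissible test
   function; the gradient and the pairing with \<mu> do not change.\<close>
 define c where "c = (LBINT x. indicat_real ?U x * f x) / m"
 define f0 where "f0 x = f x - c" for x
 have f0: "continuous_on (K n) f0" unfolding f0_def[abs_def] using f by (intro continuous_intros)
 have G0: "is_C1_gradient (K n) f0 G" unfolding f0_def[abs_def] by (rule is_C1_gradient_diff_const[OF G])
 have Gc: "continuous_on (K n) G" using G by (simp add: is_C1_gradient_def)
 have f0m: "(\<lambda>x. indicat_real ?U x * f0 x) \<in> \<B>"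
  using borel_measurable_continuous_on_indicator[OF _ continuous_on_subset[OF f0 interior_subset]] by simp
 note C = C1_W1[OF Kn.compact pq(1) f0 G0 \<eta> d]
 have "(LINT x|lebesgue_on ?U. f0 x) = (LBINT x. indicat_real ?U x * f0 x)"
 proof (rule lint_lebesgue_on(1)[OF _ _ f0m])
  show "f0 \<in> borel_measurable (lebesgue_on ?U)" using C(1) by (simp add: W1_def Lp_def)
 qed auto
 also have "\<dots> = (LBINT x. indicat_real ?U x * f x - c * indicat_real ?U x)" by (intro Bochner_Integration.integral_cong) (auto simp: f0_def indicator_def)
 also have "\<dots> = (LBINT x. indicat_real ?U x * f x) - c * m" using ifU Ufin by (subst Bochner_Integration.integral_diff) (auto simp: m_def)
 also have "\<dots> = 0" using m0 by (simp add: c_def)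
 finally have "f0 \<in> W1_mean0 p (K n)" using C(1) by (simp add: W1_mean0_def)
 then have e: "div_Lp (K n) (dq_dx q) f0 = measure_as_Wm1 (K n) \<mu> f0" using ediv conj by (simp add: eq_Wm1_perp_def)
 obtain B where B: "\<And>x. norm (indicat_real ?U x *R G x) \<le> B" and GUm [measurable]: "(\<lambda>x. indicat_real ?U x *R G x) \<in> \<B>"
  using C1_gradient_interior_bounded[OF Kn.compact Gc] by metis
 have "(LINT x|lebesgue_on ?U. dq_dx q x \<bullet> weak_gradient ?U f0 x) = (LBINT x. (indicat_real ?U x *R G x) \<bullet> dq_dx q x)"
 proof (rule lint_lebesgue_on(1))
  show "(\<lambda>x. dq_dx q x \<bullet> weak_gradient ?U f0 x) \<in> borel_measurable (lebesgue_on ?U)"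
   using C(3) borel_measurable_lebesgue_on[OF dm, of ?U] by (intro borel_measurable_inner)
  show "AE x in lborel. x \<in> ?U \<longrightarrow> dq_dx q x \<bullet> weak_gradient ?U f0 x = (indicat_real ?U x *R G x) \<bullet> dq_dx q x"
   using C(2) by eventually_elim (auto simp: inner_commute)
  show "(\<lambda>x. (indicat_real ?U x *R G x) \<bullet> dq_dx q x) \<in> \<B>" by measurable
 qed auto
 \<comment> \<open>\<open>div_Lp\<close> integrates over the interior and \<open>vint\<close> over
   all of K n; the frontier is a Lebesgue null set and q has a density.\<close>
 also have "\<dots> = (LBINT x. (indicat_real (K n) x *R G x) \<bullet> dq_dx q x)"
 proof (rule integral_cong_AE)
  show "AE x in lborel. (indicat_real ?U x *R G x) \<bullet> dq_dx q x = (indicat_real (K n) x *R G x) \<bullet> dq_dx q x"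
   using Kn.AE_interior by eventually_elim (use interior_subset[of "K n"] in \<open>auto simp: indicator_def\<close>)
  have [measurable]: "(\<lambda>x. indicat_real (K n) x *R G x) \<in> \<B>"
   using Gc Kn.compact by (intro borel_measurable_continuous_on_indicator) (auto simp: borel_compact)
  show "(\<lambda>x. (indicat_real (K n) x *R G x) \<bullet> dq_dx q x) \<in> borel_measurable lborel" by measurable
 qed measurable
 also have "\<dots> = vint (K n) q G"
 proof -
  obtain B' where "\<And>x. x \<in> K n ==> norm (G x) \<le> B'" using continuous_on_compact_bounded[OF Kn.compact Gc] by metis
  then have "vint (K n) q G = (LINT x:K n|lborel. G x \<bullet> dq_dx q x)"
   using Gc Kn.compact by (intro vint_density[OF ba _ D(1) D(2)] borel_measurable_continuous_on_indicator) (auto simp: borel_compact)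
  then show ?thesis by (simp add: set_lebesgue_integral_def)
 qed
 finally have l: "div_Lp (K n) (dq_dx q) f0 = - vint (K n) q G" by (simp add: div_Lp_def)
 have "\<exists>h. continuous_on (K n) h \<and> (AE x in lebesgue_on ?U. h x = f0 x)" using f0 by (intro exI[of _ f0]) auto
 then have "continuous_on (K n) (cont_rep (K n) f0) \<and> (AE x in lebesgue_on ?U. cont_rep (K n) f0 x = f0 x)" unfolding cont_rep_def by (rule someI_ex)
 then have "continuous_on (K n) (cont_rep (K n) f0)" "AE x in lborel. x \<in> ?U \<longrightarrow> cont_rep (K n) f0 x = f0 x" by (auto simp: AE_lebesgue_on_iff)
 then have "measure_as_Wm1 (K n) \<mu> f0 = vint (K n) \<mu> f0" unfolding measure_as_Wm1_def by (intro vint_cong Kn.continuous_eq_of_AE[OF _ f0])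
 also have "\<dots> = pairing f0" by (rule vint_K_eq_pairing[OF f0])
 also have "\<dots> = pairing f" unfolding f0_def[abs_def] by (rule pairing_add_const[OF continuous_on_subset[OF f subset_K]])
 finally show "vint (K n) q G = - pairing f" using e l by simp
qed

end

section \<open>Lower bound\<close>

lemma vmeasures_of_AE:
 fixes q :: "'a::euclidean_space set => 'b::euclidean_space"
 assumes q: "q \<in> vmeasures K" and ae: "AE x in total_variation q. x \<in> C" and C: "C \<in> sets borel"
 shows "q \<in> vmeasures C"
proof -
 obtain h where h: "sets (total_variation q) = sets borel" "h \<in> \<B>"
  "\<And>A. A \<in> sets borel ==> q A = (LINT x:A|total_variation q. h x)" by (rule total_variation_polar[OF vmeasures_borel_additive[OF q]]) blast
 note hm = h(2)[measurable] and s = h(1)[measurable_cong]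
 have "q A = q (A \<inter> C)" if A: "A \<in> sets borel" for A
 proof -
  have [measurable]: "A \<in> sets borel" "C \<in> sets borel" using A C by auto
  have "(LINT x|total_variation q. indicat_real A x *R h x) = (LINT x|total_variation q. indicat_real (A \<inter> C) x *R h x)"
  proof (rule integral_cong_AE)
   show "AE x in total_variation q. indicat_real A x *R h x = indicat_real (A \<inter> C) x *R h x"
    using ae by eventually_elim (auto simp: indicator_def)
  qed measurable
  then show ?thesis using h(3)[OF A] h(3)[of "A \<inter> C"] A C by (simp add: set_lebesgue_integral_def)
 qed
 then show ?thesis using q unfolding vmeasures_def mem_Collect_eq by (elim conjE, intro conjI) (assumption | blast)+
qed

lemma scaling_uniform_convergence:
 fixes F :: "'a::euclidean_space => 'b::euclidean_space"
 assumes F: "continuous_on UNIV F" and t: "\<And>n. 0 \<le> t n" "\<And>n. t n \<le> 1" "t \<longlonglongrightarrow> (1::real)" and e: "0 < e"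
 shows "\<forall>\<^sub>F n in sequentially. \<forall>y\<in>cball 0 R. norm (F y - F (t n *R y)) \<le> e"
proof -
 have "uniformly_continuous_on (cball 0 R) F" using F by (intro compact_uniformly_continuous continuous_on_subset[OF F]) auto
 then obtain h where h: "0 < h" "\<And>x y. x \<in> cball 0 R ==> y \<in> cball 0 R ==> dist y x < h ==> dist (F y) (F x) < e"
  using e unfolding uniformly_continuous_on_def by metis
 have "(\<lambda>n. (1 - t n) * \<bar>R\<bar>) \<longlonglongrightarrow> (1 - 1) * \<bar>R\<bar>" by (intro tendsto_intros t)
 then have "\<forall>\<^sub>F n in sequentially. (1 - t n) * \<bar>R\<bar> < h" using h(1) by (intro order_tendstoD(2)) auto
 then show ?thesis
 proof eventually_elim
  fix n assume n: "(1 - t n) * \<bar>R\<bar> < h"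
  show "\<forall>y\<in>cball 0 R. norm (F y - F (t n *R y)) \<le> e"
  proof
   fix y :: 'a assume y: "y \<in> cball 0 R"
   have "norm (t n *R y) \<le> 1 * norm y" using t(1,2)[of n] unfolding norm_scaleR by (intro mult_right_mono) auto
   then have "t n *R y \<in> cball 0 R" using y by simp
   moreover have "y - t n *R y = (1 - t n) *R y" by (simp add: algebra_simps)
   then have "dist y (t n *R y) = (1 - t n) * norm y" using t(2)[of n] by (simp add: dist_norm)
   moreover have "(1 - t n) * norm y \<le> (1 - t n) * \<bar>R\<bar>" using y t(2)[of n] by (intro mult_left_mono) auto
   ultimately show "norm (F y - F (t n *R y)) \<le> e" using h(2)[of "t n *R y" y] y n by (simp add: dist_norm less_imp_le)
  qed
 qed
qed

context gamma_setting
begin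

text \<open>The distance to \<Omega> is used as a weight. It is at most s (r n) R on K (r n), and
  the variations are uniformly bounded, so its integrals tend to 0; by lower semicontinuity the
  limit charges only points at distance 0 from \<Omega>.\<close>

lemma limit_concentrated:
 assumes conv: "weakstar_conv (\<Union>n. K n) ys x" and x: "x \<in> vmeasures (\<Union>n. K n)"
  and ys: "\<And>n. ys n \<in> vmeasures (K (r n))" and r: "(\<lambda>n. s (r n)) \<longlonglongrightarrow> 0"
 shows "x \<in> vmeasures \<Omega>"
proof -
 let ?K = "\<Union>n. K n"
 have cK: "compact ?K" using Union_K compact_K by metis
 have Kb: "?K \<in> sets borel" by (rule borel_compact[OF cK])
 have ba: "borel_additive x" "\<And>n. borel_additive (ys n)" using x ys vmeasures_borel_additive by blast+
 obtain C where C: "\<And>n. (LINT x:?K|total_variation (ys n). (1::real)) \<le> C" by (rule weakstar_conv_bounded_variation[OF cK conv ba(2)]) blast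
 obtain R where R: "0 < R" "\<And>x. x \<in> \<Omega> ==> norm x \<le> R" using compact_imp_bounded[OF compact] bounded_pos by metis
 define V where "V y = infdist y \<Omega>" for y
 have V: "continuous_on ?K V" "\<And>y. 0 \<le> V y" unfolding V_def[abs_def] by (auto intro!: continuous_intros simp: infdist_nonneg)
 have Vs: "V y \<le> s n * R" if y: "y \<in> K n" for y n
 proof -
  obtain z where z: "z \<in> \<Omega>" "y = (1 + s n) *R z" using y by (auto simp: K_def)
  have "V y \<le> dist y z" unfolding V_def by (rule infdist_le[OF z(1)])
  also have "\<dots> = s n * norm z" using s(1)[of n] unfolding z(2) by (simp add: dist_norm algebra_simps)
  also have "\<dots> \<le> s n * R" using s(1)[of n] R(2)[OF z(1)] by (intro mult_left_mono) auto
  finally show ?thesis .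
 qed
 have "(\<integral>\<^sup>+y\<in>?K. ennreal (V y) \<partial>total_variation (ys n)) \<le> ennreal (s (r n) * R * C)" for n
 proof -
  let ?T = "total_variation (ys n)"
  obtain h where T: "sets ?T = sets borel" "finite_measure ?T" by (rule total_variation_polar[OF ba(2)[of n]]) blast
  have "AE y in ?T. y \<in> K (r n)" by (rule total_variation_zero_off[OF ys borel_compact[OF compact_K]])
  then have "(\<integral>\<^sup>+y\<in>?K. ennreal (V y) \<partial>?T) \<le> (\<integral>\<^sup>+y\<in>?K. ennreal (s (r n) * R) \<partial>?T)"
   by (intro nn_integral_mono_AE, eventually_elim) (use Vs in \<open>auto simp: indicator_def intro!: ennreal_leI\<close>)
  also have "\<dots> = ennreal (LINT y:?K|?T. s (r n) * R)" using s(1)[of "r n"] R(1) by (intro nn_set_integral_eq_integral[OF cK T(2,1)]) auto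
  also have "(LINT y:?K|?T. s (r n) * R) = s (r n) * R * (LINT y:?K|?T. (1::real))" by (subst set_integral_mult_right[symmetric]) simp
  also have "\<dots> \<le> s (r n) * R * C" using C s(1)[of "r n"] R(1) by (intro mult_left_mono) auto
  finally show ?thesis by (simp add: ennreal_leI)
 qed
 then have "liminf (\<lambda>n. \<integral>\<^sup>+y\<in>?K. ennreal (V y) \<partial>total_variation (ys n)) \<le> liminf (\<lambda>n. ennreal (s (r n) * R * C))"
  by (intro Liminf_mono always_eventually allI)
 also have "\<dots> = 0"
 proof -
  have "(\<lambda>n. ennreal (s (r n) * R * C)) \<longlonglongrightarrow> ennreal (0 * R * C)" by (intro tendsto_ennrealI tendsto_intros r)
  then show ?thesis by (intro lim_imp_Liminf) auto
 qed
 finally have "(\<integral>\<^sup>+y\<in>?K. ennreal (V y) \<partial>total_variation x) \<le> 0" using weighted_variation_lsc[OF cK conv ba V(1)] V(2) by auto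
 then have z: "(\<integral>\<^sup>+y. ennreal (V y) * indicator ?K y \<partial>total_variation x) = 0" by simp
 obtain h where T: "sets (total_variation x) = sets borel" by (rule total_variation_polar[OF ba(1)]) blast
 have "(\<lambda>y. ennreal (V y) * indicator ?K y) \<in> \<B>"
 proof -
  have [measurable]: "V \<in> \<B>" unfolding V_def[abs_def] by (intro borel_measurable_continuous_onI continuous_intros)
  show ?thesis using Kb by measurable
 qed
 then have "(\<lambda>y. ennreal (V y) * indicator ?K y) \<in> borel_measurable (total_variation x)" by (simp cong: measurable_cong_sets[OF T refl])
 then have "AE y in total_variation x. ennreal (V y) * indicator ?K y = 0" using z by (subst (asm) nn_integral_0_iff_AE) auto
 moreover have "AE y in total_variation x. y \<in> ?K" by (rule total_variation_zero_off[OF x Kb])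
 ultimately have "AE y in total_variation x. y \<in> \<Omega>"
 proof eventually_elim
  fix y assume "ennreal (V y) * indicator ?K y = 0" "y \<in> ?K"
  then have "V y \<le> 0" by (simp add: ennreal_eq_0_iff)
  then have "infdist y \<Omega> = 0" using V(2)[of y] by (simp add: V_def)
  then show "y \<in> \<Omega>" using in_closed_iff_infdist_zero[of \<Omega> y] compact compact_imp_closed nonempty by blast
 qed
 then show ?thesis by (rule vmeasures_of_AE[OF x _ borel_compact[OF compact]])
qed

text \<open>The prefactor 1 + s k cancels the chain rule factor, so the gradient is dilated without
  being rescaled.\<close>

lemma scaled_C1:
 assumes \<phi>: "continuous_on \<Omega> \<phi>" and G: "is_C1_gradient \<Omega> \<phi> G"
 shows "continuous_on (K k) (\<lambda>y. (1 + s k) * \<phi> ((1 / (1 + s k)) *R y))"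
  "is_C1_gradient (K k) (\<lambda>y. (1 + s k) * \<phi> ((1 / (1 + s k)) *R y)) (\<lambda>y. G ((1 / (1 + s k)) *R y))"
proof -
 let ?t = "1 / (1 + s k)"
 have t: "?t > 0" "1 + s k \<noteq> 0" using s(1)[of k] by auto
 have im: "(\<lambda>y. ?t *R y) ` K k \<subseteq> \<Omega>" using scale_K[of _ k] by auto
 have c: "continuous_on (K k) (\<lambda>y. ?t *R y)" by (intro continuous_intros)
 show "continuous_on (K k) (\<lambda>y. (1 + s k) * \<phi> (?t *R y))" by (intro continuous_on_mult continuous_on_const continuous_on_compose2[OF \<phi> c im])
 show "is_C1_gradient (K k) (\<lambda>y. (1 + s k) * \<phi> (?t *R y)) (\<lambda>y. G (?t *R y))" unfolding is_C1_gradient_def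
 proof (intro conjI ballI)
  show "continuous_on (K k) (\<lambda>y. G (?t *R y))" using G by (intro continuous_on_compose2[OF _ c im]) (auto simp: is_C1_gradient_def)
  fix y assume "y \<in> interior (K k)"
  then have "?t *R y \<in> interior \<Omega>" unfolding K_def using t by (subst (asm) interior_scaleR_image) auto
  then have f1: "(\<phi> has_derivative (\<lambda>h. h \<bullet> G (?t *R y))) (at (?t *R y))" using G by (simp add: is_C1_gradient_def gderiv_def)
  have "((\<lambda>y. ?t *R y) has_derivative (\<lambda>h. ?t *R h)) (at y)" by (intro has_derivative_scaleR_right has_derivative_ident)
  from has_derivative_compose[OF this f1] have "((\<lambda>y. \<phi> (?t *R y)) has_derivative (\<lambda>h. (?t *R h) \<bullet> G (?t *R y))) (at y)" .
  then have "((\<lambda>y. (1 + s k) * \<phi> (?t *R y)) has_derivative (\<lambda>h. (1 + s k) * ((?t *R h) \<bullet> G (?t *R y)))) (at y)"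
   by (rule has_derivative_mult_right)
  then show "GDERIV (\<lambda>y. (1 + s k) * \<phi> (?t *R y)) y :> G (?t *R y)" unfolding gderiv_def using t(2) by simp
 qed
qed

text \<open>The test function lives on \<Omega>, so it is dilated to K (r n), where the constraint
  on the approximating measures applies. The dilated gradients converge uniformly to a fixed field,
  and the bounded variations turn this into convergence of the integrals.\<close>

lemma limit_divergence:
 assumes conv: "weakstar_conv (\<Union>n. K n) ys x" and x: "x \<in> vmeasures \<Omega>"
  and ys: "\<And>n. ys n \<in> vmeasures (K (r n))" and r: "(\<lambda>n. s (r n)) \<longlonglongrightarrow> 0"
  and div: "\<And>n f G. continuous_on (K (r n)) f ==> is_C1_gradient (K (r n)) f G ==> vint (K (r n)) (ys n) G = - pairing f"
  and \<phi>: "continuous_on \<Omega> \<phi>" and G: "is_C1_gradient \<Omega> \<phi> G"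
 shows "vint \<Omega> x G = - pairing \<phi>"
proof -
 let ?K = "\<Union>n. K n"
 have cK: "compact ?K" using Union_K compact_K by metis
 have ba: "\<And>n. borel_additive (ys n)" using ys vmeasures_borel_additive by blast
 obtain C where C: "\<And>n. (LINT x:?K|total_variation (ys n). (1::real)) \<le> C" by (rule weakstar_conv_bounded_variation[OF cK conv ba]) blast
 obtain R where R: "0 < R" "\<And>x. x \<in> ?K ==> norm x \<le> R" using compact_imp_bounded[OF cK] bounded_pos by metis
 have Gc: "continuous_on \<Omega> G" using G by (simp add: is_C1_gradient_def)
 \<comment> \<open>The limit needs one fixed continuous field on the union of the domains. H is any
   continuous extension of G; it need not be a gradient, since the constraint is only applied to the
   dilates of G.\<close>
 obtain H where H: "continuous_on UNIV H" "\<And>x. x \<in> \<Omega> ==> H x = G x"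
  by (rule Tietze_unbounded[OF Gc, of UNIV]) (use compact compact_imp_closed in auto)
 have HK: "continuous_on S H" for S using H(1) continuous_on_subset by blast
 have sub: "K n \<subseteq> ?K" "\<Omega> \<subseteq> ?K" for n using subset_K by blast+
 define t where "t n = 1 / (1 + s (r n))" for n
 have t: "0 \<le> t n" "t n \<le> 1" for n using s(1)[of "r n"] by (auto simp: t_def)
 have "(\<lambda>n. 1 / (1 + s (r n))) \<longlonglongrightarrow> 1 / (1 + 0)" by (intro tendsto_intros r) auto
 then have tl: "t \<longlonglongrightarrow> 1" by (simp add: t_def[abs_def])
 have sr: "(\<lambda>n. 1 + s (r n)) \<longlonglongrightarrow> 1 + 0" by (intro tendsto_intros r)
 define f where "f n y = (1 + s (r n)) * \<phi> (t n *R y)" for n y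
 have fG: "vint (K (r n)) (ys n) (\<lambda>y. G (t n *R y)) = - pairing (f n)" for n using div[OF scaled_C1[OF \<phi> G]] by (simp add: f_def[abs_def] t_def)
 have tO: "t n *R y \<in> \<Omega>" if "y \<in> K (r n)" for n y using scale_K[OF that] by (simp add: t_def)
 have t\<Omega>: "t n *R y \<in> \<Omega>" if "y \<in> \<Omega>" for n y using tO subset_K that by blast
 have "(\<lambda>n. pairing (f n)) \<longlonglongrightarrow> pairing \<phi>"
 proof -
  obtain B where B: "0 < B" "\<And>x. x \<in> \<Omega> ==> norm (\<phi> x) \<le> B" using continuous_on_compact_bounded[OF compact \<phi>] by metis
  have "Bseq (\<lambda>n. 1 + s (r n))" using sr by (intro convergent_imp_Bseq convergentI)
  then obtain S where S: "\<And>n. norm (1 + s (r n)) \<le> S" unfolding Bseq_def by blast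
  have S0: "0 \<le> S" using S[of 0] norm_ge_zero order_trans by blast
  have "(\<lambda>n. \<integral>x. indicat_real \<Omega> x * f n x \<partial>L) \<longlonglongrightarrow> (LINT x|L. indicat_real \<Omega> x * \<phi> x)" if L: "borel_prob_on \<Omega> L" for L
  proof (rule integral_dominated_convergence[where w="\<lambda>_. S * B"])
   note m = prob_measure[OF L]
   interpret finite_measure L by (rule m)
   show "integrable L (\<lambda>_. S * B)" by simp
   show "(\<lambda>x. indicat_real \<Omega> x * \<phi> x) \<in> borel_measurable L"
    using borel_measurable_indicator_mult_continuous[OF compact \<phi>] by (simp cong: measurable_cong_sets[OF m(2) refl])
   show "(\<lambda>x. indicat_real \<Omega> x * f n x) \<in> borel_measurable L" for n
   proof -
    have "continuous_on \<Omega> (f n)" unfolding f_def[abs_def] t_def by (rule continuous_on_subset[OF scaled_C1(1)[OF \<phi> G] subset_K])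
    then show ?thesis using borel_measurable_indicator_mult_continuous[OF compact] by (simp cong: measurable_cong_sets[OF m(2) refl])
   qed
   show "AE x in L. norm (indicat_real \<Omega> x * f n x) \<le> S * B" for n
   proof (rule AE_I2)
    fix x
    show "norm (indicat_real \<Omega> x * f n x) \<le> S * B"
    proof (cases "x \<in> \<Omega>")
     case True
     then have "norm (1 + s (r n)) * norm (\<phi> (t n *R x)) \<le> S * B" using S B(2) t\<Omega> S0 by (intro mult_mono) auto
     then show ?thesis using True by (simp add: f_def abs_mult)
    qed (use S0 B in auto)
   qed
   show "AE x in L. (\<lambda>n. indicat_real \<Omega> x * f n x) \<longlonglongrightarrow> indicat_real \<Omega> x * \<phi> x"
   proof (rule AE_I2)
    fix x
    show "(\<lambda>n. indicat_real \<Omega> x * f n x) \<longlonglongrightarrow> indicat_real \<Omega> x * \<phi> x"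
    proof (cases "x \<in> \<Omega>")
     case True
     have "(\<lambda>n. t n *R x) \<longlonglongrightarrow> 1 *R x" by (intro tendsto_intros tl)
     then have "(\<lambda>n. \<phi> (t n *R x)) \<longlonglongrightarrow> \<phi> x"
      using True t\<Omega>[OF True] by (intro continuous_on_tendsto_compose[OF \<phi>]) auto
     then have "(\<lambda>n. (1 + s (r n)) * \<phi> (t n *R x)) \<longlonglongrightarrow> (1 + 0) * \<phi> x" by (intro tendsto_mult sr)
     then show ?thesis using True by (simp add: f_def)
    qed auto
   qed
  qed
  then show ?thesis unfolding pairing_def using prob by (intro tendsto_diff)
 qed
 moreover have "(\<lambda>n. vint ?K (ys n) H + pairing (f n)) \<longlonglongrightarrow> 0"
 proof (rule LIMSEQ_I)
  fix e :: real assume e: "0 < e"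
  \<comment> \<open>A positive bound for the variations, so that the uniform error \<delta> = e/2/k
    integrates to at most e/2.\<close>
  define k where "k = \<bar>C\<bar> + 1"
  have k: "0 < k" by (simp add: k_def)
  define \<delta> where "\<delta> = e / 2 / k"
  have \<delta>: "0 < \<delta>" using e k by (simp add: \<delta>_def)
  have "\<forall>\<^sub>F n in sequentially. \<forall>y\<in>cball 0 R. norm (H y - H (t n *R y)) \<le> \<delta>"
   by (rule scaling_uniform_convergence[OF H(1) t tl \<delta>])
  then have "\<forall>\<^sub>F n in sequentially. norm (vint ?K (ys n) H + pairing (f n) - 0) < e"
  proof eventually_elim
   fix n assume n: "\<forall>y\<in>cball 0 R. norm (H y - H (t n *R y)) \<le> \<delta>"
   have Hc: "continuous_on S (\<lambda>y. H (t n *R y))" for S by (intro continuous_on_compose2[OF H(1)] continuous_intros) auto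
   have e1: "vint ?K (ys n) (\<lambda>y. H (t n *R y)) = - pairing (f n)"
   proof -
    have "vint ?K (ys n) (\<lambda>y. H (t n *R y)) = vint (K (r n)) (ys n) (\<lambda>y. H (t n *R y))"
     by (rule vint_restrict[OF ys compact_K sub(1) cK Hc])
    also have "\<dots> = vint (K (r n)) (ys n) (\<lambda>y. G (t n *R y))" using H(2) tO by (intro vint_cong) auto
    finally show ?thesis using fG by simp
   qed
   have le: "(LINT y:?K|total_variation (ys n). \<delta>) \<le> e / 2"
   proof -
    have "(LINT y:?K|total_variation (ys n). \<delta>) = \<delta> * (LINT y:?K|total_variation (ys n). (1::real))" by (subst set_integral_mult_right[symmetric]) simp
    also have "\<dots> \<le> \<delta> * k" using C[of n] \<delta> unfolding k_def by (intro mult_left_mono) auto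
    also have "\<dots> = e / 2" using k by (simp add: \<delta>_def)
    finally show ?thesis .
   qed
   have nn: "norm (H y - H (t n *R y)) \<le> \<delta>" "norm (H (t n *R y) - H y) \<le> \<delta>" if "y \<in> ?K" for y
    using n R(2)[OF that] by (auto simp: norm_minus_commute)
   have "vint ?K (ys n) (\<lambda>y. H y - H (t n *R y)) \<le> e / 2"
    using nn by (intro order_trans[OF vint_weighted_le[OF ba cK _ continuous_on_const] le] continuous_on_diff HK Hc)
   moreover have "vint ?K (ys n) (\<lambda>y. H (t n *R y) - H y) \<le> e / 2"
    using nn by (intro order_trans[OF vint_weighted_le[OF ba cK _ continuous_on_const] le] continuous_on_diff HK Hc)
   ultimately have "\<bar>vint ?K (ys n) H - vint ?K (ys n) (\<lambda>y. H (t n *R y))\<bar> \<le> e / 2"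
    unfolding vint_diff[OF ba cK HK Hc] vint_diff[OF ba cK Hc HK] by linarith
   then show "norm (vint ?K (ys n) H + pairing (f n) - 0) < e" using e e1 by simp
  qed
  then show "\<exists>no. \<forall>n\<ge>no. norm (vint ?K (ys n) H + pairing (f n) - 0) < e" by (simp add: eventually_sequentially)
 qed
 ultimately have "(\<lambda>n. vint ?K (ys n) H + pairing (f n) - pairing (f n)) \<longlonglongrightarrow> 0 - pairing \<phi>" by (intro tendsto_diff)
 then have "(\<lambda>n. vint ?K (ys n) H) \<longlonglongrightarrow> - pairing \<phi>" by simp
 moreover have "(\<lambda>n. vint ?K (ys n) H) \<longlonglongrightarrow> vint ?K x H" using conv HK by (simp add: weakstar_conv_def)
 ultimately have "vint ?K x H = - pairing \<phi>" using LIMSEQ_unique by blast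
 moreover have "vint ?K x H = vint \<Omega> x H" by (rule vint_restrict[OF x compact sub(2) cK HK])
 moreover have "vint \<Omega> x H = vint \<Omega> x G" using H(2) by (intro vint_cong) auto
 ultimately show ?thesis by simp
qed

lemma C1_gradient_spec: "\<phi> \<in> C1 \<Omega> ==> is_C1_gradient \<Omega> \<phi> (C1_gradient \<Omega> \<phi>)"
 unfolding C1_def C1_gradient_def by (auto intro: someI[of "is_C1_gradient \<Omega> \<phi>"])

text \<open>Any c above the liminf bounds the energy for infinitely many n, which gives a
  subsequence of finite energy and thereby the constraints. The power term is nonnegative and is
  dropped, and the weighted variation is lower semicontinuous.\<close>

lemma liminf_inequality:
 assumes conv: "weakstar_conv (\<Union>n. K n) xs x" and x: "x \<in> vmeasures (\<Union>n. K n)"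
 shows "H_lim W \<mu> \<Omega> x \<le> liminf (\<lambda>n. H_eps \<alpha> W \<mu> (K n) (\<tau> n) (xs n))"
proof (rule dense_ge)
 let ?K = "\<Union>n. K n"
 have cK: "compact ?K" using Union_K compact_K by metis
 fix c assume c: "liminf (\<lambda>n. H_eps \<alpha> W \<mu> (K n) (\<tau> n) (xs n)) < c"
 define J where "J = {n. H_eps \<alpha> W \<mu> (K n) (\<tau> n) (xs n) < c}"
 have "infinite J"
 proof
  assume "finite J"
  then have "\<forall>\<^sub>F n in sequentially. c \<le> H_eps \<alpha> W \<mu> (K n) (\<tau> n) (xs n)"
   unfolding cofinite_eq_sequentially[symmetric] eventually_cofinite by (simp add: J_def not_le)
  then have "c \<le> liminf (\<lambda>n. H_eps \<alpha> W \<mu> (K n) (\<tau> n) (xs n))" by (rule Liminf_bounded)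
  then show False using c by simp
 qed
 then obtain r :: "nat => nat" where r: "strict_mono r" "\<And>n. r n \<in> J" using infinite_enumerate by blast
 define ys where "ys n = xs (r n)" for n
 have le: "H_eps \<alpha> W \<mu> (K (r n)) (\<tau> (r n)) (ys n) < c" for n using r(2)[of n] by (simp add: J_def ys_def)
 have fin: "H_eps \<alpha> W \<mu> (K (r n)) (\<tau> (r n)) (ys n) < \<infinity>" for n using le[of n] by (rule order_less_le_trans) simp
 note ys = finite_energy_divergence[OF fin]
 have convy: "weakstar_conv ?K ys x" using conv LIMSEQ_subseq_LIMSEQ[OF _ r(1)] unfolding weakstar_conv_def ys_def[abs_def] comp_def by blast
 have sr: "(\<lambda>n. s (r n)) \<longlonglongrightarrow> 0" using LIMSEQ_subseq_LIMSEQ[OF s(2) r(1)] by (simp add: comp_def)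
 have x\<Omega>: "x \<in> vmeasures \<Omega>" by (rule limit_concentrated[OF convy x ys(1) sr])
 have div: "div_M_eq \<Omega> x (vint \<Omega> \<mu>)" unfolding div_M_eq_def
 proof
  fix \<phi> assume "\<phi> \<in> C1_mean0 \<Omega>"
  then have \<phi>: "\<phi> \<in> C1 \<Omega>" by (simp add: C1_mean0_def)
  then have c: "continuous_on \<Omega> \<phi>" by (simp add: C1_def)
  show "- vint \<Omega> x (C1_gradient \<Omega> \<phi>) = vint \<Omega> \<mu> \<phi>"
   using limit_divergence[OF convy x\<Omega> ys(1) sr ys(2) c C1_gradient_spec[OF \<phi>]] vint_eq_pairing[OF c] by simp
 qed
 have ba: "borel_additive x" "\<And>n. borel_additive (ys n)" using x ys(1) vmeasures_borel_additive by blast+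
 have "(\<integral>\<^sup>+y\<in>?K. ennreal (W y) \<partial>total_variation (ys n)) \<le> c" for n
 proof -
  have "AE y in total_variation (ys n). y \<in> K (r n)" by (rule total_variation_zero_off[OF ys(1) borel_compact[OF compact_K]])
  then have "(\<integral>\<^sup>+y\<in>?K. ennreal (W y) \<partial>total_variation (ys n)) = (\<integral>\<^sup>+y\<in>K (r n). ennreal (W y) \<partial>total_variation (ys n))"
   by (intro nn_integral_cong_AE, eventually_elim) (auto simp: indicator_def)
  also have "\<dots> \<le> H_eps \<alpha> W \<mu> (K (r n)) (\<tau> (r n)) (ys n)" by (simp add: H_eps_def)
  finally show ?thesis using le[of n] by simp
 qed
 then have "liminf (\<lambda>n. \<integral>\<^sup>+y\<in>?K. ennreal (W y) \<partial>total_variation (ys n)) \<le> liminf (\<lambda>n. c)"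
  by (intro Liminf_mono always_eventually allI)
 then have "(\<integral>\<^sup>+y\<in>?K. ennreal (W y) \<partial>total_variation x) \<le> c"
  using weighted_variation_lsc[OF cK convy ba W(1)] W(2) by (auto simp: Liminf_const intro: order_trans)
 moreover have "(\<integral>\<^sup>+y\<in>\<Omega>. ennreal (W y) \<partial>total_variation x) \<le> (\<integral>\<^sup>+y\<in>?K. ennreal (W y) \<partial>total_variation x)"
  using subset_K by (intro nn_integral_mono) (auto simp: indicator_def)
 ultimately show "H_lim W \<mu> \<Omega> x \<le> c" using x\<Omega> div by (simp add: H_lim_def)
qed

end

section \<open>Upper bound: smearing of measures and the recovery sequence\<close>

definition smear :: "'a::euclidean_space measure => real => ('a => real) => ('a => 'b::euclidean_space) => 'a => 'b" where
 "smear L c \<eta> u x = (LINT y|L. (c * \<eta> (x - c *R y)) *R u y)"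

text \<open>\<open>smear\<close> carries \<open>smoll\<close> over to a general base measure so that
  q itself can be smeared: with L = |q| and u its polar direction it is a field, with u = |h| the
  corresponding smearing of |q|.\<close>

lemma smoll_eq_smear: "smoll c \<eta> v = smear lborel c \<eta> v" by (simp add: fun_eq_iff smoll_def smear_def)

text \<open>The last claim is Fubini's theorem and expresses the adjointness with g ->
  \<open>c *R moll c \<eta> g\<close>. Boundedness comes from the bounded kernel; the bound depends
  on \<eta> and may blow up along the sequence, which is why a diagonal choice is made
  later.\<close>

lemma smear_properties:
 fixes u :: "'a::euclidean_space => 'b::euclidean_space"
 assumes \<eta>: "mollifier d \<eta>" and L: "sigma_finite_measure L" "sets L = sets borel" and u: "integrable L u"
 shows "smear L c \<eta> u \<in> \<B>" "\<exists>B. \<forall>x. norm (smear L c \<eta> u x) \<le> B"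
  and "integrable lborel g ==> (LBINT x. g x \<bullet> smear L c \<eta> u x) = (LINT y|L. (c *R moll c \<eta> g y) \<bullet> u y)"
proof -
 interpret L: sigma_finite_measure L by fact
 interpret pair_sigma_finite lborel L by (intro pair_sigma_finite.intro L sigma_finite_lborel)
 note L(2)[measurable_cong]
 have um [measurable]: "u \<in> \<B>" using u L(2) by (simp add: measurable_cong_sets[OF L(2) refl] borel_measurable_integrable)
 note m = mollifierD[OF \<eta>]
 note m(3)[measurable]
 obtain B where B: "0 < B" "\<And>x. \<bar>\<eta> x\<bar> \<le> B" using m(8) by blast
 have km: "(\<lambda>y. c * \<eta> (x - c *R y)) \<in> borel_measurable L" "\<bar>c * \<eta> (x - c *R y)\<bar> \<le> \<bar>c\<bar> * B" for x y
  using B by (auto simp: abs_mult intro!: mult_left_mono)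
 have ki: "integrable L (\<lambda>y. (c * \<eta> (x - c *R y)) *R u y)" for x by (rule integrable_scaled_bounded[OF u km])
 show "smear L c \<eta> u \<in> \<B>" unfolding smear_def[abs_def] by (rule L.borel_measurable_lebesgue_integral) measurable
 show "\<exists>B. \<forall>x. norm (smear L c \<eta> u x) \<le> B"
 proof (intro exI allI)
  fix x
  have "norm (smear L c \<eta> u x) \<le> (LINT y|L. \<bar>c\<bar> * B * norm (u y))" unfolding smear_def
  proof (rule Bochner_Integration.integral_norm_bound_integral[OF ki])
   show "integrable L (\<lambda>y. \<bar>c\<bar> * B * norm (u y))" using u by simp
   show "norm ((c * \<eta> (x - c *R y)) *R u y) \<le> \<bar>c\<bar> * B * norm (u y)" for y
    using km(2)[of x y] unfolding norm_scaleR real_norm_def by (intro mult_right_mono) auto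
  qed
  then show "norm (smear L c \<eta> u x) \<le> \<bar>c\<bar> * B * (LINT y|L. norm (u y))" by simp
 qed
 assume g: "integrable lborel g"
 then have [measurable]: "g \<in> \<B>" by auto
 define k where "k x y = c * \<eta> (x - c *R y)" for x y
 have km' [measurable]: "(\<lambda>(x, y). k x y * (g x \<bullet> u y)) \<in> borel_measurable (lborel \<Otimes>\<^sub>M L)" unfolding k_def by measurable
 have i2: "integrable (lborel \<Otimes>\<^sub>M L) (\<lambda>(x, y). norm (g x) * norm (u y))"
 proof (rule Fubini_integrable)
  show "(\<lambda>(x, y). norm (g x) * norm (u y)) \<in> borel_measurable (lborel \<Otimes>\<^sub>M L)" by measurable
 qed (use g u in auto)
 have i3: "integrable (lborel \<Otimes>\<^sub>M L) (\<lambda>(x, y). k x y * (g x \<bullet> u y))"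
 proof (rule Bochner_Integration.integrable_bound)
  show "integrable (lborel \<Otimes>\<^sub>M L) (\<lambda>z. \<bar>c\<bar> * B * (case z of (x, y) => norm (g x) * norm (u y)))" using i2 by simp
  show "AE z in lborel \<Otimes>\<^sub>M L. norm (case z of (x, y) => k x y * (g x \<bullet> u y)) \<le> norm (\<bar>c\<bar> * B * (case z of (x, y) => norm (g x) * norm (u y)))"
  proof (rule AE_I2, clarify)
   fix x :: 'a and y
   have "\<bar>k x y\<bar> * \<bar>g x \<bullet> u y\<bar> \<le> (\<bar>c\<bar> * B) * (norm (g x) * norm (u y))"
    using km(2) B(1) unfolding k_def by (intro mult_mono Cauchy_Schwarz_ineq2) auto
   then show "norm (k x y * (g x \<bullet> u y)) \<le> norm (\<bar>c\<bar> * B * (norm (g x) * norm (u y)))" using B(1) by (simp add: abs_mult)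
  qed
 qed measurable
 have "(LBINT x. g x \<bullet> smear L c \<eta> u x) = (\<integral>x. \<integral>y. k x y * (g x \<bullet> u y) \<partial>L \<partial>lborel)"
 proof (intro Bochner_Integration.integral_cong refl)
  fix x
  have "g x \<bullet> smear L c \<eta> u x = (LINT y|L. g x \<bullet> ((c * \<eta> (x - c *R y)) *R u y))"
   unfolding smear_def using ki[of x] by (subst integral_inner_right) auto
  then show "g x \<bullet> smear L c \<eta> u x = (LINT y|L. k x y * (g x \<bullet> u y))" by (simp add: k_def)
 qed
 also have "\<dots> = (\<integral>y. \<integral>x. k x y * (g x \<bullet> u y) \<partial>lborel \<partial>L)" using Fubini_integral[OF i3] by simp
 also have "\<dots> = (LINT y|L. (c *R moll c \<eta> g y) \<bullet> u y)"
 proof (intro Bochner_Integration.integral_cong refl)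
  fix y
  have "integrable lborel (\<lambda>x. \<eta> (x - c *R y) *R g x)" by (rule integrable_scaled_bounded[OF g, of _ B]) (use B in auto)
  then have "moll c \<eta> g y \<bullet> u y = (LBINT x. (\<eta> (x - c *R y) *R g x) \<bullet> u y)"
   unfolding moll_def by (subst integral_inner_left) auto
  then have "c * (moll c \<eta> g y \<bullet> u y) = (LBINT x. c * ((\<eta> (x - c *R y) *R g x) \<bullet> u y))" by simp
  then show "(LBINT x. k x y * (g x \<bullet> u y)) = (c *R moll c \<eta> g y) \<bullet> u y" by (auto simp: k_def mult.assoc)
 qed
 finally show "(LBINT x. g x \<bullet> smear L c \<eta> u x) = (LINT y|L. (c *R moll c \<eta> g y) \<bullet> u y)" .
qed

text \<open>\<kappa> n is the largest index k \<le> n whose product t n a k is already at most 1 /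
  (k + 1). Each fixed index qualifies eventually, so \<kappa> tends to infinity however fast a
  grows.\<close>

lemma diagonal_sequence:
 fixes t a :: "nat => real"
 assumes t: "t \<longlonglongrightarrow> 0" "\<And>n. 0 \<le> t n" and a: "\<And>k. 0 \<le> a k"
 obtains \<kappa> where "filterlim \<kappa> at_top sequentially" "(\<lambda>n. t n * a (\<kappa> n)) \<longlonglongrightarrow> 0"
proof -
 define J where "J n = {k. k \<le> n \<and> (k = 0 \<or> t n * a k \<le> 1 / (real k + 1))}" for n
 define \<kappa> where "\<kappa> n = Max (J n)" for n
 have J: "finite (J n)" "0 \<in> J n" for n by (auto simp: J_def)
 have mem: "\<kappa> n \<in> J n" for n unfolding \<kappa>_def using J[of n] by (intro Max_in) auto
 have ge: "\<forall>\<^sub>F n in sequentially. j \<le> \<kappa> n" for j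
 proof -
  have "(\<lambda>n. t n * a j) \<longlonglongrightarrow> 0 * a j" by (intro tendsto_intros t)
  then have "\<forall>\<^sub>F n in sequentially. t n * a j < 1 / (real j + 1)" by (intro order_tendstoD(2)) auto
  then show ?thesis using eventually_ge_at_top[of j]
  proof eventually_elim
   fix n assume "t n * a j < 1 / (real j + 1)" "j \<le> n"
   then have "j \<in> J n" by (simp add: J_def)
   then show "j \<le> \<kappa> n" unfolding \<kappa>_def using J by (intro Max_ge) auto
  qed
 qed
 have "(\<lambda>n. t n * a (\<kappa> n)) \<longlonglongrightarrow> 0"
 proof (rule LIMSEQ_I)
  fix e :: real assume e: "0 < e"
  obtain j where j: "1 / e < real j" using reals_Archimedean2 by blast
  have "\<forall>\<^sub>F n in sequentially. norm (t n * a (\<kappa> n) - 0) < e" using ge[of "Suc j"]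
  proof eventually_elim
   fix n assume n: "Suc j \<le> \<kappa> n"
   have "t n * a (\<kappa> n) \<le> 1 / (real (\<kappa> n) + 1)" using mem[of n] n by (simp add: J_def)
   also have "\<dots> \<le> 1 / real (Suc j)" using n by (intro divide_left_mono) auto
   also have "\<dots> < e"
   proof -
    have "1 / e < real (Suc j)" using j by simp
    then show ?thesis using e by (simp add: field_simps)
   qed
   finally show "norm (t n * a (\<kappa> n) - 0) < e" using t(2) a by simp
  qed
  then show "\<exists>no. \<forall>n\<ge>no. norm (t n * a (\<kappa> n) - 0) < e" by (simp add: eventually_sequentially)
 qed
 then show ?thesis using ge by (intro that) (auto simp: filterlim_at_top)
qed

context conic_star
begin

lemma smear_zero_off:
 fixes u :: "'a => 'b::euclidean_space"
 assumes sub: "\<And>y w. y \<in> K ==> w \<in> supp \<eta> ==> c *R y + w \<in> interior K"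
  and u: "AE y in L. u y \<noteq> 0 \<longrightarrow> y \<in> K" and x: "x \<notin> interior K"
 shows "smear L c \<eta> u x = 0" unfolding smear_def
proof (rule integral_eq_zero_AE)
 show "AE y in L. (c * \<eta> (x - c *R y)) *R u y = 0" using u
 proof eventually_elim
  fix y assume y: "u y \<noteq> 0 \<longrightarrow> y \<in> K"
  have "\<eta> (x - c *R y) = 0" if "y \<in> K"
  proof (rule ccontr)
   assume "\<not> ?thesis"
   then have "x - c *R y \<in> supp \<eta>" using closure_subset by (force simp: supp_def)
   then show False using sub[OF that, of "x - c *R y"] x by simp
  qed
  then show "(c * \<eta> (x - c *R y)) *R u y = 0" using y by auto
 qed
qed

lemma bounded_Lq_field:
 fixes f :: "'a => 'a"
 assumes [measurable]: "f \<in> \<B>" and B: "\<And>x. norm (f x) \<le> B" and z: "\<And>x. x \<notin> interior K ==> f x = 0" and q: "1 < q"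
 shows "Lq_field K q f"
proof -
 have i: "integrable lborel (\<lambda>x. indicat_real K x *R (max B 0 + max B 0 powr q))" by (rule borel_integrable_compact[OF compact]) auto
 have z': "f x = 0" if "x \<notin> K" for x using that z interior_subset[of K] by blast
 have "integrable lborel f"
 proof (rule Bochner_Integration.integrable_bound[OF i])
  show "AE x in lborel. norm (f x) \<le> norm (indicat_real K x *R (max B 0 + max B 0 powr q))"
  proof (rule AE_I2)
   fix x
   have "norm (f x) \<le> max B 0 + max B 0 powr q" using B[of x] powr_ge_zero[of "max B 0" q] by linarith
   then show "norm (f x) \<le> norm (indicat_real K x *R (max B 0 + max B 0 powr q))" using z'[of x] by (cases "x \<in> K") auto
  qed
 qed measurable
 moreover have "integrable lborel (\<lambda>x. norm (f x) powr q)"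
 proof (rule Bochner_Integration.integrable_bound[OF i])
  show "AE x in lborel. norm (norm (f x) powr q) \<le> norm (indicat_real K x *R (max B 0 + max B 0 powr q))"
  proof (rule AE_I2)
   fix x
   have "norm (f x) powr q \<le> max B 0 powr q" using B[of x] q by (intro powr_mono2) auto
   then have "norm (f x) powr q \<le> max B 0 + max B 0 powr q" by linarith
   then show "norm (norm (f x) powr q) \<le> norm (indicat_real K x *R (max B 0 + max B 0 powr q))" using z'[of x] q by (cases "x \<in> K") auto
  qed
 qed measurable
 ultimately show ?thesis using z by (simp add: Lq_field_def)
qed

text \<open>By adjointness the smoothing is moved to the test field, whose averages at shrunken
  points converge at every point of K and are bounded by B; dominated convergence then works for any
  measure L.\<close>

lemma smear_tendsto:
 fixes u F :: "'a => 'b::euclidean_space"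
 assumes c: "\<And>k. 1/2 \<le> c k" "\<And>k. c k \<le> 1" "c \<longlonglongrightarrow> 1"
  and \<eta>: "\<And>k. mollifier (d k) (\<eta> k)" and d: "d \<longlonglongrightarrow> 0"
  and sub: "\<And>k y w. y \<in> K ==> w \<in> supp (\<eta> k) ==> c k *R y + w \<in> interior K"
  and L: "sigma_finite_measure L" "sets L = sets borel" and u: "integrable L u" "AE y in L. u y \<noteq> 0 \<longrightarrow> y \<in> K"
  and F: "continuous_on K F"
 shows "(\<lambda>k. \<integral>x. (indicat_real K x *R F x) \<bullet> smear L (c k) (\<eta> k) u x \<partial>lborel) \<longlonglongrightarrow> (LINT y|L. (indicat_real K y *R F y) \<bullet> u y)"
proof -
 define g where "g x = indicat_real K x *R F x" for x
 have g: "integrable lborel g" unfolding g_def[abs_def] by (rule borel_integrable_compact[OF compact F])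
 have gm [measurable]: "g \<in> \<B>" using g by auto
 obtain B where B: "0 < B" "\<And>x. x \<in> K ==> norm (F x) \<le> B" using continuous_on_compact_bounded[OF compact F] by metis
 have gB: "norm (g x) \<le> B" for x using B by (auto simp: g_def indicator_def)
 note L(2)[measurable_cong]
 have um [measurable]: "u \<in> \<B>" using u(1) L(2) by (simp add: measurable_cong_sets[OF L(2) refl] borel_measurable_integrable)
 have gF: "AE x in lborel. x \<in> interior K \<longrightarrow> F x = g x" using interior_subset[of K] by (intro AE_I2) (auto simp: g_def)
 have lim: "(\<lambda>k. moll (c k) (\<eta> k) g y) \<longlonglongrightarrow> F y" if "y \<in> K" for y by (rule moll_tendsto(1)) (fact c \<eta> d sub g F gF that)+
 have mB: "norm (moll (c k) (\<eta> k) g y) \<le> B" for k y using moll_near[OF \<eta> g, of k "c k" y 0 B] gB by simp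
 have "(\<lambda>k. \<integral>y. (c k *R moll (c k) (\<eta> k) g y) \<bullet> u y \<partial>L) \<longlonglongrightarrow> (LINT y|L. g y \<bullet> u y)"
 proof (rule integral_dominated_convergence[where w="\<lambda>y. B * norm (u y)"])
  show "integrable L (\<lambda>y. B * norm (u y))" using u(1) by simp
  show "(\<lambda>y. g y \<bullet> u y) \<in> borel_measurable L" by measurable
  show "(\<lambda>y. (c k *R moll (c k) (\<eta> k) g y) \<bullet> u y) \<in> borel_measurable L" for k
  proof -
   have [measurable]: "moll (c k) (\<eta> k) g \<in> \<B>" by (rule borel_measurable_continuous_onI[OF moll_continuous[OF g \<eta>]])
   show ?thesis by measurable
  qed
  show "AE y in L. (\<lambda>k. (c k *R moll (c k) (\<eta> k) g y) \<bullet> u y) \<longlonglongrightarrow> g y \<bullet> u y" using u(2)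
  proof eventually_elim
   fix y assume y: "u y \<noteq> 0 \<longrightarrow> y \<in> K"
   show "(\<lambda>k. (c k *R moll (c k) (\<eta> k) g y) \<bullet> u y) \<longlonglongrightarrow> g y \<bullet> u y"
   proof (cases "y \<in> K")
    case True
    have "(\<lambda>k. (c k *R moll (c k) (\<eta> k) g y) \<bullet> u y) \<longlonglongrightarrow> (1 *R F y) \<bullet> u y" by (intro tendsto_intros c lim True)
    then show ?thesis using True by (simp add: g_def)
   qed (use y in simp)
  qed
  show "AE y in L. norm ((c k *R moll (c k) (\<eta> k) g y) \<bullet> u y) \<le> B * norm (u y)" for k
  proof (rule AE_I2)
   fix y
   have "norm ((c k *R moll (c k) (\<eta> k) g y) \<bullet> u y) \<le> norm (c k *R moll (c k) (\<eta> k) g y) * norm (u y)"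
    unfolding real_norm_def by (rule Cauchy_Schwarz_ineq2)
   also have "norm (c k *R moll (c k) (\<eta> k) g y) \<le> 1 * B" unfolding norm_scaleR using c(1,2)[of k] mB[of k y] by (intro mult_mono) auto
   finally show "norm ((c k *R moll (c k) (\<eta> k) g y) \<bullet> u y) \<le> B * norm (u y)" by (simp add: mult_right_mono)
  qed
 qed
 then show ?thesis unfolding smear_properties(3)[OF \<eta> L u(1) g, symmetric] by (simp add: g_def)
qed

end

context gamma_setting
begin

text \<open>Frees the constraint from the zero mean condition and from the choice in
  \<open>C1_gradient\<close>: two C^1 gradients agree in the interior, hence on all of \<Omega> by
  continuity.\<close>

lemma divergence_test:
 assumes q: "q \<in> vmeasures \<Omega>" and div: "div_M_eq \<Omega> q (vint \<Omega> \<mu>)"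
  and f: "continuous_on \<Omega> f" and G: "is_C1_gradient \<Omega> f G"
 shows "vint \<Omega> q G = - pairing f"
proof -
 have Ob: "\<Omega> \<in> sets borel" by (rule borel_compact[OF compact])
 define m where "m = measure lborel \<Omega>"
 have Ofin: "emeasure lborel \<Omega> < \<infinity>" using compact compact_imp_bounded by (intro emeasure_bounded_finite) auto
 have m0: "m > 0"
 proof -
  obtain r where r: "0 < r" "ball 0 r \<subseteq> interior \<Omega>" using zero_in_interior open_contains_ball[of "interior \<Omega>"] by auto
  have "0 < measure lborel (ball (0::'a) r)" using r by (intro content_ball_pos)
  also have "\<dots> \<le> m" unfolding m_def using r interior_subset[of \<Omega>] Ofin Ob by (intro measure_mono_fmeasurable) (auto simp: fmeasurable_def)
  finally show ?thesis .
 qed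
 define c where "c = (LBINT x. indicat_real \<Omega> x * f x) / m"
 define f0 where "f0 x = f x - c" for x
 have f0: "continuous_on \<Omega> f0" unfolding f0_def[abs_def] using f by (intro continuous_intros)
 have G0: "is_C1_gradient \<Omega> f0 G" unfolding f0_def[abs_def] by (rule is_C1_gradient_diff_const[OF G])
 have "(LINT x|lebesgue_on \<Omega>. f0 x) = (LBINT x. indicat_real \<Omega> x * f0 x)"
 proof (rule lint_lebesgue_on(1)[OF Ob _ borel_measurable_indicator_mult_continuous[OF compact f0]])
  show "f0 \<in> borel_measurable (lebesgue_on \<Omega>)" using f0 Ob by (intro continuous_imp_measurable_on_sets_lebesgue) auto
 qed auto
 also have "\<dots> = (LBINT x. indicat_real \<Omega> x * f x - c * indicat_real \<Omega> x)"
  by (intro Bochner_Integration.integral_cong) (auto simp: f0_def indicator_def)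
 also have "\<dots> = (LBINT x. indicat_real \<Omega> x * f x) - c * m"
  using borel_integrable_compact[OF compact f] Ofin Ob by (subst Bochner_Integration.integral_diff) (auto simp: m_def)
 also have "\<dots> = 0" using m0 by (simp add: c_def)
 finally have mean: "f0 \<in> C1_mean0 \<Omega>" using f0 G0 by (auto simp: C1_mean0_def C1_def)
 then have "- vint \<Omega> q (C1_gradient \<Omega> f0) = pairing f0" using div vint_eq_pairing[OF f0] by (simp add: div_M_eq_def)
 also have "vint \<Omega> q (C1_gradient \<Omega> f0) = vint \<Omega> q G"
 proof (rule vint_cong)
  fix x assume x: "x \<in> \<Omega>"
  have G1: "is_C1_gradient \<Omega> f0 (C1_gradient \<Omega> f0)" using mean by (intro C1_gradient_spec) (simp add: C1_mean0_def)
  have eq: "C1_gradient \<Omega> f0 y = G y" if "y \<in> interior \<Omega>" for y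
   by (rule GDERIV_unique[of f0 y]) (use G0 G1 that in \<open>auto simp: is_C1_gradient_def\<close>)
  show "C1_gradient \<Omega> f0 x = G x"
  proof (rule euclidean_eqI)
   fix b :: 'a
   show "C1_gradient \<Omega> f0 x \<bullet> b = G x \<bullet> b"
   proof (rule continuous_eq_of_AE[OF _ _ _ x, of "\<lambda>x. C1_gradient \<Omega> f0 x \<bullet> b" "\<lambda>x. G x \<bullet> b"])
    show "AE x in lborel. x \<in> interior \<Omega> \<longrightarrow> C1_gradient \<Omega> f0 x \<bullet> b = G x \<bullet> b" using eq by (intro AE_I2) simp
   qed (use G0 G1 in \<open>auto simp: is_C1_gradient_def intro!: continuous_intros\<close>)
  qed
 qed
 also have "pairing f0 = pairing f" unfolding f0_def[abs_def] by (rule pairing_add_const[OF f])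
 finally show ?thesis by simp
qed

lemma limsup_inequality:
 assumes x: "q \<in> vmeasures (\<Union>n. K n)"
 shows "\<exists>xs. range xs \<subseteq> vmeasures (\<Union>n. K n) \<and> weakstar_conv (\<Union>n. K n) xs q \<and>
  limsup (\<lambda>n. H_eps \<alpha> W \<mu> (K n) (\<tau> n) (xs n)) \<le> H_lim W \<mu> \<Omega> q"
proof (cases "q \<in> vmeasures \<Omega> \<and> div_M_eq \<Omega> q (vint \<Omega> \<mu>)")
 case False
 then have "H_lim W \<mu> \<Omega> q = \<infinity>" by (auto simp: H_lim_def)
 then show ?thesis using x by (intro exI[of _ "\<lambda>_. q"]) (auto simp: weakstar_conv_def)
next
 case True
 then have q: "q \<in> vmeasures \<Omega>" and div: "div_M_eq \<Omega> q (vint \<Omega> \<mu>)" by auto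
 let ?K = "\<Union>n. K n" and ?T = "total_variation q"
 have cK: "compact ?K" using Union_K compact_K by metis
 have Kb: "?K \<in> sets borel" by (rule borel_compact[OF cK])
 have OK: "\<Omega> \<subseteq> ?K" using subset_K by blast
 have ba: "borel_additive q" by (rule vmeasures_borel_additive[OF q])
 have Ob [measurable]: "\<Omega> \<in> sets borel" by (rule borel_compact[OF compact])
 obtain h where T: "sets ?T = sets borel" "finite_measure ?T" and hm [measurable]: "h \<in> \<B>" and h1: "\<And>x. norm (h x) \<le> 1"
  and ha: "AE x in ?T. norm (h x) = 1"
  and hv: "\<And>K F. compact K ==> continuous_on K F ==> integrable ?T (\<lambda>x. indicator K x *R (F x \<bullet> h x)) \<and> vint K q F = (LINT x:K|?T. F x \<bullet> h x)"
  by (rule vint_eq_integral_polar[OF ba]) blast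
 note T(1)[measurable_cong]
 interpret T: finite_measure ?T by (rule T)
 have Ts: "sigma_finite_measure ?T" by unfold_locales
 have TO: "AE x in ?T. x \<in> \<Omega>" by (rule total_variation_zero_off[OF q Ob])
 have hi: "integrable ?T h" by (rule integrable_bounded_borel[OF T(2,1) hm h1])
 have hz: "AE y in ?T. h y \<noteq> 0 \<longrightarrow> y \<in> \<Omega>" "AE y in ?T. norm (h y) \<noteq> 0 \<longrightarrow> y \<in> \<Omega>"
  using TO by (eventually_elim, simp)+
 \<comment> \<open>The fixed field with the sources of q. It supplies the exact divergence of all
   members of the recovery sequence.\<close>
 obtain v where v: "Lq_field \<Omega> \<alpha> v" and vdiv': "\<And>f G. continuous_on \<Omega> f ==> is_C1_gradient \<Omega> f G ==>
    flux \<Omega> G v = - ((LINT x|M. indicat_real \<Omega> x * f x) - (LINT x|N. indicat_real \<Omega> x * f x))"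
  using field_with_divergence[OF pq pd prob_measure(1-3)[OF prob(1)] prob_measure(1-3)[OF prob(2)]]
   prob_measure(4)[OF prob(1)] prob_measure(4)[OF prob(2)] by auto
 have vdiv: "flux \<Omega> G v = - pairing f" if "continuous_on \<Omega> f" "is_C1_gradient \<Omega> f G" for f G unfolding pairing_def by (rule vdiv'[OF that])
 have vm [measurable]: "v \<in> \<B>" and vi: "integrable lborel v" and va: "integrable lborel (\<lambda>x. norm (v x) powr \<alpha>)"
  and v0: "\<And>x. x \<notin> interior \<Omega> ==> v x = 0" using v by (auto simp: Lq_field_def)
 have vz: "AE y in lborel. v y \<noteq> 0 \<longrightarrow> y \<in> \<Omega>" using v0 interior_subset[of \<Omega>] by (intro AE_I2) blast
 obtain c r where c: "\<And>k. 1/2 \<le> c k" "\<And>k. c k \<le> 1" "c \<longlonglongrightarrow> 1" and r: "(\<lambda>k. d (r k)) \<longlonglongrightarrow> 0" "\<And>k. d (r k) \<le> 1"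
  and sub: "\<And>k y w. y \<in> \<Omega> ==> w \<in> supp (\<eta> (r k)) ==> c k *R y + w \<in> interior \<Omega>"
  using approximating_sequence[of d \<eta>, OF \<eta> d] by metis
 \<comment> \<open>The smearings of q, of v and of |q|. The last one is a scalar majorant for the
   first and is what meets the weight.\<close>
 define S where "S k = smear ?T (c k) (\<eta> (r k)) h" for k
 define V where "V k = smear lborel (c k) (\<eta> (r k)) v" for k
 define H where "H k = smear ?T (c k) (\<eta> (r k)) (\<lambda>y. norm (h y))" for k
 define Q where "Q k x = v x + (S k x + (-1) *R V k x)" for k x
 have S: "S k \<in> \<B>" "\<exists>B. \<forall>x. norm (S k x) \<le> B"
  "\<And>g. integrable lborel g ==> (LBINT x. g x \<bullet> S k x) = (LINT y|?T. (c k *R moll (c k) (\<eta> (r k)) g y) \<bullet> h y)" for k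
  unfolding S_def by (rule smear_properties[OF \<eta> Ts T(1) hi], assumption?)+
 have V: "V k \<in> \<B>" "\<exists>B. \<forall>x. norm (V k x) \<le> B"
  "\<And>g. integrable lborel g ==> (LBINT x. g x \<bullet> V k x) = (LBINT y. (c k *R moll (c k) (\<eta> (r k)) g y) \<bullet> v y)" for k
  unfolding V_def by (rule smear_properties[OF \<eta> sigma_finite_lborel sets_lborel vi], assumption?)+
 have H: "H k \<in> \<B>" "\<exists>B. \<forall>x. norm (H k x) \<le> B"
  "\<And>g. integrable lborel g ==> (LBINT x. g x \<bullet> H k x) = (LINT y|?T. (c k *R moll (c k) (\<eta> (r k)) g y) \<bullet> norm (h y))" for k
  unfolding H_def by (rule smear_properties[OF \<eta> Ts T(1) integrable_norm[OF hi]], assumption?)+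
 note [measurable] = S(1) V(1) H(1)
 have S0: "S k x = 0" if "x \<notin> interior \<Omega>" for k x unfolding S_def by (rule smear_zero_off[OF sub hz(1) that])
 have V0: "V k x = 0" if "x \<notin> interior \<Omega>" for k x unfolding V_def by (rule smear_zero_off[OF sub vz that])
 have SL: "Lq_field \<Omega> \<alpha> (S k)" for k using S(2)[of k] bounded_Lq_field[OF S(1) _ S0 pq(2)] by blast
 have VL: "Lq_field \<Omega> \<alpha> (V k)" for k using V(2)[of k] bounded_Lq_field[OF V(1) _ V0 pq(2)] by blast
 have QL: "Lq_field \<Omega> \<alpha> (Q k)" for k unfolding Q_def[abs_def] using pq by (intro Lq_field_add v SL Lq_field_scaleR VL) auto
 have nint: "x \<notin> interior \<Omega>" if "x \<notin> \<Omega>" for x using that interior_subset[of \<Omega>] by blast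
 have Q0: "Q k x = 0" if "x \<notin> \<Omega>" for k x using v0 S0 V0 nint[OF that] by (simp add: Q_def)
 have Si: "integrable lborel (S k)" and Vi: "integrable lborel (V k)" and Qi: "integrable lborel (Q k)" and Qa: "integrable lborel (\<lambda>x. norm (Q k x) powr \<alpha>)" for k
  using SL VL QL by (auto simp: Lq_field_def)

 \<comment> \<open>By adjointness the fluxes of S and V against g become the fluxes of q and v
   against the C^1 gradient of f, the mollified test function. Both equal -pairing f and cancel,
   although neither is -pairing F.\<close>
 have Qdiv: "flux \<Omega> g (Q k) = - pairing F" if sd: "sobolev_data (interior (K n)) p \<phi> g" and F: "continuous_on (K n) F"
  and F\<phi>: "AE x in lborel. x \<in> interior (K n) \<longrightarrow> F x = \<phi> x" for n k \<phi> g F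
 proof -
  interpret Kn: conic_star "K n" by (rule conic_star_K)
  have \<phi>: "integrable lborel \<phi>" and g: "integrable lborel g" and wg: "weak_grad (interior (K n)) \<phi> g"
   and fin: "(\<integral>\<^sup>+x. ennreal (norm (g x) powr p) \<partial>lborel) < \<infinity>" using sd by (auto simp: sobolev_data_def)
  have [measurable]: "g \<in> \<B>" using g by auto
  define G where "G y = c k *R moll (c k) (\<eta> (r k)) g y" for y
  define f where "f = moll (c k) (\<eta> (r k)) \<phi>"
  have int: "interior \<Omega> \<subseteq> interior (K n)" by (rule interior_mono[OF subset_K])
  have f: "continuous_on \<Omega> f" and G: "is_C1_gradient \<Omega> f G"
   using moll_C1[OF \<phi> g wg mollifierD(1)[OF \<eta>[of "r k"]], of \<Omega> "c k"] sub int by (auto simp: f_def G_def[abs_def])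
  have Gc: "continuous_on \<Omega> G" using G by (simp add: is_C1_gradient_def)
  define gi where "gi x = indicat_real (interior \<Omega>) x *R g x" for x
  have gim [measurable]: "gi \<in> \<B>" unfolding gi_def[abs_def] by measurable
  have gii: "integrable lborel gi" unfolding gi_def[abs_def] using g by (intro integrable_mult_indicator) auto
  have "(\<integral>\<^sup>+x. ennreal (norm (gi x) powr p) \<partial>lborel) \<le> (\<integral>\<^sup>+x. ennreal (norm (g x) powr p) \<partial>lborel)"
   using pq by (intro nn_integral_mono ennreal_leI powr_mono2) (auto simp: gi_def indicator_def)
  then have "(\<integral>\<^sup>+x. ennreal (norm (gi x) powr p) \<partial>lborel) < \<infinity>" using fin by (rule order_le_less_trans)
  then have iv: "integrable lborel (\<lambda>x. gi x \<bullet> v x)" by (intro integrable_inner_Lp[OF pq _ _ _ va]) auto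
  have iS: "integrable lborel (\<lambda>x. gi x \<bullet> S k x)"
  proof -
   obtain B where "\<And>x. norm (S k x) \<le> B" using S(2) by blast
   then show ?thesis using integrable_inner_bounded[OF gii, of "S k" B] by (simp add: inner_commute)
  qed
  have iV: "integrable lborel (\<lambda>x. gi x \<bullet> V k x)"
  proof -
   obtain B where "\<And>x. norm (V k x) \<le> B" using V(2) by blast
   then show ?thesis using integrable_inner_bounded[OF gii, of "V k" B] by (simp add: inner_commute)
  qed
  have "flux \<Omega> g (Q k) = (LBINT x. gi x \<bullet> v x + (gi x \<bullet> S k x - gi x \<bullet> V k x))"
   by (simp add: flux_def gi_def[symmetric] Q_def inner_add_right inner_diff_right)
  also have "\<dots> = flux \<Omega> g v + ((LBINT x. gi x \<bullet> S k x) - (LBINT x. gi x \<bullet> V k x))" using iv iS iV by (simp add: flux_def gi_def[symmetric])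
  also have "(LBINT x. gi x \<bullet> S k x) = (LBINT x. g x \<bullet> S k x)" using S0 by (intro Bochner_Integration.integral_cong) (auto simp: gi_def indicator_def)
  also have "\<dots> = (LINT y|?T. G y \<bullet> h y)" unfolding G_def by (rule S(3)[OF g])
  also have "\<dots> = (LINT y:\<Omega>|?T. G y \<bullet> h y)"
  proof -
   have "continuous_on UNIV G" unfolding G_def[abs_def] by (intro continuous_intros moll_continuous[OF g \<eta>])
   then have [measurable]: "G \<in> \<B>" by (rule borel_measurable_continuous_onI)
   show ?thesis unfolding set_lebesgue_integral_def
   proof (rule integral_cong_AE)
    show "AE x in ?T. G x \<bullet> h x = indicat_real \<Omega> x *R (G x \<bullet> h x)" using TO by eventually_elim simp
   qed measurable
  qed
  also have "\<dots> = vint \<Omega> q G" using hv[OF compact Gc] by simp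
  also have "\<dots> = - pairing f" by (rule divergence_test[OF q div f G])
  also have "(LBINT x. gi x \<bullet> V k x) = (LBINT x. g x \<bullet> V k x)" using V0 by (intro Bochner_Integration.integral_cong) (auto simp: gi_def indicator_def)
  also have "\<dots> = (LBINT y. G y \<bullet> v y)" unfolding G_def by (rule V(3)[OF g])
  also have "\<dots> = flux \<Omega> G v" unfolding flux_def using v0 by (intro Bochner_Integration.integral_cong) (auto simp: indicator_def)
  also have "\<dots> = - pairing f" by (rule vdiv[OF f G])
  \<comment> \<open>What survives the cancellation is v itself, whose divergence must be known for
    the Sobolev function, not only for C^1 functions.\<close>
  also have "flux \<Omega> g v = - pairing F" unfolding pairing_def using prob_measure(1,2)[OF prob(1)] prob_measure(1,2)[OF prob(2)]
   by (intro Kn.divergence_sobolev[OF pq compact subset_K v vdiv' _ _ _ _ sd F F\<phi> \<eta> d])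
  finally show ?thesis by simp
 qed

 \<comment> \<open>The part v - V of the recovery field; it tends to 0 in L^1, so it affects neither
   the weak-* limit nor the weighted variation.\<close>
 define D where "D k = (LBINT x. norm (v x - V k x))" for k
 have D: "D \<longlonglongrightarrow> 0"
 proof -
  obtain R where R: "0 < R" "\<And>x. x \<in> \<Omega> ==> norm x \<le> R" using compact_imp_bounded[OF compact] bounded_pos by metis
  have vR: "v x = 0" if "R < norm x" for x using that R(2)[of x] v0[of x] interior_subset[of \<Omega>] by force
  have lim: "(\<lambda>k. \<integral>\<^sup>+x\<in>cball 0 R. ennreal (norm (smoll (c k) (\<eta> (r k)) v x - v x)) \<partial>lborel) \<longlonglongrightarrow> 0"
   using R(1) by (intro smoll_L1_convergence[OF vi vR _ c \<eta> r]) auto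
  have "(\<lambda>k. ennreal (D k)) \<longlonglongrightarrow> ennreal 0"
  proof (rule tendsto_sandwich[OF _ _ tendsto_const])
   show "\<forall>\<^sub>F k in sequentially. ennreal (D k) \<le> (\<integral>\<^sup>+x\<in>cball 0 R. ennreal (norm (smoll (c k) (\<eta> (r k)) v x - v x)) \<partial>lborel)"
   proof (rule always_eventually, rule allI)
    fix k
    have "ennreal (D k) = (\<integral>\<^sup>+x. ennreal (norm (v x - V k x)) \<partial>lborel)"
     unfolding D_def using vi Vi by (intro nn_integral_eq_integral[symmetric]) auto
    also have "\<dots> \<le> (\<integral>\<^sup>+x\<in>cball 0 R. ennreal (norm (smoll (c k) (\<eta> (r k)) v x - v x)) \<partial>lborel)"
    proof (rule nn_integral_mono)
     fix x
     have "v x - V k x = 0" if "x \<notin> cball 0 R"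
     proof -
      have "x \<notin> \<Omega>" using that R(2)[of x] by auto
      then show ?thesis using v0 V0 nint by simp
     qed
     then show "ennreal (norm (v x - V k x)) \<le> ennreal (norm (smoll (c k) (\<eta> (r k)) v x - v x)) * indicator (cball 0 R) x"
      by (cases "x \<in> cball 0 R") (auto simp: smoll_eq_smear V_def norm_minus_commute)
    qed
    finally show "ennreal (D k) \<le> (\<integral>\<^sup>+x\<in>cball 0 R. ennreal (norm (smoll (c k) (\<eta> (r k)) v x - v x)) \<partial>lborel)" .
   qed
  qed (use lim in auto)
  then show ?thesis by (rule tendsto_ennrealD) (auto simp: D_def)
 qed

 obtain B where B: "0 < B" "\<And>x. x \<in> \<Omega> ==> norm (W x) \<le> B" using continuous_on_compact_bounded[OF compact W_\<Omega>(1)] by metis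
 \<comment> \<open>The smeared |q| tested with the weight. As W is continuous, weak convergence
   alone yields the limit energy; no recovery of |q| by the densities |S| has to be shown.\<close>
 define E where "E k = (LBINT x. (indicat_real \<Omega> x *R W x) \<bullet> H k x)" for k
 define E0 where "E0 = (LINT y|?T. (indicat_real \<Omega> y *R W y) \<bullet> norm (h y))"
 have E: "E \<longlonglongrightarrow> E0" unfolding E_def[abs_def] E0_def H_def
  by (rule smear_tendsto[OF c \<eta> r(1) sub Ts T(1) integrable_norm[OF hi] hz(2) W_\<Omega>(1)])
 have WiB: "integrable lborel (\<lambda>x. indicat_real \<Omega> x *R W x)" by (rule borel_integrable_compact[OF compact W_\<Omega>(1)])
 have Wm [measurable]: "(\<lambda>x. indicat_real \<Omega> x * W x) \<in> \<B>" by (rule borel_measurable_indicator_mult_continuous[OF compact W_\<Omega>(1)])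
 have lim: "H_lim W \<mu> \<Omega> q = ennreal E0"
 proof -
  have "(\<integral>\<^sup>+x\<in>\<Omega>. ennreal (W x) \<partial>?T) = ennreal (LINT x:\<Omega>|?T. W x)"
   using W_\<Omega>(2) by (intro nn_set_integral_eq_integral[OF compact T(2,1) W_\<Omega>(1)])
  also have "(LINT x:\<Omega>|?T. W x) = E0" unfolding E0_def set_lebesgue_integral_def
  proof (rule integral_cong_AE)
   show "AE x in ?T. indicat_real \<Omega> x *R W x = (indicat_real \<Omega> x *R W x) \<bullet> norm (h x)" using ha by eventually_elim simp
  qed (use Wm in simp_all)
  finally show ?thesis using q div by (simp add: H_lim_def)
 qed
 have SH: "norm (S k x) \<le> H k x" for k x
 proof -
  have "norm (S k x) \<le> (LINT y|?T. norm ((c k * \<eta> (r k) (x - c k *R y)) *R h y))" unfolding S_def smear_def by (rule integral_norm_bound)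
  also have "\<dots> = H k x" unfolding H_def smear_def using c(1)[of k] mollifierD(2)[OF \<eta>] by (intro Bochner_Integration.integral_cong) (auto simp: abs_mult)
  finally show ?thesis .
 qed
 have en: "(\<integral>\<^sup>+x\<in>\<Omega>. ennreal (W x * norm (Q k x)) \<partial>lborel) \<le> ennreal (B * D k + E k)" for k
 proof -
  have i1: "integrable lborel (\<lambda>x. B * norm (v x - V k x))" using vi Vi by simp
  have i2: "integrable lborel (\<lambda>x. (indicat_real \<Omega> x *R W x) \<bullet> H k x)"
  proof -
   obtain B' where "\<And>x. norm (H k x) \<le> B'" using H(2) by blast
   then have "integrable lborel (\<lambda>x. H k x \<bullet> (indicat_real \<Omega> x *R W x))" by (intro integrable_inner_bounded[OF WiB]) auto
   then show ?thesis by (simp add: mult_ac)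
  qed
  have "(\<integral>\<^sup>+x\<in>\<Omega>. ennreal (W x * norm (Q k x)) \<partial>lborel) \<le> (\<integral>\<^sup>+x. ennreal (B * norm (v x - V k x) + (indicat_real \<Omega> x *R W x) \<bullet> H k x) \<partial>lborel)"
  proof (rule nn_integral_mono)
   fix x
   show "ennreal (W x * norm (Q k x)) * indicator \<Omega> x \<le> ennreal (B * norm (v x - V k x) + (indicat_real \<Omega> x *R W x) \<bullet> H k x)"
   proof (cases "x \<in> \<Omega>")
    case True
    have "Q k x = (v x - V k x) + S k x" by (simp add: Q_def)
    then have "norm (Q k x) \<le> norm (v x - V k x) + H k x" using norm_triangle_ineq[of "v x - V k x" "S k x"] SH[of k x] by simp
    then have "W x * norm (Q k x) \<le> W x * (norm (v x - V k x) + H k x)" using W_\<Omega>(2)[OF True] by (rule mult_left_mono)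
    also have "\<dots> \<le> B * norm (v x - V k x) + W x * H k x" using B(2)[OF True] by (simp add: distrib_left) (intro mult_right_mono, auto)
    finally show ?thesis using True by (simp add: ennreal_leI)
   qed simp
  qed
  also have "\<dots> = ennreal (LBINT x. B * norm (v x - V k x) + (indicat_real \<Omega> x *R W x) \<bullet> H k x)"
  proof (rule nn_integral_eq_integral[OF Bochner_Integration.integrable_add[OF i1 i2]])
   show "AE x in lborel. 0 \<le> B * norm (v x - V k x) + (indicat_real \<Omega> x *R W x) \<bullet> H k x"
   proof (rule AE_I2)
    fix x
    have "0 \<le> H k x" using SH[of k x] norm_ge_zero order_trans by blast
    then show "0 \<le> B * norm (v x - V k x) + (indicat_real \<Omega> x *R W x) \<bullet> H k x"
     using B(1) W_\<Omega>(2)[of x] by (auto simp: indicator_def intro!: add_nonneg_nonneg)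
   qed
  qed
  also have "\<dots> = ennreal (B * D k + E k)" using i1 i2 by (subst Bochner_Integration.integral_add) (auto simp: D_def E_def)
  finally show ?thesis .
 qed

 \<comment> \<open>The power term without its factor \<tau>. It is finite for each k but may grow
   without bound, and \<open>diagonal_sequence\<close> slows k down until \<tau> compensates for
   it.\<close>
 define a where "a k = (LBINT x. norm (Q k x) powr \<alpha>) / \<alpha>" for k
 have a0: "0 \<le> a k" for k using pq by (auto simp: a_def)
 have DE0: "0 \<le> B * D k + E k" for k
 proof -
  have "0 \<le> H k x" for x using SH[of k x] norm_ge_zero[of "S k x"] by linarith
  then have "0 \<le> (indicat_real \<Omega> x *R W x) \<bullet> H k x" for x using W_\<Omega>(2)[of x] by (auto simp: indicator_def)
  then have "0 \<le> E k" unfolding E_def by (intro integral_nonneg_AE) auto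
  moreover have "0 \<le> D k" unfolding D_def by simp
  ultimately show ?thesis using B(1) by simp
 qed
 obtain \<kappa> where \<kappa>: "filterlim \<kappa> at_top sequentially" "(\<lambda>n. \<tau> n * a (\<kappa> n)) \<longlonglongrightarrow> 0"
  using diagonal_sequence[of \<tau> a] \<tau> a0 less_imp_le by metis
 define xs where "xs n = density_vmeasure (Q (\<kappa> n))" for n
 show ?thesis
 proof (intro exI[of _ xs] conjI)
  have "Q k x = 0" if "x \<notin> ?K" for k x using that Q0 OK by blast
  then show "range xs \<subseteq> vmeasures ?K" unfolding xs_def using density_vmeasure_vmeasures[OF Qi _ Kb] by blast
  show "weakstar_conv ?K xs q" unfolding weakstar_conv_def
  proof (intro allI impI)
   fix F :: "'a => 'a" assume F: "continuous_on ?K F"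
   have F\<Omega>: "continuous_on \<Omega> F" by (rule continuous_on_subset[OF F OK])
   define g where "g x = indicat_real \<Omega> x *R F x" for x
   have gi: "integrable lborel g" unfolding g_def[abs_def] by (rule borel_integrable_compact[OF compact F\<Omega>])
   then have [measurable]: "g \<in> \<B>" by auto
   obtain C where C: "0 < C" "\<And>x. x \<in> \<Omega> ==> norm (F x) \<le> C" using continuous_on_compact_bounded[OF compact F\<Omega>] by metis
   have gC: "norm (g x) \<le> C" for x using C by (auto simp: g_def indicator_def)
   have iD: "integrable lborel (\<lambda>x. g x \<bullet> (v x - V k x))" for k using vi Vi gC by (intro integrable_inner_bounded[where B=C]) auto
   have iS: "integrable lborel (\<lambda>x. g x \<bullet> S k x)" for k using Si gC by (intro integrable_inner_bounded[where B=C]) auto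
   have split: "vint ?K (density_vmeasure (Q k)) F = (LBINT x. g x \<bullet> (v x - V k x)) + (LBINT x. g x \<bullet> S k x)" for k
   proof -
    have "vint ?K (density_vmeasure (Q k)) F = (LBINT x. (indicat_real ?K x *R F x) \<bullet> Q k x)" by (rule vint_density_vmeasure[OF Qi cK F])
    also have "\<dots> = (LBINT x. g x \<bullet> (v x - V k x) + g x \<bullet> S k x)"
    proof (intro Bochner_Integration.integral_cong refl)
     fix x
     show "(indicat_real ?K x *R F x) \<bullet> Q k x = g x \<bullet> (v x - V k x) + g x \<bullet> S k x"
     proof (cases "x \<in> \<Omega>")
      case True
      then have "x \<in> ?K" using OK by blast
      then show ?thesis using True by (simp add: g_def Q_def inner_add_right inner_diff_right)
     qed (simp add: Q0 g_def)
    qed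
    also have "\<dots> = (LBINT x. g x \<bullet> (v x - V k x)) + (LBINT x. g x \<bullet> S k x)" by (rule Bochner_Integration.integral_add[OF iD iS])
    finally show ?thesis .
   qed
   have "(\<lambda>k. \<integral>x. g x \<bullet> (v x - V k x) \<partial>lborel) \<longlonglongrightarrow> 0"
   proof (rule Lim_null_comparison)
    show "(\<lambda>k. C * D k) \<longlonglongrightarrow> 0" using tendsto_mult[OF tendsto_const D, of C] by simp
    show "\<forall>\<^sub>F k in sequentially. norm (LBINT x. g x \<bullet> (v x - V k x)) \<le> C * D k"
    proof (rule always_eventually, rule allI)
     fix k
     have "norm (LBINT x. g x \<bullet> (v x - V k x)) \<le> (LBINT x. C * norm (v x - V k x))"
     proof (rule Bochner_Integration.integral_norm_bound_integral[OF iD])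
      show "integrable lborel (\<lambda>x. C * norm (v x - V k x))" using vi Vi by simp
      fix x
      have "\<bar>g x \<bullet> (v x - V k x)\<bar> \<le> norm (g x) * norm (v x - V k x)" by (rule Cauchy_Schwarz_ineq2)
      also have "\<dots> \<le> C * norm (v x - V k x)" using gC by (intro mult_right_mono) auto
      finally show "norm (g x \<bullet> (v x - V k x)) \<le> C * norm (v x - V k x)" by simp
     qed
     then show "norm (LBINT x. g x \<bullet> (v x - V k x)) \<le> C * D k" by (simp add: D_def)
    qed
   qed
   moreover have "(\<lambda>k. \<integral>x. g x \<bullet> S k x \<partial>lborel) \<longlonglongrightarrow> (LINT y|?T. g y \<bullet> h y)"
    unfolding g_def S_def by (rule smear_tendsto[OF c \<eta> r(1) sub Ts T(1) hi hz(1) F\<Omega>])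
   ultimately have "(\<lambda>k. vint ?K (density_vmeasure (Q k)) F) \<longlonglongrightarrow> 0 + (LINT y|?T. g y \<bullet> h y)"
    unfolding split by (rule tendsto_add)
   also have "0 + (LINT y|?T. g y \<bullet> h y) = vint \<Omega> q F" using hv[OF compact F\<Omega>] by (simp add: g_def set_lebesgue_integral_def)
   also have "vint \<Omega> q F = vint ?K q F" by (rule vint_restrict[OF q compact OK cK F, symmetric])
   finally have "((\<lambda>k. vint ?K (density_vmeasure (Q k)) F) \<longlongrightarrow> vint ?K q F) at_top" .
   from filterlim_compose[OF this \<kappa>(1)] show "(\<lambda>n. vint ?K (xs n) F) \<longlonglongrightarrow> vint ?K q F" by (simp add: xs_def)
  qed
  have "H_eps \<alpha> W \<mu> (K n) (\<tau> n) (xs n) \<le> ennreal (B * D (\<kappa> n) + E (\<kappa> n) + \<tau> n * a (\<kappa> n))" for n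
  proof -
   have "H_eps \<alpha> W \<mu> (K n) (\<tau> n) (xs n) = (\<integral>\<^sup>+x\<in>\<Omega>. ennreal (W x * norm (Q (\<kappa> n) x)) \<partial>lborel)
     + ennreal (\<tau> n / \<alpha> * (LBINT x. norm (Q (\<kappa> n) x) powr \<alpha>))" unfolding xs_def by (rule recovery_energy[OF QL Qdiv])
   also have "\<dots> \<le> ennreal (B * D (\<kappa> n) + E (\<kappa> n)) + ennreal (\<tau> n * a (\<kappa> n))" by (intro add_mono en) (simp add: a_def)
   also have "\<dots> = ennreal (B * D (\<kappa> n) + E (\<kappa> n) + \<tau> n * a (\<kappa> n))" using DE0 a0 \<tau>(1)[of n] by (intro ennreal_plus[symmetric]) auto
   finally show ?thesis .
  qed
  then have "limsup (\<lambda>n. H_eps \<alpha> W \<mu> (K n) (\<tau> n) (xs n)) \<le> limsup (\<lambda>n. ennreal (B * D (\<kappa> n) + E (\<kappa> n) + \<tau> n * a (\<kappa> n)))"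
   by (intro Limsup_mono always_eventually allI)
  also have "\<dots> = ennreal E0"
  proof (rule lim_imp_Limsup)
   have "(\<lambda>n. B * D (\<kappa> n) + E (\<kappa> n) + \<tau> n * a (\<kappa> n)) \<longlonglongrightarrow> B * 0 + E0 + 0"
    by (intro tendsto_intros \<kappa>(2) filterlim_compose[OF D \<kappa>(1)] filterlim_compose[OF E \<kappa>(1)])
   then show "(\<lambda>n. ennreal (B * D (\<kappa> n) + E (\<kappa> n) + \<tau> n * a (\<kappa> n))) \<longlonglongrightarrow> ennreal E0" by (intro tendsto_ennrealI) simp
  qed simp
  finally show "limsup (\<lambda>n. H_eps \<alpha> W \<mu> (K n) (\<tau> n) (xs n)) \<le> H_lim W \<mu> \<Omega> q" using lim by simp
 qed
qed

lemma gamma_limit_H: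
 "gamma_limit (vmeasures (\<Union>n. K n)) (weakstar_conv (\<Union>n. K n))
   (\<lambda>n. H_eps \<alpha> W \<mu> (K n) (\<tau> n)) (H_lim W \<mu> \<Omega>)" unfolding gamma_limit_def using liminf_inequality limsup_inequality by blast

end

section \<open>Mollifier radii, conjugate exponents and the conclusion\<close>

lemma mollifier_radii:
 fixes \<eta> :: "nat => 'a::euclidean_space => real"
 assumes \<eta>: "\<And>n. \<eta> n \<in> test_functions UNIV" "\<And>n x. \<eta> n x \<ge> 0" "\<And>n. (LINT x|lebesgue. \<eta> n x) = 1"
  and supp: "\<And>r. r > 0 ==> \<forall>\<^sub>F n in sequentially. supp (\<eta> n) \<subseteq> ball 0 r"
 obtains d where "\<And>n. mollifier (d n) (\<eta> n)" "d \<longlonglongrightarrow> 0"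
proof -
 \<comment> \<open>Inserting 0 makes the set nonempty and the radius nonnegative without an argument
   about the support.\<close>
 define \<rho> where "\<rho> n = Sup (insert 0 (norm ` supp (\<eta> n)))" for n
 have bdd: "bdd_above (insert 0 (norm ` supp (\<eta> n)))" for n
 proof -
  have "bounded (supp (\<eta> n))" using test_function_smooth(6)[OF \<eta>(1)] by (rule compact_imp_bounded)
  then have "bdd_above (norm ` supp (\<eta> n))" by (auto simp: bounded_iff bdd_above_def)
  then show ?thesis by simp
 qed
 have \<rho>: "norm x \<le> \<rho> n" if "x \<in> supp (\<eta> n)" for x n unfolding \<rho>_def using that by (intro cSup_upper bdd) auto
 have \<rho>0: "0 \<le> \<rho> n" for n unfolding \<rho>_def by (intro cSup_upper bdd) auto
 have "\<rho> \<longlonglongrightarrow> 0"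
 proof (rule LIMSEQ_I)
  fix e :: real assume e: "0 < e"
  have "\<forall>\<^sub>F n in sequentially. norm (\<rho> n - 0) < e" using supp[OF half_gt_zero[OF e]]
  proof eventually_elim
   fix n assume "supp (\<eta> n) \<subseteq> ball 0 (e / 2)"
   then have "\<rho> n \<le> e / 2" unfolding \<rho>_def using e by (intro cSup_least) (auto intro: less_imp_le)
   then show "norm (\<rho> n - 0) < e" using \<rho>0 e by simp
  qed
  then show "\<exists>no. \<forall>n\<ge>no. norm (\<rho> n - 0) < e" by (simp add: eventually_sequentially)
 qed
 then have "(\<lambda>n. \<rho> n + inverse (real (Suc n))) \<longlonglongrightarrow> 0 + 0" by (intro tendsto_add LIMSEQ_inverse_real_of_nat)
 \<comment> \<open>The radius \<rho> n may be attained on the support, while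
   \<open>mollifier\<close> asks for an open ball; the vanishing summand 1 / (n + 1) makes the
   inclusion strict.\<close>
 moreover have "mollifier (\<rho> n + inverse (real (Suc n))) (\<eta> n)" for n unfolding mollifier_def
 proof (intro conjI allI \<eta>)
  have "\<eta> n \<in> \<B>" using test_function_smooth(1)[OF \<eta>(1)] by (rule borel_measurable_continuous_onI)
  then show "(LBINT x. \<eta> n x) = 1" using \<eta>(3)[of n] by (subst (asm) integral_completion) auto
  show "supp (\<eta> n) \<subseteq> ball 0 (\<rho> n + inverse (real (Suc n)))"
  proof
   fix x assume "x \<in> supp (\<eta> n)"
   then have "norm x < \<rho> n + inverse (real (Suc n))" using \<rho> by (intro add_strict_increasing2[of "norm x" _ 0, simplified] le_less_trans[OF \<rho>]) auto
   then show "x \<in> ball 0 (\<rho> n + inverse (real (Suc n)))" by simp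
  qed
 qed
 ultimately show ?thesis by (intro that) auto
qed

text \<open>\<alpha> (n - 1) < n is equivalent to n < \<alpha> / (\<alpha> - 1). For n = 1 the
  fraction in the hypothesis is meaningless and the claim is just that the conjugate exponent
  exceeds 1.\<close>

lemma conj_exp_properties:
 assumes "1 < \<alpha>"
 shows "1 < conj_exp \<alpha>" "1 / conj_exp \<alpha> + 1 / \<alpha> = 1"
  and "(n > 1 ==> \<alpha> < real n / (real n - 1)) ==> 0 < n ==> real n < conj_exp \<alpha>"
proof -
 show p: "1 < conj_exp \<alpha>" and "1 / conj_exp \<alpha> + 1 / \<alpha> = 1" using assms by (auto simp: conj_exp_def field_simps)
 assume n: "n > 1 ==> \<alpha> < real n / (real n - 1)" "0 < n"
 show "real n < conj_exp \<alpha>"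
 proof (cases "n = 1")
  case False
  then have "1 < n" using n by auto
  then have "\<alpha> * (real n - 1) < real n" using n(1) by (simp add: field_simps)
  then show ?thesis using assms by (simp add: conj_exp_def field_simps)
 qed (use p in simp)
qed

theorem theorem4p5:
  fixes \<Omega> :: "(real ^ 'd) set"
    and w w_hat :: "real ^ 'd \<Rightarrow> real"
    and \<alpha> :: real
    and \<mu>_plus \<mu>_minus :: "(real ^ 'd) measure"
    and \<tau> :: "nat \<Rightarrow> real"
    and \<phi> :: "real \<Rightarrow> real ^ 'd \<Rightarrow> real"
    and s :: "real \<Rightarrow> real"
  defines "\<mu> \<equiv> \<lambda>A. measure \<mu>_plus A - measure \<mu>_minus A"
    and "\<Omega>_enl \<equiv> \<lambda>t. (\<lambda>x. (1 + s t) *\<^sub>R x) ` \<Omega>"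
  defines "\<Omega>_tilde \<equiv> \<Union>n. \<Omega>_enl (\<tau> n)"
  assumes "compact \<Omega>" and "bounded (interior \<Omega>)" and "lipschitz_domain (interior \<Omega>)"
    and star: "\<And>x t. x \<in> \<Omega> \<Longrightarrow> 0 \<le> t \<Longrightarrow> t < 1 \<Longrightarrow> t *\<^sub>R x \<in> interior \<Omega>"
    and w: "continuous_on \<Omega> w" "\<And>x. x \<in> \<Omega> \<Longrightarrow> 0 \<le> w x"
    and \<alpha>: "1 < \<alpha>" "CARD('d) > 1 \<Longrightarrow> \<alpha> < real CARD('d) / (real CARD('d) - 1)"
    and "borel_prob_on \<Omega> \<mu>_plus" and "borel_prob_on \<Omega> \<mu>_minus"
    and "neumann_uniquely_solvable (conj_exp \<alpha>) \<Omega>"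
    and \<tau>: "\<And>n. \<tau> n > 0" "\<tau> \<longlonglongrightarrow> 0"
    and \<phi>: "\<And>n. \<phi> (\<tau> n) \<in> test_functions UNIV" "\<And>n x. \<phi> (\<tau> n) x \<ge> 0"
           "\<And>n. (LINT x|lebesgue. \<phi> (\<tau> n) x) = 1"
           "\<And>r. r > 0 \<Longrightarrow> \<forall>\<^sub>F n in sequentially. supp (\<phi> (\<tau> n)) \<subseteq> ball 0 r"
    and s: "\<And>n. s (\<tau> n) > 0" "(\<lambda>n. s (\<tau> n)) \<longlonglongrightarrow> 0"
    and enl: "\<And>n. {x + y | x y. x \<in> \<Omega> \<and> y \<in> supp (\<phi> (\<tau> n))} \<subseteq> \<Omega>_enl (\<tau> n)"
             "\<And>m n. \<tau> m > \<tau> n \<Longrightarrow> \<Omega>_enl (\<tau> n) \<subseteq> \<Omega>_enl (\<tau> m)"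
    and w_hat: "continuous_on \<Omega>_tilde w_hat" "\<And>x. x \<in> \<Omega> \<Longrightarrow> w_hat x = w x"
               "(INF x\<in>\<Omega>_tilde. w_hat x) = (INF x\<in>\<Omega>. w x)"
  shows "gamma_limit (vmeasures \<Omega>_tilde) (weakstar_conv \<Omega>_tilde)
           (\<lambda>n. H_eps \<alpha> w_hat \<mu> (\<Omega>_enl (\<tau> n)) (\<tau> n))
           (H_lim w \<mu> \<Omega>)"
proof -
 have cO: "conic_star \<Omega>" by (rule conic_star_lipschitz[OF assms(4,6) star])
 interpret conic_star \<Omega> by (rule cO)
 obtain d where d: "\<And>n. mollifier (d n) (\<phi> (\<tau> n))" "d \<longlonglongrightarrow> 0" by (rule mollifier_radii[where \<eta>="\<lambda>n. \<phi> (\<tau> n)", OF \<phi>]) (assumption, blast)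
 note ce = conj_exp_properties[OF \<alpha>(1)]
 have pd: "real DIM(real ^ 'd) < conj_exp \<alpha>" using ce(3)[of "CARD('d)"] \<alpha>(2) by simp
 note prob = \<open>borel_prob_on \<Omega> \<mu>_plus\<close> \<open>borel_prob_on \<Omega> \<mu>_minus\<close>
 have setting: "gamma_setting \<Omega> (\<lambda>n. s (\<tau> n)) \<tau> d (\<lambda>n. \<phi> (\<tau> n)) (conj_exp \<alpha>) \<alpha> \<mu>_plus \<mu>_minus V"
  if "continuous_on \<Omega>_tilde V" "\<And>x. x \<in> \<Omega>_tilde ==> 0 \<le> V x" for V
  using that s \<tau> d ce \<alpha>(1) pd prob unfolding \<Omega>_tilde_def \<Omega>_enl_def by unfold_locales auto
 \<comment> \<open>An instance with zero weight comes first: compactness of the union of the domains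
   is proved inside the locale, and it is needed to show that \<open>w_hat\<close> is nonnegative,
   which the instance with \<open>w_hat\<close> presupposes.\<close>
 interpret Z: gamma_setting \<Omega> "\<lambda>n. s (\<tau> n)" \<tau> d "\<lambda>n. \<phi> (\<tau> n)" "conj_exp \<alpha>" \<alpha> \<mu>_plus \<mu>_minus "\<lambda>_. 0" "\<lambda>n. \<Omega>_enl (\<tau> n)"
  by (rule setting) (auto simp: \<Omega>_enl_def)
 have "compact \<Omega>_tilde" unfolding \<Omega>_tilde_def using Z.Union_K Z.compact_K by metis
 then have "compact (w_hat ` \<Omega>_tilde)" using w_hat(1) by (rule compact_continuous_image[rotated])
 then have bdd: "bdd_below (w_hat ` \<Omega>_tilde)" by (intro bounded_imp_bdd_below compact_imp_bounded)
 \<comment> \<open>The infima of \<open>w_hat\<close> and w agree. Compactness bounds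
   \<open>w_hat\<close> from below, without which the real infimum would not be a lower
   bound.\<close>
 have w0: "0 \<le> w_hat x" if "x \<in> \<Omega>_tilde" for x
 proof -
  have "0 \<le> (INF x\<in>\<Omega>. w x)" using w(2) nonempty by (intro cINF_greatest) auto
  also have "\<dots> \<le> w_hat x" unfolding w_hat(3)[symmetric] by (rule cINF_lower[OF bdd that])
  finally show ?thesis .
 qed
 interpret G: gamma_setting \<Omega> "\<lambda>n. s (\<tau> n)" \<tau> d "\<lambda>n. \<phi> (\<tau> n)" "conj_exp \<alpha>" \<alpha> \<mu>_plus \<mu>_minus w_hat "\<lambda>n. \<Omega>_enl (\<tau> n)"
  by (rule setting) (auto simp: \<Omega>_enl_def w_hat(1) w0)
 \<comment> \<open>The limit functional integrates over \<Omega> only, where the extension agrees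
   with w.\<close>
 have "H_lim w_hat \<mu> \<Omega> = H_lim w \<mu> \<Omega>"
 proof
  fix q :: "(real ^ 'd) set => real ^ 'd"
  have "(\<integral>\<^sup>+x\<in>\<Omega>. ennreal (w_hat x) \<partial>total_variation q) = (\<integral>\<^sup>+x\<in>\<Omega>. ennreal (w x) \<partial>total_variation q)"
   using w_hat(2) by (intro nn_integral_cong) (auto simp: indicator_def)
  then show "H_lim w_hat \<mu> \<Omega> q = H_lim w \<mu> \<Omega> q" by (simp add: H_lim_def)
 qed
 then show ?thesis using G.gamma_limit_H unfolding \<mu>_def G.\<mu>_def \<Omega>_tilde_def by simp
qed

end
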